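(* We have $$\inf_{\phi\in\mathcal{K}_0}\mathcal{A}(\phi)=-\min_{(m,w)\in\mathcal{K}_1}\mathcal{B}(m,w).$$ Moreover, the minimum in the right-hand side is achieved by a unique pair $(m,w)\in\mathcal{K}_1$, satisfying $(m,w)\in L^q((0,T)\times\mathbb{T}^d)\times L^{\frac{r'q}{r'+q-1}}((0,T)\times\mathbb{T}^d)$.
   Context: Fix $T>0$ and let $\mathbb{T}^d=\mathbb{R}^d/\mathbb{Z}^d$. $D$ is the space gradient. Standing assumptions. (Coupling) $f:\mathbb{T}^d\times[0,\infty)\to\mathbb{R}$ is continuous, strictly increasing in its second variable, $f(x,0)=0$ for all $x$, and there are $q>1$, $C>0$ with $\frac1C m^{q-1}-C\le f(x,m)\le Cm^{q-1}+C$ for all $m\ge0$. (Hamiltonian) $H:\mathbb{T}^d\times\mathbb{R}^d\to\mathbb{R}$ is continuous, convex and differentiable in the second variable, $D_pH$ (derivative in the second variable) is continuous in both variables, and there are $r>\max\{d(q-1),1\}$ and $C>0$ with $\frac{1}{rC}|\xi|^r-C\le H(x,\xi)\le\frac Cr|\xi|^r+C$ for all $(x,\xi)$. Let $\frac1r+\frac1{r'}=1$. ($x$-dependence) There are $\theta\in[0,\frac{r}{d+1})$ and $C>0$ with $|H(x,\xi)-H(y,\xi)|\le C|x-y|\max(|\xi|,1)^\theta$ for all $x,y\in\mathbb{T}^d$, $\xi\in\mathbb{R}^d$. (Data) $\phi_T:\mathbb{T}^d\to\mathbb{R}$ is $C^1$; $m_0:\mathbb{T}^d\to\mathbb{R}$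 is continuous, $m_0\ge0$, $\int_{\mathbb{T}^d}m_0\,dx=1$. $F(x,m)=\int_0^mf(x,\tau)d\tau$ for $m\ge0$, $F(x,m)=+\infty$ for $m<0$; $F^*$ and $H^*$ are the convex conjugates of $F$ and $H$ with respect to the second variable. $\mathcal{K}_0$ is the set of $\phi\in C^1([0,T]\times\mathbb{T}^d)$ with $\phi(T,x)=\phi_T(x)$, and $$\mathcal{A}(\phi)=\int_0^T\!\int_{\mathbb{T}^d}F^*\big(x,-\partial_t\phi(t,x)+H(x,D\phi(t,x))\big)dx\,dt-\int_{\mathbb{T}^d}\phi(0,x)m_0(x)dx .$$ $\mathcal{K}_1$ is the set of $(m,w)\in L^1((0,T)\times\mathbb{T}^d)\times L^1((0,T)\times\mathbb{T}^d,\mathbb{R}^d)$ with $m\ge0$ a.e., $\int_{\mathbb{T}^d}m(t,x)dx=1$ for a.e. $t$, and $\partial_tm+\mathrm{div}(w)=0$ in $(0,T)\times\mathbb{T}^d$, $m(0)=m_0$ in the sense of distributions. On $\mathcal{K}_1$, $$\mathcal{B}(m,w)=\int_0^T\!\int_{\mathbb{T}^d}\Big(mH^*\big(x,-\tfrac wm\big)+F(x,m)\Big)dx\,dt+\int_{\mathbb{T}^d}\phi_T(x)m(T,x)dx,$$ where, if $m=0$, $mH^*(x,-\frac wm)$ is $+\infty$ if $w\ne0$ and $0$ if $w=0$. $\mathcal{B}(m,w)=+\infty$ if the first integral is infinite; otherwise $w=mv$ with $v\in L^{r'}(m\,dx\,dt)$, $m$ is identified with a continuous map from $[0,T]$ to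 the Borel probability measures on $\mathbb{T}^d$ (weak convergence), and the last term is the integral of $\phi_T$ against $m(T)$. *)

theory Defs
  imports "HOL-Probability.Probability"
begin

text \<open>
  The torus is encoded by its universal cover: functions on \<open>\<real>\<^sup>d/\<int>\<^sup>d\<close> are \<open>\<int>\<^sup>d\<close>-periodic functions
  on \<open>real ^ 'd\<close>.  For measure-theoretic purposes the torus is identified with the fundamental
  domain \<open>[0,1)\<^sup>d\<close>, onto which the quotient map restricts to a Borel isomorphism.
\<close>

definition lattice :: "(real ^ 'd) set" where
  "lattice = {k. \<forall>i. k $ i \<in> \<int>}"

definition periodic :: "(real ^ 'd \<Rightarrow> 'b) \<Rightarrow> bool" where
  "periodic g \<longleftrightarrow> (\<forall>x. \<forall>k\<in>lattice. g (x + k) = g x)"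

definition torus_dist :: "real ^ 'd \<Rightarrow> real ^ 'd \<Rightarrow> real" where
  "torus_dist x y = infdist (x - y) lattice"

definition cell :: "(real ^ 'd) set" where
  "cell = {x. \<forall>i. 0 \<le> x $ i \<and> x $ i < 1}"

definition torus :: "(real ^ 'd) measure" where
  "torus = restrict_space lborel cell"

definition cyl :: "real \<Rightarrow> (real \<times> (real ^ 'd)) measure" where
  "cyl T = restrict_space lborel ({0<..<T} \<times> cell)"

definition in_Lp :: "'a measure \<Rightarrow> real \<Rightarrow> ('a \<Rightarrow> 'b::euclidean_space) \<Rightarrow> bool" where
  "in_Lp M p u \<longleftrightarrow> u \<in> borel_measurable M \<and> integrable M (\<lambda>z. norm (u z) powr p)"

text \<open>
  Lebesgue integral of an extended-real function, as positive part minus negative part.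
  Note that \<open>\<infinity> - \<infinity> = \<infinity>\<close> in \<^typ>\<open>ereal\<close>; below the negative parts always have finite integral, because
  \<open>F\<^sup>* \<ge> 0\<close>, \<open>F \<ge> 0\<close> and \<open>H\<^sup>*(x,v) \<ge> - H(x,0)\<close>.
\<close>

definition ext_integral :: "'a measure \<Rightarrow> ('a \<Rightarrow> ereal) \<Rightarrow> ereal" where
  "ext_integral M u =
     enn2ereal (\<integral>\<^sup>+z. e2ennreal (u z) \<partial>M) - enn2ereal (\<integral>\<^sup>+z. e2ennreal (- u z) \<partial>M)"

definition conjugate :: "('a::real_inner \<Rightarrow> ereal) \<Rightarrow> 'a \<Rightarrow> ereal" where
  "conjugate g y = (SUP x. ereal (x \<bullet> y) - g x)"

definition grad :: "('a::real_inner \<Rightarrow> real) \<Rightarrow> 'a \<Rightarrow> 'a" where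
  "grad g x = (THE D. GDERIV g x :> D)"

definition coupling_primitive :: "('x \<Rightarrow> real \<Rightarrow> real) \<Rightarrow> 'x \<Rightarrow> real \<Rightarrow> ereal" where
  "coupling_primitive f x m = (if m \<ge> 0 then ereal (integral {0..m} (f x)) else \<infinity>)"

definition F_star :: "('x \<Rightarrow> real \<Rightarrow> real) \<Rightarrow> 'x \<Rightarrow> real \<Rightarrow> ereal" where
  "F_star f x = conjugate (coupling_primitive f x)"

definition H_star :: "('x \<Rightarrow> real ^ 'd \<Rightarrow> real) \<Rightarrow> 'x \<Rightarrow> real ^ 'd \<Rightarrow> ereal" where
  "H_star H x = conjugate (\<lambda>\<xi>. ereal (H x \<xi>))"

definition K0 :: "real \<Rightarrow> (real ^ 'd \<Rightarrow> real) \<Rightarrow> (real \<times> (real ^ 'd) \<Rightarrow> real) set" where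
  "K0 T \<phi>T = {\<phi>.
     (\<forall>t\<in>{0..T}. periodic (\<lambda>x. \<phi> (t, x))) \<and>
     (\<exists>a b. continuous_on ({0..T} \<times> UNIV) a \<and> continuous_on ({0..T} \<times> UNIV) b \<and>
        (\<forall>t\<in>{0..T}. \<forall>x.
           ((\<lambda>s. \<phi> (s, x)) has_real_derivative a (t, x)) (at t within {0..T}) \<and>
           (GDERIV (\<lambda>y. \<phi> (t, y)) x :> b (t, x)))) \<and>
     (\<forall>x. \<phi> (T, x) = \<phi>T x)}"

definition A_fun ::
  "real \<Rightarrow> (real ^ 'd \<Rightarrow> real \<Rightarrow> real) \<Rightarrow> (real ^ 'd \<Rightarrow> real ^ 'd \<Rightarrow> real) \<Rightarrow>
   (real ^ 'd \<Rightarrow> real) \<Rightarrow> (real \<times> (real ^ 'd) \<Rightarrow> real) \<Rightarrow> ereal" where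
  "A_fun T f H m0 \<phi> =
     ext_integral (cyl T)
       (\<lambda>(t, x). F_star f x (- deriv (\<lambda>s. \<phi> (s, x)) t + H x (grad (\<lambda>y. \<phi> (t, y)) x)))
     - ereal (\<integral>x. \<phi> (0, x) * m0 x \<partial>torus)"

primrec Ck :: "nat \<Rightarrow> ('a::euclidean_space \<Rightarrow> real) \<Rightarrow> bool" where
  "Ck 0 g \<longleftrightarrow> continuous_on UNIV g"
| "Ck (Suc k) g \<longleftrightarrow>
     (\<forall>z. g differentiable (at z)) \<and> (\<forall>v. Ck k (\<lambda>z. frechet_derivative g (at z) v))"

text \<open>
  Test functions in \<open>C\<^sub>c\<^sup>\<infinity>([0,T) \<times> \<real>\<^sup>d/\<int>\<^sup>d)\<close>, given by smooth extensions to negative times.  They need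
  not vanish at time 0, so testing against them also encodes the initial condition.
\<close>

definition test_functions :: "real \<Rightarrow> (real \<times> (real ^ 'd) \<Rightarrow> real) set" where
  "test_functions T = {\<zeta>.
     (\<forall>k. Ck k \<zeta>) \<and> (\<forall>t. periodic (\<lambda>x. \<zeta> (t, x))) \<and> (\<exists>s<T. \<forall>t\<ge>s. \<forall>x. \<zeta> (t, x) = 0)}"

definition continuity_equation ::
  "real \<Rightarrow> (real ^ 'd \<Rightarrow> real) \<Rightarrow> (real \<times> (real ^ 'd) \<Rightarrow> real) \<Rightarrow> (real \<times> (real ^ 'd) \<Rightarrow> real ^ 'd) \<Rightarrow> bool"
  where
  "continuity_equation T m0 m w \<longleftrightarrow> (\<forall>\<zeta>\<in>test_functions T.
     (\<integral>(t, x). m (t, x) * deriv (\<lambda>s. \<zeta> (s, x)) t + w (t, x) \<bullet> grad (\<lambda>y. \<zeta> (t, y)) x \<partial>cyl T)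
     + (\<integral>x. \<zeta> (0, x) * m0 x \<partial>torus) = 0)"

definition K1 ::
  "real \<Rightarrow> (real ^ 'd \<Rightarrow> real) \<Rightarrow>
   ((real \<times> (real ^ 'd) \<Rightarrow> real) \<times> (real \<times> (real ^ 'd) \<Rightarrow> real ^ 'd)) set" where
  "K1 T m0 = {(m, w).
     integrable (cyl T) m \<and> integrable (cyl T) w \<and>
     (AE z in cyl T. 0 \<le> m z) \<and>
     (AE t in restrict_space lborel {0<..<T}. (\<integral>x. m (t, x) \<partial>torus) = 1) \<and>
     continuity_equation T m0 m w}"

text \<open>
  \<open>\<mu>\<close> is the representative of \<open>m\<close> that is a narrowly continuous curve of Borel probability measures
  on the torus.  Weak convergence is tested against continuous functions on the torus, that is,
  continuous periodic functions (not continuous functions on \<^const>\<open>cell\<close>).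
\<close>

definition narrow_curve :: "real \<Rightarrow> (real \<times> (real ^ 'd) \<Rightarrow> real) \<Rightarrow> (real \<Rightarrow> (real ^ 'd) measure) \<Rightarrow> bool"
  where
  "narrow_curve T m \<mu> \<longleftrightarrow>
     (\<forall>t\<in>{0..T}. prob_space (\<mu> t) \<and> sets (\<mu> t) = sets (restrict_space borel cell)) \<and>
     (\<forall>\<psi>. continuous_on UNIV \<psi> \<and> periodic \<psi> \<longrightarrow> continuous_on {0..T} (\<lambda>t. \<integral>x. \<psi> x \<partial>\<mu> t :: real)) \<and>
     (AE t in restrict_space lborel {0<..<T}. \<mu> t = density torus (\<lambda>x. ennreal (m (t, x))))"

text \<open>
  By continuity two narrowly continuous representatives of \<open>m\<close> agree on all of \<open>[0,T]\<close>, so the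
  choice below does not affect the measure at time \<open>T\<close>.
\<close>

definition at_time :: "real \<Rightarrow> (real \<times> (real ^ 'd) \<Rightarrow> real) \<Rightarrow> real \<Rightarrow> (real ^ 'd) measure" where
  "at_time T m = (SOME \<mu>. narrow_curve T m \<mu>)"

definition kinetic ::
  "('x \<Rightarrow> real ^ 'd \<Rightarrow> real) \<Rightarrow> 'x \<Rightarrow> real \<Rightarrow> real ^ 'd \<Rightarrow> ereal" where
  "kinetic H x m w =
     (if m = 0 then (if w = 0 then 0 else \<infinity>) else ereal m * H_star H x (- (w /\<^sub>R m)))"

definition B_fun ::
  "real \<Rightarrow> (real ^ 'd \<Rightarrow> real \<Rightarrow> real) \<Rightarrow> (real ^ 'd \<Rightarrow> real ^ 'd \<Rightarrow> real) \<Rightarrow> (real ^ 'd \<Rightarrow> real) \<Rightarrow>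
   (real \<times> (real ^ 'd) \<Rightarrow> real) \<times> (real \<times> (real ^ 'd) \<Rightarrow> real ^ 'd) \<Rightarrow> ereal" where
  "B_fun T f H \<phi>T = (\<lambda>(m, w).
     let I = ext_integral (cyl T)
               (\<lambda>(t, x). kinetic H x (m (t, x)) (w (t, x)) + coupling_primitive f x (m (t, x)))
     in if I = \<infinity> then \<infinity> else I + ereal (\<integral>x. \<phi>T x \<partial>at_time T m T))"

end

theory Submission
  imports Defs
begin

text \<open>
  One inequality of the duality is elementary.  Let \<open>\<phi>\<close> belong to \<^const>\<open>K0\<close> and \<open>(m, w)\<close> to
  \<^const>\<open>K1\<close>, and put \<open>a = - \<partial>\<^sub>t \<phi> + H(x, D\<phi>)\<close>.  Testing the continuity equation with \<open>\<phi> - \<phi>\<^sub>T\<close>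
  shows that the sum of the two functionals is the integral of
  \<open>(F\<^sup>*(x, a) + F(x, m) - a m) + (m H\<^sup>*(x, - w / m) + w \<bullet> D\<phi> + m H(x, D\<phi>))\<close>, and both brackets are
  nonnegative by the definition of the conjugates.  This is \<open>weak_duality\<close>.  It rests on two
  facts about \<^const>\<open>K1\<close>: the equation, which is given against smooth functions, holds against C1
  functions (\<open>cont_eq_C1\<close>, by convolution in space with a trigonometric kernel of finite rank and an
  integration by parts in time), and the terminal term of the primal functional equals
  \<open>\<integral> \<phi>\<^sub>T m\<^sub>0 + \<integral>\<integral> w \<bullet> D\<phi>\<^sub>T\<close> (\<open>terminal_value\<close>, which includes the existence of a narrowly continuous
  representative, \<open>narrow_curve_exists\<close>).

  The other inequality comes together with the minimiser, by a Galerkin argument in place of an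
  abstract duality theorem.  Minimise the dual functional plus \<open>\<epsilon> |c|\<^sup>2\<close> over the functions
  \<open>\<phi>\<^sub>T + \<Sum>\<^sub>i c\<^sub>i \<psi>\<^sub>i\<close>, for finitely many C1 functions \<open>\<psi>\<^sub>i\<close> that vanish at time \<open>T\<close>.  At a minimum
  point put \<open>m = (F\<^sup>*)'(x, a)\<close> and \<open>w = - m D\<^sub>pH(x, D\<phi>)\<close>.  Both Fenchel inequalities above are
  then equalities, which bounds the energy of \<open>(m, w)\<close> by minus the infimum of the dual functional,
  and the optimality condition says that the continuity equation tested with \<open>\<psi>\<^sub>i\<close> fails only by
  \<open>2 \<epsilon> c\<^sub>i\<close>, which is small (\<open>galerkin\<close>).  Hence for every finite set of test functions and every
  tolerance the set of pairs with this energy bound that satisfy these tests up to the tolerance is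
  nonempty.  These sets are convex and directed downwards, and the growth of \<open>f\<close> and \<open>H\<close> bounds
  them in \<open>L\<^sup>q \<times> L\<^sup>p\<close> with \<open>p = r' q / (r' + q - 1)\<close> (\<open>L_coercive\<close>).  Minimising the strictly convex
  functional \<open>\<integral> sqrt (1 + |u|\<^sup>2)\<close> along the family yields one point in the L1-closure of all of them
  (\<open>nested_convex_L1\<close>).  This point satisfies all tests exactly, and by lower semicontinuity its
  energy is still at most minus the infimum (\<open>limit_energy\<close>); so it lies in \<^const>\<open>K1\<close> and, by weak
  duality, is a minimiser.

  For uniqueness, the midpoint of two minimisers is again in \<^const>\<open>K1\<close>, so the energy density is
  affine between them almost everywhere.  But it is strictly convex: \<open>F\<close> is strictly convex in \<open>m\<close>
  because \<open>f\<close> is strictly increasing, and for fixed \<open>m > 0\<close> the kinetic part is strictly convex in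
  \<open>w\<close> because \<open>H\<close> is differentiable in \<open>\<xi>\<close> (\<open>L_strict\<close>).
\<close>

section \<open>The torus as a measure space\<close>

definition tint :: "real ^ 'd \<Rightarrow> real ^ 'd" where
  "tint x = (\<chi> i. of_int \<lfloor>x $ i\<rfloor>)"

definition tfrac :: "real ^ 'd \<Rightarrow> real ^ 'd" where
  "tfrac x = x - tint x"

lemma tint_lattice: "tint x \<in> lattice"
  by (simp add: tint_def lattice_def)

lemma tfrac_cell: "tfrac x \<in> cell"
  by (simp add: tfrac_def tint_def cell_def) linarith

lemma lattice_0 [simp]: "0 \<in> lattice"
  by (simp add: lattice_def)

lemma lattice_minus: "k \<in> lattice \<Longrightarrow> - k \<in> lattice"
  by (simp add: lattice_def)

lemma lattice_add: "k \<in> lattice \<Longrightarrow> l \<in> lattice \<Longrightarrow> k + l \<in> lattice"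
  by (simp add: lattice_def)

lemma cell_lattice_unique:
  fixes x :: "real ^ 'd"
  assumes "k \<in> lattice" shows "x - k \<in> cell \<longleftrightarrow> k = tint x"
proof
  assume c: "x - k \<in> cell"
  have "k $ i = of_int \<lfloor>x $ i\<rfloor>" for i
  proof -
    obtain j where j: "k $ i = of_int j" using assms by (auto simp: lattice_def elim: Ints_cases)
    have "0 \<le> x $ i - k $ i" "x $ i - k $ i < 1" using c by (auto simp: cell_def)
    then have "\<lfloor>x $ i\<rfloor> = j" using j by linarith
    then show ?thesis using j by simp
  qed
  then show "k = tint x" by (simp add: tint_def vec_eq_iff)
next
  assume "k = tint x" then show "x - k \<in> cell" using tfrac_cell[of x] by (simp add: tfrac_def)
qed

lemma tfrac_id: "x \<in> cell \<Longrightarrow> tfrac x = x"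
  using cell_lattice_unique[of 0 x] by (simp add: tfrac_def)

lemma periodic_tfrac: "periodic g \<Longrightarrow> g (tfrac x) = g x"
  unfolding periodic_def tfrac_def using tint_lattice[of x]
  by (metis diff_add_cancel)

lemma periodic_lattice: "periodic g \<Longrightarrow> k \<in> lattice \<Longrightarrow> g (x - k) = g x"
  unfolding periodic_def by (metis diff_add_cancel)

lemma tfrac_add_lattice: assumes "k \<in> lattice" shows "tfrac (x + k) = tfrac x"
proof -
  have "x - (tint (x + k) - k) \<in> cell" using tfrac_cell[of "x + k"] by (simp add: tfrac_def algebra_simps)
  then have "tint (x + k) - k = tint x"
    using cell_lattice_unique[of "tint (x + k) - k" x] assms tint_lattice[of "x+k"]
      lattice_add[of "tint (x+k)" "-k"] lattice_minus[of k] by simp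
  then show ?thesis by (simp add: tfrac_def algebra_simps)
qed

lemma countable_lattice: "countable (lattice :: (real ^ 'd) set)"
proof -
  have "lattice \<subseteq> range (\<lambda>f :: 'd \<Rightarrow> int. (\<chi> i. (of_int (f i) :: real)))"
  proof
    fix k :: "real ^ 'd" assume "k \<in> lattice"
    then have "k = (\<chi> i. of_int \<lfloor>k $ i\<rfloor>)"
      by (auto simp: lattice_def vec_eq_iff)
    then show "k \<in> range (\<lambda>f :: 'd \<Rightarrow> int. (\<chi> i. (of_int (f i) :: real)))"
      by (intro image_eqI[where x = "\<lambda>i. \<lfloor>k $ i\<rfloor>"]) auto
  qed
  then show ?thesis by (meson countable_image countable_subset countableI_type)
qed

lemma vec_nth_borel [measurable]: "(\<lambda>x :: real ^ 'd. x $ i) \<in> borel_measurable borel"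
  by (intro borel_measurable_continuous_onI continuous_intros)

lemma cell_borel [measurable, simp]: "cell \<in> sets borel"
proof -
  have "{x :: real ^ 'd. \<forall>i. 0 \<le> x $ i \<and> x $ i < 1} \<in> sets borel" by measurable
  then show ?thesis by (simp add: cell_def)
qed

lemma tint_borel [measurable]: "tint \<in> borel_measurable borel"
  unfolding tint_def
  by (subst borel_measurable_euclidean_space) (auto simp: Basis_vec_def inner_axis)

lemma tfrac_borel [measurable]: "tfrac \<in> borel_measurable borel"
  unfolding tfrac_def by measurable

lemma cell_bounds: "box 0 (\<chi> i. 1) \<subseteq> (cell :: (real ^ 'd) set)" "(cell :: (real ^ 'd) set) \<subseteq> cbox 0 (\<chi> i. 1)"
  by (auto simp: cell_def mem_box_cart less_imp_le)

lemma emeasure_cell: "emeasure lborel (cell :: (real ^ 'd) set) = 1"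
proof -
  have p: "(\<Prod>b\<in>Basis. ((\<chi> i. 1) - 0 :: real ^ 'd) \<bullet> b) = 1"
    by (rule prod.neutral) (auto simp: Basis_vec_def inner_axis)
  have le: "\<And>b. b \<in> Basis \<Longrightarrow> (0 :: real ^ 'd) \<bullet> b \<le> (\<chi> i. 1) \<bullet> b"
    by (auto simp: Basis_vec_def inner_axis)
  have "emeasure lborel (cell :: (real ^ 'd) set) \<le> emeasure lborel (cbox 0 (\<chi> i. 1) :: (real ^ 'd) set)"
    by (intro emeasure_mono cell_bounds) auto
  moreover have "emeasure lborel (box 0 (\<chi> i. 1) :: (real ^ 'd) set) \<le> emeasure lborel (cell :: (real ^ 'd) set)"
    by (intro emeasure_mono cell_bounds) auto
  moreover have "emeasure lborel (cbox 0 (\<chi> i. 1) :: (real ^ 'd) set) = 1"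
    using p by (subst emeasure_lborel_cbox[OF le]) (simp_all only: ennreal_1)
  moreover have "emeasure lborel (box 0 (\<chi> i. 1) :: (real ^ 'd) set) = 1"
    using p by (subst emeasure_lborel_box[OF le]) (simp_all only: ennreal_1)
  ultimately show ?thesis by (metis antisym)
qed

lemma space_torus [simp]: "space (torus :: (real ^ 'd) measure) = cell"
  by (simp add: torus_def space_restrict_space)

lemma sets_torus: "sets (torus :: (real ^ 'd) measure) = sets (restrict_space borel cell)"
  by (simp add: torus_def sets_restrict_space)

lemma prob_space_torus: "prob_space (torus :: (real ^ 'd) measure)"
  by standard (simp add: torus_def emeasure_restrict_space space_restrict_space emeasure_cell)

interpretation torus: prob_space "torus :: (real ^ 'd) measure"
  by (rule prob_space_torus)

lemma measurable_torus: "f \<in> borel_measurable borel \<Longrightarrow> f \<in> borel_measurable torus"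
  unfolding torus_def by (intro measurable_restrict_space1) simp

lemma measurable_torus_cont:
  fixes f :: "real ^ 'd \<Rightarrow> 'b::topological_space"
  shows "continuous_on UNIV f \<Longrightarrow> f \<in> borel_measurable torus"
  by (intro measurable_torus borel_measurable_continuous_onI)

definition tm :: "real \<Rightarrow> real measure" where
  "tm T = restrict_space lborel {0<..<T}"

lemma space_tm [simp]: "space (tm T) = {0<..<T}"
  by (simp add: tm_def space_restrict_space)

lemma finite_measure_tm: "finite_measure (tm T)"
  by standard (cases "0 \<le> T"; simp add: tm_def emeasure_restrict_space)

interpretation tm: finite_measure "tm T" for T
  by (rule finite_measure_tm)

lemma measurable_tm: "f \<in> borel_measurable borel \<Longrightarrow> f \<in> borel_measurable (tm T)"
  unfolding tm_def by (intro measurable_restrict_space1) simp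

lemma space_cyl: "space (cyl T :: (real \<times> (real ^ 'd)) measure) = {0<..<T} \<times> cell"
  by (simp add: cyl_def space_restrict_space)

lemma cylset_borel [measurable, simp]: "{0<..<T :: real} \<times> (cell :: (real ^ 'd) set) \<in> sets borel"
  by (intro borel_Times) auto

lemma sets_pair_restrict_space:
  assumes A: "A \<in> sets M" and B: "B \<in> sets N"
  shows "sets (restrict_space M A \<Otimes>\<^sub>M restrict_space N B) = sets (restrict_space (M \<Otimes>\<^sub>M N) (A \<times> B))"
    (is "sets ?L = sets ?R")
proof -
  have AB: "A \<inter> space M = A" "B \<inter> space N = B" using A B sets.sets_into_space by blast+
  have sp: "space ?L = A \<times> B" "space ?R = A \<times> B"
    using AB by (auto simp: space_pair_measure space_restrict_space)
  have f1: "fst \<in> measurable ?R (restrict_space M A)" and s1: "snd \<in> measurable ?R (restrict_space N B)"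
    by (rule measurable_restrict_space2; use sp in \<open>auto intro: measurable_restrict_space1\<close>)+
  have "(\<lambda>z. (fst z, snd z)) \<in> measurable ?R ?L" using f1 s1 by (rule measurable_Pair)
  then have m1: "(\<lambda>z. z) \<in> measurable ?R ?L" by simp
  have f2: "fst \<in> measurable ?L M" and s2: "snd \<in> measurable ?L N"
    by (rule measurable_compose[OF measurable_fst] measurable_compose[OF measurable_snd];
        rule measurable_restrict_space1; simp)+
  have "(\<lambda>z. (fst z, snd z)) \<in> measurable ?L (M \<Otimes>\<^sub>M N)" using f2 s2 by (rule measurable_Pair)
  then have m2: "(\<lambda>z. z) \<in> measurable ?L ?R"
    by (intro measurable_restrict_space2) (use sp in auto)
  show ?thesis
  proof (intro set_eqI iffI)
    fix X assume X: "X \<in> sets ?L"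
    have "X \<subseteq> A \<times> B" using sets.sets_into_space[OF X] sp by simp
    then have "(\<lambda>z. z) -` X \<inter> space ?R = X" using sp by auto
    then show "X \<in> sets ?R" using measurable_sets[OF m1 X] by simp
  next
    fix X assume X: "X \<in> sets ?R"
    have "X \<subseteq> A \<times> B" using sets.sets_into_space[OF X] sp by simp
    then have "(\<lambda>z. z) -` X \<inter> space ?L = X" using sp by auto
    then show "X \<in> sets ?L" using measurable_sets[OF m2 X] by simp
  qed
qed

lemma sets_cyl: "sets (cyl T :: (real \<times> (real ^ 'd)) measure) = sets (tm T \<Otimes>\<^sub>M torus)"
proof -
  have "sets (tm T \<Otimes>\<^sub>M (torus :: (real ^ 'd) measure)) =
     sets (restrict_space (lborel \<Otimes>\<^sub>M lborel) ({0<..<T} \<times> (cell :: (real ^ 'd) set)))"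
    unfolding tm_def torus_def by (rule sets_pair_restrict_space) simp_all
  then show ?thesis unfolding cyl_def lborel_prod by simp
qed

text \<open>
  Lebesgue measure on the cylinder is the product of its time and space parts, which is what
  makes Fubini's theorem available.
\<close>
lemma cyl_eq: "tm T \<Otimes>\<^sub>M torus = (cyl T :: (real \<times> (real ^ 'd)) measure)"
proof (rule pair_measure_eqI)
  show "sigma_finite_measure (tm T)" "sigma_finite_measure (torus :: (real ^ 'd) measure)"
    by unfold_locales
  show "sets (tm T \<Otimes>\<^sub>M torus) = sets (cyl T :: (real \<times> (real ^ 'd)) measure)"
    by (simp add: sets_cyl)
next
  fix A and B :: "(real ^ 'd) set"
  assume A: "A \<in> sets (tm T)" and B: "B \<in> sets torus"
  then have AB: "A \<subseteq> {0<..<T}" "B \<subseteq> cell" "A \<in> sets borel" "B \<in> sets borel"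
    by (auto simp: tm_def torus_def sets_restrict_space)
  have "emeasure (cyl T) (A \<times> B) = emeasure lborel (A \<times> B)"
    unfolding cyl_def by (subst emeasure_restrict_space) (use AB in auto)
  also have "\<dots> = emeasure (lborel \<Otimes>\<^sub>M lborel) (A \<times> B)"
    by (simp add: lborel_prod)
  also have "\<dots> = emeasure lborel A * emeasure lborel B"
    using AB by (intro lborel.emeasure_pair_measure_Times) auto
  also have "emeasure lborel A = emeasure (tm T) A"
    unfolding tm_def by (subst emeasure_restrict_space) (use AB in auto)
  also have "emeasure lborel B = emeasure torus B"
    unfolding torus_def by (subst emeasure_restrict_space) (use AB in auto)
  finally show "emeasure (tm T) A * emeasure torus B = emeasure (cyl T) (A \<times> B)" by simp
qed

lemma finite_measure_cyl: "finite_measure (cyl T :: (real \<times> (real ^ 'd)) measure)"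
proof -
  have "emeasure (tm T \<Otimes>\<^sub>M (torus :: (real ^ 'd) measure)) ({0<..<T} \<times> cell)
      = emeasure (tm T) {0<..<T} * emeasure (torus :: (real ^ 'd) measure) cell"
    using sets.top[of "tm T"] sets.top[of "torus :: (real ^ 'd) measure"]
    by (intro torus.emeasure_pair_measure_Times) simp_all
  also have "\<dots> = emeasure (tm T) {0<..<T}"
    using torus.emeasure_space_1[where 'd = 'd] by simp
  finally have "emeasure (tm T \<Otimes>\<^sub>M (torus :: (real ^ 'd) measure)) ({0<..<T} \<times> cell) \<noteq> \<infinity>"
    using tm.emeasure_finite[of T "{0<..<T}"] by (simp del: tm.emeasure_finite)
  then show ?thesis
    unfolding cyl_eq[symmetric] by (intro finite_measureI) (simp add: space_pair_measure)
qed

interpretation cyl: finite_measure "cyl T :: (real \<times> (real ^ 'd)) measure" for T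
  by (rule finite_measure_cyl)

interpretation tmtorus: pair_sigma_finite "tm T" "torus :: (real ^ 'd) measure" for T
  by unfold_locales

lemma cyl_fubini:
  fixes h :: "real \<times> (real ^ 'd) \<Rightarrow> 'b::{banach, second_countable_topology}"
  assumes "integrable (cyl T) h"
  shows "AE t in tm T. integrable torus (\<lambda>x. h (t, x))"
    and "integrable (tm T) (\<lambda>t. \<integral>x. h (t, x) \<partial>torus)"
    and "(\<integral>z. h z \<partial>cyl T) = (\<integral>t. \<integral>x. h (t, x) \<partial>torus \<partial>tm T)"
  using assms tmtorus.AE_integrable_fst'[of T h] tmtorus.integrable_fst'[of T h] tmtorus.integral_fst'[of T h]
  by (simp_all add: cyl_eq)

lemma measurable_cyl_borel: "f \<in> borel_measurable borel \<Longrightarrow> f \<in> borel_measurable (cyl T)"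
  unfolding cyl_def by (intro measurable_restrict_space1) simp

lemma measurable_cyl_cont:
  fixes f :: "real \<times> (real ^ 'd) \<Rightarrow> 'b::topological_space"
  assumes "continuous_on ({0..T} \<times> UNIV) f" shows "f \<in> borel_measurable (cyl T)"
proof -
  have "continuous_on ({0<..<T} \<times> cell) f"
    by (rule continuous_on_subset[OF assms]) auto
  then have "f \<in> borel_measurable (restrict_space borel ({0<..<T} \<times> cell))"
    by (rule borel_measurable_continuous_on_restrict)
  then show ?thesis
    by (simp add: cyl_def measurable_cong_sets[OF sets_restrict_space_cong[OF sets_lborel] refl])
qed

text \<open>
  The map \<open>y \<mapsto> a - y\<close> preserves Lebesgue measure but moves the cell.  Since every point has
  exactly one lattice translate in the cell, inserting \<open>1 = \<Sum>\<^sub>k 1\<^sub>c\<^sub>e\<^sub>l\<^sub>l(y - k)\<close> and translating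
  each term by its \<open>k\<close> exchanges the two cells.
\<close>
lemma torus_reflect:
  fixes a :: "real ^ 'd"
  shows "distr torus torus (\<lambda>y. tfrac (a - y)) = torus"
proof (rule measure_eqI)
  show "sets (distr torus torus (\<lambda>y. tfrac (a - y))) = sets torus" by simp
next
  fix A :: "(real ^ 'd) set" assume "A \<in> sets (distr torus torus (\<lambda>y. tfrac (a - y)))"
  then have A [measurable]: "A \<in> sets borel" and Ac: "A \<subseteq> cell" "A \<in> sets torus"
    by (auto simp: torus_def sets_restrict_space)
  define g :: "real ^ 'd \<Rightarrow> ennreal" where "g = (\<lambda>y. indicator A (tfrac y))"
  have [measurable]: "g \<in> borel_measurable borel" unfolding g_def by measurable
  have gper: "g (y + k) = g y" if "k \<in> lattice" for y k
    using that by (simp add: g_def tfrac_add_lattice)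
  have tf: "(\<lambda>y. tfrac (a - y)) \<in> measurable torus torus"
    unfolding torus_def
    by (intro measurable_restrict_space1 measurable_restrict_space2) (auto simp: tfrac_cell)
  have cs: "(\<integral>\<^sup>+k. indicator cell (b - k) \<partial>count_space lattice) = (1 :: ennreal)" for b :: "real ^ 'd"
  proof -
    have "(\<integral>\<^sup>+k. indicator cell (b - k) \<partial>count_space lattice) = (\<integral>\<^sup>+k. indicator {tint b} k \<partial>count_space lattice)"
      by (intro nn_integral_cong) (auto simp: indicator_def cell_lattice_unique)
    also have "\<dots> = 1"
      using tint_lattice[of b] by (subst nn_integral_indicator) (auto simp: emeasure_count_space_finite)
    finally show ?thesis .
  qed
  have "emeasure (distr torus torus (\<lambda>y. tfrac (a - y))) A = (\<integral>\<^sup>+y. g (a - y) \<partial>torus)"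
  proof -
    have "emeasure (distr torus torus (\<lambda>y. tfrac (a - y))) A = (\<integral>\<^sup>+y. indicator A y \<partial>distr torus torus (\<lambda>y. tfrac (a - y)))"
      using Ac by simp
    also have "\<dots> = (\<integral>\<^sup>+y. g (a - y) \<partial>torus)"
      unfolding g_def using Ac by (intro nn_integral_distr tf) auto
    finally show ?thesis .
  qed
  also have "\<dots> = (\<integral>\<^sup>+y. indicator cell y * g (a - y) \<partial>lborel)"
    unfolding torus_def by (subst nn_integral_restrict_space) (auto simp: mult.commute)
  also have "\<dots> = (\<integral>\<^sup>+y. indicator cell (a - y) * g y \<partial>lborel)"
  proof -
    have "lborel = distr lborel borel (\<lambda>x :: real ^ 'd. a + (-1) *\<^sub>R x)"
      using lborel_affine[of "-1" a] by (simp add: density_1)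
    then have "(\<integral>\<^sup>+y. indicator cell (a - y) * g y \<partial>lborel) =
        (\<integral>\<^sup>+y. indicator cell (a - y) * g y \<partial>distr lborel borel (\<lambda>x. a + (-1) *\<^sub>R x))"
      by simp
    also have "\<dots> = (\<integral>\<^sup>+y. indicator cell y * g (a - y) \<partial>lborel)"
      by (subst nn_integral_distr) auto
    finally show ?thesis by simp
  qed
  also have "\<dots> = (\<integral>\<^sup>+y. (\<integral>\<^sup>+k. indicator cell (y - k) * (indicator cell (a - y) * g y) \<partial>count_space lattice) \<partial>lborel)"
    by (intro nn_integral_cong) (subst nn_integral_multc, auto simp: cs)
  also have "\<dots> = (\<integral>\<^sup>+k. (\<integral>\<^sup>+y. indicator cell (y - k) * (indicator cell (a - y) * g y) \<partial>lborel) \<partial>count_space lattice)"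
    by (intro nn_integral_count_space_nn_integral countable_lattice) measurable
  also have "\<dots> = (\<integral>\<^sup>+k. (\<integral>\<^sup>+y. indicator cell ((a - y) - k) * (indicator cell y * g y) \<partial>lborel) \<partial>count_space lattice)"
  proof (rule nn_integral_cong)
    fix k :: "real ^ 'd" assume "k \<in> space (count_space lattice)"
    then have k: "k \<in> lattice" by simp
    have "(\<integral>\<^sup>+y. indicator cell (y - k) * (indicator cell (a - y) * g y) \<partial>lborel)
        = (\<integral>\<^sup>+y. indicator cell (y - k) * (indicator cell (a - y) * g y) \<partial>distr lborel borel ((+) k))"
      by (simp add: lborel_distr_plus)
    also have "\<dots> = (\<integral>\<^sup>+y. indicator cell y * (indicator cell (a - (k + y)) * g (k + y)) \<partial>lborel)"
      by (subst nn_integral_distr) auto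
    also have "\<dots> = (\<integral>\<^sup>+y. indicator cell ((a - y) - k) * (indicator cell y * g y) \<partial>lborel)"
      by (intro nn_integral_cong) (simp add: gper[OF k] add.commute[of k] algebra_simps)
    finally show "(\<integral>\<^sup>+y. indicator cell (y - k) * (indicator cell (a - y) * g y) \<partial>lborel)
      = (\<integral>\<^sup>+y. indicator cell ((a - y) - k) * (indicator cell y * g y) \<partial>lborel)" .
  qed
  also have "\<dots> = (\<integral>\<^sup>+y. (\<integral>\<^sup>+k. indicator cell ((a - y) - k) * (indicator cell y * g y) \<partial>count_space lattice) \<partial>lborel)"
    by (intro nn_integral_count_space_nn_integral[symmetric] countable_lattice) measurable
  also have "\<dots> = (\<integral>\<^sup>+y. indicator cell y * g y \<partial>lborel)"
    by (intro nn_integral_cong) (subst nn_integral_multc, auto simp: cs)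
  also have "\<dots> = (\<integral>\<^sup>+y. indicator A y \<partial>lborel)"
    using Ac by (intro nn_integral_cong) (auto simp: g_def indicator_def tfrac_id)
  also have "\<dots> = emeasure torus A"
    unfolding torus_def using Ac by (subst emeasure_restrict_space) auto
  finally show "emeasure (distr torus torus (\<lambda>y. tfrac (a - y))) A = emeasure torus A" .
qed

lemma integral_torus_reflect:
  fixes g :: "real ^ 'd \<Rightarrow> 'b::{banach, second_countable_topology}"
  assumes [measurable]: "g \<in> borel_measurable borel" and g: "periodic g"
  shows "(\<integral>y. g (a - y) \<partial>torus) = (\<integral>y. g y \<partial>torus)"
proof -
  have tf: "(\<lambda>y. tfrac (a - y)) \<in> measurable torus torus"
    unfolding torus_def
    by (intro measurable_restrict_space1 measurable_restrict_space2) (auto simp: tfrac_cell)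
  have "(\<integral>y. g y \<partial>torus) = (\<integral>y. g y \<partial>distr torus torus (\<lambda>y. tfrac (a - y)))"
    by (simp add: torus_reflect)
  also have "\<dots> = (\<integral>y. g (tfrac (a - y)) \<partial>torus)"
    by (intro integral_distr tf measurable_torus) simp
  finally show ?thesis by (simp add: periodic_tfrac[OF g])
qed

lemma cell_compact_nbhd: "x \<in> cell \<Longrightarrow> dist x y < 1 \<Longrightarrow> y \<in> cbox (\<chi> i. -1) (\<chi> i. 2)"
proof -
  assume x: "x \<in> cell" and d: "dist x y < 1"
  have "\<bar>x $ i - y $ i\<bar> < 1" for i
    using dist_vec_nth_le[of x i y] d by (simp add: dist_real_def)
  moreover have "0 \<le> x $ i" "x $ i < 1" for i using x by (auto simp: cell_def)
  ultimately show ?thesis unfolding mem_box_cart by (simp add: abs_less_iff) (smt (verit))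
qed

lemma cell_subset_cbox: "(cell :: (real ^ 'd) set) \<subseteq> cbox (\<chi> i. -1) (\<chi> i. 2)"
  using cell_compact_nbhd[of x x for x] by auto

text \<open>
  A lattice translation moves the first point into the cell and the second one into a fixed
  compact box, on which continuity is uniform.
\<close>
lemma periodic_uniform:
  fixes g :: "real \<times> (real ^ 'd) \<Rightarrow> 'b::metric_space"
  assumes c: "continuous_on ({0..T} \<times> UNIV) g" and p: "\<And>t. t \<in> {0..T} \<Longrightarrow> periodic (\<lambda>x. g (t, x))"
    and e: "0 < e"
  shows "\<exists>d>0. \<forall>t\<in>{0..T}. \<forall>s\<in>{0..T}. \<forall>x y. dist (t, x) (s, y) < d \<longrightarrow> dist (g (t, x)) (g (s, y)) < e"
proof -
  let ?K = "{0..T} \<times> (cbox (\<chi> i. -1) (\<chi> i. 2) :: (real ^ 'd) set)"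
  have "uniformly_continuous_on ?K g"
    by (intro compact_uniformly_continuous compact_Times continuous_on_subset[OF c]) auto
  then obtain d where d: "d > 0"
    "\<And>z w. z \<in> ?K \<Longrightarrow> w \<in> ?K \<Longrightarrow> dist w z < d \<Longrightarrow> dist (g w) (g z) < e"
    using e unfolding uniformly_continuous_on_def by metis
  show ?thesis
  proof (intro exI[of _ "min d 1"] conjI ballI allI impI)
    show "0 < min d 1" using d by simp
    fix t s :: real and x y :: "real ^ 'd"
    assume ts: "t \<in> {0..T}" "s \<in> {0..T}" and dd: "dist (t, x) (s, y) < min d 1"
    define k where "k = tint x"
    have k: "k \<in> lattice" by (simp add: k_def tint_lattice)
    have dx: "dist (x - k) (y - k) < 1"
      using dd dist_snd_le[of "(t,x)" "(s,y)"] by (simp add: dist_norm)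
    have xk: "x - k \<in> cell" using tfrac_cell[of x] by (simp add: k_def tfrac_def)
    have "dist (t, x - k) (s, y - k) < d" using dd by (simp add: dist_Pair_Pair dist_norm)
    then have "dist (g (t, x - k)) (g (s, y - k)) < e"
      using d(2)[of "(s, y - k)" "(t, x - k)"] ts cell_compact_nbhd[OF xk dx] xk cell_subset_cbox by auto
    then show "dist (g (t, x)) (g (s, y)) < e"
      using periodic_lattice[OF p[OF ts(1)] k] periodic_lattice[OF p[OF ts(2)] k] by simp
  qed
qed

lemma periodic_bounded:
  fixes g :: "real \<times> (real ^ 'd) \<Rightarrow> 'b::real_normed_vector"
  assumes c: "continuous_on ({0..T} \<times> UNIV) g" and p: "\<And>t. t \<in> {0..T} \<Longrightarrow> periodic (\<lambda>x. g (t, x))"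
  shows "\<exists>M\<ge>0. \<forall>t\<in>{0..T}. \<forall>x. norm (g (t, x)) \<le> M"
proof -
  let ?K = "{0..T} \<times> (cbox (\<chi> i. -1) (\<chi> i. 2) :: (real ^ 'd) set)"
  have "compact (g ` ?K)"
    by (intro compact_continuous_image compact_Times continuous_on_subset[OF c]) auto
  then obtain M where M: "\<And>z. z \<in> ?K \<Longrightarrow> norm (g z) \<le> M"
    by (meson bounded_iff compact_imp_bounded image_eqI)
  have "norm (g (t, x)) \<le> max M 0" if "t \<in> {0..T}" for t x
    using M[of "(t, tfrac x)"] that tfrac_cell[of x] cell_subset_cbox periodic_tfrac[OF p[OF that], of x]
    by (auto simp: le_max_iff_disj)
  then show ?thesis by (intro exI[of _ "max M 0"]) auto
qed

lemma periodic_bounded_space: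
  fixes g :: "real ^ 'd \<Rightarrow> 'b::real_normed_vector"
  assumes c: "continuous_on UNIV g" and p: "periodic g"
  shows "\<exists>M\<ge>0. \<forall>x. norm (g x) \<le> M"
proof -
  have "continuous_on ({0..1 :: real} \<times> UNIV) (\<lambda>z. g (snd z))"
    by (auto intro!: continuous_on_compose2[OF c] continuous_intros)
  from periodic_bounded[OF this] p obtain M where "M \<ge> 0" "\<forall>t\<in>{0..1::real}. \<forall>x. norm (g x) \<le> M" by auto
  then show ?thesis by (intro exI[of _ M]) (auto dest!: bspec[of _ _ 0])
qed

lemma periodic_uniform_space:
  fixes g :: "real ^ 'd \<Rightarrow> 'b::metric_space"
  assumes c: "continuous_on UNIV g" and p: "periodic g" and e: "0 < e"
  shows "\<exists>d>0. \<forall>x y. dist x y < d \<longrightarrow> dist (g x) (g y) < e"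
proof -
  have "continuous_on ({0..1} \<times> UNIV) (\<lambda>z. g (snd z))"
    by (auto intro!: continuous_on_compose2[OF c] continuous_intros)
  from periodic_uniform[OF this _ e] p obtain d where "d > 0"
    "\<forall>t\<in>{0..1::real}. \<forall>s\<in>{0..1::real}. \<forall>x y. dist (t, x) (s, y) < d \<longrightarrow> dist (g x) (g y) < e" by auto
  then show ?thesis by (intro exI[of _ d]) (auto dest!: bspec[of _ _ 0] simp: dist_Pair_Pair)
qed

lemma integrable_torus_cont:
  fixes g :: "real ^ 'd \<Rightarrow> 'b::{banach, second_countable_topology}"
  assumes "continuous_on UNIV g" "periodic g" shows "integrable torus g"
  using periodic_bounded_space[OF assms] measurable_torus_cont[OF assms(1)]
  by (auto intro!: torus.integrable_const_bound)

lemma integrable_cyl_mult: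
  fixes u :: "real \<times> (real ^ 'd) \<Rightarrow> real"
  assumes "integrable (cyl T) u" "g \<in> borel_measurable (cyl T)" "\<And>z. z \<in> space (cyl T) \<Longrightarrow> \<bar>g z\<bar> \<le> M"
  shows "integrable (cyl T) (\<lambda>z. u z * g z)"
proof (rule Bochner_Integration.integrable_bound[where f = "\<lambda>z. M * u z"])
  show "AE z in cyl T. norm (u z * g z) \<le> norm (M * u z)"
  proof (rule AE_I2)
    fix z :: "real \<times> (real ^ 'd)" assume "z \<in> space (cyl T)"
    then have "\<bar>u z\<bar> * \<bar>g z\<bar> \<le> \<bar>u z\<bar> * \<bar>M\<bar>"
      by (intro mult_left_mono) (use assms(3)[of z] in auto)
    then show "norm (u z * g z) \<le> norm (M * u z)" by (simp add: abs_mult mult.commute)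
  qed
qed (use assms in auto)

lemma integrable_cyl_inner:
  fixes w :: "real \<times> (real ^ 'd) \<Rightarrow> real ^ 'd"
  assumes "integrable (cyl T) w" "g \<in> borel_measurable (cyl T)" "\<And>z. z \<in> space (cyl T) \<Longrightarrow> norm (g z) \<le> M"
  shows "integrable (cyl T) (\<lambda>z. w z \<bullet> g z)"
proof (rule Bochner_Integration.integrable_bound[where f = "\<lambda>z. M *\<^sub>R w z"])
  show "(\<lambda>z. w z \<bullet> g z) \<in> borel_measurable (cyl T)"
    using assms(1,2) by (intro borel_measurable_inner) auto
  show "AE z in cyl T. norm (w z \<bullet> g z) \<le> norm (M *\<^sub>R w z)"
  proof (rule AE_I2)
    fix z :: "real \<times> (real ^ 'd)" assume "z \<in> space (cyl T)"
    then have "norm (w z) * norm (g z) \<le> norm (w z) * \<bar>M\<bar>"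
      by (intro mult_left_mono) (use assms(3)[of z] in auto)
    then show "norm (w z \<bullet> g z) \<le> norm (M *\<^sub>R w z)"
      using Cauchy_Schwarz_ineq2[of "w z" "g z"] by (simp add: mult.commute)
  qed
qed (use assms in auto)

section \<open>Trigonometric monomials and a finite-rank approximate identity\<close>

definition trig1 :: "'d \<times> bool \<Rightarrow> real ^ 'd \<Rightarrow> real" where
  "trig1 p x = (if snd p then cos (2 * pi * x $ fst p) else sin (2 * pi * x $ fst p))"

definition trig1_grad :: "'d \<times> bool \<Rightarrow> real ^ 'd \<Rightarrow> real ^ 'd" where
  "trig1_grad p x = (if snd p then - (2 * pi * sin (2 * pi * x $ fst p)) else 2 * pi * cos (2 * pi * x $ fst p))
     *\<^sub>R axis (fst p) 1"

definition tmono :: "('d \<times> bool) list \<Rightarrow> real ^ 'd \<Rightarrow> real" where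
  "tmono l x = prod_list (map (\<lambda>p. trig1 p x) l)"

primrec tgrad :: "('d \<times> bool) list \<Rightarrow> real ^ 'd \<Rightarrow> real ^ 'd" where
  "tgrad [] x = 0"
| "tgrad (p # l) x = trig1 p x *\<^sub>R tgrad l x + tmono l x *\<^sub>R trig1_grad p x"

lemma tmono_simps [simp]: "tmono [] x = 1" "tmono (p # l) x = trig1 p x * tmono l x"
  "tmono (l @ l') x = tmono l x * tmono l' x"
  by (simp_all add: tmono_def)

lemma cos_sin_int_shift:
  assumes "k \<in> \<int>"
  shows "cos (2 * pi * (s + k)) = cos (2 * pi * s)" "sin (2 * pi * (s + k)) = sin (2 * pi * s)"
proof -
  obtain n where n: "k = of_int n" using assms by (auto elim: Ints_cases)
  show "cos (2 * pi * (s + k)) = cos (2 * pi * s)" "sin (2 * pi * (s + k)) = sin (2 * pi * s)"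
    using cos_int_2pin[of n] sin_int_2pin[of n]
    by (simp_all add: n distrib_left cos_add sin_add mult.assoc)
qed

lemma trig1_periodic: "k \<in> lattice \<Longrightarrow> trig1 p (x + k) = trig1 p x"
  "k \<in> lattice \<Longrightarrow> trig1_grad p (x + k) = trig1_grad p x"
  by (auto simp: trig1_def trig1_grad_def lattice_def cos_sin_int_shift)

lemma tmono_periodic: "periodic (tmono l)"
  unfolding periodic_def by (induction l) (auto simp: trig1_periodic)

lemma tgrad_periodic: "periodic (tgrad l)"
  unfolding periodic_def
  by (induction l) (simp_all add: trig1_periodic tmono_periodic[unfolded periodic_def, rule_format])

lemma trig1_cont: "continuous_on UNIV (trig1 p)"
  unfolding trig1_def by (cases "snd p") (auto intro!: continuous_intros)

lemma trig1_grad_cont: "continuous_on UNIV (trig1_grad p)"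
  unfolding trig1_grad_def by (cases "snd p") (auto intro!: continuous_intros)

lemma tmono_cont: "continuous_on UNIV (tmono l)"
  by (induction l) (auto intro!: continuous_intros trig1_cont)

lemma tgrad_cont: "continuous_on UNIV (tgrad l)"
  by (induction l) (auto intro!: continuous_intros trig1_cont tmono_cont trig1_grad_cont)

lemma tmono_bound: "\<bar>tmono l x\<bar> \<le> 1"
proof (induction l)
  case (Cons p l)
  have "\<bar>trig1 p x\<bar> \<le> 1" by (simp add: trig1_def)
  then show ?case using Cons by (simp add: abs_mult mult_le_one)
qed simp

lemma GDERIV_trig1: "GDERIV (trig1 p) x :> trig1_grad p x"
proof -
  have n: "GDERIV (\<lambda>x. x $ fst p) x :> axis (fst p) 1"
    unfolding gderiv_def inner_axis
    by (simp add: bounded_linear_imp_has_derivative[OF bounded_linear_vec_nth])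
  have c: "DERIV (\<lambda>s. cos (2 * pi * s)) s :> - (2 * pi * sin (2 * pi * s))" for s
    by (auto intro!: derivative_eq_intros)
  have s: "DERIV (\<lambda>s. sin (2 * pi * s)) s :> 2 * pi * cos (2 * pi * s)" for s
    by (auto intro!: derivative_eq_intros)
  show ?thesis
    using GDERIV_DERIV_compose[OF n c] GDERIV_DERIV_compose[OF n s]
    unfolding trig1_def trig1_grad_def by (cases "snd p") simp_all
qed

lemma GDERIV_tmono: "GDERIV (tmono l) x :> tgrad l x"
proof (induction l)
  case Nil then show ?case by (simp add: GDERIV_const)
next
  case (Cons p l)
  have "GDERIV (\<lambda>x. trig1 p x * tmono l x) x :> trig1 p x *\<^sub>R tgrad l x + tmono l x *\<^sub>R trig1_grad p x"
    using GDERIV_mult[OF GDERIV_trig1 Cons] by simp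
  then show ?case by simp
qed

text \<open>
  Kernels of finite rank: integrating against such a kernel sends every function to a combination
  of finitely many trigonometric monomials.
\<close>
definition separable :: "(real ^ 'd \<Rightarrow> real ^ 'd \<Rightarrow> real) \<Rightarrow> bool" where
  "separable \<kappa> \<longleftrightarrow> (\<exists>L. \<forall>x y. \<kappa> x y = (\<Sum>(c, l, l')\<leftarrow>L. c * tmono l x * tmono l' y))"

lemma separable_mult:
  assumes "separable \<kappa>" "separable \<kappa>'" shows "separable (\<lambda>x y. \<kappa> x y * \<kappa>' x y)"
proof -
  obtain L L' where L: "\<And>x y. \<kappa> x y = (\<Sum>(c, l, l')\<leftarrow>L. c * tmono l x * tmono l' y)"
    and L': "\<And>x y. \<kappa>' x y = (\<Sum>(c, l, l')\<leftarrow>L'. c * tmono l x * tmono l' y)"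
    using assms unfolding separable_def by blast
  define P where "P = concat (map (\<lambda>(c, l, l'). map (\<lambda>(d, m, m'). (c * d, l @ m, l' @ m')) L') L)"
  have one: "(\<Sum>(c, l, l')\<leftarrow>map (\<lambda>(d, m, m'). (c * d, l @ m, l' @ m')) M. c * tmono l x * tmono l' y)
      = c * tmono l x * tmono l' y * (\<Sum>(c, l, l')\<leftarrow>M. c * tmono l x * tmono l' y)" for c l l' x y M
    by (induction M) (auto simp: algebra_simps)
  have "(\<Sum>(c, l, l')\<leftarrow>P. c * tmono l x * tmono l' y) = \<kappa> x y * \<kappa>' x y" for x y
    unfolding P_def L L' by (induction L) (auto simp: one distrib_right simp del: map_map)
  then show ?thesis unfolding separable_def by metis
qed

lemma separable_const: "separable (\<lambda>x y. c)"
  unfolding separable_def by (rule exI[of _ "[(c, [], [])]"]) simp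

lemma separable_prod:
  "finite I \<Longrightarrow> (\<And>i. i \<in> I \<Longrightarrow> separable (\<kappa> i)) \<Longrightarrow> separable (\<lambda>x y. \<Prod>i\<in>I. \<kappa> i x y)"
  by (induction I rule: finite_induct) (auto simp: separable_const intro!: separable_mult)

lemma separable_power: "separable \<kappa> \<Longrightarrow> separable (\<lambda>x y. \<kappa> x y ^ n)"
  by (induction n) (auto simp: separable_const intro!: separable_mult)

text \<open>
  Powers of this function concentrate at the lattice, and they remain trigonometric polynomials;
  normalised, they form a finite-rank approximate identity on the torus.
\<close>
definition bump :: "real ^ 'd \<Rightarrow> real" where
  "bump y = (\<Prod>i\<in>UNIV. (1 + cos (2 * pi * y $ i)) / 2)"

lemma separable_bump: "separable (\<lambda>x y :: real ^ 'd. bump (x - y))"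
  unfolding bump_def
proof (rule separable_prod)
  fix i :: 'd
  have "(1 + cos (2 * pi * (x - y) $ i)) / 2 =
    (\<Sum>(c, l, l')\<leftarrow>[(1/2, [], []), (1/2, [(i, True)], [(i, True)]), (1/2, [(i, False)], [(i, False)])].
      c * tmono l x * tmono l' y)" for x y :: "real ^ 'd"
    by (simp add: trig1_def right_diff_distrib cos_diff field_simps)
  then show "separable (\<lambda>x y. (1 + cos (2 * pi * (x - y) $ i)) / 2)"
    unfolding separable_def by metis
qed simp

lemma bump_factor: "0 \<le> (1 + cos s) / 2" "(1 + cos s) / 2 \<le> 1" for s :: real
proof -
  have "(1 + (- 1)) / 2 \<le> (1 + cos s) / 2"
    by (intro divide_right_mono add_left_mono cos_ge_minus_one) simp
  then show "0 \<le> (1 + cos s) / 2" by simp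
  show "(1 + cos s) / 2 \<le> 1" by simp
qed

lemma bump_bounds: "0 \<le> bump y" "bump y \<le> 1"
  unfolding bump_def using bump_factor by (auto intro!: prod_nonneg prod_le_1)

lemma bump_cont: "continuous_on UNIV bump"
  unfolding bump_def by (intro continuous_intros) auto

lemma bump_0: "bump 0 = 1"
  by (simp add: bump_def)

lemma bump_periodic: "periodic bump"
  unfolding periodic_def bump_def
  by (auto intro!: prod.cong simp: lattice_def cos_sin_int_shift)

lemma bump_eq_1: assumes "bump y = 1" shows "y \<in> lattice"
proof -
  have "cos (2 * pi * y $ i) = 1" for i
  proof (rule ccontr)
    assume "cos (2 * pi * y $ i) \<noteq> 1"
    then have lt: "(1 + cos (2 * pi * y $ i)) / 2 < 1" using cos_le_one[of "2 * pi * y $ i"] by (simp add: less_le)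
    have "bump y = (1 + cos (2 * pi * y $ i)) / 2 * (\<Prod>j\<in>UNIV - {i}. (1 + cos (2 * pi * y $ j)) / 2)"
      unfolding bump_def by (simp add: prod.remove)
    also have "\<dots> \<le> (1 + cos (2 * pi * y $ i)) / 2 * 1"
      using bump_factor by (intro mult_left_mono prod_le_1) auto
    finally show False using lt assms by simp
  qed
  then have "\<exists>n::int. 2 * pi * y $ i = of_int n * 2 * pi" for i
    by (simp add: cos_one_2pi_int)
  then have "y $ i \<in> \<int>" for i
    by (metis Ints_of_int mult.assoc mult.commute mult_cancel_right pi_neq_zero zero_neq_numeral mult_eq_0_iff)
  then show ?thesis by (simp add: lattice_def)
qed

text \<open>
  On a compact set of representatives at distance at least \<open>\<delta>\<close> from the lattice the bump has a
  maximum, which is less than 1 because the bump equals 1 on the lattice only.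
\<close>
lemma bump_far:
  assumes "0 < \<delta>"
  shows "\<exists>\<rho>\<in>{0..<1}. \<forall>y\<in>cell. \<rho> < bump (y :: real ^ 'd) \<longrightarrow> (\<exists>j\<in>lattice. norm (y - j) < \<delta>)"
proof -
  define S where "S = cbox (\<chi> i. -1) (\<chi> i. 2) \<inter> (\<Inter>j\<in>lattice. {y :: real ^ 'd. \<delta> \<le> norm (y - j)})"
  have "compact S" unfolding S_def
    by (intro compact_Int_closed compact_cbox closed_INT ballI closed_Collect_le continuous_intros)
  show ?thesis
  proof (cases "S = {}")
    case True
    then show ?thesis using cell_subset_cbox by (intro bexI[of _ 0]) (force simp: S_def)+
  next
    case False
    obtain z where z: "z \<in> S" "\<And>y. y \<in> S \<Longrightarrow> bump y \<le> bump z"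
      using continuous_attains_sup[OF \<open>compact S\<close> False continuous_on_subset[OF bump_cont]] by auto
    have "z \<notin> lattice" using z(1) assms by (auto simp: S_def dest!: bspec[of _ _ z])
    then have "bump z < 1" using bump_eq_1[of z] bump_bounds[of z] by linarith
    then show ?thesis
      using bump_bounds[of z] z(2) cell_subset_cbox
      by (intro bexI[of _ "bump z"]) (force simp: S_def not_less)+
  qed
qed

definition bump_mass :: "(real ^ 'd) itself \<Rightarrow> nat \<Rightarrow> real" where
  "bump_mass _ n = (\<integral>y. bump (y :: real ^ 'd) ^ n \<partial>torus)"

lemma bump_pow: "continuous_on UNIV (\<lambda>y. bump y ^ n)" "periodic (\<lambda>y. bump y ^ n)"
  by (auto simp: periodic_def bump_periodic[unfolded periodic_def, rule_format] intro!: continuous_intros bump_cont)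

text \<open>
  The bump exceeds \<open>\<rho>\<close> on a set of positive measure near 0.  Hence the mass of its powers decays
  no faster than any geometric sequence of ratio below 1.
\<close>
lemma bump_mass_lower:
  assumes "\<rho> < 1" "0 \<le> \<rho>"
  shows "\<exists>\<mu>>0. \<forall>n. \<mu> * \<rho> ^ n \<le> bump_mass TYPE(real ^ 'd) n"
proof -
  define U where "U = {y :: real ^ 'd. \<rho> < bump y}"
  have oU: "open U" unfolding U_def by (intro open_Collect_less continuous_intros bump_cont)
  have "U \<inter> box 0 (\<chi> i. 1) \<noteq> {}"
  proof -
    have "isCont bump (0 :: real ^ 'd)" by (rule continuous_on_interior[OF bump_cont]) simp
    then have "((\<lambda>s. bump ((\<chi> i. s) :: real ^ 'd)) \<longlongrightarrow> bump (0 :: real ^ 'd)) (at_right (0::real))"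
    proof (rule isCont_tendsto_compose)
      have "isCont (\<lambda>s. \<Sum>i\<in>UNIV. s *\<^sub>R axis i 1 :: real ^ 'd) 0" by (intro continuous_intros)
      then have "((\<lambda>s. \<Sum>i\<in>UNIV. s *\<^sub>R axis i 1 :: real ^ 'd) \<longlongrightarrow> 0) (at 0)"
        by (simp add: isCont_def)
      moreover have "(\<Sum>i\<in>UNIV. s *\<^sub>R axis i 1) = ((\<chi> i. s) :: real ^ 'd)" for s :: real
        by (simp add: vec_eq_iff axis_def if_distrib[of "\<lambda>z. _ * z"] cong: if_cong)
      ultimately show "((\<lambda>s. (\<chi> i. s)) \<longlongrightarrow> (0 :: real ^ 'd)) (at_right (0::real))"
        by (simp add: filterlim_at_split)
    qed
    then have "\<forall>\<^sub>F s in at_right (0::real). \<rho> < bump ((\<chi> i. s) :: real ^ 'd)"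
      using assms bump_0 by (metis order_tendstoD(1))
    moreover have "\<forall>\<^sub>F s in at_right (0::real). s \<in> {0<..<1}"
      by (rule eventually_at_right_real) simp
    ultimately have "\<forall>\<^sub>F s in at_right (0::real). ((\<chi> i. s) :: real ^ 'd) \<in> U \<inter> box 0 (\<chi> i. 1)"
      by eventually_elim (auto simp: U_def mem_box_cart)
    then show ?thesis using eventually_happens trivial_limit_at_right_real by blast
  qed
  then have "\<not> negligible (U \<inter> box 0 (\<chi> i. 1))" using oU by (intro open_not_negligible) auto
  then have pos: "emeasure lborel (U \<inter> box 0 (\<chi> i. 1)) \<noteq> 0"
    using oU by (simp add: negligible_iff_null_sets null_sets_def)
  define V where "V = U \<inter> cell"
  have Vb: "V \<in> sets borel" using oU by (auto simp: V_def)
  then have V: "V \<in> sets torus" by (auto simp: torus_def sets_restrict_space V_def)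
  have "emeasure torus V = emeasure lborel V"
    unfolding torus_def by (subst emeasure_restrict_space) (auto simp: V_def)
  also have "\<dots> \<ge> emeasure lborel (U \<inter> box 0 (\<chi> i. 1))"
    using cell_bounds(1) Vb by (intro emeasure_mono) (auto simp: V_def)
  finally have "emeasure torus V \<noteq> 0" using pos by auto
  then have mu: "measure torus V > 0"
    by (simp add: torus.emeasure_eq_measure zero_less_measure_iff)
  have "measure torus V * \<rho> ^ n \<le> bump_mass TYPE(real ^ 'd) n" for n
  proof -
    have "measure torus V * \<rho> ^ n = (\<integral>y. indicator V y *\<^sub>R \<rho> ^ n \<partial>torus)"
      using V by (simp add: Int_absorb2 V_def)
    also have "\<dots> \<le> (\<integral>y. bump (y :: real ^ 'd) ^ n \<partial>torus)"
    proof (rule integral_mono)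
      show "integrable torus (\<lambda>y. indicator V y *\<^sub>R \<rho> ^ n)"
        using V by (intro integrable_scaleR_left) (simp add: torus.emeasure_eq_measure)
      show "integrable torus (\<lambda>y :: real ^ 'd. bump y ^ n)" by (intro integrable_torus_cont bump_pow)
      show "indicator V y *\<^sub>R \<rho> ^ n \<le> bump y ^ n" for y
        using assms bump_bounds(1)[of y] by (auto simp: indicator_def V_def U_def intro: power_mono)
    qed
    finally show ?thesis by (simp add: bump_mass_def)
  qed
  with mu show ?thesis by blast
qed

lemma bump_mass_pos: "0 < bump_mass TYPE(real ^ 'd) n"
proof -
  obtain \<mu> where "\<mu> > 0" "\<mu> * (1/2) ^ n \<le> bump_mass TYPE(real ^ 'd) n" using bump_mass_lower[of "1/2"] by auto
  then show ?thesis by (smt (verit) zero_less_power mult_pos_pos half_gt_zero)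
qed

definition kern :: "nat \<Rightarrow> real ^ 'd \<Rightarrow> real" where
  "kern n y = bump y ^ n / bump_mass TYPE(real ^ 'd) n"

lemma kern_nonneg: "0 \<le> kern n (y :: real ^ 'd)"
  using bump_bounds(1)[of y] bump_mass_pos[of n, where 'd = 'd] by (simp add: kern_def less_imp_le)

lemma kern_cont: "continuous_on UNIV (kern n :: real ^ 'd \<Rightarrow> real)"
  unfolding kern_def using bump_mass_pos[of n, where 'd = 'd]
  by (intro continuous_intros bump_pow) auto

lemma kern_periodic: "periodic (kern n)"
  by (simp add: kern_def periodic_def bump_periodic[unfolded periodic_def, rule_format])

lemma kern_integral: "(\<integral>y. kern n (y :: real ^ 'd) \<partial>torus) = 1"
  unfolding kern_def using bump_mass_pos[of n, where 'd = 'd] by (simp add: bump_mass_def)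

lemma kern_integrable: "integrable torus (kern n)"
  by (intro integrable_torus_cont kern_cont kern_periodic)

lemma kern_separable: "separable (\<lambda>x y. kern n (x - y :: real ^ 'd))"
  using separable_mult[OF separable_power[OF separable_bump, of n] separable_const[of "1 / bump_mass TYPE(real ^ 'd) n"]]
  by (simp add: kern_def)

definition kern_list :: "nat \<Rightarrow> (real \<times> ('d::finite \<times> bool) list \<times> ('d \<times> bool) list) list" where
  "kern_list n = (SOME L. \<forall>x y :: real ^ 'd. kern n (x - y) = (\<Sum>(c, l, l')\<leftarrow>L. c * tmono l x * tmono l' y))"

lemma kern_list: "kern n (x - y) = (\<Sum>(c, l, l')\<leftarrow>kern_list n. c * tmono l x * tmono l' y)"
  using someI_ex[OF kern_separable[of n, unfolded separable_def]] unfolding kern_list_def by blast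

definition conv :: "nat \<Rightarrow> (real ^ 'd \<Rightarrow> 'b::{banach, second_countable_topology}) \<Rightarrow> real ^ 'd \<Rightarrow> 'b" where
  "conv n g x = (\<integral>y. kern n y *\<^sub>R g (x - y) \<partial>torus)"

lemma conv_integrable:
  fixes g :: "real ^ 'd \<Rightarrow> 'b::{banach, second_countable_topology}"
  assumes "continuous_on UNIV g" "periodic g"
  shows "integrable torus (\<lambda>y. kern n y *\<^sub>R g (x - y))"
proof (rule integrable_torus_cont)
  show "continuous_on UNIV (\<lambda>y. kern n y *\<^sub>R g (x - y))"
    by (intro continuous_intros kern_cont continuous_on_compose2[OF assms(1)]) auto
  show "periodic (\<lambda>y. kern n y *\<^sub>R g (x - y))"
    unfolding periodic_def
    using kern_periodic[of n] periodic_lattice[OF assms(2)]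
    by (auto simp: periodic_def diff_diff_eq[symmetric])
qed

text \<open>
  A reflection of the torus moves the argument \<open>x\<close> into the kernel, where it separates from the
  variable of integration.
\<close>
lemma conv_alt:
  fixes g :: "real ^ 'd \<Rightarrow> real"
  assumes "continuous_on UNIV g" "periodic g"
  shows "conv n g x = (\<Sum>(c, l, l')\<leftarrow>kern_list n. c * (\<integral>y. tmono l' y * g y \<partial>torus) * tmono l x)"
proof -
  have "(\<integral>y. kern n (x - y) * g y \<partial>torus) = (\<integral>y. kern n (x - (x - y)) * g (x - y) \<partial>torus)"
  proof (rule integral_torus_reflect[symmetric])
    show "(\<lambda>y. kern n (x - y) * g y) \<in> borel_measurable borel"
      by (intro borel_measurable_continuous_onI continuous_intros assms(1) continuous_on_compose2[OF kern_cont]) auto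
    show "periodic (\<lambda>y. kern n (x - y) * g y)"
      using assms(2) periodic_lattice[OF kern_periodic[of n]]
      by (auto simp: periodic_def diff_diff_eq[symmetric])
  qed
  then have 1: "conv n g x = (\<integral>y. kern n (x - y) * g y \<partial>torus)"
    by (simp add: conv_def)
  have int: "integrable torus (\<lambda>y. tmono l' y * g y)" for l'
    using assms tmono_periodic[of l']
    by (intro integrable_torus_cont continuous_intros tmono_cont) (auto simp: periodic_def)
  have i2: "integrable torus (\<lambda>y. (\<Sum>(c, l, l')\<leftarrow>L. c * tmono l x * tmono l' y) * g y)" for L
  proof (induction L)
    case (Cons a L)
    obtain c l l' where a: "a = (c, l, l')" by (cases a) auto
    show ?case using Bochner_Integration.integrable_add[OF integrable_mult_right[OF int, of "c * tmono l x" l'] Cons] by (simp add: a algebra_simps)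
  qed simp
  have "(\<integral>y. (\<Sum>(c, l, l')\<leftarrow>L. c * tmono l x * tmono l' y) * g y \<partial>torus)
     = (\<Sum>(c, l, l')\<leftarrow>L. c * (\<integral>y. tmono l' y * g y \<partial>torus) * tmono l x)" for L
  proof (induction L)
    case (Cons a L)
    obtain c l l' where a: "a = (c, l, l')" by (cases a) auto
    have "(\<integral>y. (\<Sum>(c, l, l')\<leftarrow>a # L. c * tmono l x * tmono l' y) * g y \<partial>torus)
       = (\<integral>y. (c * tmono l x) * (tmono l' y * g y) + (\<Sum>(c, l, l')\<leftarrow>L. c * tmono l x * tmono l' y) * g y \<partial>torus)"
      by (simp add: a algebra_simps)
    also have "\<dots> = (c * tmono l x) * (\<integral>y. tmono l' y * g y \<partial>torus) + (\<integral>y. (\<Sum>(c, l, l')\<leftarrow>L. c * tmono l x * tmono l' y) * g y \<partial>torus)"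
      using int i2 by (subst Bochner_Integration.integral_add) auto
    finally show ?case using Cons by (simp add: a)
  qed simp
  then show ?thesis by (simp add: 1 kern_list)
qed

text \<open>
  The index \<open>N\<close> depends on \<open>g\<close> only through a bound and a modulus of continuity.  This
  uniformity allows the lemma to be applied to all time slices of one function simultaneously.
\<close>
lemma kern_approx:
  assumes e: "0 < \<epsilon>" and d: "0 < \<delta>"
  shows "\<exists>N. \<forall>n\<ge>N. \<forall>g :: real ^ 'd \<Rightarrow> 'b::{banach, second_countable_topology}.
    continuous_on UNIV g \<longrightarrow> periodic g \<longrightarrow> (\<forall>y. norm (g y) \<le> M) \<longrightarrow>
    (\<forall>y z. dist y z < \<delta> \<longrightarrow> dist (g y) (g z) < \<epsilon>) \<longrightarrow> (\<forall>x. norm (conv n g x - g x) \<le> 2 * \<epsilon>)"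
proof -
  obtain \<rho> where rho: "0 \<le> \<rho>" "\<rho> < 1" "\<And>y :: real ^ 'd. y \<in> cell \<Longrightarrow> \<rho> < bump y \<Longrightarrow> \<exists>j\<in>lattice. norm (y - j) < \<delta>"
    using bump_far[OF d, where 'd = 'd] by auto
  (* Any rate strictly between rho and 1: the kernel is at most a multiple of (rho / rho')^n away from the lattice. *)
  define \<rho>' where "\<rho>' = (1 + \<rho>) / 2"
  have r': "\<rho> < \<rho>'" "\<rho>' < 1" "0 < \<rho>'" using rho by (auto simp: \<rho>'_def)
  obtain \<mu> where mu: "\<mu> > 0" "\<And>n. \<mu> * \<rho>' ^ n \<le> bump_mass TYPE(real ^ 'd) n" using bump_mass_lower[of \<rho>'] r' by auto
  have "(\<lambda>n. 2 * M / \<mu> * (\<rho> / \<rho>') ^ n) \<longlonglongrightarrow> 2 * M / \<mu> * 0"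
    using r' rho by (intro tendsto_intros LIMSEQ_power_zero) auto
  then obtain N where N: "\<And>n. n \<ge> N \<Longrightarrow> 2 * M / \<mu> * (\<rho> / \<rho>') ^ n < \<epsilon>"
    using e by (metis (no_types, lifting) order_tendstoD(2) mult_zero_right eventually_sequentially)
  show ?thesis
  proof (intro exI[of _ N] allI impI)
    fix n x and g :: "real ^ 'd \<Rightarrow> 'b"
    assume n: "N \<le> n" and g: "continuous_on UNIV g" "periodic g" and M: "\<forall>y. norm (g y) \<le> M"
      and dg: "\<forall>y z. dist y z < \<delta> \<longrightarrow> dist (g y) (g z) < \<epsilon>"
    have M0: "0 \<le> M" using M norm_ge_zero order_trans by blast
    have pt: "norm (kern n y *\<^sub>R g (x - y) - kern n y *\<^sub>R g x) \<le> \<epsilon> * kern n y + 2 * M / \<mu> * (\<rho> / \<rho>') ^ n"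
      if y: "y \<in> cell" for y
    proof (cases "\<rho> < bump y")
      case True
      then obtain j where j: "j \<in> lattice" "norm (y - j) < \<delta>" using rho(3) y by blast
      have "g (x - y) = g (x - y + j)" using g(2) j(1) by (simp add: periodic_def)
      then have "norm (g (x - y) - g x) < \<epsilon>"
        using dg[rule_format, of "x - y + j" x] j(2)
        by (simp add: dist_norm norm_minus_commute algebra_simps)
      then have "norm (kern n y *\<^sub>R (g (x - y) - g x)) \<le> \<epsilon> * kern n y"
        using kern_nonneg[of n y] mult_left_mono[of "norm (g (x - y) - g x)" \<epsilon> "kern n y"] by (simp add: mult.commute[of \<epsilon>])
      moreover have "0 \<le> 2 * M / \<mu> * (\<rho> / \<rho>') ^ n" using M0 mu rho r' by simp
      ultimately show ?thesis by (simp add: scaleR_diff_right)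
    next
      case False
      have "kern n y \<le> \<rho> ^ n / (\<mu> * \<rho>' ^ n)"
        unfolding kern_def using False bump_bounds(1)[of y] mu r' rho
        by (intro frac_le power_mono) auto
      moreover have "norm (g (x - y) - g x) \<le> 2 * M"
        using norm_triangle_ineq4[of "g (x - y)" "g x"] M by (smt (verit))
      ultimately have "kern n y * norm (g (x - y) - g x) \<le> \<rho> ^ n / (\<mu> * \<rho>' ^ n) * (2 * M)"
        using kern_nonneg[of n y] M0 by (intro mult_mono) auto
      moreover have "0 \<le> \<epsilon> * kern n y" using e kern_nonneg[of n y] by simp
      ultimately show ?thesis
        using kern_nonneg[of n y] by (simp add: scaleR_diff_right[symmetric] power_divide mult.commute)
    qed
    have i1: "integrable torus (\<lambda>y. kern n y *\<^sub>R g (x - y))" by (rule conv_integrable[OF g])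
    have i2: "integrable torus (\<lambda>y. kern n y *\<^sub>R g x)" by (intro integrable_scaleR_left kern_integrable)
    have eq: "conv n g x - g x = (\<integral>y. kern n y *\<^sub>R g (x - y) - kern n y *\<^sub>R g x \<partial>torus)"
      unfolding conv_def using i1 i2 by (simp add: kern_integral kern_integrable)
    have "norm (conv n g x - g x) \<le> (\<integral>y. norm (kern n y *\<^sub>R g (x - y) - kern n y *\<^sub>R g x) \<partial>torus)"
      unfolding eq by (rule integral_norm_bound)
    also have "\<dots> \<le> (\<integral>y. \<epsilon> * kern n y + 2 * M / \<mu> * (\<rho> / \<rho>') ^ n \<partial>(torus :: (real ^ 'd) measure))"
      using i1 i2 pt by (intro integral_mono) (auto intro!: integrable_norm kern_integrable)
    also have "\<dots> = \<epsilon> + 2 * M / \<mu> * (\<rho> / \<rho>') ^ n"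
      by (simp add: kern_integrable kern_integral torus.prob_space[simplified])
    also have "\<dots> \<le> 2 * \<epsilon>" using N[OF n] by simp
    finally show "norm (conv n g x - g x) \<le> 2 * \<epsilon>" .
  qed
qed

text \<open>
  By the mean value theorem and uniform continuity of \<open>b\<close>, first-order Taylor expansion of \<open>g\<close> has
  a uniformly small relative error, and averaging with the kernel keeps this.
\<close>
lemma conv_gderiv:
  fixes g :: "real ^ 'd \<Rightarrow> real"
  assumes D: "\<And>x. GDERIV g x :> b x" and cb: "continuous_on UNIV b" and g: "periodic g" and pb: "periodic b"
  shows "GDERIV (conv n g) x :> conv n b x"
proof -
  have cg: "continuous_on UNIV g"
    using D unfolding gderiv_def by (meson continuous_at_imp_continuous_on has_derivative_continuous)
  have key: "\<exists>d>0. \<forall>h. norm h < d \<longrightarrow> norm (conv n g (x + h) - conv n g x - h \<bullet> conv n b x) \<le> e * norm h"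
    if e: "e > 0" for e
  proof -
    obtain d where d: "d > 0" "\<And>y z. dist y z < d \<Longrightarrow> dist (b y) (b z) < e"
      using periodic_uniform_space[OF cb pb e] by auto
    have pt: "norm (g (z + h) - g z - h \<bullet> b z) \<le> e * norm h" if h: "norm h < d" for h z
    proof -
      define p where "p s = g (z + s *\<^sub>R h) - s * (h \<bullet> b z)" for s :: real
      have dp: "(p has_real_derivative (h \<bullet> b (z + s *\<^sub>R h) - h \<bullet> b z)) (at s)" for s
      proof -
        have "((\<lambda>s. g (z + s *\<^sub>R h)) has_derivative (\<lambda>r. (r *\<^sub>R h) \<bullet> b (z + s *\<^sub>R h))) (at s)"
          by (rule has_derivative_compose[of "\<lambda>s. z + s *\<^sub>R h" "\<lambda>r. r *\<^sub>R h", OF _ D[unfolded gderiv_def]])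
             (auto intro!: derivative_eq_intros)
        then have "((\<lambda>s. g (z + s *\<^sub>R h)) has_real_derivative (h \<bullet> b (z + s *\<^sub>R h))) (at s)"
          by (simp add: has_field_derivative_def mult.commute[of "h \<bullet> _"] mult_commute_abs)
        then show ?thesis unfolding p_def by (auto intro!: derivative_eq_intros)
      qed
      obtain s where s: "0 < s" "s < 1" "p 1 - p 0 = h \<bullet> b (z + s *\<^sub>R h) - h \<bullet> b z"
        using MVT2[of 0 1 p "\<lambda>s. h \<bullet> b (z + s *\<^sub>R h) - h \<bullet> b z"] dp by auto
      have "norm (s *\<^sub>R h) < d" using s h by (smt (verit) mult_left_le_one_le norm_ge_zero norm_scaleR)
      then have "norm (b (z + s *\<^sub>R h) - b z) \<le> e" using d(2)[of "z + s *\<^sub>R h" z] by (simp add: dist_norm)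
      then have "\<bar>h \<bullet> (b (z + s *\<^sub>R h) - b z)\<bar> \<le> norm h * e"
        using Cauchy_Schwarz_ineq2[of h "b (z + s *\<^sub>R h) - b z"] by (smt (verit) mult_left_mono norm_ge_zero)
      then show ?thesis using s(3) by (simp add: p_def inner_diff_right mult.commute)
    qed
    have "norm (conv n g (x + h) - conv n g x - h \<bullet> conv n b x) \<le> e * norm h" if h: "norm h < d" for h
    proof -
      have i: "integrable torus (\<lambda>y. kern n y *\<^sub>R g (x + h - y))" "integrable torus (\<lambda>y. kern n y *\<^sub>R g (x - y))"
        "integrable torus (\<lambda>y. kern n y *\<^sub>R b (x - y))" by (intro conv_integrable cg cb g pb)+
      have ih: "integrable torus (\<lambda>y. h \<bullet> (kern n y *\<^sub>R b (x - y)))" by (rule integrable_inner_right) (use i(3) in simp)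
      have eq: "conv n g (x + h) - conv n g x - h \<bullet> conv n b x
         = (\<integral>y. kern n y *\<^sub>R g (x + h - y) - kern n y *\<^sub>R g (x - y) - h \<bullet> (kern n y *\<^sub>R b (x - y)) \<partial>torus)"
        unfolding conv_def using i ih integral_inner_right[of h torus "\<lambda>y. kern n y *\<^sub>R b (x - y)"] by simp
      have "norm (conv n g (x + h) - conv n g x - h \<bullet> conv n b x) \<le> (\<integral>y. norm (kern n y *\<^sub>R g (x + h - y) - kern n y *\<^sub>R g (x - y) - h \<bullet> (kern n y *\<^sub>R b (x - y))) \<partial>torus)"
        unfolding eq by (rule integral_norm_bound)
      also have "\<dots> \<le> (\<integral>y. (e * norm h) * kern n (y :: real ^ 'd) \<partial>torus)"
      proof (rule integral_mono)
        show "integrable torus (\<lambda>y. norm (kern n y *\<^sub>R g (x + h - y) - kern n y *\<^sub>R g (x - y) - h \<bullet> (kern n y *\<^sub>R b (x - y))))"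
          using i ih by (intro integrable_norm Bochner_Integration.integrable_diff)
        show "integrable torus (\<lambda>y. (e * norm h) * kern n y)" by (intro integrable_mult_right kern_integrable)
        fix y
        have "norm (kern n y *\<^sub>R g (x + h - y) - kern n y *\<^sub>R g (x - y) - h \<bullet> (kern n y *\<^sub>R b (x - y)))
          = kern n y * norm (g ((x - y) + h) - g (x - y) - h \<bullet> b (x - y))"
        proof -
          have "kern n y *\<^sub>R g (x + h - y) - kern n y *\<^sub>R g (x - y) - h \<bullet> (kern n y *\<^sub>R b (x - y))
            = kern n y * (g ((x - y) + h) - g (x - y) - h \<bullet> b (x - y))"
            by (simp add: algebra_simps)
          then show ?thesis using kern_nonneg[of n y] by (simp only: norm_mult) simp
        qed
        also have "\<dots> \<le> kern n y * (e * norm h)"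
          using pt[OF h, of "x - y"] kern_nonneg[of n y] by (intro mult_left_mono) auto
        finally show "norm (kern n y *\<^sub>R g (x + h - y) - kern n y *\<^sub>R g (x - y) - h \<bullet> (kern n y *\<^sub>R b (x - y))) \<le> (e * norm h) * kern n y"
          by (simp add: mult.commute)
      qed
      also have "\<dots> = e * norm h" by (simp add: kern_integral)
      finally show ?thesis .
    qed
    then show ?thesis using d(1) by blast
  qed
  show ?thesis
    unfolding gderiv_def has_derivative_at_alt
  proof (intro conjI allI impI)
    show "bounded_linear (\<lambda>h. h \<bullet> conv n b x)" by (rule bounded_linear_inner_left)
    fix e :: real assume "0 < e"
    from key[OF this] obtain d where d: "d > 0" "\<forall>h. norm h < d \<longrightarrow> norm (conv n g (x + h) - conv n g x - h \<bullet> conv n b x) \<le> e * norm h" by auto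
    show "\<exists>d>0. \<forall>y. norm (y - x) < d \<longrightarrow> norm (conv n g y - conv n g x - (y - x) \<bullet> conv n b x) \<le> e * norm (y - x)"
    proof (intro exI[of _ d] conjI allI impI d(1))
      fix y assume "norm (y - x) < d"
      from d(2)[rule_format, OF this]
      show "norm (conv n g y - conv n g x - (y - x) \<bullet> conv n b x) \<le> e * norm (y - x)" by simp
    qed
  qed
qed

lemma GDERIV_unique: "GDERIV f x :> a \<Longrightarrow> GDERIV f x :> b \<Longrightarrow> a = b"
  unfolding gderiv_def by (metis has_derivative_unique inner_commute vector_eq_ldot)

text \<open>
  The Fourier-type coefficients involve \<open>g\<close> and not its gradient: the identity arises by
  differentiating the expansion of \<open>conv n g\<close>.  Thus the expansions of a function and of its
  gradient have the same coefficients.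
\<close>
lemma conv_grad_alt:
  fixes g :: "real ^ 'd \<Rightarrow> real"
  assumes D: "\<And>x. GDERIV g x :> b x" and cb: "continuous_on UNIV b" and g: "periodic g" and pb: "periodic b"
  shows "conv n b x = (\<Sum>(c, l, l')\<leftarrow>kern_list n. (c * (\<integral>y. tmono l' y * g y \<partial>torus)) *\<^sub>R tgrad l x)"
proof -
  have cg: "continuous_on UNIV g"
    using D unfolding gderiv_def by (meson continuous_at_imp_continuous_on has_derivative_continuous)
  have L: "GDERIV (\<lambda>x. \<Sum>(c, l, l')\<leftarrow>L. c * (\<integral>y. tmono l' y * g y \<partial>torus) * tmono l x) x :>
      (\<Sum>(c, l, l')\<leftarrow>L. (c * (\<integral>y. tmono l' y * g y \<partial>torus)) *\<^sub>R tgrad l x)" for L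
  proof (induction L)
    case (Cons a L)
    obtain c l l' where a: "a = (c, l, l')" by (cases a) auto
    have "GDERIV (\<lambda>x. c * (\<integral>y. tmono l' y * g y \<partial>torus) * tmono l x) x :> (c * (\<integral>y. tmono l' y * g y \<partial>torus)) *\<^sub>R tgrad l x"
      using GDERIV_mult[OF GDERIV_const[of "c * (\<integral>y. tmono l' y * g y \<partial>torus)"] GDERIV_tmono[of l x]] by simp
    from GDERIV_add[OF this Cons] show ?case by (simp add: a)
  qed (simp add: GDERIV_const)
  have "conv n g = (\<lambda>x. \<Sum>(c, l, l')\<leftarrow>kern_list n. c * (\<integral>y. tmono l' y * g y \<partial>torus) * tmono l x)"
    using conv_alt[OF cg g] by auto
  with L[of "kern_list n"] have "GDERIV (conv n g) x :> (\<Sum>(c, l, l')\<leftarrow>kern_list n. (c * (\<integral>y. tmono l' y * g y \<partial>torus)) *\<^sub>R tgrad l x)"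
    by simp
  then show ?thesis by (rule GDERIV_unique[OF conv_gderiv[OF assms]])
qed

section \<open>Time cut-offs and the continuity equation in integrated form\<close>

lemma Ck_intro:
  assumes "\<And>z. (g has_derivative D z) (at z)" "\<And>v. Ck k (\<lambda>z. D z v)"
  shows "Ck (Suc k) g"
proof -
  have "frechet_derivative g (at z) = D z" for z
    using frechet_derivative_at[OF assms(1)] by simp
  then show ?thesis using assms by (auto simp: differentiable_def)
qed

lemma Ck_SucD:
  assumes "Ck (Suc k) g"
  shows "(g has_derivative frechet_derivative g (at z)) (at z)" "Ck k (\<lambda>z. frechet_derivative g (at z) v)"
  using assms by (auto simp: frechet_derivative_works)

lemma Ck_cont: "Ck k g \<Longrightarrow> continuous_on UNIV g"
  by (cases k) (auto intro!: continuous_at_imp_continuous_on differentiable_imp_continuous_within)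

lemma Ck_mono: "Ck (Suc k) g \<Longrightarrow> Ck k g"
proof (induction k arbitrary: g)
  case 0 then show ?case using Ck_cont[OF 0] by simp
next
  case (Suc k)
  show ?case
    by (rule Ck_intro[OF Ck_SucD(1)[OF Suc.prems]]) (rule Suc.IH[OF Ck_SucD(2)[OF Suc.prems]])
qed

lemma Ck_const: "Ck k (\<lambda>z. c)"
proof (induction k arbitrary: c)
  case (Suc k)
  show ?case by (rule Ck_intro[of _ "\<lambda>z v. 0"]) (auto intro!: Suc)
qed simp

lemma Ck_add: "Ck k f \<Longrightarrow> Ck k g \<Longrightarrow> Ck k (\<lambda>z. f z + g z)"
proof (induction k arbitrary: f g)
  case 0 then show ?case by (auto intro: continuous_intros)
next
  case (Suc k)
  show ?case
    by (rule Ck_intro[OF has_derivative_add[OF Ck_SucD(1)[OF Suc.prems(1)] Ck_SucD(1)[OF Suc.prems(2)]]])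
       (intro Suc.IH Ck_SucD(2)[OF Suc.prems(1)] Ck_SucD(2)[OF Suc.prems(2)])
qed

lemma Ck_mult: "Ck k f \<Longrightarrow> Ck k g \<Longrightarrow> Ck k (\<lambda>z. f z * g z)"
proof (induction k arbitrary: f g)
  case 0 then show ?case by (auto intro: continuous_intros)
next
  case (Suc k)
  show ?case
    by (rule Ck_intro[OF has_derivative_mult[OF Ck_SucD(1)[OF Suc.prems(1)] Ck_SucD(1)[OF Suc.prems(2)]]])
       (intro Ck_add Suc.IH Ck_SucD(2)[OF Suc.prems(1)] Ck_SucD(2)[OF Suc.prems(2)] Ck_mono[OF Suc.prems(1)] Ck_mono[OF Suc.prems(2)])
qed

lemma Ck_affine:
  assumes l: "bounded_linear l"
  shows "Ck k g \<Longrightarrow> Ck k (\<lambda>z. g (l z + c))"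
proof (induction k arbitrary: g)
  case 0
  have "continuous_on UNIV (\<lambda>z. l z + c)"
    using l by (intro continuous_intros) (simp add: linear_continuous_on)
  with 0 show ?case by (auto intro: continuous_on_compose2)
next
  case (Suc k)
  have d: "((\<lambda>z. l z + c) has_derivative l) (at z)" for z
    using bounded_linear_imp_has_derivative[OF l] by (auto intro!: derivative_eq_intros)
  show ?case
    by (rule Ck_intro[OF has_derivative_compose[OF d Ck_SucD(1)[OF Suc.prems]]])
       (rule Suc.IH[OF Ck_SucD(2)[OF Suc.prems]])
qed

lemma Ck_real_intro:
  fixes h :: "real \<Rightarrow> real"
  assumes "\<And>s. (h has_real_derivative h' s) (at s)" "Ck k h'"
  shows "Ck (Suc k) h"
proof (rule Ck_intro)
  show "(h has_derivative (*) (h' s)) (at s)" for s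
    using assms(1)[of s] by (simp add: has_field_derivative_def)
  show "Ck k (\<lambda>s. h' s * v)" for v by (intro Ck_mult Ck_const assms)
qed

lemma Ck_cos: "Ck k (\<lambda>s. c * cos (2 * pi * s + b))"
proof (induction k arbitrary: b c)
  case 0 then show ?case by (auto intro!: continuous_intros)
next
  case (Suc k)
  show ?case
  proof (rule Ck_real_intro[OF _ Suc.IH])
    show "((\<lambda>s. c * cos (2 * pi * s + b)) has_real_derivative (c * (2 * pi)) * cos (2 * pi * s + (b + pi / 2))) (at s)" for s
      by (auto intro!: derivative_eq_intros simp: cos_add sin_add algebra_simps)
  qed
qed

lemma Ck_trig1: "Ck k (trig1 p :: real ^ 'd \<Rightarrow> real)"
proof -
  have l: "bounded_linear (\<lambda>x :: real ^ 'd. x $ fst p)" by (rule bounded_linear_vec_nth)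
  have "Ck k (\<lambda>s. cos (2 * pi * s + b))" for b using Ck_cos[of k 1 b] by simp
  from Ck_affine[where c = 0, OF l this]
  have a: "Ck k (\<lambda>x :: real ^ 'd. cos (2 * pi * x $ fst p + b))" for b by simp
  show ?thesis
  proof (cases "snd p")
    case True then show ?thesis using a[of 0] by (simp add: trig1_def[abs_def])
  next
    case False then show ?thesis using a[of "- (pi / 2)"] by (simp add: trig1_def[abs_def] cos_diff)
  qed
qed

lemma Ck_tmono: "Ck k (tmono l)"
proof (induction l)
  case Nil then show ?case using Ck_const[of k 1] by (simp add: tmono_def[abs_def])
next
  case (Cons p l)
  from Ck_mult[OF Ck_trig1 this, of p] show ?case by (simp add: tmono_def[abs_def])
qed

text \<open>
  The functions \<open>P(1/s) exp(-1/s)\<close>, continued by 0, form a class that is closed under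
  differentiation; this proves their smoothness by induction.
\<close>
definition flat :: "real poly \<Rightarrow> real \<Rightarrow> real" where
  "flat P s = (if 0 < s then poly P (1 / s) * exp (- (1 / s)) else 0)"

lemma poly_exp_0: "((\<lambda>u :: real. poly P u * exp (- u)) \<longlongrightarrow> 0) at_top"
proof -
  have "((\<lambda>u. \<Sum>i\<le>degree P. coeff P i * (u ^ i / exp u)) \<longlongrightarrow> (\<Sum>i\<le>degree P. coeff P i * 0)) at_top"
    by (intro tendsto_intros tendsto_power_div_exp_0)
  then show ?thesis by (simp add: poly_altdef sum_distrib_right exp_minus divide_inverse mult.assoc)
qed

lemma flat_deriv: "(flat P has_real_derivative flat ([:0, 0, 1:] * (P - pderiv P)) s) (at s)"
proof -
  consider "s > 0" | "s < 0" | "s = 0" by linarith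
  then show ?thesis
  proof cases
    case 1
    have "((\<lambda>s. poly P (1 / s) * exp (- (1 / s))) has_real_derivative
        flat ([:0, 0, 1:] * (P - pderiv P)) s) (at s)"
      using 1 by (auto intro!: derivative_eq_intros simp: flat_def power2_eq_square field_simps)
    then show ?thesis
      by (rule has_field_derivative_transform_within_open[of _ _ _ "{0<..}"])
         (use 1 in \<open>auto simp: flat_def\<close>)
  next
    case 2
    have "((\<lambda>s. 0) has_real_derivative flat ([:0, 0, 1:] * (P - pderiv P)) s) (at s)"
      using 2 by (auto simp: flat_def)
    then show ?thesis
      by (rule has_field_derivative_transform_within_open[of _ _ _ "{..<0}"])
         (use 2 in \<open>auto simp: flat_def\<close>)
  next
    case 3
    have "((\<lambda>h. (flat P (0 + h) - flat P 0) / h) \<longlongrightarrow> 0) (at_left 0)"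
    proof (rule tendsto_eventually)
      show "\<forall>\<^sub>F h in at_left 0. (flat P (0 + h) - flat P 0) / h = 0"
        by (auto simp: flat_def eventually_at_filter)
    qed
    moreover have "((\<lambda>h. (flat P (0 + h) - flat P 0) / h) \<longlongrightarrow> 0) (at_right 0)"
    proof (rule Lim_transform_eventually)
      show "((\<lambda>h. poly ([:0, 1:] * P) (inverse h) * exp (- inverse h)) \<longlongrightarrow> 0) (at_right (0::real))"
        by (rule filterlim_compose[OF poly_exp_0 filterlim_inverse_at_top_right])
      show "\<forall>\<^sub>F h in at_right 0. poly ([:0, 1:] * P) (inverse h) * exp (- inverse h) = (flat P (0 + h) - flat P 0) / h"
        by (auto simp: flat_def eventually_at_filter field_simps)
    qed
    ultimately show ?thesis
      using 3 by (simp add: DERIV_def flat_def filterlim_split_at)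
  qed
qed

lemma Ck_flat: "Ck k (flat P)"
proof (induction k arbitrary: P)
  case 0
  show ?case using flat_deriv[THEN DERIV_isCont] by (auto intro: continuous_at_imp_continuous_on)
next
  case (Suc k) show ?case by (rule Ck_real_intro[OF flat_deriv Suc])
qed

lemma flat1: "0 \<le> flat [:1:] s" "flat [:1:] s \<le> 1" "s \<le> 0 \<Longrightarrow> flat [:1:] s = 0"
  by (auto simp: flat_def)

text \<open>
  A smooth function of time that vanishes for \<open>s \<le> a\<close> and near \<open>T\<close>, and tends to the
  indicator of \<open>(a, T)\<close>.
\<close>
definition cut :: "real \<Rightarrow> real \<Rightarrow> nat \<Rightarrow> real \<Rightarrow> real" where
  "cut T a n s = flat [:1:] (real (Suc n) * (s - a)) * flat [:1:] (real (Suc n) * (T - s) - 1)"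

lemma cut_bounds: "0 \<le> cut T a n s" "cut T a n s \<le> 1"
  unfolding cut_def using flat1 by (auto intro!: mult_le_one)

lemma cut_zero: "T - 1 / real (Suc n) \<le> s \<Longrightarrow> cut T a n s = 0"
  unfolding cut_def
  by (subst flat1(3)[of "real (Suc n) * (T - s) - 1"]) (auto simp: field_simps)

lemma Ck_cut: "Ck k (cut T a n)"
proof -
  have "Ck k (\<lambda>s. flat [:1:] ((*) (real (Suc n)) s + (- real (Suc n) * a)))"
    "Ck k (\<lambda>s. flat [:1:] ((*) (- real (Suc n)) s + (real (Suc n) * T - 1)))"
    by (rule Ck_affine[OF bounded_linear_mult_right Ck_flat])+
  from Ck_mult[OF this] show ?thesis unfolding cut_def[abs_def] by (simp add: algebra_simps)
qed

lemma cut_lim: "a < s \<Longrightarrow> s < T \<Longrightarrow> (\<lambda>n. cut T a n s) \<longlonglongrightarrow> 1" "s \<le> a \<Longrightarrow> (\<lambda>n. cut T a n s) \<longlonglongrightarrow> 0"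
proof -
  assume s: "a < s" "s < T"
  have l: "((\<lambda>u. flat [:1:] u) \<longlongrightarrow> 1) at_top"
  proof (rule Lim_transform_eventually)
    have "((\<lambda>u::real. exp (- (1 / u))) \<longlongrightarrow> exp (- 0)) at_top"
      by (intro tendsto_intros real_tendsto_divide_at_top[OF tendsto_const filterlim_ident])
    then show "((\<lambda>u::real. exp (- (1 / u))) \<longlongrightarrow> 1) at_top" by simp
    show "\<forall>\<^sub>F u in at_top. exp (- (1 / u)) = flat [:1:] u"
      using eventually_gt_at_top[of 0] by eventually_elim (simp add: flat_def)
  qed
  have n: "filterlim (\<lambda>n. real (Suc n)) at_top sequentially"
    by (rule filterlim_compose[OF filterlim_real_sequentially filterlim_Suc])
  have 1: "filterlim (\<lambda>n. real (Suc n) * (s - a)) at_top sequentially"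
    using s by (intro filterlim_at_top_mult_tendsto_pos[OF tendsto_const _ n]) auto
  have 2: "filterlim (\<lambda>n. - 1 + real (Suc n) * (T - s)) at_top sequentially"
    using s by (intro filterlim_tendsto_add_at_top[OF tendsto_const] filterlim_at_top_mult_tendsto_pos[OF tendsto_const _ n]) auto
  from tendsto_mult[OF filterlim_compose[OF l 1] filterlim_compose[OF l 2]]
  show "(\<lambda>n. cut T a n s) \<longlonglongrightarrow> 1" unfolding cut_def by (simp add: algebra_simps)
next
  assume "s \<le> a"
  then have "real (Suc n) * (s - a) \<le> 0" for n by (simp add: mult_nonneg_nonpos)
  then have "cut T a n s = 0" for n unfolding cut_def by (subst flat1(3)) auto
  then show "(\<lambda>n. cut T a n s) \<longlonglongrightarrow> 0" by simp
qed

lemma cut_cont: "continuous_on UNIV (cut T a n)"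
  using Ck_cut by (rule Ck_cont)

text \<open>
  The primitive of \<open>- cut\<close> that vanishes near \<open>T\<close>: the time factor of admissible test functions.
\<close>
definition cutint :: "real \<Rightarrow> real \<Rightarrow> nat \<Rightarrow> real \<Rightarrow> real" where
  "cutint T a n t = - (LBINT s=T..t. cut T a n s)"

lemma cutint_deriv: "(cutint T a n has_real_derivative - cut T a n t) (at t)"
proof -
  define A B where "A = min T t - 1" and "B = max T t + 1"
  have "((\<lambda>u. LBINT y=T..u. cut T a n y) has_vector_derivative cut T a n t) (at t within {A..B})"
    by (rule interval_integral_FTC2) (auto simp: A_def B_def intro!: continuous_on_subset[OF cut_cont])
  moreover have "at t within {A..B} = at t"
    by (rule at_within_Icc_at) (auto simp: A_def B_def)
  ultimately show ?thesis
    unfolding cutint_def has_real_derivative_iff_has_vector_derivative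
    by (auto intro!: derivative_eq_intros)
qed

lemma Ck_cutint: "Ck k (cutint T a n)"
proof (cases k)
  case 0 then show ?thesis
    using cutint_deriv[THEN DERIV_isCont] by (auto intro: continuous_at_imp_continuous_on)
next
  case (Suc j)
  have "Ck j (\<lambda>t. (-1) * cut T a n t)" by (intro Ck_mult Ck_const Ck_cut)
  then show ?thesis unfolding Suc by (intro Ck_real_intro[OF cutint_deriv]) simp
qed

lemma cutint_zero: assumes "T - 1 / real (Suc n) \<le> t" shows "cutint T a n t = 0"
proof -
  have "0 < 1 / real (Suc n)" by simp
  then have "(LBINT s=T..t. cut T a n s) = (LBINT s=T..t. 0)"
    using assms
  proof (intro interval_integral_cong cut_zero)
    fix x assume "x \<in> einterval (min (ereal T) (ereal t)) (max (ereal T) (ereal t))"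
    then have "min T t < x" by (auto simp: einterval_iff min_def split: if_splits)
    then show "T - 1 / real (Suc n) \<le> x" using assms \<open>0 < 1 / real (Suc n)\<close> by linarith
  qed
  then show ?thesis by (simp add: cutint_def)
qed

lemma cutint_eq:
  assumes t: "0 \<le> t" "t \<le> T"
  shows "cutint T a n t = (\<integral>s. indicator {t<..} s * cut T a n s \<partial>tm T)"
proof -
  have "cutint T a n t = (LBINT s=t..T. cut T a n s)"
    unfolding cutint_def by (subst interval_integral_endpoints_reverse) simp
  also have "\<dots> = (LBINT s:{t<..<T}. cut T a n s)"
    using t by (simp add: interval_lebesgue_integral_def)
  also have "\<dots> = (\<integral>s. indicator {0<..<T} s *\<^sub>R (indicator {t<..} s * cut T a n s) \<partial>lborel)"
    unfolding set_lebesgue_integral_def using t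
    by (intro Bochner_Integration.integral_cong) (auto simp: indicator_def)
  also have "\<dots> = (\<integral>s. indicator {t<..} s * cut T a n s \<partial>tm T)"
    unfolding tm_def by (subst integral_restrict_space) auto
  finally show ?thesis .
qed

interpretation tmtm: pair_sigma_finite "tm T" "tm T" for T
  by unfold_locales

text \<open>
  Integration by parts in time for factors that are merely integrable or bounded, as Fubini's
  theorem on the triangle \<open>t < s\<close>.
\<close>
lemma ibp_tm:
  fixes v :: "real \<Rightarrow> real"
  assumes v: "integrable (tm T) v" and k: "k \<in> borel_measurable (tm T)" "\<And>s. s \<in> {0<..<T} \<Longrightarrow> \<bar>k s\<bar> \<le> M"
  shows "(\<integral>t. v t * (\<integral>s. indicator {t<..} s * k s \<partial>tm T) \<partial>tm T) = (\<integral>s. k s * (\<integral>t. indicator {..<s} t * v t \<partial>tm T) \<partial>tm T)"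
proof -
  have [measurable]: "v \<in> borel_measurable (tm T)" "k \<in> borel_measurable (tm T)" using v k by auto
  have tb: "(\<lambda>x. x) \<in> measurable (tm T) borel" unfolding tm_def by (intro measurable_restrict_space1) simp
  have f1: "fst \<in> borel_measurable (tm T \<Otimes>\<^sub>M tm T)" and s1: "snd \<in> borel_measurable (tm T \<Otimes>\<^sub>M tm T)"
    by (rule measurable_compose[OF measurable_fst tb] measurable_compose[OF measurable_snd tb])+
  have ind: "(\<lambda>z. if fst z < snd z then 1 else 0 :: real) \<in> borel_measurable (tm T \<Otimes>\<^sub>M tm T)"
    using f1 s1 by measurable
  define F where "F = (\<lambda>(t, s). v t * (if t < s then 1 else 0) * k s)"
  have Fm: "F \<in> borel_measurable (tm T \<Otimes>\<^sub>M tm T)"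
    unfolding F_def case_prod_beta by (intro borel_measurable_times ind) measurable
  have Fint: "integrable (tm T \<Otimes>\<^sub>M tm T) F"
  proof (rule tmtm.Fubini_integrable[OF Fm])
    have m2: "(\<lambda>t. \<integral>s. norm (F (t, s)) \<partial>tm T) \<in> borel_measurable (tm T)"
      using Fm by measurable
    have bd: "norm (F (t, s)) \<le> \<bar>v t\<bar> * M" if "s \<in> {0<..<T}" for t s
      using k(2)[OF that] by (auto simp: F_def abs_mult intro!: mult_left_mono)
    have inner: "integrable (tm T) (\<lambda>s. F (t, s))" if t: "t \<in> {0<..<T}" for t
    proof -
      have "(\<lambda>s. F (t, s)) \<in> borel_measurable (tm T)"
        using measurable_Pair2[OF Fm, of t] t by simp
      then show ?thesis using bd by (intro tm.integrable_const_bound[where B = "\<bar>v t\<bar> * M"]) auto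
    qed
    show "AE x in tm T. integrable (tm T) (\<lambda>y. F (x, y))" using inner by (intro AE_I2) simp
    show "integrable (tm T) (\<lambda>x. \<integral>y. norm (F (x, y)) \<partial>tm T)"
    proof (rule Bochner_Integration.integrable_bound[OF integrable_mult_left[OF integrable_abs[OF v], of "M * measure (tm T) {0<..<T}"] m2])
      show "AE t in tm T. norm (\<integral>s. norm (F (t, s)) \<partial>tm T) \<le> norm (\<bar>v t\<bar> * (M * measure (tm T) {0<..<T}))"
      proof (rule AE_I2)
        fix t assume t: "t \<in> space (tm T)"
        have "(\<integral>s. norm (F (t, s)) \<partial>tm T) \<le> (\<integral>s. \<bar>v t\<bar> * M \<partial>tm T)"
          using bd inner[of t] t by (intro integral_mono) auto
        also have "\<dots> = \<bar>v t\<bar> * (M * measure (tm T) {0<..<T})" by simp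
        finally show "norm (\<integral>s. norm (F (t, s)) \<partial>tm T) \<le> norm (\<bar>v t\<bar> * (M * measure (tm T) {0<..<T}))"
          by (simp add: abs_of_nonneg)
      qed
    qed
  qed
  have fub: "(\<integral>s. \<integral>t. v t * (if t < s then 1 else 0) * k s \<partial>tm T \<partial>tm T) = (\<integral>t. \<integral>s. v t * (if t < s then 1 else 0) * k s \<partial>tm T \<partial>tm T)"
    by (rule tmtm.Fubini_integral) (use Fint in \<open>simp add: F_def\<close>)
  have A: "(\<integral>s. v t * (if t < s then 1 else 0) * k s \<partial>tm T) = v t * (\<integral>s. indicator {t<..} s * k s \<partial>tm T)" for t
    unfolding mult.assoc integral_mult_right_zero by (simp add: indicator_def of_bool_def)
  have B: "(\<integral>t. v t * (if t < s then 1 else 0) * k s \<partial>tm T) = k s * (\<integral>t. indicator {..<s} t * v t \<partial>tm T)" for s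
    unfolding integral_mult_left_zero by (simp add: indicator_def of_bool_def mult.commute)
  from fub show ?thesis unfolding A B by simp
qed

lemma integrable_tm_mult:
  fixes g k :: "real \<Rightarrow> real"
  assumes g: "integrable (tm T) g" and k: "k \<in> borel_measurable (tm T)" "\<And>s. s \<in> {0<..<T} \<Longrightarrow> \<bar>k s\<bar> \<le> M"
  shows "integrable (tm T) (\<lambda>s. k s * g s)"
proof (rule Bochner_Integration.integrable_bound[OF integrable_mult_right[OF g, of M]])
  show "AE s in tm T. norm (k s * g s) \<le> norm (M * g s)"
  proof (rule AE_I2)
    fix s assume "s \<in> space (tm T)"
    then have "\<bar>k s\<bar> * \<bar>g s\<bar> \<le> \<bar>M\<bar> * \<bar>g s\<bar>"
      by (intro mult_right_mono) (use k(2)[of s] in auto)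
    then show "norm (k s * g s) \<le> norm (M * g s)" by (simp add: abs_mult)
  qed
qed (use assms in auto)

lemma integrable_primitive:
  fixes v :: "real \<Rightarrow> real"
  assumes v: "integrable (tm T) v"
  shows "integrable (tm T) (\<lambda>s. \<integral>t. indicator {..<s} t * v t \<partial>tm T)"
proof -
  have tb: "(\<lambda>x. x) \<in> measurable (tm T) borel" unfolding tm_def by (intro measurable_restrict_space1) simp
  have f1: "fst \<in> borel_measurable (tm T \<Otimes>\<^sub>M tm T)" and s1: "snd \<in> borel_measurable (tm T \<Otimes>\<^sub>M tm T)"
    by (rule measurable_compose[OF measurable_fst tb] measurable_compose[OF measurable_snd tb])+
  have [measurable]: "v \<in> borel_measurable (tm T)" using v by auto
  have "(\<lambda>z. (if snd z < fst z then 1 else 0) * v (snd z)) \<in> borel_measurable (tm T \<Otimes>\<^sub>M tm T)"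
    using f1 s1 by measurable
  then have "(\<lambda>(s, t). indicator {..<s} t * v t) \<in> borel_measurable (tm T \<Otimes>\<^sub>M tm T)"
    by (simp add: case_prod_beta indicator_def of_bool_def)
  then have m: "(\<lambda>s. \<integral>t. indicator {..<s} t * v t \<partial>tm T) \<in> borel_measurable (tm T)"
    by (rule tm.borel_measurable_lebesgue_integral)
  have ti: "(indicator {..<s} :: real \<Rightarrow> real) \<in> borel_measurable (tm T)" for s
    by (rule measurable_tm) simp
  have "\<bar>\<integral>t. indicator {..<s} t * v t \<partial>tm T\<bar> \<le> (\<integral>t. \<bar>v t\<bar> \<partial>tm T)" for s
  proof -
    have "\<bar>\<integral>t. indicator {..<s} t * v t \<partial>tm T\<bar> \<le> (\<integral>t. \<bar>indicator {..<s} t * v t\<bar> \<partial>tm T)"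
      by (rule integral_abs_bound)
    also have "\<dots> \<le> (\<integral>t. \<bar>v t\<bar> \<partial>tm T)"
      by (intro integral_mono integrable_abs v integrable_tm_mult[OF v ti, where M = 1]) (auto simp: indicator_def)
    finally show ?thesis .
  qed
  then show ?thesis using m by (intro tm.integrable_const_bound[where B = "\<integral>t. \<bar>v t\<bar> \<partial>tm T"]) auto
qed

text \<open>
  The positive and the negative part of \<open>g\<close> are densities of two finite measures that agree on
  all half-lines, hence coincide.
\<close>
lemma tm_zero_AE:
  fixes g :: "real \<Rightarrow> real"
  assumes g: "integrable (tm T) g"
    and z: "\<And>a. 0 \<le> a \<Longrightarrow> a < T \<Longrightarrow> (\<integral>s. indicator {a<..} s * g s \<partial>tm T) = 0"
  shows "AE s in tm T. g s = 0"
proof -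
  define G where "G s = indicator {0<..<T} s * g s" for s
  have Gi: "integrable lborel G"
    using g unfolding tm_def G_def by (subst (asm) integrable_restrict_space) (auto simp: mult.commute)
  then have [measurable]: "G \<in> borel_measurable borel" by auto
  have z': "(\<integral>s. indicator {a<..} s * G s \<partial>lborel) = 0" for a
  proof -
    have "(\<integral>s. indicator {a<..} s * G s \<partial>lborel) = (\<integral>s. indicator {0<..<T} s *\<^sub>R (indicator {max a 0<..} s * g s) \<partial>lborel)"
      unfolding G_def by (intro Bochner_Integration.integral_cong) (auto simp: indicator_def)
    also have "\<dots> = (\<integral>s. indicator {max a 0<..} s * g s \<partial>tm T)"
      unfolding tm_def by (subst integral_restrict_space) auto
    also have "\<dots> = 0"
    proof (cases "max a 0 < T")
      case True then show ?thesis by (intro z) auto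
    next
      case False
      have "(\<integral>s. indicator {max a 0<..} s * g s \<partial>tm T) = (\<integral>s. 0 \<partial>tm T)"
        using False by (intro Bochner_Integration.integral_cong) (auto simp: indicator_def)
      then show ?thesis by simp
    qed
    finally show ?thesis .
  qed
  define P where "P = density lborel (\<lambda>s. ennreal (max (G s) 0))"
  define N where "N = density lborel (\<lambda>s. ennreal (max (- G s) 0))"
  have ip: "integrable lborel (\<lambda>s. indicator {a<..} s * max (G s) 0)"
    "integrable lborel (\<lambda>s. indicator {a<..} s * max (- G s) 0)" for a
    using Gi by (auto intro!: integrable_real_mult_indicator simp: mult.commute[of "indicator _ _"])
  have eP: "emeasure P {a<..} = ennreal (\<integral>s. indicator {a<..} s * max (G s) 0 \<partial>lborel)" for a
  proof -
    have "ennreal (\<integral>s. indicator {a<..} s * max (G s) 0 \<partial>lborel) = (\<integral>\<^sup>+s. ennreal (indicator {a<..} s * max (G s) 0) \<partial>lborel)"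
      by (rule nn_integral_eq_integral[symmetric, OF ip(1)]) simp
    then show ?thesis unfolding P_def
      by (subst emeasure_density) (auto simp: indicator_def intro!: nn_integral_cong)
  qed
  have eN: "emeasure N {a<..} = ennreal (\<integral>s. indicator {a<..} s * max (- G s) 0 \<partial>lborel)" for a
  proof -
    have "ennreal (\<integral>s. indicator {a<..} s * max (- G s) 0 \<partial>lborel) = (\<integral>\<^sup>+s. ennreal (indicator {a<..} s * max (- G s) 0) \<partial>lborel)"
      by (rule nn_integral_eq_integral[symmetric, OF ip(2)]) simp
    then show ?thesis unfolding N_def
      by (subst emeasure_density) (auto simp: indicator_def intro!: nn_integral_cong)
  qed
  have "(\<integral>s. indicator {a<..} s * max (G s) 0 \<partial>lborel) = (\<integral>s. indicator {a<..} s * max (- G s) 0 \<partial>lborel)" for a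
  proof -
    have "(\<integral>s. indicator {a<..} s * max (G s) 0 \<partial>lborel) - (\<integral>s. indicator {a<..} s * max (- G s) 0 \<partial>lborel)
      = (\<integral>s. indicator {a<..} s * max (G s) 0 - indicator {a<..} s * max (- G s) 0 \<partial>lborel)"
      using ip by simp
    also have "\<dots> = (\<integral>s. indicator {a<..} s * G s \<partial>lborel)"
      by (intro Bochner_Integration.integral_cong) (auto simp: indicator_def)
    finally show ?thesis using z' by simp
  qed
  then have "P = N"
    by (intro measure_eqI_lessThan) (auto simp: eP eN, auto simp: P_def N_def)
  then have "AE s in lborel. ennreal (max (G s) 0) = ennreal (max (- G s) 0)"
    unfolding P_def N_def by (intro sigma_finite_measure.density_unique[OF sigma_finite_lborel]) auto
  then have "AE s in lborel. G s = 0" by eventually_elim (auto simp: max_def split: if_splits)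
  then show ?thesis unfolding tm_def G_def
    by (subst AE_restrict_space_iff) auto
qed

lemma grad_eq: "GDERIV g x :> D \<Longrightarrow> grad g x = D"
  unfolding grad_def by (rule the_equality) (auto intro: GDERIV_unique)

text \<open>
  The value that the continuity equation predicts for \<open>\<integral> e m(t)\<close>: the initial value plus the
  flux accumulated up to time \<open>t\<close>.
\<close>
definition mass_flux :: "real \<Rightarrow> (real ^ 'd \<Rightarrow> real) \<Rightarrow> (real \<times> (real ^ 'd) \<Rightarrow> real ^ 'd) \<Rightarrow>
   (real ^ 'd \<Rightarrow> real) \<Rightarrow> (real ^ 'd \<Rightarrow> real ^ 'd) \<Rightarrow> real \<Rightarrow> real" where
  "mass_flux T m0 w e De t = (\<integral>x. e x * m0 x \<partial>torus) +
     (\<integral>s. indicator {..<t} s * (\<integral>x. w (s, x) \<bullet> De x \<partial>torus) \<partial>tm T)"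

text \<open>
  Testing with \<open>cutint(t) e(x)\<close> and integrating by parts shows that the difference \<open>g\<close> of the two
  sides is orthogonal to all cut-offs, so its integral over \<open>(a, T)\<close> vanishes for all \<open>a\<close>.
\<close>
lemma cont_eq_smooth:
  fixes m :: "real \<times> (real ^ 'd) \<Rightarrow> real"
  assumes ce: "continuity_equation T m0 m w" and T: "0 < T"
    and m: "integrable (cyl T) m" and w: "integrable (cyl T) w"
    and e: "\<And>k. Ck k e" "periodic e" and De: "\<And>x. GDERIV e x :> De x" "continuous_on UNIV De" "periodic De"
  shows "AE t in tm T. (\<integral>x. e x * m (t, x) \<partial>torus) = mass_flux T m0 w e De t"
proof -
  have ec: "continuous_on UNIV e" using e(1)[of 0] by simp
  obtain Me where Me: "\<And>x. \<bar>e x\<bar> \<le> Me" using periodic_bounded_space[OF ec e(2)] by auto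
  obtain MD where MD: "\<And>x. norm (De x) \<le> MD" using periodic_bounded_space[OF De(2,3)] by auto
  have em [measurable]: "(\<lambda>z. e (snd z)) \<in> borel_measurable (cyl T)"
    by (intro measurable_cyl_cont continuous_on_compose2[OF ec] continuous_intros) auto
  have dm [measurable]: "(\<lambda>z. De (snd z)) \<in> borel_measurable (cyl T)"
    by (intro measurable_cyl_cont continuous_on_compose2[OF De(2)] continuous_intros) auto
  have im: "integrable (cyl T) (\<lambda>z. m z * e (snd z))"
    using Me by (intro integrable_cyl_mult[OF m em]) auto
  have iw: "integrable (cyl T) (\<lambda>z. w z \<bullet> De (snd z))"
    using MD by (intro integrable_cyl_inner[OF w dm]) auto
  define u where "u t = (\<integral>x. m (t, x) * e x \<partial>torus)" for t
  define v where "v t = (\<integral>x. w (t, x) \<bullet> De x \<partial>torus)" for t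
  define c where "c = (\<integral>x. e x * m0 x \<partial>torus)"
  have ui: "integrable (tm T) u" using cyl_fubini(2)[OF im] by (simp add: u_def[abs_def])
  have vi: "integrable (tm T) v" using cyl_fubini(2)[OF iw] by (simp add: v_def[abs_def])
  (* The equation tested with zeta(t, x) = cutint(t) e(x), after integration by parts in time. *)
  have key: "(\<integral>s. cut T a n s * (mass_flux T m0 w e De s - u s) \<partial>tm T) = 0" for a n
  proof -
    define \<zeta> where "\<zeta> = (\<lambda>z :: real \<times> (real ^ 'd). cutint T a n (fst z) * e (snd z))"
    have "Ck k \<zeta>" for k
    proof -
      have "Ck k (\<lambda>z :: real \<times> (real ^ 'd). cutint T a n (fst z + 0))" by (rule Ck_affine[OF bounded_linear_fst Ck_cutint])
      moreover have "Ck k (\<lambda>z :: real \<times> (real ^ 'd). e (snd z + 0))" by (rule Ck_affine[OF bounded_linear_snd e(1)])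
      ultimately show ?thesis unfolding \<zeta>_def by (intro Ck_mult) simp_all
    qed
    moreover have "periodic (\<lambda>x. \<zeta> (t, x))" for t using e(2) by (simp add: \<zeta>_def periodic_def)
    moreover have "\<exists>s<T. \<forall>t\<ge>s. \<forall>x. \<zeta> (t, x) = 0"
      by (intro exI[of _ "T - 1 / real (Suc n)"]) (auto simp: \<zeta>_def cutint_zero)
    ultimately have "\<zeta> \<in> test_functions T" by (simp add: test_functions_def)
    with ce have eq: "(\<integral>(t, x). m (t, x) * deriv (\<lambda>s. \<zeta> (s, x)) t + w (t, x) \<bullet> grad (\<lambda>y. \<zeta> (t, y)) x \<partial>cyl T)
       + (\<integral>x. \<zeta> (0, x) * m0 x \<partial>torus) = 0" by (auto simp: continuity_equation_def)
    have d1: "deriv (\<lambda>s. \<zeta> (s, x)) t = - cut T a n t * e x" for t x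
      unfolding \<zeta>_def by (rule DERIV_imp_deriv) (auto intro!: derivative_eq_intros cutint_deriv)
    have d2: "grad (\<lambda>y. \<zeta> (t, y)) x = cutint T a n t *\<^sub>R De x" for t x
      unfolding \<zeta>_def using GDERIV_mult[OF GDERIV_const[of "cutint T a n t"] De(1)] by (intro grad_eq) simp
    have cm [measurable]: "(\<lambda>z :: real \<times> (real ^ 'd). cut T a n (fst z)) \<in> borel_measurable (cyl T)"
      by (intro measurable_cyl_cont continuous_on_compose2[OF cut_cont] continuous_intros) auto
    have cic: "continuous_on UNIV (cutint T a n)" by (rule Ck_cont[OF Ck_cutint])
    have cim [measurable]: "(\<lambda>z :: real \<times> (real ^ 'd). cutint T a n (fst z)) \<in> borel_measurable (cyl T)"
      by (intro measurable_cyl_cont continuous_on_compose2[OF cic] continuous_intros) auto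
    obtain Mc where Mc: "\<And>t. t \<in> {0..T} \<Longrightarrow> \<bar>cutint T a n t\<bar> \<le> Mc"
    proof -
      have "compact (cutint T a n ` {0..T})" by (intro compact_continuous_image continuous_on_subset[OF cic]) auto
      then show ?thesis using that by (metis bounded_iff compact_imp_bounded image_eqI real_norm_def)
    qed
    have i1: "integrable (cyl T) (\<lambda>z. (m z * e (snd z)) * cut T a n (fst z))"
      using cut_bounds[of T a n] by (intro integrable_cyl_mult[OF im cm, where M = 1]) (auto simp: abs_le_iff intro: order_trans[of _ 0])
    have i2: "integrable (cyl T) (\<lambda>z. (w z \<bullet> De (snd z)) * cutint T a n (fst z))"
      using Mc by (intro integrable_cyl_mult[OF iw cim, where M = Mc]) (auto simp: space_cyl)
    have F1: "(\<integral>z. (m z * e (snd z)) * cut T a n (fst z) \<partial>cyl T) = (\<integral>t. cut T a n t * u t \<partial>tm T)"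
      unfolding cyl_fubini(3)[OF i1] u_def by (simp add: mult.commute)
    have F2: "(\<integral>z. (w z \<bullet> De (snd z)) * cutint T a n (fst z) \<partial>cyl T) = (\<integral>t. v t * cutint T a n t \<partial>tm T)"
      unfolding cyl_fubini(3)[OF i2] v_def by simp
    have "(\<integral>t. v t * cutint T a n t \<partial>tm T) = (\<integral>t. v t * (\<integral>s. indicator {t<..} s * cut T a n s \<partial>tm T) \<partial>tm T)"
      by (intro Bochner_Integration.integral_cong) (auto simp: cutint_eq)
    also have "\<dots> = (\<integral>s. cut T a n s * (\<integral>t. indicator {..<s} t * v t \<partial>tm T) \<partial>tm T)"
      using cut_bounds[of T a n]
      by (intro ibp_tm[OF vi, where M = 1] measurable_tm borel_measurable_continuous_onI cut_cont) (auto simp: abs_le_iff intro: order_trans[of _ 0])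
    finally have F3: "(\<integral>t. v t * cutint T a n t \<partial>tm T) = (\<integral>s. cut T a n s * (\<integral>t. indicator {..<s} t * v t \<partial>tm T) \<partial>tm T)" .
    have F4: "cutint T a n 0 = (\<integral>s. cut T a n s \<partial>tm T)"
      using T cutint_eq[of 0 T a n] by (auto intro!: Bochner_Integration.integral_cong simp: indicator_def)
    have F5: "(\<integral>x. \<zeta> (0, x) * m0 x \<partial>torus) = c * cutint T a n 0"
      by (simp add: \<zeta>_def c_def mult.assoc)
    have "(\<integral>(t, x). m (t, x) * deriv (\<lambda>s. \<zeta> (s, x)) t + w (t, x) \<bullet> grad (\<lambda>y. \<zeta> (t, y)) x \<partial>cyl T)
      = (\<integral>z. (w z \<bullet> De (snd z)) * cutint T a n (fst z) - (m z * e (snd z)) * cut T a n (fst z) \<partial>cyl T)"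
      by (intro Bochner_Integration.integral_cong) (auto simp: d1 d2 algebra_simps)
    also have "\<dots> = (\<integral>s. cut T a n s * (\<integral>t. indicator {..<s} t * v t \<partial>tm T) \<partial>tm T) - (\<integral>t. cut T a n t * u t \<partial>tm T)"
      using i1 i2 by (simp add: F1 F2 F3)
    finally have E: "(\<integral>s. cut T a n s * (\<integral>t. indicator {..<s} t * v t \<partial>tm T) \<partial>tm T) - (\<integral>t. cut T a n t * u t \<partial>tm T) + c * (\<integral>s. cut T a n s \<partial>tm T) = 0"
      using eq F5 F4 by simp
    have cb: "cut T a n \<in> borel_measurable (tm T)" by (intro measurable_tm borel_measurable_continuous_onI cut_cont)
    have ca: "\<bar>cut T a n s\<bar> \<le> 1" for s using cut_bounds[of T a n s] by simp
    have "(\<integral>s. cut T a n s * (mass_flux T m0 w e De s - u s) \<partial>tm T) =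
       (\<integral>s. (c * cut T a n s + cut T a n s * (\<integral>t. indicator {..<s} t * v t \<partial>tm T)) - cut T a n s * u s \<partial>tm T)"
      by (simp add: mass_flux_def v_def c_def algebra_simps)
    also have "\<dots> = (c * (\<integral>s. cut T a n s \<partial>tm T) + (\<integral>s. cut T a n s * (\<integral>t. indicator {..<s} t * v t \<partial>tm T) \<partial>tm T)) - (\<integral>s. cut T a n s * u s \<partial>tm T)"
    proof -
      have "integrable (tm T) (\<lambda>s. cut T a n s)" using cb ca by (intro tm.integrable_const_bound[where B = 1]) auto
      then have i: "integrable (tm T) (\<lambda>s. c * cut T a n s)" by (rule integrable_mult_right)
      show ?thesis
        using i integrable_tm_mult[OF integrable_primitive[OF vi] cb ca] integrable_tm_mult[OF ui cb ca] by simp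
    qed
    finally show ?thesis using E by simp
  qed
  define g where "g s = mass_flux T m0 w e De s - u s" for s
  have gi: "integrable (tm T) g"
  proof -
    have "mass_flux T m0 w e De s = c + (\<integral>t. indicator {..<s} t * v t \<partial>tm T)" for s
      by (simp add: mass_flux_def c_def v_def)
    then show ?thesis unfolding g_def using integrable_primitive[OF vi] ui by simp
  qed
  have "(\<integral>s. indicator {a<..} s * g s \<partial>tm T) = 0" if a: "0 \<le> a" "a < T" for a
  proof -
    have "(\<lambda>n. \<integral>s. cut T a n s * g s \<partial>tm T) \<longlonglongrightarrow> (\<integral>s. indicator {a<..} s * g s \<partial>tm T)"
    proof (rule integral_dominated_convergence[where w = "\<lambda>s. \<bar>g s\<bar>"])
      have ti: "(indicator {a<..} :: real \<Rightarrow> real) \<in> borel_measurable (tm T)" by (rule measurable_tm) simp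
      show "(\<lambda>s. indicator {a<..} s * g s) \<in> borel_measurable (tm T)" using ti gi by auto
      show "(\<lambda>s. cut T a n s * g s) \<in> borel_measurable (tm T)" for n
        by (intro borel_measurable_times borel_measurable_integrable[OF gi] measurable_tm[OF borel_measurable_continuous_onI[OF cut_cont]])
      show "integrable (tm T) (\<lambda>s. \<bar>g s\<bar>)" using gi by simp
      show "AE s in tm T. (\<lambda>n. cut T a n s * g s) \<longlonglongrightarrow> indicator {a<..} s * g s"
      proof (rule AE_I2)
        fix s assume "s \<in> space (tm T)"
        then have "(\<lambda>n. cut T a n s) \<longlonglongrightarrow> indicator {a<..} s"
          using cut_lim(1)[of a s T] cut_lim(2)[of s a T] by (cases "a < s") auto
        then show "(\<lambda>n. cut T a n s * g s) \<longlonglongrightarrow> indicator {a<..} s * g s" by (intro tendsto_intros)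
      qed
      show "AE s in tm T. norm (cut T a n s * g s) \<le> \<bar>g s\<bar>" for n
        using cut_bounds[of T a n] by (intro AE_I2) (simp add: abs_mult mult_left_le_one_le)
    qed
    then show ?thesis using key[of a] by (simp add: g_def LIMSEQ_const_iff)
  qed
  then have "AE s in tm T. g s = 0" by (rule tm_zero_AE[OF gi])
  then show ?thesis
    by eventually_elim (simp add: g_def u_def mult.commute)
qed

section \<open>The continuity equation against C1 functions\<close>

text \<open>
  A C1 function on the closed cylinder together with its time derivative \<open>a\<close> and its space
  gradient \<open>b\<close>, the two objects that enter the integrals.
\<close>
definition C1rep :: "real \<Rightarrow> (real \<times> (real ^ 'd) \<Rightarrow> real) \<Rightarrow> (real \<times> (real ^ 'd) \<Rightarrow> real) \<Rightarrow>
    (real \<times> (real ^ 'd) \<Rightarrow> real ^ 'd) \<Rightarrow> bool" where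
  "C1rep T \<phi> a b \<longleftrightarrow> continuous_on ({0..T} \<times> UNIV) a \<and> continuous_on ({0..T} \<times> UNIV) b \<and>
     (\<forall>t\<in>{0..T}. periodic (\<lambda>x. \<phi> (t, x)) \<and> periodic (\<lambda>x. a (t, x)) \<and> periodic (\<lambda>x. b (t, x)) \<and>
       (\<forall>x. ((\<lambda>s. \<phi> (s, x)) has_real_derivative a (t, x)) (at t within {0..T}) \<and>
            (GDERIV (\<lambda>y. \<phi> (t, y)) x :> b (t, x))))"

lemma GDERIV_shift: "GDERIV g (x + k :: real ^ 'd) :> D \<Longrightarrow> GDERIV (\<lambda>y. g (y + k)) x :> D"
  unfolding gderiv_def
  by (rule has_derivative_compose[of "\<lambda>y. y + k" "\<lambda>h. h" x UNIV g, simplified]) (auto intro!: derivative_eq_intros)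

lemma GDERIV_periodic:
  fixes g :: "real ^ 'd \<Rightarrow> real"
  assumes D: "\<And>x. GDERIV g x :> De x" and g: "periodic g" shows "periodic De"
  unfolding periodic_def
proof (intro allI ballI)
  fix x k :: "real ^ 'd" assume k: "k \<in> lattice"
  have "GDERIV (\<lambda>y. g (y + k)) x :> De (x + k)" by (rule GDERIV_shift[OF D])
  moreover have "(\<lambda>y. g (y + k)) = g" using g k by (auto simp: periodic_def)
  ultimately show "De (x + k) = De x" using D GDERIV_unique by metis
qed

lemma K0_C1rep:
  fixes \<phi> :: "real \<times> (real ^ 'd) \<Rightarrow> real"
  assumes "\<phi> \<in> K0 T g" "0 < T"
  shows "\<exists>a b. C1rep T \<phi> a b"
proof -
  obtain a b where ab: "continuous_on ({0..T} \<times> UNIV) a" "continuous_on ({0..T} \<times> UNIV) b"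
    and d: "\<And>t x. t \<in> {0..T} \<Longrightarrow> ((\<lambda>s. \<phi> (s, x)) has_real_derivative a (t, x)) (at t within {0..T})"
      "\<And>t x. t \<in> {0..T} \<Longrightarrow> GDERIV (\<lambda>y. \<phi> (t, y)) x :> b (t, x)"
    and p: "\<And>t. t \<in> {0..T} \<Longrightarrow> periodic (\<lambda>x. \<phi> (t, x))"
    using assms by (auto simp: K0_def)
  have "periodic (\<lambda>x. b (t, x))" if "t \<in> {0..T}" for t
    by (rule GDERIV_periodic[OF d(2) p]) (use that in auto)
  moreover have "periodic (\<lambda>x. a (t, x))" if t: "t \<in> {0..T}" for t
    unfolding periodic_def
  proof (intro allI ballI)
    fix x k :: "real ^ 'd" assume k: "k \<in> lattice"
    have "((\<lambda>s. \<phi> (s, x)) has_real_derivative a (t, x + k)) (at t within {0..T})"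
      by (rule has_field_derivative_transform_within[OF d(1)[OF t, of "x + k"] zero_less_one t])
         (use p k in \<open>auto simp: periodic_def\<close>)
    then show "a (t, x + k) = a (t, x)"
      using vector_derivative_unique_within_closed_interval[of 0 T t "\<lambda>s. \<phi> (s, x)" "a (t, x + k)" "a (t, x)"]
        d(1)[OF t, of x] assms(2) t
      by (auto simp: has_real_derivative_iff_has_vector_derivative)
  qed
  ultimately show ?thesis using ab d p unfolding C1rep_def by blast
qed

lemma C1repD:
  assumes "C1rep T \<phi> a b"
  shows "continuous_on ({0..T} \<times> UNIV) a" "continuous_on ({0..T} \<times> UNIV) b"
    "\<And>t. t \<in> {0..T} \<Longrightarrow> periodic (\<lambda>x. \<phi> (t, x))"
    "\<And>t. t \<in> {0..T} \<Longrightarrow> periodic (\<lambda>x. a (t, x))"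
    "\<And>t. t \<in> {0..T} \<Longrightarrow> periodic (\<lambda>x. b (t, x))"
    "\<And>t x. t \<in> {0..T} \<Longrightarrow> ((\<lambda>s. \<phi> (s, x)) has_real_derivative a (t, x)) (at t within {0..T})"
    "\<And>t x. t \<in> {0..T} \<Longrightarrow> GDERIV (\<lambda>y. \<phi> (t, y)) x :> b (t, x)"
  using assms unfolding C1rep_def by blast+

lemma C1rep_deriv:
  assumes "C1rep T \<phi> a b" "t \<in> {0<..<T}"
  shows "deriv (\<lambda>s. \<phi> (s, x)) t = a (t, x)" "grad (\<lambda>y. \<phi> (t, y)) x = b (t, x)"
proof -
  have t: "t \<in> {0..T}" using assms by auto
  have "at t within {0..T} = at t" using assms(2) by (intro at_within_Icc_at) auto
  then show "deriv (\<lambda>s. \<phi> (s, x)) t = a (t, x)"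
    using C1repD(6)[OF assms(1) t, of x] by (simp add: DERIV_imp_deriv)
  show "grad (\<lambda>y. \<phi> (t, y)) x = b (t, x)" by (rule grad_eq[OF C1repD(7)[OF assms(1) t]])
qed

lemma cont_slice:
  assumes "continuous_on ({0..T} \<times> UNIV) a" "t \<in> {0..T}" shows "continuous_on UNIV (\<lambda>x. a (t, x))"
  using assms by (intro continuous_on_compose2[OF assms(1)] continuous_intros) auto

lemma GDERIV_cont: "(\<And>x. GDERIV g x :> De x) \<Longrightarrow> continuous_on UNIV g"
  unfolding gderiv_def by (meson continuous_at_imp_continuous_on has_derivative_continuous)

lemma tm_meas_cyl:
  assumes "A \<in> borel_measurable (tm T)"
  shows "(\<lambda>z :: real \<times> (real ^ 'd). A (fst z)) \<in> borel_measurable (cyl T)"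
  using measurable_compose[OF measurable_fst assms, of torus] by (simp add: cyl_eq)

lemma measurable_snd_cyl:
  assumes "g \<in> borel_measurable torus"
  shows "(\<lambda>z :: real \<times> (real ^ 'd). g (snd z)) \<in> borel_measurable (cyl T)"
  using measurable_compose[OF measurable_snd assms, of "tm T"] by (simp add: cyl_eq)

lemma cyl_swap:
  fixes h :: "real \<times> (real ^ 'd) \<Rightarrow> real"
  assumes "integrable (cyl T) h"
  shows "(\<integral>x. \<integral>t. h (t, x) \<partial>tm T \<partial>torus) = (\<integral>t. \<integral>x. h (t, x) \<partial>torus \<partial>tm T)"
  by (rule tmtorus.Fubini_integral) (use assms in \<open>simp add: cyl_eq case_prod_beta\<close>)

lemma FTC_tm:
  assumes d: "\<And>s. s \<in> {0..T} \<Longrightarrow> (F has_real_derivative f s) (at s within {0..T})"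
    and c: "continuous_on {0..T} f" and t: "t \<in> {0..T}"
  shows "F T - F t = (\<integral>s. indicator {t<..} s * f s \<partial>tm T)"
proof -
  have "(\<integral>s. indicator {t..T} s *\<^sub>R f s \<partial>lborel) = F T - F t"
  proof (rule integral_FTC_atLeastAtMost)
    fix s assume "t \<le> s" "s \<le> T"
    then show "(F has_vector_derivative f s) (at s within {t..T})"
      using d[of s] t by (auto simp: has_real_derivative_iff_has_vector_derivative intro: has_vector_derivative_within_subset)
  qed (use t c in \<open>auto intro: continuous_on_subset\<close>)
  moreover have "(\<integral>s. indicator {t..T} s *\<^sub>R f s \<partial>lborel) = (\<integral>s. indicator {0<..<T} s *\<^sub>R (indicator {t<..} s * f s) \<partial>lborel)"
  proof (rule integral_cong_AE)
    have fm: "(\<lambda>s. indicator {0..T} s *\<^sub>R f s) \<in> borel_measurable borel"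
      by (rule borel_measurable_continuous_on_indicator[OF _ c]) simp
    have "(\<lambda>s. indicator {t..T} s *\<^sub>R (indicator {0..T} s *\<^sub>R f s)) \<in> borel_measurable lborel" using fm by measurable
    moreover have "(\<lambda>s. indicator {t..T} s *\<^sub>R (indicator {0..T} s *\<^sub>R f s)) = (\<lambda>s. indicator {t..T} s *\<^sub>R f s)"
      using t by (auto simp: indicator_def)
    ultimately show "(\<lambda>s. indicator {t..T} s *\<^sub>R f s) \<in> borel_measurable lborel" by simp
    have "(\<lambda>s. indicator {0<..<T} s *\<^sub>R (indicator {t<..} s * (indicator {0..T} s *\<^sub>R f s))) \<in> borel_measurable lborel" using fm by measurable
    moreover have "(\<lambda>s. indicator {0<..<T} s *\<^sub>R (indicator {t<..} s * (indicator {0..T} s *\<^sub>R f s))) = (\<lambda>s. indicator {0<..<T} s *\<^sub>R (indicator {t<..} s * f s))"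
      by (auto simp: indicator_def)
    ultimately show "(\<lambda>s. indicator {0<..<T} s *\<^sub>R (indicator {t<..} s * f s)) \<in> borel_measurable lborel" by simp
    have "AE s in lborel. s \<noteq> t" "AE s in lborel. s \<noteq> T" by (rule AE_lborel_singleton)+
    then show "AE s in lborel. indicator {t..T} s *\<^sub>R f s = indicator {0<..<T} s *\<^sub>R (indicator {t<..} s * f s)"
      by eventually_elim (use t in \<open>auto simp: indicator_def\<close>)
  qed
  ultimately show ?thesis unfolding tm_def by (subst integral_restrict_space) auto
qed

text \<open>
  The tested continuity equation as a linear condition on a triple that stands for
  \<open>(\<partial>\<^sub>t\<psi>, D\<psi>, \<psi>(0))\<close>.  Keeping the entries independent makes the condition stable under sums and
  uniform limits of each entry, whether or not they are derivatives of one function.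
\<close>
definition balanced :: "real \<Rightarrow> (real ^ 'd \<Rightarrow> real) \<Rightarrow> (real \<times> (real ^ 'd) \<Rightarrow> real) \<Rightarrow> (real \<times> (real ^ 'd) \<Rightarrow> real ^ 'd) \<Rightarrow>
    (real \<times> (real ^ 'd) \<Rightarrow> real) \<Rightarrow> (real \<times> (real ^ 'd) \<Rightarrow> real ^ 'd) \<Rightarrow> (real ^ 'd \<Rightarrow> real) \<Rightarrow> bool" where
  "balanced T m0 m w \<alpha> \<beta> \<gamma> \<longleftrightarrow> integrable (cyl T) (\<lambda>z. m z * \<alpha> z) \<and> integrable (cyl T) (\<lambda>z. w z \<bullet> \<beta> z) \<and>
     integrable torus (\<lambda>x. \<gamma> x * m0 x) \<and>
     (\<integral>z. m z * \<alpha> z \<partial>cyl T) + (\<integral>z. w z \<bullet> \<beta> z \<partial>cyl T) + (\<integral>x. \<gamma> x * m0 x \<partial>torus) = (0::real)"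

lemma balanced_add:
  assumes "balanced T m0 m w \<alpha> \<beta> \<gamma>" "balanced T m0 m w \<alpha>' \<beta>' \<gamma>'"
  shows "balanced T m0 m w (\<lambda>z. \<alpha> z + \<alpha>' z) (\<lambda>z. \<beta> z + \<beta>' z) (\<lambda>z. \<gamma> z + \<gamma>' z)"
  using assms unfolding balanced_def by (auto simp: distrib_left distrib_right inner_add_right)

lemma balanced_scale:
  assumes "balanced T m0 m w \<alpha> \<beta> \<gamma>"
  shows "balanced T m0 m w (\<lambda>z. c * \<alpha> z) (\<lambda>z. c *\<^sub>R \<beta> z) (\<lambda>z. c * \<gamma> z)"
proof -
  have "c * ((\<integral>z. m z * \<alpha> z \<partial>cyl T) + (\<integral>z. w z \<bullet> \<beta> z \<partial>cyl T) + (\<integral>x. \<gamma> x * m0 x \<partial>torus)) = 0"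
    using assms unfolding balanced_def by simp
  then have *: "c * (\<integral>z. m z * \<alpha> z \<partial>cyl T) + c * (\<integral>z. w z \<bullet> \<beta> z \<partial>cyl T) + c * (\<integral>x. \<gamma> x * m0 x \<partial>torus) = 0"
    by (simp only: distrib_left)
  have i: "integrable (cyl T) (\<lambda>z. c * (m z * \<alpha> z))" "integrable (cyl T) (\<lambda>z. c * (w z \<bullet> \<beta> z))"
    "integrable torus (\<lambda>x. c * (\<gamma> x * m0 x))"
    by (rule integrable_mult_right, use assms in \<open>simp add: balanced_def\<close>)+
  have e: "(\<lambda>z. m z * (c * \<alpha> z)) = (\<lambda>z. c * (m z * \<alpha> z))" "(\<lambda>z. w z \<bullet> (c *\<^sub>R \<beta> z)) = (\<lambda>z. c * (w z \<bullet> \<beta> z))"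
    "(\<lambda>x. c * \<gamma> x * m0 x) = (\<lambda>x. c * (\<gamma> x * m0 x))"
    by (simp_all add: fun_eq_iff)
  show ?thesis unfolding balanced_def e using i * by simp
qed

lemma balanced_sum_list:
  assumes "\<And>p. p \<in> set L \<Longrightarrow> balanced T m0 m w (\<alpha> p) (\<beta> p) (\<gamma> p)"
  shows "balanced T m0 m w (\<lambda>z. \<Sum>p\<leftarrow>L. \<alpha> p z) (\<lambda>z. \<Sum>p\<leftarrow>L. \<beta> p z) (\<lambda>z. \<Sum>p\<leftarrow>L. \<gamma> p z)"
  using assms
proof (induction L)
  case Nil then show ?case by (simp add: balanced_def)
next
  case (Cons p L)
  then show ?case using balanced_add[of T m0 m w "\<alpha> p" "\<beta> p" "\<gamma> p"] by simp
qed

lemma countable_tmono_index: "countable (UNIV :: ('d::finite \<times> bool) list set)"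
  using countable_lists[of "UNIV :: ('d \<times> bool) set"] by (simp add: countable_finite)

text \<open>
  There are only countably many monomials, so one null set of times serves them all.
\<close>
lemma flux_tmono:
  fixes m :: "real \<times> (real ^ 'd) \<Rightarrow> real"
  assumes ce: "continuity_equation T m0 m w" and T: "0 < T"
    and m: "integrable (cyl T) m" and w: "integrable (cyl T) w"
  shows "AE t in tm T. \<forall>l. (\<integral>x. tmono l x * m (t, x) \<partial>torus) = mass_flux T m0 w (tmono l) (tgrad l) t"
proof -
  have "AE t in tm T. \<forall>l\<in>UNIV. (\<integral>x. tmono l x * m (t, x) \<partial>torus) = mass_flux T m0 w (tmono l) (tgrad l) t"
    by (subst AE_ball_countable[OF countable_tmono_index])
       (intro ballI cont_eq_smooth[OF ce T m w] Ck_tmono tmono_periodic GDERIV_tmono tgrad_cont tgrad_periodic)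
  then show ?thesis by simp
qed

text \<open>
  The triple belongs to the function \<open>B(t) tmono l x\<close>, where \<open>B(t)\<close> is the coefficient of
  \<open>\<psi>(t)\<close> at \<open>l'\<close>.  Here \<open>B' = A\<close> and \<open>B(T) = 0\<close>; inserting the known value of
  \<open>\<integral> tmono l x m(t, x) dx\<close> and integrating by parts in time makes all terms cancel.
\<close>
lemma balanced_term:
  fixes m \<psi> a :: "real \<times> (real ^ 'd) \<Rightarrow> real"
  assumes ce: "continuity_equation T m0 m w" and T: "0 < T"
    and m: "integrable (cyl T) m" and w: "integrable (cyl T) w" and m0: "continuous_on UNIV m0" "periodic m0"
    and \<psi>: "C1rep T \<psi> a b" "\<And>x. \<psi> (T, x) = 0"
  shows "balanced T m0 m w (\<lambda>z. (\<integral>y. tmono l' y * a (fst z, y) \<partial>torus) * tmono l (snd z))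
    (\<lambda>z. (\<integral>y. tmono l' y * \<psi> (fst z, y) \<partial>torus) *\<^sub>R tgrad l (snd z))
    (\<lambda>x. (\<integral>y. tmono l' y * \<psi> (0, y) \<partial>torus) * tmono l x)"
proof -
  (* A and B are the coefficients of the time derivative a and of psi itself. *)
  define A where "A t = (\<integral>y. tmono l' y * a (t, y) \<partial>torus)" for t
  define B where "B t = (\<integral>y. tmono l' y * \<psi> (t, y) \<partial>torus)" for t
  obtain Ma where Ma: "Ma \<ge> 0" "\<And>t x. t \<in> {0..T} \<Longrightarrow> norm (a (t, x)) \<le> Ma"
    using periodic_bounded[OF C1repD(1)[OF \<psi>(1)] C1repD(4)[OF \<psi>(1)]] by blast
  obtain MD where MD: "\<And>x. norm (tgrad l x) \<le> MD" using periodic_bounded_space[OF tgrad_cont tgrad_periodic] by blast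
  have am: "a \<in> borel_measurable (cyl T)" by (rule measurable_cyl_cont[OF C1repD(1)[OF \<psi>(1)]])
  have tmm: "(\<lambda>z. tmono k (snd z)) \<in> borel_measurable (cyl T)" for k :: "('d \<times> bool) list"
    by (rule measurable_snd_cyl[OF measurable_torus_cont[OF tmono_cont]])
  have tgm: "(\<lambda>z. tgrad k (snd z)) \<in> borel_measurable (cyl T)" for k :: "('d \<times> bool) list"
    by (rule measurable_snd_cyl[OF measurable_torus_cont[OF tgrad_cont]])
  have ia: "integrable (cyl T) (\<lambda>z. a z * tmono l' (snd z))"
  proof (rule integrable_cyl_mult[where M = 1])
    show "integrable (cyl T) a"
      using Ma am by (auto intro!: cyl.integrable_const_bound[where B = Ma] AE_I2 simp: space_cyl)
    show "(\<lambda>z. tmono l' (snd z)) \<in> borel_measurable (cyl T)" by (rule tmm)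
    show "\<bar>tmono l' (snd z)\<bar> \<le> 1" for z :: "real \<times> (real ^ 'd)" by (rule tmono_bound)
  qed
  have Ai: "integrable (tm T) A" using cyl_fubini(2)[OF ia] by (simp add: A_def[abs_def] mult.commute)
  have Am: "A \<in> borel_measurable (tm T)" using Ai by auto
  have Ab: "\<bar>A t\<bar> \<le> Ma" if t: "t \<in> {0<..<T}" for t
  proof -
    have "\<bar>A t\<bar> \<le> (\<integral>y. \<bar>tmono l' y * a (t, y)\<bar> \<partial>torus)" unfolding A_def by (rule integral_abs_bound)
    also have "\<dots> \<le> (\<integral>y. Ma \<partial>(torus :: (real ^ 'd) measure))"
    proof (rule integral_mono)
      have tt: "t \<in> {0..T}" using t by auto
      have "continuous_on UNIV (\<lambda>y. tmono l' y * a (t, y))"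
        by (intro continuous_intros tmono_cont cont_slice[OF C1repD(1)[OF \<psi>(1)] tt])
      moreover have "periodic (\<lambda>y. tmono l' y * a (t, y))"
        using C1repD(4)[OF \<psi>(1) tt] tmono_periodic[of l'] by (auto simp: periodic_def)
      ultimately show "integrable torus (\<lambda>y. \<bar>tmono l' y * a (t, y)\<bar>)"
        by (intro integrable_abs integrable_torus_cont)
      show "\<bar>tmono l' y * a (t, y)\<bar> \<le> Ma" for y
        using tmono_bound[of l' y] Ma(2)[OF tt, of y] mult_mono[of "\<bar>tmono l' y\<bar>" 1 "\<bar>a (t, y)\<bar>" Ma] by (simp add: abs_mult)
    qed simp
    also have "\<dots> = Ma" by (simp add: torus.prob_space[simplified])
    finally show ?thesis .
  qed
  have B: "B t = - (\<integral>s. indicator {t<..} s * A s \<partial>tm T)" if t: "t \<in> {0..T}" for t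
  proof -
    have *: "\<psi> (t, y) = - (\<integral>s. indicator {t<..} s * a (s, y) \<partial>tm T)" for y
    proof -
      have cc: "continuous_on {0..T} (\<lambda>s. a (s, y))"
        by (intro continuous_on_compose2[OF C1repD(1)[OF \<psi>(1)]] continuous_intros) auto
      show ?thesis using FTC_tm[OF C1repD(6)[OF \<psi>(1)] cc t] \<psi>(2)[of y] by simp
    qed
    have ii: "integrable (cyl T) (\<lambda>z. (a z * tmono l' (snd z)) * indicator {t<..} (fst z))"
      by (intro integrable_cyl_mult[OF ia, where M = 1] tm_meas_cyl measurable_tm) auto
    have "tmono l' y * \<psi> (t, y) = - (\<integral>s. (a (s, y) * tmono l' y) * indicator {t<..} s \<partial>tm T)" for y
    proof -
      have "(\<integral>s. (a (s, y) * tmono l' y) * indicator {t<..} s \<partial>tm T) = (\<integral>s. tmono l' y * (indicator {t<..} s * a (s, y)) \<partial>tm T)"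
        by (intro Bochner_Integration.integral_cong) auto
      also have "\<dots> = tmono l' y * (\<integral>s. indicator {t<..} s * a (s, y) \<partial>tm T)" by (rule integral_mult_right_zero)
      finally show ?thesis unfolding * by simp
    qed
    then have "B t = - (\<integral>y. \<integral>s. (a (s, y) * tmono l' y) * indicator {t<..} s \<partial>tm T \<partial>torus)"
      unfolding B_def by simp
    also have "\<dots> = - (\<integral>s. \<integral>y. (a (s, y) * tmono l' y) * indicator {t<..} s \<partial>torus \<partial>tm T)"
      using cyl_swap[OF ii] by simp
    also have "\<dots> = - (\<integral>s. indicator {t<..} s * A s \<partial>tm T)"
      by (simp add: A_def mult.commute)
    finally show ?thesis .
  qed
  have B': "B t = (\<integral>s. indicator {t<..} s * (- A s) \<partial>tm T)" if t: "t \<in> {0..T}" for t using B[OF t] by simp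
  define u where "u t = (\<integral>x. m (t, x) * tmono l x \<partial>torus)" for t
  define v where "v t = (\<integral>x. w (t, x) \<bullet> tgrad l x \<partial>torus)" for t
  define c where "c = (\<integral>x. tmono l x * m0 x \<partial>torus)"
  have im: "integrable (cyl T) (\<lambda>z. m z * tmono l (snd z))"
    using tmono_bound by (intro integrable_cyl_mult[OF m tmm]) auto
  have iw: "integrable (cyl T) (\<lambda>z. w z \<bullet> tgrad l (snd z))"
    using MD by (intro integrable_cyl_inner[OF w tgm]) auto
  have ui: "integrable (tm T) u" using cyl_fubini(2)[OF im] by (simp add: u_def[abs_def])
  have vi: "integrable (tm T) v" using cyl_fubini(2)[OF iw] by (simp add: v_def[abs_def])
  have "(\<lambda>t. B t) \<in> borel_measurable (tm T)"
  proof -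
    have tb: "(\<lambda>x. x) \<in> measurable (tm T) borel" unfolding tm_def by (intro measurable_restrict_space1) simp
    have f1: "fst \<in> borel_measurable (tm T \<Otimes>\<^sub>M tm T)" and s1: "snd \<in> borel_measurable (tm T \<Otimes>\<^sub>M tm T)"
      by (rule measurable_compose[OF measurable_fst tb] measurable_compose[OF measurable_snd tb])+
    have "(\<lambda>z. (if fst z < snd z then 1 else 0) * (- A (snd z))) \<in> borel_measurable (tm T \<Otimes>\<^sub>M tm T)"
      using f1 s1 Am by measurable
    then have "(\<lambda>(t, s). indicator {t<..} s * (- A s)) \<in> borel_measurable (tm T \<Otimes>\<^sub>M tm T)"
      by (simp add: case_prod_beta indicator_def of_bool_def)
    then have "(\<lambda>t. \<integral>s. indicator {t<..} s * (- A s) \<partial>tm T) \<in> borel_measurable (tm T)"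
      by (rule tm.borel_measurable_lebesgue_integral)
    then show ?thesis by (rule measurable_cong[THEN iffD1, rotated]) (auto simp: B')
  qed
  note Bm = this
  define MB where "MB = (\<integral>s. \<bar>A s\<bar> \<partial>tm T)"
  have Bb: "\<bar>B t\<bar> \<le> MB" if t: "t \<in> {0..T}" for t
  proof -
    have ti: "(indicator {t<..} :: real \<Rightarrow> real) \<in> borel_measurable (tm T)" by (rule measurable_tm) simp
    have "\<bar>B t\<bar> \<le> (\<integral>s. \<bar>indicator {t<..} s * A s\<bar> \<partial>tm T)" unfolding B[OF t] abs_minus by (rule integral_abs_bound)
    also have "\<dots> \<le> MB" unfolding MB_def
      by (intro integral_mono integrable_abs Ai integrable_tm_mult[OF Ai ti, where M = 1]) (auto simp: indicator_def)
    finally show ?thesis .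
  qed
  have i1: "integrable (cyl T) (\<lambda>z. (m z * tmono l (snd z)) * A (fst z))"
    using Ab by (intro integrable_cyl_mult[OF im tm_meas_cyl[OF Am], where M = Ma]) (auto simp: space_cyl)
  have i2: "integrable (cyl T) (\<lambda>z. (w z \<bullet> tgrad l (snd z)) * B (fst z))"
    using Bb by (intro integrable_cyl_mult[OF iw tm_meas_cyl[OF Bm], where M = MB]) (auto simp: space_cyl)
  have e1: "(\<integral>z. (m z * tmono l (snd z)) * A (fst z) \<partial>cyl T) = (\<integral>s. A s * u s \<partial>tm T)"
    unfolding cyl_fubini(3)[OF i1] u_def by (simp add: mult.commute)
  have e2: "(\<integral>z. (w z \<bullet> tgrad l (snd z)) * B (fst z) \<partial>cyl T) = (\<integral>t. v t * B t \<partial>tm T)"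
    unfolding cyl_fubini(3)[OF i2] v_def by simp
  have ae: "AE t in tm T. u t = c + (\<integral>s. indicator {..<t} s * v s \<partial>tm T)"
    using flux_tmono[OF ce T m w] by eventually_elim (simp add: u_def c_def v_def mass_flux_def mult.commute)
  have "(\<integral>s. A s * u s \<partial>tm T) = (\<integral>s. A s * (c + (\<integral>t. indicator {..<s} t * v t \<partial>tm T)) \<partial>tm T)"
    using ae integrable_primitive[OF vi] Am ui by (intro integral_cong_AE) auto
  also have "\<dots> = c * (\<integral>s. A s \<partial>tm T) + (\<integral>s. A s * (\<integral>t. indicator {..<s} t * v t \<partial>tm T) \<partial>tm T)"
    using Ai integrable_tm_mult[OF integrable_primitive[OF vi] Am Ab] by (simp add: distrib_left mult.commute[of _ c])
  finally have e3: "(\<integral>s. A s * u s \<partial>tm T) = c * (\<integral>s. A s \<partial>tm T) + (\<integral>s. A s * (\<integral>t. indicator {..<s} t * v t \<partial>tm T) \<partial>tm T)" .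
  have "(\<integral>t. v t * B t \<partial>tm T) = (\<integral>t. - (v t * (\<integral>s. indicator {t<..} s * A s \<partial>tm T)) \<partial>tm T)"
    by (intro Bochner_Integration.integral_cong) (auto simp: B)
  also have "\<dots> = - (\<integral>s. A s * (\<integral>t. indicator {..<s} t * v t \<partial>tm T) \<partial>tm T)"
    using ibp_tm[OF vi Am Ab] by simp
  finally have e4: "(\<integral>t. v t * B t \<partial>tm T) = - (\<integral>s. A s * (\<integral>t. indicator {..<s} t * v t \<partial>tm T) \<partial>tm T)" .
  have e5: "B 0 = - (\<integral>s. A s \<partial>tm T)"
    using B[of 0] T by (auto intro!: Bochner_Integration.integral_cong simp: indicator_def)
  have i3: "integrable torus (\<lambda>x. tmono l x * m0 x)"
    using m0 tmono_periodic[of l] by (intro integrable_torus_cont continuous_intros tmono_cont) (auto simp: periodic_def)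
  have f: "(\<lambda>z. m z * (A (fst z) * tmono l (snd z))) = (\<lambda>z. (m z * tmono l (snd z)) * A (fst z))"
    "(\<lambda>z. w z \<bullet> (B (fst z) *\<^sub>R tgrad l (snd z))) = (\<lambda>z. (w z \<bullet> tgrad l (snd z)) * B (fst z))"
    "(\<lambda>x. B 0 * tmono l x * m0 x) = (\<lambda>x. B 0 * (tmono l x * m0 x))"
    by (auto simp: fun_eq_iff)
  have i4: "integrable torus (\<lambda>x. B 0 * (tmono l x * m0 x))" by (rule integrable_mult_right[OF i3])
  have e6: "(\<integral>x. B 0 * (tmono l x * m0 x) \<partial>torus) = B 0 * c" by (simp add: c_def)
  show ?thesis
    unfolding balanced_def A_def[symmetric] B_def[symmetric] f e6 e1 e2 e3 e4
    using i1 i2 i4 e5 by simp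
qed

text \<open>
  Uniform approximation of the three entries suffices, since \<open>m\<close>, \<open>w\<close> and \<open>m0\<close> are integrable.
\<close>
lemma balanced_limit:
  fixes m :: "real \<times> (real ^ 'd) \<Rightarrow> real" and w :: "real \<times> (real ^ 'd) \<Rightarrow> real ^ 'd" and c :: "real ^ 'd \<Rightarrow> real"
  assumes m: "integrable (cyl T) m" and w: "integrable (cyl T) w" and m0: "integrable torus m0"
    and am: "a \<in> borel_measurable (cyl T)" "\<And>z. z \<in> space (cyl T) \<Longrightarrow> \<bar>a z\<bar> \<le> Ma"
    and bm: "b \<in> borel_measurable (cyl T)" "\<And>z. z \<in> space (cyl T) \<Longrightarrow> norm (b z) \<le> Mb"
    and cm: "c \<in> borel_measurable torus" "\<And>x. \<bar>c x\<bar> \<le> Mc"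
    and app: "\<And>\<epsilon>. 0 < \<epsilon> \<Longrightarrow> \<exists>\<alpha> \<beta> \<gamma>. balanced T m0 m w \<alpha> \<beta> \<gamma> \<and>
      (\<forall>z\<in>space (cyl T). norm (\<alpha> z - a z) \<le> 2 * \<epsilon> \<and> norm (\<beta> z - b z) \<le> 2 * \<epsilon>) \<and> (\<forall>x. norm (\<gamma> x - c x) \<le> 2 * \<epsilon>)"
  shows "balanced T m0 m w a b c"
proof -
  have I1: "integrable (cyl T) (\<lambda>z. m z * a z)" by (rule integrable_cyl_mult[OF m am])
  have I2: "integrable (cyl T) (\<lambda>z. w z \<bullet> b z)" by (rule integrable_cyl_inner[OF w bm])
  have I3: "integrable torus (\<lambda>x. c x * m0 x)"
  proof (rule Bochner_Integration.integrable_bound[OF integrable_mult_right[OF m0, of Mc]])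
    show "AE x in torus. norm (c x * m0 x) \<le> norm (Mc * m0 x)"
    proof (rule AE_I2)
      fix x :: "real ^ 'd"
      have "\<bar>c x\<bar> * \<bar>m0 x\<bar> \<le> \<bar>Mc\<bar> * \<bar>m0 x\<bar>" using cm(2)[of x] by (intro mult_right_mono) auto
      then show "norm (c x * m0 x) \<le> norm (Mc * m0 x)" by (simp add: abs_mult)
    qed
  qed (use cm m0 in auto)
  define R where "R = (\<integral>z. m z * a z \<partial>cyl T) + (\<integral>z. w z \<bullet> b z \<partial>cyl T) + (\<integral>x. c x * m0 x \<partial>torus)"
  define S where "S = (\<integral>z. norm (m z) \<partial>cyl T) + (\<integral>z. norm (w z) \<partial>cyl T) + (\<integral>x. norm (m0 x) \<partial>torus)"
  have im0: "integrable torus (\<lambda>x. norm (m0 x))" by (intro integrable_norm m0)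
  have bound: "\<bar>R\<bar> \<le> 2 * \<epsilon> * S" if e: "0 < \<epsilon>" for \<epsilon>
  proof -
    obtain \<alpha> \<beta> \<gamma> where bal: "balanced T m0 m w \<alpha> \<beta> \<gamma>"
      and a1: "\<And>z. z \<in> space (cyl T) \<Longrightarrow> norm (\<alpha> z - a z) \<le> 2 * \<epsilon>"
      and b1: "\<And>z. z \<in> space (cyl T) \<Longrightarrow> norm (\<beta> z - b z) \<le> 2 * \<epsilon>"
      and g1: "\<And>x. norm (\<gamma> x - c x) \<le> 2 * \<epsilon>"
      using app[OF e] by blast
    have J1: "integrable (cyl T) (\<lambda>z. m z * \<alpha> z)" and J2: "integrable (cyl T) (\<lambda>z. w z \<bullet> \<beta> z)"
      and J3: "integrable torus (\<lambda>x. \<gamma> x * m0 x)"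
      and J: "(\<integral>z. m z * \<alpha> z \<partial>cyl T) + (\<integral>z. w z \<bullet> \<beta> z \<partial>cyl T) + (\<integral>x. \<gamma> x * m0 x \<partial>torus) = 0"
      using bal unfolding balanced_def by simp_all
    have "R = R - ((\<integral>z. m z * \<alpha> z \<partial>cyl T) + (\<integral>z. w z \<bullet> \<beta> z \<partial>cyl T) + (\<integral>x. \<gamma> x * m0 x \<partial>torus))"
      using J by simp
    also have "\<dots> = (\<integral>z. m z * (a z - \<alpha> z) \<partial>cyl T) + (\<integral>z. w z \<bullet> (b z - \<beta> z) \<partial>cyl T) + (\<integral>x. (c x - \<gamma> x) * m0 x \<partial>torus)"
      unfolding R_def using I1 I2 I3 J1 J2 J3 by (simp add: right_diff_distrib left_diff_distrib inner_diff_right)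
    finally have R: "R = \<dots>" .
    have r1: "\<bar>\<integral>z. m z * (a z - \<alpha> z) \<partial>cyl T\<bar> \<le> 2 * \<epsilon> * (\<integral>z. norm (m z) \<partial>cyl T)"
    proof -
      have "\<bar>\<integral>z. m z * (a z - \<alpha> z) \<partial>cyl T\<bar> \<le> (\<integral>z. \<bar>m z * (a z - \<alpha> z)\<bar> \<partial>cyl T)" by (rule integral_abs_bound)
      also have "\<dots> \<le> (\<integral>z. 2 * \<epsilon> * norm (m z) \<partial>cyl T)"
      proof (rule integral_mono)
        show "integrable (cyl T) (\<lambda>z. \<bar>m z * (a z - \<alpha> z)\<bar>)" using I1 J1 by (simp add: right_diff_distrib)
        show "integrable (cyl T) (\<lambda>z. 2 * \<epsilon> * norm (m z))" using m by simp
        show "\<bar>m z * (a z - \<alpha> z)\<bar> \<le> 2 * \<epsilon> * norm (m z)" if "z \<in> space (cyl T)" for z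
          using mult_left_mono[OF a1[OF that], of "\<bar>m z\<bar>"] by (simp add: abs_mult abs_minus_commute mult.commute)
      qed
      finally show ?thesis by simp
    qed
    have r2: "\<bar>\<integral>z. w z \<bullet> (b z - \<beta> z) \<partial>cyl T\<bar> \<le> 2 * \<epsilon> * (\<integral>z. norm (w z) \<partial>cyl T)"
    proof -
      have "\<bar>\<integral>z. w z \<bullet> (b z - \<beta> z) \<partial>cyl T\<bar> \<le> (\<integral>z. \<bar>w z \<bullet> (b z - \<beta> z)\<bar> \<partial>cyl T)" by (rule integral_abs_bound)
      also have "\<dots> \<le> (\<integral>z. 2 * \<epsilon> * norm (w z) \<partial>cyl T)"
      proof (rule integral_mono)
        show "integrable (cyl T) (\<lambda>z. \<bar>w z \<bullet> (b z - \<beta> z)\<bar>)" using I2 J2 by (simp add: inner_diff_right)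
        show "integrable (cyl T) (\<lambda>z. 2 * \<epsilon> * norm (w z))" using w by simp
        show "\<bar>w z \<bullet> (b z - \<beta> z)\<bar> \<le> 2 * \<epsilon> * norm (w z)" if "z \<in> space (cyl T)" for z
          using mult_left_mono[OF b1[OF that], of "norm (w z)"] Cauchy_Schwarz_ineq2[of "w z" "b z - \<beta> z"]
          by (simp add: norm_minus_commute mult.commute)
      qed
      finally show ?thesis by simp
    qed
    have r3: "\<bar>\<integral>x. (c x - \<gamma> x) * m0 x \<partial>torus\<bar> \<le> 2 * \<epsilon> * (\<integral>x. norm (m0 x) \<partial>torus)"
    proof -
      have "\<bar>\<integral>x. (c x - \<gamma> x) * m0 x \<partial>torus\<bar> \<le> (\<integral>x. \<bar>(c x - \<gamma> x) * m0 x\<bar> \<partial>torus)" by (rule integral_abs_bound)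
      also have "\<dots> \<le> (\<integral>x. 2 * \<epsilon> * norm (m0 x) \<partial>torus)"
      proof (rule integral_mono)
        show "integrable torus (\<lambda>x. \<bar>(c x - \<gamma> x) * m0 x\<bar>)" using I3 J3 by (simp add: left_diff_distrib)
        show "integrable torus (\<lambda>x. 2 * \<epsilon> * norm (m0 x))" using im0 by simp
        show "\<bar>(c x - \<gamma> x) * m0 x\<bar> \<le> 2 * \<epsilon> * norm (m0 x)" for x
          using mult_right_mono[OF g1[of x], of "\<bar>m0 x\<bar>"] by (simp add: abs_mult abs_minus_commute)
      qed
      finally show ?thesis by simp
    qed
    show ?thesis using r1 r2 r3 unfolding R S_def by (simp add: distrib_left)
  qed
  have "R = 0"
  proof (rule ccontr)
    assume "R \<noteq> 0"
    have S: "S \<ge> 0" unfolding S_def by (intro add_nonneg_nonneg integral_nonneg_AE) auto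
    define e where "e = \<bar>R\<bar> / (4 * (S + 1))"
    have "e > 0" using \<open>R \<noteq> 0\<close> S by (simp add: e_def)
    have "2 * e * S = \<bar>R\<bar> / 2 * (S / (S + 1))" using S by (simp add: e_def field_simps)
    also have "\<dots> \<le> \<bar>R\<bar> / 2 * 1" using S by (intro mult_left_mono) auto
    finally show False using bound[OF \<open>e > 0\<close>] \<open>R \<noteq> 0\<close> by simp
  qed
  then show ?thesis using I1 I2 I3 by (simp add: balanced_def R_def)
qed

text \<open>
  Convolving \<open>\<psi>(t)\<close> in space with the finite-rank kernel gives a finite combination of the
  functions in \<open>balanced_term\<close>, and it converges to \<open>\<psi>\<close> uniformly together with both derivatives.
\<close>
lemma cont_eq_C1:
  fixes m \<psi> a :: "real \<times> (real ^ 'd) \<Rightarrow> real"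
  assumes ce: "continuity_equation T m0 m w" and T: "0 < T"
    and m: "integrable (cyl T) m" and w: "integrable (cyl T) w" and m0: "continuous_on UNIV m0" "periodic m0"
    and \<psi>: "C1rep T \<psi> a b" "\<And>x. \<psi> (T, x) = 0"
  shows "balanced T m0 m w a b (\<lambda>x. \<psi> (0, x))"
proof -
  obtain Ma where Ma: "\<And>t x. t \<in> {0..T} \<Longrightarrow> norm (a (t, x)) \<le> Ma"
    using periodic_bounded[OF C1repD(1)[OF \<psi>(1)] C1repD(4)[OF \<psi>(1)]] by blast
  obtain Mb where Mb: "\<And>t x. t \<in> {0..T} \<Longrightarrow> norm (b (t, x)) \<le> Mb"
    using periodic_bounded[OF C1repD(2)[OF \<psi>(1)] C1repD(5)[OF \<psi>(1)]] by blast
  have z0: "0 \<in> {0..T}" using T by simp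
  have c0: "continuous_on UNIV (\<lambda>x. \<psi> (0, x))" by (rule GDERIV_cont[OF C1repD(7)[OF \<psi>(1) z0]])
  have p0: "periodic (\<lambda>x. \<psi> (0, x))" by (rule C1repD(3)[OF \<psi>(1) z0])
  obtain M0 where M0: "\<And>x. norm (\<psi> (0, x)) \<le> M0" using periodic_bounded_space[OF c0 p0] by auto
  have am: "a \<in> borel_measurable (cyl T)" "b \<in> borel_measurable (cyl T)"
    by (rule measurable_cyl_cont C1repD[OF \<psi>(1)])+
  have im0: "integrable torus m0" by (intro integrable_torus_cont m0)
  have app: "\<exists>\<alpha> \<beta> \<gamma>. balanced T m0 m w \<alpha> \<beta> \<gamma> \<and>
      (\<forall>z\<in>space (cyl T). norm (\<alpha> z - a z) \<le> 2 * \<epsilon> \<and> norm (\<beta> z - b z) \<le> 2 * \<epsilon>) \<and> (\<forall>x. norm (\<gamma> x - \<psi> (0, x)) \<le> 2 * \<epsilon>)"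
    if e: "0 < \<epsilon>" for \<epsilon>
  proof -
    obtain d1 where d1: "d1 > 0" "\<And>t s x y. t \<in> {0..T} \<Longrightarrow> s \<in> {0..T} \<Longrightarrow> dist (t, x) (s, y) < d1 \<Longrightarrow> dist (a (t, x)) (a (s, y)) < \<epsilon>"
      using periodic_uniform[OF C1repD(1)[OF \<psi>(1)] C1repD(4)[OF \<psi>(1)] e] by blast
    obtain d2 where d2: "d2 > 0" "\<And>t s x y. t \<in> {0..T} \<Longrightarrow> s \<in> {0..T} \<Longrightarrow> dist (t, x) (s, y) < d2 \<Longrightarrow> dist (b (t, x)) (b (s, y)) < \<epsilon>"
      using periodic_uniform[OF C1repD(2)[OF \<psi>(1)] C1repD(5)[OF \<psi>(1)] e] by blast
    obtain d3 where d3: "d3 > 0" "\<And>x y. dist x y < d3 \<Longrightarrow> dist (\<psi> (0, x)) (\<psi> (0, y)) < \<epsilon>"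
      using periodic_uniform_space[OF c0 p0 e] by blast
    obtain N1 where N1: "\<And>n (g :: real ^ 'd \<Rightarrow> real) x. n \<ge> N1 \<Longrightarrow> continuous_on UNIV g \<Longrightarrow> periodic g \<Longrightarrow> \<forall>y. norm (g y) \<le> Ma \<Longrightarrow>
        \<forall>y z. dist y z < d1 \<longrightarrow> dist (g y) (g z) < \<epsilon> \<Longrightarrow> norm (conv n g x - g x) \<le> 2 * \<epsilon>"
      using kern_approx[OF e d1(1), of Ma] by metis
    obtain N2 where N2: "\<And>n (g :: real ^ 'd \<Rightarrow> real ^ 'd) x. n \<ge> N2 \<Longrightarrow> continuous_on UNIV g \<Longrightarrow> periodic g \<Longrightarrow> \<forall>y. norm (g y) \<le> Mb \<Longrightarrow>
        \<forall>y z. dist y z < d2 \<longrightarrow> dist (g y) (g z) < \<epsilon> \<Longrightarrow> norm (conv n g x - g x) \<le> 2 * \<epsilon>"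
      using kern_approx[OF e d2(1), of Mb] by metis
    obtain N3 where N3: "\<And>n (g :: real ^ 'd \<Rightarrow> real) x. n \<ge> N3 \<Longrightarrow> continuous_on UNIV g \<Longrightarrow> periodic g \<Longrightarrow> \<forall>y. norm (g y) \<le> M0 \<Longrightarrow>
        \<forall>y z. dist y z < d3 \<longrightarrow> dist (g y) (g z) < \<epsilon> \<Longrightarrow> norm (conv n g x - g x) \<le> 2 * \<epsilon>"
      using kern_approx[OF e d3(1), of M0] by metis
    (* One kernel for all three entries; the index is independent of the time slice. *)
    define n where "n = max N1 (max N2 N3)"
    define \<alpha> where "\<alpha> z = conv n (\<lambda>y. a (fst z, y)) (snd z)" for z
    define \<beta> where "\<beta> z = conv n (\<lambda>y. b (fst z, y)) (snd z)" for z
    define \<gamma> where "\<gamma> x = conv n (\<lambda>y. \<psi> (0, y)) x" for x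
    have a1: "norm (\<alpha> z - a z) \<le> 2 * \<epsilon>" if "z \<in> space (cyl T)" for z
    proof -
      have t: "fst z \<in> {0..T}" using that by (auto simp: space_cyl)
      show ?thesis unfolding \<alpha>_def
        using N1[of n "\<lambda>y. a (fst z, y)" "snd z"] Ma[OF t] d1(2)[OF t t] cont_slice[OF C1repD(1)[OF \<psi>(1)] t] C1repD(4)[OF \<psi>(1) t]
        by (auto simp: n_def dist_Pair_Pair)
    qed
    have b1: "norm (\<beta> z - b z) \<le> 2 * \<epsilon>" if "z \<in> space (cyl T)" for z
    proof -
      have t: "fst z \<in> {0..T}" using that by (auto simp: space_cyl)
      show ?thesis unfolding \<beta>_def
        using N2[of n "\<lambda>y. b (fst z, y)" "snd z"] Mb[OF t] d2(2)[OF t t] cont_slice[OF C1repD(2)[OF \<psi>(1)] t] C1repD(5)[OF \<psi>(1) t]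
        by (auto simp: n_def dist_Pair_Pair)
    qed
    have g1: "norm (\<gamma> x - \<psi> (0, x)) \<le> 2 * \<epsilon>" for x
      unfolding \<gamma>_def using N3[of n "\<lambda>y. \<psi> (0, y)" x] M0 d3(2) c0 p0 by (auto simp: n_def)
    define L where "L = (kern_list n :: (real \<times> ('d \<times> bool) list \<times> ('d \<times> bool) list) list)"
    have bal: "balanced T m0 m w
       (\<lambda>z. \<Sum>(c, l, l')\<leftarrow>L. c * ((\<integral>y. tmono l' y * a (fst z, y) \<partial>torus) * tmono l (snd z)))
       (\<lambda>z. \<Sum>(c, l, l')\<leftarrow>L. c *\<^sub>R ((\<integral>y. tmono l' y * \<psi> (fst z, y) \<partial>torus) *\<^sub>R tgrad l (snd z)))
       (\<lambda>x. \<Sum>(c, l, l')\<leftarrow>L. c * ((\<integral>y. tmono l' y * \<psi> (0, y) \<partial>torus) * tmono l x))"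
      using balanced_sum_list[of L T m0 m w "\<lambda>(c, l, l') z. c * ((\<integral>y. tmono l' y * a (fst z, y) \<partial>torus) * tmono l (snd z))"
         "\<lambda>(c, l, l') z. c *\<^sub>R ((\<integral>y. tmono l' y * \<psi> (fst z, y) \<partial>torus) *\<^sub>R tgrad l (snd z))"
         "\<lambda>(c, l, l') x. c * ((\<integral>y. tmono l' y * \<psi> (0, y) \<partial>torus) * tmono l x)"]
        balanced_scale[OF balanced_term[OF ce T m w m0 \<psi>]]
      by (simp add: case_prod_beta')
    have A: "\<alpha> z = (\<Sum>(c, l, l')\<leftarrow>L. c * ((\<integral>y. tmono l' y * a (fst z, y) \<partial>torus) * tmono l (snd z)))" if "z \<in> space (cyl T)" for z
    proof -
      have t: "fst z \<in> {0..T}" using that by (auto simp: space_cyl)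
      show ?thesis unfolding \<alpha>_def L_def
        by (subst conv_alt[OF cont_slice[OF C1repD(1)[OF \<psi>(1)] t] C1repD(4)[OF \<psi>(1) t]]) (simp add: mult.assoc)
    qed
    have B: "\<beta> z = (\<Sum>(c, l, l')\<leftarrow>L. c *\<^sub>R ((\<integral>y. tmono l' y * \<psi> (fst z, y) \<partial>torus) *\<^sub>R tgrad l (snd z)))" if "z \<in> space (cyl T)" for z
    proof -
      have t: "fst z \<in> {0..T}" using that by (auto simp: space_cyl)
      show ?thesis unfolding \<beta>_def L_def
        by (subst conv_grad_alt[OF C1repD(7)[OF \<psi>(1) t] cont_slice[OF C1repD(2)[OF \<psi>(1)] t] C1repD(3)[OF \<psi>(1) t] C1repD(5)[OF \<psi>(1) t]])
           (simp add: mult.assoc)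
    qed
    have G: "\<gamma> x = (\<Sum>(c, l, l')\<leftarrow>L. c * ((\<integral>y. tmono l' y * \<psi> (0, y) \<partial>torus) * tmono l x))" for x
      unfolding \<gamma>_def L_def by (subst conv_alt[OF c0 p0]) (simp add: mult.assoc)
    have "balanced T m0 m w \<alpha> \<beta> \<gamma>"
      using bal A B unfolding balanced_def
      by (simp add: G cong: Bochner_Integration.integrable_cong Bochner_Integration.integral_cong)
    then show ?thesis using a1 b1 g1 by blast
  qed
  show ?thesis
    by (rule balanced_limit[OF m w im0 am(1) _ am(2) _ measurable_torus_cont[OF c0] _ app, where Ma = Ma and Mb = Mb and Mc = M0])
       (use Ma Mb M0 in \<open>auto simp: space_cyl\<close>)
qed

text \<open>
  The same approximation at one fixed time: a formula for \<open>\<integral> e m(t)\<close> that holds for all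
  trigonometric monomials \<open>e\<close> extends to all C1 functions.
\<close>
lemma flux_C1:
  fixes m :: "real \<times> (real ^ 'd) \<Rightarrow> real"
  assumes mi: "integrable torus (\<lambda>x. m (t, x))" and w: "integrable (cyl T) w" and m0: "continuous_on UNIV m0" "periodic m0"
    and fl: "\<And>l. (\<integral>x. tmono l x * m (t, x) \<partial>torus) = mass_flux T m0 w (tmono l) (tgrad l) t"
    and e: "\<And>x. GDERIV e x :> De x" "continuous_on UNIV De" "periodic e"
  shows "(\<integral>x. e x * m (t, x) \<partial>torus) = mass_flux T m0 w e De t"
proof -
  define w' where "w' z = indicator {..<t} (fst z) *\<^sub>R w z" for z
  have ti: "(\<lambda>z :: real \<times> (real ^ 'd). indicator {..<t} (fst z) :: real) \<in> borel_measurable (cyl T)"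
    by (intro tm_meas_cyl measurable_tm) auto
  have w': "integrable (cyl T) w'"
  proof (rule Bochner_Integration.integrable_bound[OF w])
    show "w' \<in> borel_measurable (cyl T)"
      unfolding w'_def by (intro borel_measurable_scaleR ti borel_measurable_integrable[OF w])
  qed (auto simp: w'_def indicator_def)
  define n0 where "n0 x = m0 x - m (t, x)" for x
  have im0: "integrable torus m0" by (intro integrable_torus_cont m0)
  have n0: "integrable torus n0" unfolding n0_def using im0 mi by simp
  have pD: "periodic De" by (rule GDERIV_periodic[OF e(1,3)])
  have ec: "continuous_on UNIV e" by (rule GDERIV_cont[OF e(1)])
  (* The formula at time t is a balance for the flux stopped at t, with initial datum m0 - m(t). *)
  have bal_iff: "(\<integral>x. g x * m (t, x) \<partial>torus) = mass_flux T m0 w g Dg t \<longleftrightarrow> balanced T n0 (\<lambda>z. 0) w' (\<lambda>z. 0) (\<lambda>z. Dg (snd z)) g"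
    if g: "continuous_on UNIV g" "periodic g" "continuous_on UNIV Dg" "periodic Dg" for g Dg
  proof -
    obtain Mg where Mg: "\<And>x. \<bar>g x\<bar> \<le> Mg" using periodic_bounded_space[OF g(1,2)] by auto
    obtain MD where MD: "\<And>x. norm (Dg x) \<le> MD" using periodic_bounded_space[OF g(3,4)] by auto
    have bd: "integrable torus (\<lambda>x. g x * h x)" if h: "integrable torus h" for h
    proof (rule Bochner_Integration.integrable_bound[OF integrable_mult_right[OF h, of Mg]])
      show "AE x in torus. norm (g x * h x) \<le> norm (Mg * h x)"
      proof (rule AE_I2)
        fix x :: "real ^ 'd"
        have "\<bar>g x\<bar> * \<bar>h x\<bar> \<le> \<bar>Mg\<bar> * \<bar>h x\<bar>" using Mg[of x] by (intro mult_right_mono) auto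
        then show "norm (g x * h x) \<le> norm (Mg * h x)" by (simp add: abs_mult)
      qed
    qed (use measurable_torus_cont[OF g(1)] h in auto)
    have iw: "integrable (cyl T) (\<lambda>z. w' z \<bullet> Dg (snd z))"
      using MD by (intro integrable_cyl_inner[OF w' measurable_snd_cyl[OF measurable_torus_cont[OF g(3)]]]) auto
    have "(\<integral>z. w' z \<bullet> Dg (snd z) \<partial>cyl T) = (\<integral>s. indicator {..<t} s * (\<integral>x. w (s, x) \<bullet> Dg x \<partial>torus) \<partial>tm T)"
      unfolding cyl_fubini(3)[OF iw] by (simp add: w'_def)
    moreover have "(\<integral>x. g x * n0 x \<partial>torus) = (\<integral>x. g x * m0 x \<partial>torus) - (\<integral>x. g x * m (t, x) \<partial>torus)"
      unfolding n0_def using bd[OF im0] bd[OF mi] by (simp add: right_diff_distrib)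
    ultimately show ?thesis using iw bd[OF n0] by (auto simp: balanced_def mass_flux_def)
  qed
  obtain Me where Me: "\<And>x. norm (e x) \<le> Me" using periodic_bounded_space[OF ec e(3)] by auto
  obtain MD where MD: "\<And>x. norm (De x) \<le> MD" using periodic_bounded_space[OF e(2) pD] by auto
  have app: "\<exists>\<alpha> \<beta> \<gamma>. balanced T n0 (\<lambda>z. 0) w' \<alpha> \<beta> \<gamma> \<and>
      (\<forall>z\<in>space (cyl T). norm (\<alpha> z - 0) \<le> 2 * \<epsilon> \<and> norm (\<beta> z - De (snd z)) \<le> 2 * \<epsilon>) \<and> (\<forall>x. norm (\<gamma> x - e x) \<le> 2 * \<epsilon>)"
    if ep: "0 < \<epsilon>" for \<epsilon> :: real
  proof -
    obtain d2 where d2: "d2 > 0" "\<And>x y. dist x y < d2 \<Longrightarrow> dist (De x) (De y) < \<epsilon>"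
      using periodic_uniform_space[OF e(2) pD ep] by blast
    obtain d3 where d3: "d3 > 0" "\<And>x y. dist x y < d3 \<Longrightarrow> dist (e x) (e y) < \<epsilon>"
      using periodic_uniform_space[OF ec e(3) ep] by blast
    obtain N2 where N2: "\<And>n x. n \<ge> N2 \<Longrightarrow> norm (conv n De x - De x) \<le> 2 * \<epsilon>"
      using kern_approx[OF ep d2(1), of MD] e(2) pD MD d2(2) by metis
    obtain N3 where N3: "\<And>n x. n \<ge> N3 \<Longrightarrow> norm (conv n e x - e x) \<le> 2 * \<epsilon>"
      using kern_approx[OF ep d3(1), of Me] ec e(3) Me d3(2) by metis
    define n where "n = max N2 N3"
    define L where "L = (kern_list n :: (real \<times> ('d \<times> bool) list \<times> ('d \<times> bool) list) list)"
    have bt: "balanced T n0 (\<lambda>z. 0) w' (\<lambda>z. 0) (\<lambda>z. tgrad l (snd z)) (tmono l)" for l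
      using bal_iff[of "tmono l" "tgrad l"] fl[of l] tmono_cont tmono_periodic tgrad_cont tgrad_periodic by blast
    have bal: "balanced T n0 (\<lambda>z. 0) w' (\<lambda>z. \<Sum>p\<leftarrow>L. 0)
       (\<lambda>z. \<Sum>p\<leftarrow>L. (fst p * (\<integral>y. tmono (snd (snd p)) y * e y \<partial>torus)) *\<^sub>R tgrad (fst (snd p)) (snd z))
       (\<lambda>x. \<Sum>p\<leftarrow>L. fst p * (\<integral>y. tmono (snd (snd p)) y * e y \<partial>torus) * tmono (fst (snd p)) x)"
    proof (rule balanced_sum_list)
      fix p :: "real \<times> ('d \<times> bool) list \<times> ('d \<times> bool) list"
      show "balanced T n0 (\<lambda>z. 0) w' (\<lambda>z. 0)
       (\<lambda>z. (fst p * (\<integral>y. tmono (snd (snd p)) y * e y \<partial>torus)) *\<^sub>R tgrad (fst (snd p)) (snd z))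
       (\<lambda>x. fst p * (\<integral>y. tmono (snd (snd p)) y * e y \<partial>torus) * tmono (fst (snd p)) x)"
        using balanced_scale[OF bt, of "fst p * (\<integral>y. tmono (snd (snd p)) y * e y \<partial>torus)" "fst (snd p)"] by simp
    qed
    have "balanced T n0 (\<lambda>z. 0) w' (\<lambda>z. 0) (\<lambda>z. conv n De (snd z)) (conv n e)"
      using bal unfolding conv_alt[OF ec e(3), abs_def] conv_grad_alt[OF e(1,2,3) pD, abs_def] L_def
      by (simp add: sum_list_triv case_prod_beta')
    then show ?thesis
      using N2[of n] N3[of n] ep
      by (intro exI[of _ "\<lambda>z. 0"] exI[of _ "\<lambda>z. conv n De (snd z)"] exI[of _ "conv n e"]) (auto simp: n_def)
  qed
  have "balanced T n0 (\<lambda>z. 0) w' (\<lambda>z. 0) (\<lambda>z. De (snd z)) e"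
  proof (rule balanced_limit[where Ma = 0 and Mb = MD and Mc = Me])
    show "integrable (cyl T) w'" "integrable torus n0" by (rule w' n0)+
    show "(\<lambda>z. De (snd z)) \<in> borel_measurable (cyl T)" by (rule measurable_snd_cyl[OF measurable_torus_cont[OF e(2)]])
    show "e \<in> borel_measurable torus" by (rule measurable_torus_cont[OF ec])
    show "\<exists>\<alpha> \<beta> \<gamma>. balanced T n0 (\<lambda>z. 0) w' \<alpha> \<beta> \<gamma> \<and>
      (\<forall>z\<in>space (cyl T). norm (\<alpha> z - 0) \<le> 2 * \<epsilon> \<and> norm (\<beta> z - De (snd z)) \<le> 2 * \<epsilon>) \<and> (\<forall>x. norm (\<gamma> x - e x) \<le> 2 * \<epsilon>)"
      if "0 < \<epsilon>" for \<epsilon> by (rule app[OF that])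
  qed (use Me MD in auto)
  then show ?thesis using bal_iff[OF ec e(3) e(2) pD] by blast
qed

section \<open>Narrowly continuous curves and the terminal value\<close>

text \<open>
  Schoenberg's function: continuous, 2-periodic, equal to 0 on \<open>[0, 1/3]\<close> and to 1 on \<open>[2/3, 1]\<close>.
\<close>
definition tri :: "real \<Rightarrow> real" where
  "tri s = max 0 (min 1 (3 * arccos (cos (pi * s)) / pi - 1))"

lemma tri_bounds: "0 \<le> tri s" "tri s \<le> 1"
  by (auto simp: tri_def)

lemma tri_cont: "continuous_on UNIV tri"
  unfolding tri_def by (intro continuous_intros) auto

lemma tri_shift: "tri (2 * of_int n + s) = tri s"
proof -
  have "cos (pi * (2 * of_int n + s)) = cos (pi * s)"
  proof -
    have "pi * (2 * of_int n + s) = 2 * pi * of_int n + pi * s" by (simp add: algebra_simps)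
    then show ?thesis using cos_int_2pin[of n] sin_int_2pin[of n] by (simp only: cos_add)
  qed
  then show ?thesis by (simp add: tri_def)
qed

lemma tri_low: "0 \<le> s \<Longrightarrow> s \<le> 1 / 3 \<Longrightarrow> tri s = 0"
proof -
  assume s: "0 \<le> s" "s \<le> 1 / 3"
  have "arccos (cos (pi * s)) = pi * s" using s by (intro arccos_cos) (auto simp: mult_le_cancel_left1)
  then show ?thesis using s by (simp add: tri_def)
qed

lemma tri_high: "2 / 3 \<le> s \<Longrightarrow> s \<le> 1 \<Longrightarrow> tri s = 1"
proof -
  assume s: "2 / 3 \<le> s" "s \<le> 1"
  have "arccos (cos (pi * s)) = pi * s" using s by (intro arccos_cos) (auto simp: mult_le_cancel_left1)
  then show ?thesis using s by (simp add: tri_def)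
qed

lemma ternary_summable:
  assumes "\<And>j. a j \<in> {0, 1 :: real}" shows "summable (\<lambda>j. 2 * a j / 3 ^ Suc j)"
proof (rule summable_comparison_test')
  show "summable (\<lambda>j. (2 / 3) * (1 / 3 :: real) ^ j)" by (intro summable_mult summable_geometric) simp
  show "norm (2 * a j / 3 ^ Suc j) \<le> 2 / 3 * (1 / 3) ^ j" for j
    using assms[of j] by (auto simp: power_divide)
qed

lemma ternary_bounds:
  assumes a: "\<And>j. a j \<in> {0, 1 :: real}"
  shows "0 \<le> (\<Sum>j. 2 * a j / 3 ^ Suc j)" "(\<Sum>j. 2 * a j / 3 ^ Suc j) \<le> 1"
proof -
  have g: "(\<lambda>j. (2 / 3) * (1 / 3 :: real) ^ j) sums 1"
    using sums_mult[OF geometric_sums[of "1/3 :: real"], of "2/3"] by simp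
  have le: "2 * a j / 3 ^ Suc j \<le> (2 / 3) * (1 / 3) ^ j" "0 \<le> 2 * a j / 3 ^ Suc j" for j
    using a[of j] by (auto simp: power_divide)
  show "0 \<le> (\<Sum>j. 2 * a j / 3 ^ Suc j)" by (rule suminf_nonneg[OF ternary_summable[OF a] le(2)])
  show "(\<Sum>j. 2 * a j / 3 ^ Suc j) \<le> 1"
    using suminf_le[OF le(1) ternary_summable[OF a] sums_summable[OF g]] sums_unique[OF g] by simp
qed

text \<open>
  Multiplication by \<open>3^k\<close> turns the digits before the \<open>k\<close>-th into an even integer, which
  2-periodicity removes; the next digit, 0 or 2, then decides between the two intervals of
  constancy.
\<close>
lemma tri_digit:
  assumes a: "\<And>j. a j \<in> {0, 1 :: real}"
  shows "tri (3 ^ k * (\<Sum>j. 2 * a j / 3 ^ Suc j)) = a k"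
  using a
proof (induction k arbitrary: a)
  case (0 a)
  define S' where "S' = (\<Sum>j. 2 * a (Suc j) / 3 ^ Suc j)"
  have s': "summable (\<lambda>j. 2 * a (Suc j) / 3 ^ Suc j)" using 0 by (intro ternary_summable) auto
  have b: "0 \<le> S'" "S' \<le> 1" unfolding S'_def using 0 by (intro ternary_bounds; auto)+
  have "(\<Sum>j. 2 * a j / 3 ^ Suc j) = 2 * a 0 / 3 + (\<Sum>j. 2 * a (Suc j) / 3 ^ Suc (Suc j))"
    using suminf_split_head[where f = "\<lambda>j. 2 * a j / 3 ^ Suc j", OF ternary_summable[OF 0]] by simp
  also have "(\<Sum>j. 2 * a (Suc j) / 3 ^ Suc (Suc j)) = S' / 3"
    unfolding S'_def using suminf_divide[OF s', of 3] by (simp add: mult.commute)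
  finally have "(\<Sum>j. 2 * a j / 3 ^ Suc j) = 2 * a 0 / 3 + S' / 3" .
  then show ?case using 0[of 0] b tri_low[of "S' / 3"] tri_high[of "2 / 3 + S' / 3"] by auto
next
  case (Suc k a)
  define S' where "S' = (\<Sum>j. 2 * a (Suc j) / 3 ^ Suc j)"
  have s': "summable (\<lambda>j. 2 * a (Suc j) / 3 ^ Suc j)" using Suc by (intro ternary_summable) auto
  have "(\<Sum>j. 2 * a j / 3 ^ Suc j) = 2 * a 0 / 3 + (\<Sum>j. 2 * a (Suc j) / 3 ^ Suc (Suc j))"
    using suminf_split_head[where f = "\<lambda>j. 2 * a j / 3 ^ Suc j", OF ternary_summable[OF Suc.prems]] by simp
  also have "(\<Sum>j. 2 * a (Suc j) / 3 ^ Suc (Suc j)) = S' / 3"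
    unfolding S'_def using suminf_divide[OF s', of 3] by (simp add: mult.commute)
  finally have e: "(\<Sum>j. 2 * a j / 3 ^ Suc j) = 2 * a 0 / 3 + S' / 3" .
  obtain n :: int where n: "3 ^ k * a 0 = of_int n"
    using Suc.prems[of 0] by (metis insertE mult.right_neutral mult_zero_right of_int_0 of_int_numeral of_int_power singletonD)
  have "3 ^ Suc k * (\<Sum>j. 2 * a j / 3 ^ Suc j) = 2 * of_int n + 3 ^ k * S'"
    unfolding e n[symmetric] by (simp add: algebra_simps)
  then show ?case using tri_shift[of n "3 ^ k * S'"] Suc.IH[of "\<lambda>j. a (Suc j)"] Suc.prems by (simp add: S'_def)
qed

definition bdigit :: "nat \<Rightarrow> real \<Rightarrow> real" where
  "bdigit j u = of_int (\<lfloor>2 ^ Suc j * u\<rfloor> - 2 * \<lfloor>2 ^ j * u\<rfloor>)"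

lemma bdigit_01: "bdigit j u \<in> {0, 1}"
proof -
  have "\<lfloor>2 * (2 ^ j * u)\<rfloor> - 2 * \<lfloor>2 ^ j * u\<rfloor> \<in> {0, 1}"
    using floor_correct[of "2 ^ j * u"] floor_correct[of "2 * (2 ^ j * u)"] by simp linarith
  then show ?thesis unfolding bdigit_def by (auto simp: mult.assoc)
qed

lemma bdigit_sums:
  assumes "0 \<le> u" "u < 1" shows "(\<lambda>j. bdigit j u / 2 ^ Suc j) sums u"
proof -
  have ps: "(\<Sum>j<n. bdigit j u / 2 ^ Suc j) = of_int \<lfloor>2 ^ n * u\<rfloor> / 2 ^ n" for n
  proof (induction n)
    case 0
    have "\<lfloor>u\<rfloor> = 0" using assms by linarith
    then show ?case by simp
  next
    case (Suc n)
    then show ?case by (simp add: bdigit_def field_simps)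
  qed
  have "(\<lambda>n. of_int \<lfloor>2 ^ n * u\<rfloor> / 2 ^ n) \<longlonglongrightarrow> u"
  proof (rule tendsto_sandwich[of "\<lambda>n. u - (1 / 2) ^ n" _ _ "\<lambda>n. u"])
    have "of_int \<lfloor>2 ^ n * u\<rfloor> / 2 ^ n \<ge> u - (1 / 2) ^ n" for n
    proof -
      have "2 ^ n * u - 1 \<le> of_int \<lfloor>2 ^ n * u\<rfloor>" by linarith
      then have "(2 ^ n * u - 1) / 2 ^ n \<le> of_int \<lfloor>2 ^ n * u\<rfloor> / 2 ^ n" by (intro divide_right_mono) auto
      then show ?thesis by (simp add: diff_divide_distrib power_divide)
    qed
    then show "\<forall>\<^sub>F n in sequentially. u - (1 / 2) ^ n \<le> of_int \<lfloor>2 ^ n * u\<rfloor> / 2 ^ n" by simp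
    have "of_int \<lfloor>2 ^ n * u\<rfloor> / 2 ^ n \<le> u" for n
      by (simp add: divide_le_eq mult.commute)
    then show "\<forall>\<^sub>F n in sequentially. of_int \<lfloor>2 ^ n * u\<rfloor> / 2 ^ n \<le> u" by simp
    have "(\<lambda>n. u - (1 / 2 :: real) ^ n) \<longlonglongrightarrow> u - 0" by (intro tendsto_intros LIMSEQ_power_zero) simp
    then show "(\<lambda>n. u - (1 / 2 :: real) ^ n) \<longlonglongrightarrow> u" by simp
  qed auto
  then show ?thesis unfolding sums_def ps .
qed

text \<open>
  An enumeration of the pairs of a coordinate and the position of a binary digit.
\<close>
definition cidx :: "'d::finite \<times> nat \<Rightarrow> nat" where
  "cidx = to_nat_on UNIV"

lemma cidx_inj: "inj (cidx :: 'd::finite \<times> nat \<Rightarrow> nat)"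
proof -
  have "countable (UNIV :: ('d \<times> nat) set)"
    using countable_SIGMA[of "UNIV :: 'd set" "\<lambda>_. UNIV :: nat set"] by (simp add: countable_finite)
  then show ?thesis unfolding cidx_def by (rule inj_on_to_nat_on)
qed

text \<open>
  Indices that enumerate no pair carry the digit 0.
\<close>
definition code_digit :: "real ^ 'd \<Rightarrow> nat \<Rightarrow> real" where
  "code_digit x k = (if k \<in> range (cidx :: 'd \<times> nat \<Rightarrow> nat)
     then bdigit (snd (inv (cidx :: 'd \<times> nat \<Rightarrow> nat) k)) (x $ fst (inv (cidx :: 'd \<times> nat \<Rightarrow> nat) k)) else 0)"

text \<open>
  The point of the Cantor set whose ternary digits record the binary digits of all coordinates
  of \<open>x\<close>: a Borel right inverse, on the cell, of the continuous curve defined next.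
\<close>
definition code_point :: "real ^ 'd \<Rightarrow> real" where
  "code_point x = (\<Sum>k. 2 * code_digit x k / 3 ^ Suc k)"

text \<open>
  Schoenberg's space-filling curve.
\<close>
definition space_curve :: "real \<Rightarrow> real ^ 'd" where
  "space_curve s = (\<chi> i. \<Sum>j. tri (3 ^ cidx (i, j) * s) / 2 ^ Suc j)"

lemma code_digit_01: "code_digit x k \<in> {0, 1}"
  unfolding code_digit_def using bdigit_01 by auto

lemma space_curve_code: assumes x: "x \<in> cell" shows "space_curve (code_point x) = x"
proof -
  have "tri (3 ^ cidx (i, j) * code_point x) = bdigit j (x $ i)" for i j
    unfolding code_point_def tri_digit[OF code_digit_01] by (simp add: code_digit_def inv_f_f[OF cidx_inj])
  moreover have "(\<Sum>j. bdigit j (x $ i) / 2 ^ Suc j) = x $ i" for i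
    using x by (intro sums_unique[symmetric] bdigit_sums) (auto simp: cell_def)
  ultimately show ?thesis by (simp add: space_curve_def vec_eq_iff del: power_Suc)
qed

lemma space_curve_cont: "continuous_on UNIV (space_curve :: real \<Rightarrow> real ^ 'd)"
  unfolding space_curve_def
proof (rule continuous_on_vec_lambda)
  fix i :: 'd
  have "uniform_limit UNIV (\<lambda>n s. \<Sum>j<n. tri (3 ^ cidx (i, j) * s) / 2 ^ Suc j) (\<lambda>s. \<Sum>j. tri (3 ^ cidx (i, j) * s) / 2 ^ Suc j) sequentially"
  proof (rule Weierstrass_m_test)
    show "norm (tri (3 ^ cidx (i, j) * s) / 2 ^ Suc j) \<le> (1 / 2) ^ Suc j" for j s
      using tri_bounds[of "3 ^ cidx (i, j) * s"] by (simp add: power_divide divide_right_mono)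
    show "summable (\<lambda>j. (1 / 2 :: real) ^ Suc j)" by (simp add: summable_mult summable_geometric)
  qed
  moreover have "continuous_on UNIV (\<lambda>s. \<Sum>j<n. tri (3 ^ cidx (i, j) * s) / 2 ^ Suc j)" for n
    by (intro continuous_intros continuous_on_compose2[OF tri_cont]) auto
  ultimately show "continuous_on UNIV (\<lambda>s. \<Sum>j. tri (3 ^ cidx (i, j) * s) / 2 ^ Suc j)"
    by (intro uniform_limit_theorem[where F = sequentially]) auto
qed

lemma code_point_borel: "(code_point :: real ^ 'd \<Rightarrow> real) \<in> borel_measurable borel"
proof -
  have "(\<lambda>x :: real ^ 'd. bdigit j (x $ i)) \<in> borel_measurable borel" for i j
    unfolding bdigit_def by measurable
  then have "(\<lambda>x :: real ^ 'd. code_digit x k) \<in> borel_measurable borel" for k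
    unfolding code_digit_def by (cases "k \<in> range (cidx :: 'd \<times> nat \<Rightarrow> nat)") auto
  then show ?thesis unfolding code_point_def by measurable
qed

lemma code_point_bounds: "0 \<le> code_point x" "code_point x \<le> 1"
  unfolding code_point_def using ternary_bounds[OF code_digit_01] by auto

text \<open>
  Weak compactness of the probability measures on the torus, reduced to Helly's theorem on the
  line: transport the measures to \<open>[0, 1]\<close> by the Borel code, extract a weakly convergent
  subsequence there, and transport back along the curve.  Composition with the curve keeps test
  functions continuous, so the limits are inherited even though the code itself is not continuous.
\<close>
lemma torus_prob_compact:
  fixes \<mu> :: "nat \<Rightarrow> (real ^ 'd) measure"
  assumes p: "\<And>n. prob_space (\<mu> n)" and s: "\<And>n. sets (\<mu> n) = sets (restrict_space borel cell)"
  shows "\<exists>\<rho> r. strict_mono (r :: nat \<Rightarrow> nat) \<and> prob_space \<rho> \<and> sets \<rho> = sets (restrict_space borel (cell :: (real ^ 'd) set)) \<and>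
    (\<forall>\<psi> :: real ^ 'd \<Rightarrow> real. continuous_on UNIV \<psi> \<longrightarrow> periodic \<psi> \<longrightarrow> (\<lambda>n. \<integral>x. \<psi> x \<partial>\<mu> (r n)) \<longlonglongrightarrow> (\<integral>x. \<psi> x \<partial>\<rho>))"
proof -
  have spc: "space (\<mu> n) = cell" for n using sets_eq_imp_space_eq[OF s[of n]] by (simp add: space_restrict_space)
  have cm: "code_point \<in> measurable (\<mu> n) borel" for n
    unfolding measurable_cong_sets[OF s refl] by (intro measurable_restrict_space1 code_point_borel)
  define \<nu> where "\<nu> n = distr (\<mu> n) borel code_point" for n
  have rd: "real_distribution (\<nu> n)" for n
  proof -
    interpret prob_space "\<mu> n" by (rule p)
    interpret d: prob_space "\<nu> n" unfolding \<nu>_def by (rule prob_space_distr[OF cm])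
    show ?thesis by unfold_locales (simp_all add: \<nu>_def)
  qed
  have one: "measure (\<nu> n) {-1<..2} = 1" for n
  proof -
    interpret prob_space "\<mu> n" by (rule p)
    have cb: "- 1 < code_point x" "code_point x \<le> 2" for x :: "real ^ 'd"
      using code_point_bounds[of x] by linarith+
    have "measure (\<nu> n) {-1<..2} = measure (\<mu> n) (code_point -` {-1<..2} \<inter> space (\<mu> n))"
      unfolding \<nu>_def by (rule measure_distr[OF cm]) simp
    also have "code_point -` {-1<..2} \<inter> space (\<mu> n) = space (\<mu> n)"
      using cb by auto
    finally show ?thesis by (simp add: prob_space)
  qed
  (* All measures live on [0, 1], so tightness is automatic. *)
  have "tight \<nu>" unfolding tight_def using rd one
    by (intro conjI allI impI exI[of _ "-1"] exI[of _ 2]) auto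
  from tight_imp_convergent_subsubsequence[OF this strict_mono_id]
  obtain r M where r: "strict_mono (r :: nat \<Rightarrow> nat)" and M: "real_distribution M" and wc: "weak_conv_m (\<nu> \<circ> r) M"
    by auto
  interpret M: real_distribution M by (rule M)
  have scb: "(space_curve :: real \<Rightarrow> real ^ 'd) \<in> borel_measurable borel"
    by (rule borel_measurable_continuous_onI[OF space_curve_cont])
  have fm: "(\<lambda>s. tfrac (space_curve s :: real ^ 'd)) \<in> measurable M (restrict_space borel cell)"
    using scb by (intro measurable_restrict_space2) (auto simp: tfrac_cell)
  define \<rho> where "\<rho> = distr M (restrict_space borel cell) (\<lambda>s. tfrac (space_curve s :: real ^ 'd))"
  show ?thesis
  proof (intro exI[of _ \<rho>] exI[of _ r] conjI allI impI)
    show "strict_mono r" by (rule r)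
    show "prob_space \<rho>" unfolding \<rho>_def by (rule M.prob_space_distr[OF fm])
    show "sets \<rho> = sets (restrict_space borel cell)" by (simp add: \<rho>_def)
    fix \<psi> :: "real ^ 'd \<Rightarrow> real" assume psi: "continuous_on UNIV \<psi>" "periodic \<psi>"
    have pb: "\<psi> \<in> borel_measurable borel" by (rule borel_measurable_continuous_onI[OF psi(1)])
    have pc: "continuous_on UNIV (\<lambda>s. \<psi> (space_curve s))"
      by (rule continuous_on_compose2[OF psi(1) space_curve_cont]) simp
    obtain B where B: "\<And>x. norm (\<psi> x) \<le> B" using periodic_bounded_space[OF psi] by auto
    have "(\<lambda>n. \<integral>x. \<psi> (space_curve x) \<partial>(\<nu> \<circ> r) n) \<longlonglongrightarrow> (\<integral>x. \<psi> (space_curve x) \<partial>M)"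
    proof (rule weak_conv_imp_integral_bdd_continuous_conv[OF _ M wc])
      show "real_distribution ((\<nu> \<circ> r) n)" for n using rd by simp
      show "isCont (\<lambda>x. \<psi> (space_curve x)) x" for x using pc by (simp add: continuous_on_eq_continuous_at)
      show "norm (\<psi> (space_curve x)) \<le> B" for x by (rule B)
    qed
    moreover have "(\<integral>x. \<psi> (space_curve x) \<partial>(\<nu> \<circ> r) n) = (\<integral>x. \<psi> x \<partial>\<mu> (r n))" for n
    proof -
      have "(\<integral>x. \<psi> (space_curve x) \<partial>(\<nu> \<circ> r) n) = (\<integral>x. \<psi> (space_curve (code_point x)) \<partial>\<mu> (r n))"
        unfolding \<nu>_def o_def using pb scb by (subst integral_distr[OF cm]) auto
      also have "\<dots> = (\<integral>x. \<psi> x \<partial>\<mu> (r n))"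
        by (intro Bochner_Integration.integral_cong) (auto simp: spc space_curve_code)
      finally show ?thesis .
    qed
    moreover have "(\<integral>x. \<psi> (space_curve x) \<partial>M) = (\<integral>x. \<psi> x \<partial>\<rho>)"
    proof -
      have "(\<integral>x. \<psi> x \<partial>\<rho>) = (\<integral>x. \<psi> (tfrac (space_curve x)) \<partial>M)"
        unfolding \<rho>_def by (rule integral_distr[OF fm]) (intro measurable_restrict_space1 pb)
      then show ?thesis by (simp add: periodic_tfrac[OF psi(2)])
    qed
    ultimately show "(\<lambda>n. \<integral>x. \<psi> x \<partial>\<mu> (r n)) \<longlonglongrightarrow> (\<integral>x. \<psi> x \<partial>\<rho>)" by simp
  qed
qed

lemma AE_tm_dense:
  assumes ae: "AE t in tm T. P t" and t: "t \<in> {0..T}" and T: "0 < T"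
  shows "\<exists>s. (\<forall>n :: nat. P (s n) \<and> s n \<in> {0<..<T}) \<and> s \<longlonglongrightarrow> t"
proof -
  have ex: "\<exists>u. P u \<and> u \<in> {0<..<T} \<and> \<bar>u - t\<bar> < e" if e: "0 < e" for e
  proof (rule ccontr)
    assume neg: "\<not> ?thesis"
    define a b where "a = max 0 (t - e)" and "b = min T (t + e)"
    have ab: "a < b" "0 \<le> a" "b \<le> T" using t T e by (auto simp: a_def b_def)
    have "AE u in tm T. u \<notin> {a<..<b}"
      using ae AE_space
    proof eventually_elim
      case (elim u)
      show ?case
      proof
        assume "u \<in> {a<..<b}"
        then have "\<bar>u - t\<bar> < e" by (auto simp: a_def b_def abs_less_iff)
        with neg elim show False by auto
      qed
    qed
    then have "AE u in lborel. u \<in> {0<..<T} \<longrightarrow> u \<notin> {a<..<b}"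
      unfolding tm_def by (subst (asm) AE_restrict_space_iff) auto
    then have "AE u in lborel. u \<notin> {a<..<b}" by eventually_elim (use ab in auto)
    then have "emeasure lborel {a<..<b} = 0" by (subst (asm) AE_iff_measurable[of "{a<..<b}"]) (auto simp: greaterThanLessThan_def)
    then show False using ab by (simp add: emeasure_lborel_Ioo)
  qed
  have "\<forall>n. \<exists>u. P u \<and> u \<in> {0<..<T} \<and> \<bar>u - t\<bar> < 1 / real (Suc n)" using ex by simp
  then obtain s where s: "\<And>n. P (s n)" "\<And>n. s n \<in> {0<..<T}" "\<And>n. \<bar>s n - t\<bar> < 1 / real (Suc n)"
    by metis
  have "(\<lambda>n. s n - t) \<longlonglongrightarrow> 0"
  proof (rule Lim_null_comparison[of _ "\<lambda>n. 1 / real (Suc n)"])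
    show "\<forall>\<^sub>F n in sequentially. norm (s n - t) \<le> 1 / real (Suc n)" using s(3) by (simp add: less_imp_le)
    show "(\<lambda>n. 1 / real (Suc n)) \<longlonglongrightarrow> 0" using LIMSEQ_inverse_real_of_nat by (simp add: divide_inverse)
  qed
  then show ?thesis using s by (intro exI[of _ s]) (auto simp: LIM_zero_iff)
qed

lemma mass_flux_cont:
  fixes w :: "real \<times> (real ^ 'd) \<Rightarrow> real ^ 'd"
  assumes w: "integrable (cyl T) w" and De: "continuous_on UNIV De" "periodic De"
  shows "continuous_on S (mass_flux T m0 w e De)"
proof -
  obtain MD where MD: "\<And>x. norm (De x) \<le> MD" using periodic_bounded_space[OF De] by auto
  have iw: "integrable (cyl T) (\<lambda>z. w z \<bullet> De (snd z))"
    using MD by (intro integrable_cyl_inner[OF w measurable_snd_cyl[OF measurable_torus_cont[OF De(1)]]]) auto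
  define v where "v t = (\<integral>x. w (t, x) \<bullet> De x \<partial>torus)" for t
  have vi: "integrable (tm T) v" using cyl_fubini(2)[OF iw] by (simp add: v_def[abs_def])
  have "continuous_on S (\<lambda>t. \<integral>s. indicator {..<t} s * v s \<partial>tm T)"
  proof (rule continuous_on_sequentiallyI)
    fix u a assume u: "\<forall>n. u n \<in> S" "a \<in> S" "u \<longlonglongrightarrow> a"
    show "(\<lambda>n. \<integral>s. indicator {..<u n} s * v s \<partial>tm T) \<longlonglongrightarrow> (\<integral>s. indicator {..<a} s * v s \<partial>tm T)"
    proof (rule integral_dominated_convergence[where w = "\<lambda>s. \<bar>v s\<bar>"])
      have ti: "(indicator {..<t} :: real \<Rightarrow> real) \<in> borel_measurable (tm T)" for t by (rule measurable_tm) simp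
      show "(\<lambda>s. indicator {..<a} s * v s) \<in> borel_measurable (tm T)" "\<And>n. (\<lambda>s. indicator {..<u n} s * v s) \<in> borel_measurable (tm T)"
        by (intro borel_measurable_times ti borel_measurable_integrable[OF vi])+
      show "integrable (tm T) (\<lambda>s. \<bar>v s\<bar>)" using vi by simp
      show "AE s in tm T. norm (indicator {..<u n} s * v s) \<le> \<bar>v s\<bar>" for n by (intro AE_I2) (auto simp: indicator_def)
      have "AE s in tm T. s \<noteq> a" unfolding tm_def using AE_lborel_singleton[of a] by (subst AE_restrict_space_iff) auto
      then show "AE s in tm T. (\<lambda>n. indicator {..<u n} s * v s) \<longlonglongrightarrow> indicator {..<a} s * v s"
      proof eventually_elim
        case (elim s)
        have "\<forall>\<^sub>F n in sequentially. indicator {..<u n} s = (indicator {..<a} s :: real)"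
        proof (cases "s < a")
          case True
          show ?thesis using order_tendstoD(1)[OF u(3) True] by eventually_elim (use True in auto)
        next
          case False
          then have "a < s" using elim by simp
          from order_tendstoD(2)[OF u(3) this] show ?thesis by eventually_elim (use False in auto)
        qed
        then have "(\<lambda>n. indicator {..<u n} s :: real) \<longlonglongrightarrow> indicator {..<a} s" by (rule tendsto_eventually)
        then show ?case by (intro tendsto_intros)
      qed
    qed
  qed
  then show ?thesis unfolding mass_flux_def v_def by (intro continuous_intros)
qed

lemma torus_meas_cont:
  fixes \<psi> :: "real ^ 'd \<Rightarrow> real"
  assumes p: "prob_space \<mu>" and s: "sets \<mu> = sets (restrict_space borel (cell :: (real ^ 'd) set))"
    and psi: "continuous_on UNIV \<psi>" "periodic \<psi>"
  shows "integrable \<mu> \<psi>"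
proof -
  interpret prob_space \<mu> by (rule p)
  obtain B where B: "\<And>x. norm (\<psi> x) \<le> B" using periodic_bounded_space[OF psi] by auto
  have "\<psi> \<in> borel_measurable \<mu>"
    unfolding measurable_cong_sets[OF s refl] by (intro measurable_restrict_space1 borel_measurable_continuous_onI psi)
  then show ?thesis using B by (intro integrable_const_bound[where B = B]) auto
qed

lemma integral_conv:
  fixes \<psi> :: "real ^ 'd \<Rightarrow> real"
  assumes p: "prob_space \<mu>" and s: "sets \<mu> = sets (restrict_space borel (cell :: (real ^ 'd) set))"
    and psi: "continuous_on UNIV \<psi>" "periodic \<psi>"
  shows "(\<integral>x. conv n \<psi> x \<partial>\<mu>) = (\<Sum>(c, l, l')\<leftarrow>kern_list n. c * (\<integral>y. tmono l' y * \<psi> y \<partial>torus) * (\<integral>x. tmono l x \<partial>\<mu>))"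
    "integrable \<mu> (conv n \<psi>)"
proof -
  have it: "integrable \<mu> (\<lambda>x. tmono l x)" for l by (rule torus_meas_cont[OF p s tmono_cont tmono_periodic])
  have "integrable \<mu> (\<lambda>x. \<Sum>(c, l, l')\<leftarrow>L. c * (\<integral>y. tmono l' y * \<psi> y \<partial>torus) * tmono l x) \<and>
     (\<integral>x. (\<Sum>(c, l, l')\<leftarrow>L. c * (\<integral>y. tmono l' y * \<psi> y \<partial>torus) * tmono l x) \<partial>\<mu>) =
     (\<Sum>(c, l, l')\<leftarrow>L. c * (\<integral>y. tmono l' y * \<psi> y \<partial>torus) * (\<integral>x. tmono l x \<partial>\<mu>))" for L
    by (induction L) (auto simp: it)
  then show "(\<integral>x. conv n \<psi> x \<partial>\<mu>) = (\<Sum>(c, l, l')\<leftarrow>kern_list n. c * (\<integral>y. tmono l' y * \<psi> y \<partial>torus) * (\<integral>x. tmono l x \<partial>\<mu>))"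
    "integrable \<mu> (conv n \<psi>)"
    unfolding conv_alt[OF psi, abs_def] by auto
qed

lemma density_slice:
  fixes m :: "real \<times> (real ^ 'd) \<Rightarrow> real"
  assumes i: "integrable torus (\<lambda>x. m (t, x))" and n: "AE x in torus. 0 \<le> m (t, x)" and one: "(\<integral>x. m (t, x) \<partial>torus) = 1"
  shows "prob_space (density torus (\<lambda>x. ennreal (m (t, x))))"
    and "continuous_on UNIV e \<Longrightarrow> (\<integral>x. e x \<partial>density torus (\<lambda>x. ennreal (m (t, x)))) = (\<integral>x. e x * m (t, x) \<partial>torus)"
proof -
  have mm: "(\<lambda>x. m (t, x)) \<in> borel_measurable torus" using i by auto
  show "prob_space (density torus (\<lambda>x. ennreal (m (t, x))))"
  proof
    have "emeasure (density torus (\<lambda>x. ennreal (m (t, x)))) cell = (\<integral>\<^sup>+x. ennreal (m (t, x)) \<partial>torus)"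
      using mm sets.top[of "torus :: (real ^ 'd) measure"]
      by (subst emeasure_density) (auto intro!: nn_integral_cong)
    also have "\<dots> = 1" using nn_integral_eq_integral[OF i n] one by simp
    finally show "emeasure (density torus (\<lambda>x. ennreal (m (t, x)))) (space (density torus (\<lambda>x. ennreal (m (t, x))))) = 1" by simp
  qed
  show "(\<integral>x. e x \<partial>density torus (\<lambda>x. ennreal (m (t, x)))) = (\<integral>x. e x * m (t, x) \<partial>torus)" if "continuous_on UNIV e"
    using integral_density[OF measurable_torus_cont[OF that] mm n] by (simp add: mult.commute)
qed

lemma good_times:
  fixes m :: "real \<times> (real ^ 'd) \<Rightarrow> real"
  assumes T: "0 < T" and mw: "(m, w) \<in> K1 T m0"
  shows "AE t in tm T. integrable torus (\<lambda>x. m (t, x)) \<and> (AE x in torus. 0 \<le> m (t, x)) \<and> (\<integral>x. m (t, x) \<partial>torus) = 1 \<and>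
    (\<forall>l. (\<integral>x. tmono l x * m (t, x) \<partial>torus) = mass_flux T m0 w (tmono l) (tgrad l) t)"
proof -
  have m: "integrable (cyl T) m" and w: "integrable (cyl T) w" and nn: "AE z in cyl T. 0 \<le> m z"
    and one: "AE t in tm T. (\<integral>x. m (t, x) \<partial>torus) = 1" and ce: "continuity_equation T m0 m w"
    using mw unfolding K1_def tm_def by auto
  have nn': "AE t in tm T. AE x in torus. 0 \<le> m (t, x)"
    using nn unfolding cyl_eq[symmetric] by (rule tmtorus.AE_pair)
  show ?thesis
    using cyl_fubini(1)[OF m] nn' one flux_tmono[OF ce T m w] by eventually_elim auto
qed

text \<open>
  At good times the measure is given by the slice of \<open>m\<close>.  At the remaining times take a weak
  limit of measures at good times.  In both cases the trigonometric moments are the values of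
  \<open>mass_flux\<close>, which is continuous in time; uniform approximation by trigonometric polynomials
  transfers continuity to all test functions.
\<close>
lemma narrow_curve_exists:
  fixes m :: "real \<times> (real ^ 'd) \<Rightarrow> real"
  assumes T: "0 < T" and mw: "(m, w) \<in> K1 T m0"
  shows "\<exists>\<mu>. narrow_curve T m \<mu>"
proof -
  have m: "integrable (cyl T) m" and w: "integrable (cyl T) w" using mw by (auto simp: K1_def)
  define good where "good t \<longleftrightarrow> integrable torus (\<lambda>x. m (t, x)) \<and> (AE x in torus. 0 \<le> m (t, x)) \<and> (\<integral>x. m (t, x) \<partial>torus) = 1 \<and>
    (\<forall>l. (\<integral>x. tmono l x * m (t, x) \<partial>torus) = mass_flux T m0 w (tmono l) (tgrad l) t)" for t
  have gAE: "AE t in tm T. good t" using good_times[OF T mw] by (simp add: good_def)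
  define dn where "dn t = density torus (\<lambda>x. ennreal (m (t, x)))" for t
  have gd: "prob_space (dn t)" "sets (dn t) = sets (restrict_space borel (cell :: (real ^ 'd) set))"
    "(\<integral>x. tmono l x \<partial>dn t) = mass_flux T m0 w (tmono l) (tgrad l) t" if "good t" for t l
    using that density_slice[of m t] tmono_cont[of l] by (auto simp: good_def dn_def sets_torus)
  have "\<exists>\<rho>. prob_space \<rho> \<and> sets \<rho> = sets (restrict_space borel (cell :: (real ^ 'd) set)) \<and>
     (\<forall>l. (\<integral>x. tmono l x \<partial>\<rho>) = mass_flux T m0 w (tmono l) (tgrad l) t) \<and> (good t \<longrightarrow> \<rho> = dn t)" if t: "t \<in> {0..T}" for t
  proof (cases "good t")
    case True then show ?thesis using gd[OF True] by blast
  next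
    case False
    obtain s where s: "\<And>n. good (s n)" "s \<longlonglongrightarrow> t" using AE_tm_dense[OF gAE t T] by auto
    obtain \<rho> r where r: "strict_mono (r :: nat \<Rightarrow> nat)" and rho: "prob_space \<rho>" "sets \<rho> = sets (restrict_space borel (cell :: (real ^ 'd) set))"
      and cv: "\<And>\<psi> :: real ^ 'd \<Rightarrow> real. continuous_on UNIV \<psi> \<Longrightarrow> periodic \<psi> \<Longrightarrow> (\<lambda>n. \<integral>x. \<psi> x \<partial>dn (s (r n))) \<longlonglongrightarrow> (\<integral>x. \<psi> x \<partial>\<rho>)"
      using torus_prob_compact[of "\<lambda>n. dn (s n)"] gd(1,2)[OF s(1)] by blast
    have "(\<integral>x. tmono l x \<partial>\<rho>) = mass_flux T m0 w (tmono l) (tgrad l) t" for l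
    proof (rule LIMSEQ_unique)
      show "(\<lambda>n. \<integral>x. tmono l x \<partial>dn (s (r n))) \<longlonglongrightarrow> (\<integral>x. tmono l x \<partial>\<rho>)" by (rule cv[OF tmono_cont tmono_periodic])
      have "continuous_on UNIV (mass_flux T m0 w (tmono l) (tgrad l))" by (rule mass_flux_cont[OF w tgrad_cont tgrad_periodic])
      then have "isCont (mass_flux T m0 w (tmono l) (tgrad l)) t" by (simp add: continuous_on_eq_continuous_at)
      from isCont_tendsto_compose[OF this LIMSEQ_subseq_LIMSEQ[OF s(2) r]]
      show "(\<lambda>n. \<integral>x. tmono l x \<partial>dn (s (r n))) \<longlonglongrightarrow> mass_flux T m0 w (tmono l) (tgrad l) t"
        by (simp add: gd(3)[OF s(1)])
    qed
    with rho False show ?thesis by blast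
  qed
  then obtain \<mu> where mu: "\<And>t. t \<in> {0..T} \<Longrightarrow> prob_space (\<mu> t)" "\<And>t. t \<in> {0..T} \<Longrightarrow> sets (\<mu> t) = sets (restrict_space borel (cell :: (real ^ 'd) set))"
     "\<And>t l. t \<in> {0..T} \<Longrightarrow> (\<integral>x. tmono l x \<partial>\<mu> t) = mass_flux T m0 w (tmono l) (tgrad l) t" "\<And>t. t \<in> {0..T} \<Longrightarrow> good t \<Longrightarrow> \<mu> t = dn t"
    by metis
  have "narrow_curve T m \<mu>" unfolding narrow_curve_def
  proof (intro conjI ballI allI impI)
    show "prob_space (\<mu> t)" "sets (\<mu> t) = sets (restrict_space borel cell)" if "t \<in> {0..T}" for t using mu that by auto
    have "AE t in tm T. \<mu> t = dn t" using gAE AE_space by eventually_elim (auto intro!: mu(4))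
    then show "AE t in restrict_space lborel {0<..<T}. \<mu> t = density torus (\<lambda>x. ennreal (m (t, x)))" unfolding tm_def dn_def .
    fix \<psi> :: "real ^ 'd \<Rightarrow> real" assume "continuous_on UNIV \<psi> \<and> periodic \<psi>"
    then have psi: "continuous_on UNIV \<psi>" "periodic \<psi>" by auto
    obtain B where B: "\<And>x. norm (\<psi> x) \<le> B" using periodic_bounded_space[OF psi] by auto
    have "uniform_limit {0..T} (\<lambda>n t. \<integral>x. conv n \<psi> x \<partial>\<mu> t) (\<lambda>t. \<integral>x. \<psi> x \<partial>\<mu> t) sequentially"
    proof (rule uniform_limitI)
      fix e :: real assume e: "0 < e"
      then have e4: "0 < e / 4" by simp
      obtain d where d: "d > 0" "\<And>x y. dist x y < d \<Longrightarrow> dist (\<psi> x) (\<psi> y) < e / 4"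
        using periodic_uniform_space[OF psi e4] by blast
      obtain N where N: "\<And>n x. n \<ge> N \<Longrightarrow> norm (conv n \<psi> x - \<psi> x) \<le> 2 * (e / 4)"
        using kern_approx[OF e4 d(1), of B] psi B d(2) by metis
      show "\<forall>\<^sub>F n in sequentially. \<forall>t\<in>{0..T}. dist (\<integral>x. conv n \<psi> x \<partial>\<mu> t) (\<integral>x. \<psi> x \<partial>\<mu> t) < e"
        unfolding eventually_sequentially
      proof (intro exI[of _ N] allI impI ballI)
        fix n t assume n: "N \<le> n" and t: "t \<in> {0..T}"
        interpret prob_space "\<mu> t" by (rule mu(1)[OF t])
        have i: "integrable (\<mu> t) (conv n \<psi>)" "integrable (\<mu> t) \<psi>"
          using integral_conv(2)[OF mu(1,2)[OF t] psi] torus_meas_cont[OF mu(1,2)[OF t] psi] by auto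
        have "\<bar>(\<integral>x. conv n \<psi> x - \<psi> x \<partial>\<mu> t)\<bar> \<le> (\<integral>x. \<bar>conv n \<psi> x - \<psi> x\<bar> \<partial>\<mu> t)" by (rule integral_abs_bound)
        also have "\<dots> \<le> (\<integral>x. e / 2 \<partial>\<mu> t)"
          using i N[OF n] by (intro integral_mono) auto
        also have "\<dots> = e / 2" by (simp add: prob_space)
        finally show "dist (\<integral>x. conv n \<psi> x \<partial>\<mu> t) (\<integral>x. \<psi> x \<partial>\<mu> t) < e"
          using i e by (simp add: dist_real_def)
      qed
    qed
    moreover have "continuous_on {0..T} (\<lambda>t. \<integral>x. conv n \<psi> x \<partial>\<mu> t)" for n
    proof -
      have "continuous_on {0..T} (\<lambda>t. \<Sum>(c, l, l')\<leftarrow>L. c * (\<integral>y. tmono l' y * \<psi> y \<partial>torus) * mass_flux T m0 w (tmono l) (tgrad l) t)" for L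
        by (induction L) (auto intro!: continuous_intros mass_flux_cont[OF w tgrad_cont tgrad_periodic])
      then show ?thesis
        by (rule continuous_on_eq) (simp add: integral_conv(1)[OF mu(1,2) psi] mu(3))
    qed
    ultimately show "continuous_on {0..T} (\<lambda>t. \<integral>x. \<psi> x \<partial>\<mu> t)"
      by (intro uniform_limit_theorem[where F = sequentially]) auto
  qed
  then show ?thesis by blast
qed

text \<open>
  Both sides are values at \<open>T\<close> of continuous functions of time that agree at almost all times.
\<close>
lemma terminal_value:
  fixes m :: "real \<times> (real ^ 'd) \<Rightarrow> real"
  assumes T: "0 < T" and mw: "(m, w) \<in> K1 T m0" and m0: "continuous_on UNIV m0" "periodic m0"
    and e: "\<And>x. GDERIV e x :> De x" "continuous_on UNIV De" "periodic e"
  shows "(\<integral>x. e x \<partial>at_time T m T) = (\<integral>x. e x * m0 x \<partial>torus) + (\<integral>z. w z \<bullet> De (snd z) \<partial>cyl T)"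
proof -
  have w: "integrable (cyl T) w" using mw by (auto simp: K1_def)
  have ec: "continuous_on UNIV e" by (rule GDERIV_cont[OF e(1)])
  have pD: "periodic De" by (rule GDERIV_periodic[OF e(1,3)])
  define \<mu> where "\<mu> = at_time T m"
  have nc: "narrow_curve T m \<mu>" unfolding \<mu>_def at_time_def by (rule someI_ex[OF narrow_curve_exists[OF T mw]])
  have c1: "continuous_on {0..T} (\<lambda>t. \<integral>x. e x \<partial>\<mu> t)" using nc ec e(3) by (auto simp: narrow_curve_def)
  have c2: "continuous_on {0..T} (mass_flux T m0 w e De)" by (rule mass_flux_cont[OF w e(2) pD])
  have "AE t in tm T. \<mu> t = density torus (\<lambda>x. ennreal (m (t, x)))" using nc unfolding narrow_curve_def tm_def by blast
  then have ae: "AE t in tm T. (\<integral>x. e x \<partial>\<mu> t) = mass_flux T m0 w e De t"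
    using good_times[OF T mw]
  proof eventually_elim
    case (elim t)
    then have "(\<integral>x. e x \<partial>\<mu> t) = (\<integral>x. e x * m (t, x) \<partial>torus)" using density_slice(2)[of m t e] ec by simp
    also have "\<dots> = mass_flux T m0 w e De t" using elim by (intro flux_C1[OF _ w m0 _ e]) auto
    finally show ?case .
  qed
  obtain s where s: "\<And>n :: nat. (\<integral>x. e x \<partial>\<mu> (s n)) = mass_flux T m0 w e De (s n)" "\<And>n. s n \<in> {0<..<T}" "s \<longlonglongrightarrow> T"
    using AE_tm_dense[OF ae _ T, of T] T by auto
  have TT: "T \<in> {0..T}" using T by simp
  have "\<forall>\<^sub>F n in sequentially. s n \<in> {0..T}" using s(2) by (auto simp: less_imp_le)
  then have "(\<lambda>n. \<integral>x. e x \<partial>\<mu> (s n)) \<longlonglongrightarrow> (\<integral>x. e x \<partial>\<mu> T)" "(\<lambda>n. mass_flux T m0 w e De (s n)) \<longlonglongrightarrow> mass_flux T m0 w e De T"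
    using continuous_on_tendsto_compose[OF c1 s(3) TT] continuous_on_tendsto_compose[OF c2 s(3) TT] by auto
  then have eq: "(\<integral>x. e x \<partial>\<mu> T) = mass_flux T m0 w e De T" using s(1) LIMSEQ_unique by auto
  obtain MD where MD: "\<And>x. norm (De x) \<le> MD" using periodic_bounded_space[OF e(2) pD] by auto
  have iw: "integrable (cyl T) (\<lambda>z. w z \<bullet> De (snd z))"
    using MD by (intro integrable_cyl_inner[OF w measurable_snd_cyl[OF measurable_torus_cont[OF e(2)]]]) auto
  have "(\<integral>z. w z \<bullet> De (snd z) \<partial>cyl T) = (\<integral>s. indicator {..<T} s * (\<integral>x. w (s, x) \<bullet> De x \<partial>torus) \<partial>tm T)"
    unfolding cyl_fubini(3)[OF iw] by (intro Bochner_Integration.integral_cong) auto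
  then show ?thesis using eq by (simp add: \<mu>_def mass_flux_def)
qed

section \<open>The energy density\<close>

text \<open>
  The linear term exceeds the power only up to the point where \<open>C = k m^(p - 1)\<close>.
\<close>
lemma young_absorb:
  fixes p :: real
  assumes p: "1 < p" and "0 < k" "0 \<le> C" shows "\<exists>K\<ge>0. \<forall>m\<ge>0. C * m \<le> k * m powr p + K"
proof (intro exI[of _ "C * (C / k) powr (1 / (p - 1))"] conjI allI impI)
  show "0 \<le> C * (C / k) powr (1 / (p - 1))" using assms by simp
  fix m :: real assume m: "0 \<le> m"
  show "C * m \<le> k * m powr p + C * (C / k) powr (1 / (p - 1))"
  proof (cases "m \<le> (C / k) powr (1 / (p - 1))")
    case True
    then have "C * m \<le> C * (C / k) powr (1 / (p - 1))" using assms by (intro mult_left_mono) auto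
    moreover have "0 \<le> k * m powr p" using assms by simp
    ultimately show ?thesis by linarith
  next
    case False
    then have "((C / k) powr (1 / (p - 1))) powr (p - 1) \<le> m powr (p - 1)"
      using p by (intro powr_mono2) auto
    then have "C / k \<le> m powr (p - 1)" using p assms by (simp add: powr_powr)
    then have "C \<le> k * m powr (p - 1)" using assms by (simp add: divide_le_eq mult.commute)
    then have "C * m \<le> k * m powr (p - 1) * m" using m by (rule mult_right_mono)
    also have "\<dots> = k * m powr p"
      using m p powr_add[of m "p - 1" 1] by (cases "m = 0") (auto simp: mult.assoc)
    finally show ?thesis using assms by (simp add: add_increasing2)
  qed
qed

text \<open>
  The data of the problem, with names for the derivatives of \<open>H\<close> and \<open>\<phi>T\<close> and for the growth
  constants of \<open>f\<close> and \<open>H\<close>.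
\<close>
locale mfg_data =
  fixes T q r :: real and f :: "real ^ 'd \<Rightarrow> real \<Rightarrow> real" and H :: "real ^ 'd \<Rightarrow> real ^ 'd \<Rightarrow> real"
    and DpH :: "real ^ 'd \<Rightarrow> real ^ 'd \<Rightarrow> real ^ 'd" and \<phi>T m0 :: "real ^ 'd \<Rightarrow> real"
    and D\<phi>T :: "real ^ 'd \<Rightarrow> real ^ 'd" and Cf CH :: real
  assumes T: "0 < T"
    and f_continuous: "continuous_on (UNIV \<times> {0..}) (\<lambda>(x, \<tau>). f x \<tau>)"
    and f_increasing: "\<And>x. strict_mono_on {0..} (f x)"
    and f_zero: "\<And>x. f x 0 = 0"
    and q: "1 < q"
    and Cf: "0 < Cf"
    and f_growth: "\<And>x \<tau>. 0 \<le> \<tau> \<Longrightarrow> 1 / Cf * \<tau> powr (q - 1) - Cf \<le> f x \<tau>"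
    and H_continuous: "continuous_on UNIV (\<lambda>(x, \<xi>). H x \<xi>)"
    and H_convex: "\<And>x. convex_on UNIV (H x)"
    and H_grad: "\<And>x \<xi>. GDERIV (H x) \<xi> :> DpH x \<xi>"
    and DpH_cont: "continuous_on UNIV (\<lambda>(x, \<xi>). DpH x \<xi>)"
    and r: "1 < r"
    and CH: "0 < CH"
    and H_lower: "\<And>x \<xi>. 1 / (r * CH) * norm \<xi> powr r - CH \<le> H x \<xi>"
    and H_upper: "\<And>x \<xi>. H x \<xi> \<le> CH / r * norm \<xi> powr r + CH"
    and \<phi>T_periodic: "periodic \<phi>T"
    and \<phi>T_grad: "\<And>x. GDERIV \<phi>T x :> D\<phi>T x"
    and D\<phi>T_cont: "continuous_on UNIV D\<phi>T"
    and m0_periodic: "periodic m0"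
    and m0_continuous: "continuous_on UNIV m0"
    and m0_nonneg: "\<And>x. 0 \<le> m0 x"
    and m0_mass: "(\<integral>x. m0 x \<partial>torus) = 1"
begin

lemma f_cont_x: "0 \<le> \<tau> \<Longrightarrow> continuous_on UNIV (\<lambda>x. f x \<tau>)"
  by (rule continuous_on_compose2[OF f_continuous, of UNIV "\<lambda>x. (x, \<tau>)", simplified])
     (auto intro!: continuous_on_Pair continuous_on_id continuous_on_const)

lemma f_cont_m: "continuous_on {0..b} (f x)"
  by (rule continuous_on_compose2[OF f_continuous, of "{0..b}" "\<lambda>\<tau>. (x, \<tau>)", simplified])
     (auto intro!: continuous_on_Pair continuous_on_id continuous_on_const)

lemma f_less: "0 \<le> a \<Longrightarrow> a < b \<Longrightarrow> f x a < f x b"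
  using f_increasing[of x] by (auto simp: strict_mono_on_def)

lemma f_le: "0 \<le> a \<Longrightarrow> a \<le> b \<Longrightarrow> f x a \<le> f x b"
  using f_less[of a b x] by (cases "a = b") auto

lemma mstar_ex: "\<exists>m\<ge>0. f x m = max a 0"
proof -
  define B where "B = (Cf * (max a 0 + Cf)) powr (1 / (q - 1))"
  have B: "0 \<le> B" by (simp add: B_def)
  have "B powr (q - 1) = Cf * (max a 0 + Cf)"
    using q Cf by (simp add: B_def powr_powr)
  then have "max a 0 \<le> f x B"
    using f_growth[OF B, of x] Cf by simp
  then show ?thesis
    using IVT'[of "f x" 0 "max a 0" B] B f_cont_m by (auto simp: f_zero)
qed

text \<open>
  The derivative of \<open>F\<^sup>*(x, -)\<close>: the inverse function of \<open>f x\<close>, continued by 0 to negative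
  arguments.
\<close>
definition mstar :: "real ^ 'd \<Rightarrow> real \<Rightarrow> real" where
  "mstar x a = (SOME m. 0 \<le> m \<and> f x m = max a 0)"

lemma mstar: "0 \<le> mstar x a" "f x (mstar x a) = max a 0"
  using someI_ex[of "\<lambda>m. 0 \<le> m \<and> f x m = max a 0"] mstar_ex[of x a] by (auto simp: mstar_def)

lemma mstar_less: "0 \<le> m \<Longrightarrow> mstar x a < m \<longleftrightarrow> max a 0 < f x m"
  using mstar[of x a] f_less[of "mstar x a" m x] f_le[of m "mstar x a" x] by (metis linorder_not_le)

lemma mstar_greater: "0 \<le> m \<Longrightarrow> m < mstar x a \<longleftrightarrow> f x m < max a 0"
  using mstar[of x a] f_less[of m "mstar x a" x] f_le[of "mstar x a" m x] by (metis linorder_not_le)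

text \<open>
  By monotonicity of \<open>f x\<close>, strict bounds on \<open>mstar\<close> are strict inequalities between the continuous
  functions \<open>f x m\<close> and \<open>max a 0\<close>, hence stable under perturbation of \<open>(x, a)\<close>.
\<close>
lemma mstar_cont: "continuous_on UNIV (\<lambda>(x, a). mstar x a)"
  unfolding continuous_on_def
proof (intro ballI)
  fix z0 :: "(real ^ 'd) \<times> real"
  obtain x0 a0 where z0: "z0 = (x0, a0)" by (cases z0)
  have fl: "((\<lambda>z. f (fst z) m) \<longlongrightarrow> f x0 m) (at z0)" if "0 \<le> m" for m
  proof -
    have "continuous_on UNIV (\<lambda>z :: (real ^ 'd) \<times> real. f (fst z) m)"
      by (rule continuous_on_compose2[OF f_cont_x[OF that]]) (auto intro: continuous_intros)
    then show ?thesis by (simp add: continuous_on_def z0)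
  qed
  have al: "((\<lambda>z. max (snd z) 0) \<longlongrightarrow> max a0 0) (at z0)"
  proof -
    have "continuous_on UNIV (\<lambda>z :: (real ^ 'd) \<times> real. max (snd z) 0)" by (intro continuous_intros)
    then show ?thesis by (simp add: continuous_on_def z0)
  qed
  have "((\<lambda>z. mstar (fst z) (snd z)) \<longlongrightarrow> mstar x0 a0) (at z0)"
  proof (rule order_tendstoI)
    fix m assume m: "m < mstar x0 a0"
    show "\<forall>\<^sub>F z in at z0. m < mstar (fst z) (snd z)"
    proof (cases "0 \<le> m")
      case True
      then have lt: "f x0 m < max a0 0" using m mstar_greater by blast
      then have "((\<lambda>z. max (snd z) 0 - f (fst z) m) \<longlongrightarrow> max a0 0 - f x0 m) (at z0)"
        by (intro tendsto_intros al fl True)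
      then have "\<forall>\<^sub>F z in at z0. 0 < max (snd z) 0 - f (fst z) m"
        using lt by (intro order_tendstoD) auto
      then show ?thesis by eventually_elim (simp add: mstar_greater[OF True])
    next
      case False
      then have "m < mstar (fst z) (snd z)" for z using mstar(1)[of "fst z" "snd z"] by linarith
      then show ?thesis by simp
    qed
  next
    fix m assume m: "mstar x0 a0 < m"
    then have m0: "0 \<le> m" using mstar(1)[of x0 a0] by linarith
    then have lt: "max a0 0 < f x0 m" using m mstar_less by blast
    then have "((\<lambda>z. f (fst z) m - max (snd z) 0) \<longlongrightarrow> f x0 m - max a0 0) (at z0)"
      by (intro tendsto_intros al fl m0)
    then have "\<forall>\<^sub>F z in at z0. 0 < f (fst z) m - max (snd z) 0"
      using lt by (intro order_tendstoD) auto
    then show "\<forall>\<^sub>F z in at z0. mstar (fst z) (snd z) < m"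
      by eventually_elim (simp add: mstar_less[OF m0])
  qed
  then show "((\<lambda>(x, a). mstar x a) \<longlongrightarrow> (case z0 of (x, a) \<Rightarrow> mstar x a)) (at z0 within UNIV)"
    by (simp add: z0 case_prod_beta')
qed

text \<open>
  The real-valued form of \<open>F\<close>, for \<open>m \<ge> 0\<close>.
\<close>
definition Fr :: "real ^ 'd \<Rightarrow> real \<Rightarrow> real" where
  "Fr x m = integral {0..m} (f x)"

lemma Fr_deriv: "t \<in> {0..b} \<Longrightarrow> (Fr x has_real_derivative f x t) (at t within {0..b})"
  unfolding Fr_def using integral_has_real_derivative[OF f_cont_m] by blast

lemma Fr_deriv_at: "0 < t \<Longrightarrow> (Fr x has_real_derivative f x t) (at t)"
  using Fr_deriv[of t "t + 1" x] at_within_Icc_at[of 0 t "t + 1"] by simp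

lemma Fr_cont_m: "continuous_on {0..b} (Fr x)"
  using Fr_deriv by (meson DERIV_continuous_on)

lemma Fr_diff: "0 < t \<Longrightarrow> Fr x differentiable (at t)"
  using Fr_deriv_at real_differentiable_def by blast

lemma Fr_0 [simp]: "Fr x 0 = 0"
  by (simp add: Fr_def)

lemma Fr_strict:
  assumes "0 \<le> a" "0 \<le> b" "a \<noteq> b"
  shows "f x a * (b - a) < Fr x b - Fr x a"
proof (cases "a < b")
  case True
  have "\<exists>l z. a < z \<and> z < b \<and> (Fr x has_real_derivative l) (at z) \<and> Fr x b - Fr x a = (b - a) * l"
    by (rule MVT[OF True]) (use assms True in \<open>auto intro!: continuous_on_subset[OF Fr_cont_m[of b]] Fr_diff\<close>)
  then obtain l z where z: "a < z" "z < b" "(Fr x has_real_derivative l) (at z)" "Fr x b - Fr x a = (b - a) * l" by blast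
  have "l = f x z" using DERIV_unique[OF z(3) Fr_deriv_at] z(1) assms(1) by auto
  then have "f x a < l" using f_less[of a z x] z assms by simp
  then show ?thesis using z(4) True by (simp add: mult.commute)
next
  case False
  then have lt: "b < a" using assms by simp
  have "\<exists>l z. b < z \<and> z < a \<and> (Fr x has_real_derivative l) (at z) \<and> Fr x a - Fr x b = (a - b) * l"
    by (rule MVT[OF lt]) (use assms lt in \<open>auto intro!: continuous_on_subset[OF Fr_cont_m[of a]] Fr_diff\<close>)
  then obtain l z where z: "b < z" "z < a" "(Fr x has_real_derivative l) (at z)" "Fr x a - Fr x b = (a - b) * l" by blast
  have "l = f x z" using DERIV_unique[OF z(3) Fr_deriv_at] z(1) assms(2) by auto
  then have "l < f x a" using f_less[of z a x] z assms by simp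
  then have "(a - b) * l < (a - b) * f x a" using lt by simp
  then show ?thesis using z(4) by (simp add: algebra_simps)
qed

lemma Fr_subgrad:
  assumes "0 \<le> a" "0 \<le> b" shows "f x a * (b - a) \<le> Fr x b - Fr x a"
  using Fr_strict[OF assms, of x] by (cases "a = b") auto

lemma Fr_mid:
  assumes "0 \<le> a" "0 \<le> b"
  shows "Fr x ((a + b) / 2) \<le> (Fr x a + Fr x b) / 2" "a \<noteq> b \<Longrightarrow> Fr x ((a + b) / 2) < (Fr x a + Fr x b) / 2"
proof -
  define c where "c = (a + b) / 2"
  have c: "0 \<le> c" using assms by (simp add: c_def)
  have "f x c * (a - c) + f x c * (b - c) = f x c * ((a - c) + (b - c))" by (simp only: distrib_left)
  also have "\<dots> = 0" by (simp add: c_def field_simps)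
  finally have e: "f x c * (a - c) + f x c * (b - c) = 0" .
  show "Fr x ((a + b) / 2) \<le> (Fr x a + Fr x b) / 2"
    using add_mono[OF Fr_subgrad[OF c assms(1), of x] Fr_subgrad[OF c assms(2), of x]] unfolding e c_def[symmetric] by (simp add: field_simps)
  assume ne: "a \<noteq> b"
  then have "c \<noteq> a" by (simp add: c_def field_simps)
  then show "Fr x ((a + b) / 2) < (Fr x a + Fr x b) / 2"
    using add_less_le_mono[OF Fr_strict[OF c assms(1), of x] Fr_subgrad[OF c assms(2), of x]] unfolding e c_def[symmetric] by (simp add: field_simps)
qed

text \<open>
  Rescaling to a fixed interval turns joint continuity of \<open>F\<close> into continuity of a parameter
  integral.
\<close>
lemma Fr_scale: assumes m: "0 \<le> m" shows "Fr x m = integral (cbox 0 1) (\<lambda>s. m * f x (s * m))"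
proof -
  have "((\<lambda>s. m * f x (s * m)) has_integral (Fr x (1 * m) - Fr x (0 * m))) {0..1}"
  proof (rule fundamental_theorem_of_calculus)
    fix s :: real assume s: "s \<in> {0..1}"
    have sm: "s * m \<in> {0..m}" using s m by (auto simp: mult_left_le_one_le)
    have "(\<lambda>s. s * m) ` {0..1} \<subseteq> {0..m}" using m by (auto simp: mult_left_le_one_le)
    then have "(Fr x has_real_derivative f x (s * m)) (at (s * m) within (\<lambda>s. s * m) ` {0..1})"
      by (rule DERIV_subset[OF Fr_deriv[OF sm]])
    moreover have "((\<lambda>s. s * m) has_real_derivative m) (at s within {0..1})" by (auto intro!: derivative_eq_intros)
    ultimately have "(Fr x \<circ> (\<lambda>s. s * m) has_real_derivative f x (s * m) * m) (at s within {0..1})"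
      by (rule DERIV_image_chain)
    then show "((\<lambda>s. Fr x (s * m)) has_vector_derivative m * f x (s * m)) (at s within {0..1})"
      by (simp add: has_real_derivative_iff_has_vector_derivative o_def mult.commute)
  qed simp
  from integral_unique[OF this] show ?thesis unfolding cbox_interval by simp
qed

lemma Fr_cont: "continuous_on (UNIV \<times> {0..}) (\<lambda>(x, m). Fr x m)"
proof -
  have "continuous_on ((UNIV \<times> {0..}) \<times> cbox 0 1) (\<lambda>(z, s). snd z * f (fst z) (s * snd z))"
    unfolding case_prod_beta
    by (intro continuous_intros continuous_on_compose2[OF f_continuous[unfolded case_prod_beta'], of _ "\<lambda>w. (fst (fst w), snd w * snd (fst w))", simplified]) auto
  from integral_continuous_on_param[OF this]
  have "continuous_on (UNIV \<times> {0..}) (\<lambda>z. integral (cbox 0 1) (\<lambda>s. snd z * f (fst z) (s * snd z)))" by simp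
  then show ?thesis by (rule continuous_on_eq) (auto simp: Fr_scale)
qed

lemma Fr_lower:
  assumes m: "0 \<le> m" shows "1 / (Cf * q) * m powr q - Cf * m \<le> Fr x m"
proof (cases "m = 0")
  case True then show ?thesis using q by simp
next
  case False
  then have mp: "0 < m" using m by simp
  define g where "g t = Fr x t - (1 / (Cf * q) * t powr q - Cf * t)" for t
  have "\<exists>l z. 0 < z \<and> z < m \<and> (g has_real_derivative l) (at z) \<and> g m - g 0 = (m - 0) * l"
  proof (rule MVT[OF mp])
    show "continuous_on {0..m} g" unfolding g_def using q
      by (intro continuous_intros Fr_cont_m continuous_on_powr') auto
    show "g differentiable (at z)" if "0 < z" "z < m" for z
      unfolding g_def real_differentiable_def using that q Cf
      by (auto intro!: exI derivative_eq_intros Fr_deriv_at)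
  qed
  then obtain l z where z: "0 < z" "z < m" "(g has_real_derivative l) (at z)" "g m - g 0 = m * l" by auto
  have "(g has_real_derivative (f x z - (1 / (Cf * q) * (q * z powr (q - 1)) - Cf))) (at z)"
    unfolding g_def using z q Cf by (auto intro!: derivative_eq_intros Fr_deriv_at)
  then have "l = f x z - (1 / Cf * z powr (q - 1) - Cf)" using DERIV_unique[OF z(3)] q by simp
  then have "0 \<le> l" using f_growth[of z x] z by simp
  then have "0 \<le> g m" using z(4) mp q by (simp add: g_def zero_le_mult_iff)
  then show ?thesis by (simp add: g_def)
qed

text \<open>
  \<open>F\<^sup>*\<close>, written with the maximiser in its defining supremum.
\<close>
definition Fs :: "real ^ 'd \<Rightarrow> real \<Rightarrow> real" where
  "Fs x a = a * mstar x a - Fr x (mstar x a)"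

lemma fenchel_young: assumes m: "0 \<le> m" shows "m * a - Fr x m \<le> Fs x a"
proof -
  have "max a 0 * (m - mstar x a) \<le> Fr x m - Fr x (mstar x a)"
    using Fr_subgrad[OF mstar(1)[of x a] m, of x] mstar(2)[of x a] by simp
  moreover have "a * (m - mstar x a) \<le> max a 0 * (m - mstar x a)"
  proof (cases "0 \<le> a")
    case False
    then have "mstar x a = 0" using mstar(2)[of x a] mstar_greater[of 0 x a] mstar(1)[of x a] f_zero by (auto simp: max_def)
    then show ?thesis using False m by (simp add: mult_nonpos_nonneg)
  qed simp
  ultimately show ?thesis by (simp add: Fs_def algebra_simps)
qed

lemma F_star_eq: "F_star f x a = ereal (Fs x a)"
  unfolding F_star_def conjugate_def
proof (rule antisym)
  show "(SUP m. ereal (m \<bullet> a) - coupling_primitive f x m) \<le> ereal (Fs x a)"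
  proof (rule SUP_least)
    fix m :: real
    show "ereal (m \<bullet> a) - coupling_primitive f x m \<le> ereal (Fs x a)"
      using fenchel_young[where m = m and a = a and x = x] by (simp add: coupling_primitive_def Fr_def)
  qed
  have "ereal (Fs x a) = ereal (mstar x a \<bullet> a) - coupling_primitive f x (mstar x a)"
    using mstar(1)[of x a] by (simp add: coupling_primitive_def Fs_def Fr_def mult.commute)
  also have "\<dots> \<le> (SUP m. ereal (m \<bullet> a) - coupling_primitive f x m)" by (rule SUP_upper) simp
  finally show "ereal (Fs x a) \<le> (SUP m. ereal (m \<bullet> a) - coupling_primitive f x m)" .
qed

lemma Fs_ineq: "Fs x b - Fs x a \<le> mstar x b * (b - a)"
  using fenchel_young[OF mstar(1)[of x b], where a = a and x = x] by (simp add: Fs_def[of x b] algebra_simps)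

lemma Fs_cont: "continuous_on UNIV (\<lambda>(x, a). Fs x a)"
proof -
  have m: "continuous_on UNIV (\<lambda>z. mstar (fst z) (snd z))" using mstar_cont by (simp add: case_prod_beta')
  have "continuous_on UNIV (\<lambda>z. Fr (fst z) (mstar (fst z) (snd z)))"
    by (rule continuous_on_compose2[OF Fr_cont[unfolded case_prod_beta'], of _ "\<lambda>z. (fst z, mstar (fst z) (snd z))", simplified])
       (auto intro!: continuous_intros m simp: mstar)
  then show ?thesis unfolding Fs_def case_prod_beta' by (intro continuous_intros m)
qed

lemma H_cont_xi: "continuous_on UNIV (H x)"
  by (rule continuous_on_compose2[OF H_continuous, of UNIV "\<lambda>\<xi>. (x, \<xi>)", simplified])
     (auto intro!: continuous_on_Pair continuous_on_id continuous_on_const)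

lemma H_tangent: "DpH x \<xi> \<bullet> (\<eta> - \<xi>) \<le> H x \<eta> - H x \<xi>"
proof -
  define p where "p s = H x (\<xi> + s *\<^sub>R (\<eta> - \<xi>))" for s :: real
  have cv: "convex_on UNIV p"
  proof (rule convex_onI)
    fix t a b :: real assume t: "0 < t" "t < 1"
    have "\<xi> + ((1 - t) *\<^sub>R a + t *\<^sub>R b) *\<^sub>R (\<eta> - \<xi>) = (1 - t) *\<^sub>R (\<xi> + a *\<^sub>R (\<eta> - \<xi>)) + t *\<^sub>R (\<xi> + b *\<^sub>R (\<eta> - \<xi>))"
      by (simp add: algebra_simps)
    then show "p ((1 - t) *\<^sub>R a + t *\<^sub>R b) \<le> (1 - t) * p a + t * p b"
      unfolding p_def using convex_onD[OF H_convex[of x], of t "\<xi> + a *\<^sub>R (\<eta> - \<xi>)" "\<xi> + b *\<^sub>R (\<eta> - \<xi>)"] t by simp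
  qed simp
  have "((\<lambda>s. H x (\<xi> + s *\<^sub>R (\<eta> - \<xi>))) has_derivative (\<lambda>h. (h *\<^sub>R (\<eta> - \<xi>)) \<bullet> DpH x \<xi>)) (at 0)"
    by (rule has_derivative_compose[of "\<lambda>s. \<xi> + s *\<^sub>R (\<eta> - \<xi>)" "\<lambda>h. h *\<^sub>R (\<eta> - \<xi>)"])
       (use H_grad[of x \<xi>] in \<open>auto intro!: derivative_eq_intros simp: gderiv_def\<close>)
  then have d: "(p has_real_derivative ((\<eta> - \<xi>) \<bullet> DpH x \<xi>)) (at 0)"
    unfolding p_def has_field_derivative_def by (simp add: mult_commute_abs)
  have "(\<eta> - \<xi>) \<bullet> DpH x \<xi> * (1 - 0) \<le> p 1 - p 0"
    by (rule convex_on_imp_above_tangent[OF cv]) (use d in auto)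
  then show ?thesis by (simp add: p_def inner_commute)
qed

text \<open>
  The kinetic energy as a supremum of affine functions of \<open>(m, w)\<close>.  The formula covers the
  conventions at \<open>m = 0\<close>, and it displays convexity, lower semicontinuity and measurability.
\<close>
definition P :: "real ^ 'd \<Rightarrow> real \<Rightarrow> real ^ 'd \<Rightarrow> ereal" where
  "P x m w = (SUP \<xi>. ereal (- (w \<bullet> \<xi>) - m * H x \<xi>))"

lemma kinetic_eq: assumes m: "0 \<le> m" shows "kinetic H x m w = P x m w"
proof (cases "m = 0")
  case True
  show ?thesis
  proof (cases "w = 0")
    case True then show ?thesis using \<open>m = 0\<close> by (simp add: kinetic_def P_def)
  next
    case False
    have "P x m w = \<infinity>" unfolding P_def
    proof (rule SUP_PInfty)
      fix n :: nat
      show "\<exists>\<xi>\<in>UNIV. ereal (real n) \<le> ereal (- (w \<bullet> \<xi>) - m * H x \<xi>)"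
        using False \<open>m = 0\<close> by (intro bexI[of _ "- (real n / (w \<bullet> w)) *\<^sub>R w"]) auto
    qed
    then show ?thesis using \<open>m = 0\<close> False by (simp add: kinetic_def)
  qed
next
  case False
  then have mp: "0 < m" using m by simp
  have "ereal m * H_star H x (- (w /\<^sub>R m)) = (SUP \<xi>. ereal m * (ereal (\<xi> \<bullet> - (w /\<^sub>R m)) - ereal (H x \<xi>)))"
    unfolding H_star_def conjugate_def by (rule Sup_ereal_mult_left') (use m in auto)
  also have "\<dots> = P x m w"
    unfolding P_def using mp by (intro SUP_cong) (auto simp: field_simps inner_commute)
  finally show ?thesis using False by (simp add: kinetic_def)
qed

lemma P_upper: "ereal (- (w \<bullet> \<xi>) - m * H x \<xi>) \<le> P x m w"
  unfolding P_def by (rule SUP_upper) simp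

text \<open>
  The equality case of Fenchel's inequality for \<open>H\<close>: by convexity the supremum is attained at
  \<open>\<xi>\<close> when \<open>w\<close> is the corresponding multiple of the gradient.
\<close>
lemma P_attained:
  assumes m: "0 \<le> m" shows "P x m (- (m *\<^sub>R DpH x \<xi>)) \<le> ereal (m * (DpH x \<xi> \<bullet> \<xi> - H x \<xi>))"
  unfolding P_def
proof (rule SUP_least)
  fix \<eta>
  have "m * (DpH x \<xi> \<bullet> (\<eta> - \<xi>)) \<le> m * (H x \<eta> - H x \<xi>)" by (rule mult_left_mono[OF H_tangent m])
  then show "ereal (- (- (m *\<^sub>R DpH x \<xi>) \<bullet> \<eta>) - m * H x \<eta>) \<le> ereal (m * (DpH x \<xi> \<bullet> \<xi> - H x \<xi>))"
    by (simp add: algebra_simps inner_diff_right)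
qed

text \<open>
  The energy density of the primal functional for \<open>m \<ge> 0\<close>.
\<close>
definition L :: "real ^ 'd \<Rightarrow> real \<Rightarrow> real ^ 'd \<Rightarrow> ereal" where
  "L x m w = P x m w + ereal (Fr x m)"

lemma L_eq: "0 \<le> m \<Longrightarrow> kinetic H x m w + coupling_primitive f x m = L x m w"
  by (simp add: L_def kinetic_eq coupling_primitive_def Fr_def)

lemma L_le_iff: "L x m w \<le> ereal lv \<longleftrightarrow> (\<forall>\<xi>. - (w \<bullet> \<xi>) - m * H x \<xi> + Fr x m \<le> lv)"
proof -
  have "L x m w \<le> ereal lv \<longleftrightarrow> P x m w \<le> ereal (lv - Fr x m)"
    unfolding L_def by (cases "P x m w") (auto simp: algebra_simps)
  also have "\<dots> \<longleftrightarrow> (\<forall>\<xi>. - (w \<bullet> \<xi>) - m * H x \<xi> + Fr x m \<le> lv)"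
    unfolding P_def SUP_le_iff by (auto simp: algebra_simps)
  finally show ?thesis .
qed

lemma L_lower: "ereal (- (w \<bullet> \<xi>) - m * H x \<xi> + Fr x m) \<le> L x m w"
  using P_upper[of w \<xi> m x] unfolding L_def
  by (cases "P x m w") auto

text \<open>
  This is \<open>r' q / (r' + q - 1)\<close> for \<open>r' = r / (r - 1)\<close>.
\<close>
definition pw :: real where
  "pw = r * q / (r + (q - 1) * (r - 1))"

lemma pw_den: "0 < r + (q - 1) * (r - 1)"
  using q r by (intro add_pos_nonneg) auto

lemma pw_gt1: "1 < pw"
  unfolding pw_def using q r pw_den by (simp add: less_divide_eq algebra_simps)

lemma pw_le_q: "pw \<le> q"
proof -
  have "r * q \<le> (r + (q - 1) * (r - 1)) * q"
    using q r by (intro mult_right_mono) auto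
  then show ?thesis unfolding pw_def using pw_den by (simp add: divide_le_eq mult.commute)
qed

text \<open>
  The exponent is chosen for this identity: it makes Young's inequality with exponents \<open>q\<close> and
  \<open>q / (q - 1)\<close> bound \<open>m |w|^((pw - 1) r)\<close> by \<open>m^q + |w|^pw\<close>.
\<close>
lemma pw_exp: "(pw - 1) * r * (q / (q - 1)) = pw"
proof -
  have "pw - 1 = (q - 1) / (r + (q - 1) * (r - 1))"
    unfolding pw_def using pw_den by (simp add: field_simps)
  then show ?thesis using q unfolding pw_def by simp
qed

text \<open>
  Insert \<open>\<xi> = - \<delta> |w|^(pw - 2) w\<close> into the supremum.  The gain is \<open>\<delta> |w|^pw\<close>, and the cost
  \<open>m H(x, \<xi>)\<close> is of the order \<open>\<delta>^r m |w|^((pw - 1) r)\<close>, hence at most a multiple of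
  \<open>\<delta>^r (m^q + |w|^pw)\<close>.  As \<open>r > 1\<close>, a small \<open>\<delta>\<close> lets the gain and the growth of \<open>F\<close> absorb the
  cost.
\<close>
lemma L_coercive:
  "\<exists>\<kappa>>0. \<exists>C\<ge>0. \<forall>x m w. 0 \<le> m \<longrightarrow> ereal (\<kappa> * (m powr q + norm w powr pw) - C) \<le> L x m w"
proof -
  define k where "k = 1 / (Cf * q)"
  have k: "0 < k" using Cf q by (simp add: k_def)
  define c where "c = CH / r"
  have c: "0 < c" using CH r by (simp add: c_def)
  (* e = delta^(r - 1) is small enough for the cost c delta^r to be at most delta / 2 and k / 4. *)
  define e where "e = min 1 (min (1 / (2 * c)) (k / (4 * c)))"
  have e: "0 < e" "e \<le> 1" "c * e \<le> 1 / 2" "c * e \<le> k / 4"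
    using k c by (auto simp: e_def min_def field_simps)
  define \<delta> where "\<delta> = e powr (1 / (r - 1))"
  have d0: "0 < \<delta>" using e by (simp add: \<delta>_def)
  have d1: "\<delta> \<le> 1" unfolding \<delta>_def using e r by (intro powr_le1) auto
  have de: "\<delta> powr (r - 1) = e" unfolding \<delta>_def using r e by (simp add: powr_powr)
  have dr: "\<delta> powr r = \<delta> * e"
    using powr_add[of \<delta> 1 "r - 1"] d0 de by simp
  have dc1: "c * \<delta> powr r \<le> \<delta> / 2" using mult_left_mono[OF e(3), of \<delta>] d0 by (simp add: dr algebra_simps)
  have dc2: "c * \<delta> powr r \<le> k / 4"
  proof -
    have "\<delta> * (c * e) \<le> 1 * (c * e)" using d1 c e by (intro mult_right_mono) auto
    then show ?thesis using e(4) by (simp add: dr algebra_simps)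
  qed
  obtain K where K: "K \<ge> 0" "\<And>m. m \<ge> 0 \<Longrightarrow> (CH + Cf) * m \<le> k / 4 * m powr q + K"
    using young_absorb[OF q, of "k / 4" "CH + Cf"] k CH Cf by auto
  define \<kappa> where "\<kappa> = min (\<delta> / 2) (k / 2)"
  have kap: "0 < \<kappa>" "\<kappa> \<le> \<delta> / 2" "\<kappa> \<le> k / 2" using d0 k by (auto simp: \<kappa>_def)
  have "ereal (\<kappa> * (m powr q + norm w powr pw) - K) \<le> L x m w" if m: "0 \<le> m" for x m w
  proof -
    define W where "W = norm w powr pw"
    have W0: "0 \<le> W" by (simp add: W_def)
    define \<xi> where "\<xi> = - (\<delta> * norm w powr (pw - 2)) *\<^sub>R w"
    have wx: "- (w \<bullet> \<xi>) = \<delta> * W"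
    proof (cases "w = 0")
      case False
      then have "norm w powr (pw - 2) * (norm w)\<^sup>2 = W"
        using powr_add[of "norm w" "pw - 2" 2] by (simp add: W_def powr_numeral)
      then show ?thesis by (simp add: \<xi>_def power2_norm_eq_inner mult.assoc)
    qed (simp add: \<xi>_def W_def)
    have nx: "norm \<xi> powr r = \<delta> powr r * norm w powr ((pw - 1) * r)"
    proof (cases "w = 0")
      case False
      then have "norm w powr (pw - 2) * norm w = norm w powr (pw - 1)"
        using powr_add[of "norm w" "pw - 2" 1] by simp
      then have "norm \<xi> = \<delta> * norm w powr (pw - 1)"
        using d0 by (simp add: \<xi>_def abs_mult mult.assoc)
      then show ?thesis using d0 by (simp add: powr_mult powr_powr)
    qed (simp add: \<xi>_def)
    define X where "X = norm w powr ((pw - 1) * r)"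
    have Y: "m * X \<le> m powr q + W"
    proof -
      have q': "1 < q / (q - 1)" "1 / q + 1 / (q / (q - 1)) = 1" using q by (auto simp: field_simps)
      have "m * X \<le> m powr q / q + X powr (q / (q - 1)) / (q / (q - 1))"
        by (rule Youngs_inequality[OF q q' m]) (simp add: X_def)
      then have "m * X \<le> m powr q / q + W / (q / (q - 1))" unfolding X_def W_def powr_powr pw_exp .
      moreover have "m powr q / q \<le> m powr q" using q by (simp add: divide_le_eq mult_le_cancel_left1)
      moreover have "W / (q / (q - 1)) \<le> W" using q' W0 divide_le_eq[of W "q / (q - 1)" W] mult_left_mono[of 1 "q / (q - 1)" W] by simp
      ultimately show ?thesis by linarith
    qed
    have "m * H x \<xi> \<le> m * (c * norm \<xi> powr r + CH)"
      unfolding c_def by (rule mult_left_mono[OF H_upper m])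
    also have "\<dots> = c * \<delta> powr r * (m * X) + CH * m"
      by (simp add: nx X_def algebra_simps)
    also have "\<dots> \<le> c * \<delta> powr r * (m powr q + W) + CH * m"
      using Y c by (intro add_right_mono mult_left_mono) auto
    also have "\<dots> = c * \<delta> powr r * m powr q + c * \<delta> powr r * W + CH * m"
      by (simp add: algebra_simps)
    also have "\<dots> \<le> k / 4 * m powr q + \<delta> / 2 * W + CH * m"
      using mult_right_mono[OF dc2, of "m powr q"] mult_right_mono[OF dc1 W0] by simp
    finally have h: "m * H x \<xi> \<le> k / 4 * m powr q + \<delta> / 2 * W + CH * m" .
    have "\<kappa> * W \<le> \<delta> / 2 * W" "\<kappa> * m powr q \<le> k / 2 * m powr q"
      using mult_right_mono[OF kap(2) W0] mult_right_mono[OF kap(3), of "m powr q"] by simp_all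
    then have "\<kappa> * (m powr q + W) - K \<le> - (w \<bullet> \<xi>) - m * H x \<xi> + Fr x m"
      using h wx Fr_lower[OF m, of x] K(2)[OF m] unfolding k_def[symmetric] by (simp add: algebra_simps)
    then show ?thesis using L_lower[of w \<xi> m x] unfolding W_def by (meson ereal_less_eq(3) order_trans)
  qed
  then show ?thesis using kap(1) K(1) by blast
qed

lemma L_mid:
  assumes m: "0 \<le> m" "0 \<le> m'" and l: "L x m w \<le> ereal lv" "L x m' w' \<le> ereal lv'"
  shows "L x ((m + m') / 2) ((w + w') /\<^sub>R 2) \<le> ereal ((lv + lv') / 2)"
  unfolding L_le_iff
proof
  fix \<xi>
  have "- (w \<bullet> \<xi>) - m * H x \<xi> + Fr x m \<le> lv" "- (w' \<bullet> \<xi>) - m' * H x \<xi> + Fr x m' \<le> lv'"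
    using l unfolding L_le_iff by auto
  then show "- (((w + w') /\<^sub>R 2) \<bullet> \<xi>) - (m + m') / 2 * H x \<xi> + Fr x ((m + m') / 2) \<le> (lv + lv') / 2"
    using Fr_mid(1)[OF m, of x] by (simp add: inner_add_left field_simps)
qed

text \<open>
  Since \<open>r > 1\<close>, the lower growth bound of \<open>H\<close> beats the linear term outside a large ball.
\<close>
lemma P_maximiser:
  assumes m: "0 < m"
  shows "\<exists>\<xi>. \<forall>\<eta>. - (w \<bullet> \<eta>) - m * H x \<eta> \<le> - (w \<bullet> \<xi>) - m * H x \<xi>"
proof -
  define g where "g \<eta> = - (w \<bullet> \<eta>) - m * H x \<eta>" for \<eta>
  define K where "K = m * CH + \<bar>m * H x 0\<bar>"
  define b where "b = m / (r * CH)"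
  have b: "0 < b" using m r CH by (simp add: b_def)
  have K: "0 \<le> K" using m CH by (simp add: K_def)
  (* Outside the ball of radius R the growth b |eta|^r exceeds |w| |eta| + K |eta|. *)
  define R where "R = max 1 (((norm w + K) / b) powr (1 / (r - 1)))"
  have R: "1 \<le> R" by (simp add: R_def)
  have out: "g \<eta> \<le> g 0" if e: "R < norm \<eta>" for \<eta>
  proof -
    have n1: "1 \<le> norm \<eta>" using e R by linarith
    have "((norm w + K) / b) powr (1 / (r - 1)) \<le> norm \<eta>" using e by (simp add: R_def)
    then have "(((norm w + K) / b) powr (1 / (r - 1))) powr (r - 1) \<le> norm \<eta> powr (r - 1)"
      using r by (intro powr_mono2) auto
    then have "(norm w + K) / b \<le> norm \<eta> powr (r - 1)"
      using r b K by (simp add: powr_powr)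
    then have s: "norm w + K \<le> b * norm \<eta> powr (r - 1)" using b by (simp add: divide_le_eq mult.commute)
    have "norm \<eta> powr r = norm \<eta> powr (r - 1) * norm \<eta>"
      using powr_add[of "norm \<eta>" "r - 1" 1] n1 by simp
    then have "b * norm \<eta> powr r = (b * norm \<eta> powr (r - 1)) * norm \<eta>" by simp
    also have "\<dots> \<ge> (norm w + K) * norm \<eta>" using s by (intro mult_right_mono) auto
    finally have t: "(norm w + K) * norm \<eta> \<le> b * norm \<eta> powr r" .
    have A: "K * 1 \<le> K * norm \<eta>" using n1 K by (intro mult_left_mono) auto
    have "m * (1 / (r * CH) * norm \<eta> powr r - CH) \<le> m * H x \<eta>"
      using H_lower m by (intro mult_left_mono) auto
    then have B: "b * norm \<eta> powr r - m * CH \<le> m * H x \<eta>" by (simp add: b_def right_diff_distrib)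
    have C: "norm w * norm \<eta> + K * norm \<eta> \<le> b * norm \<eta> powr r" using t by (simp only: distrib_right)
    have "m * H x 0 \<le> K - m * CH" by (simp add: K_def)
    moreover have "- (w \<bullet> \<eta>) \<le> norm w * norm \<eta>" using Cauchy_Schwarz_ineq2[of w \<eta>] by linarith
    ultimately show ?thesis using A B C unfolding g_def by simp
  qed
  have "continuous_on (cball 0 R) g" unfolding g_def
    by (intro continuous_intros continuous_on_subset[OF H_cont_xi]) auto
  then obtain \<xi> where xi: "\<xi> \<in> cball 0 R" "\<And>\<eta>. \<eta> \<in> cball 0 R \<Longrightarrow> g \<eta> \<le> g \<xi>"
    using continuous_attains_sup[OF compact_cball, of 0 R g] R by auto
  have "g \<eta> \<le> g \<xi>" for \<eta>
    using xi(2)[of \<eta>] xi(2)[of 0] out[of \<eta>] R by (cases "norm \<eta> \<le> R") auto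
  then show ?thesis unfolding g_def by blast
qed

text \<open>
  This is where differentiability of \<open>H\<close> enters: a maximiser determines \<open>w\<close>.
\<close>
lemma P_critical:
  assumes "\<And>\<eta>. - (w \<bullet> \<eta>) - m * H x \<eta> \<le> - (w \<bullet> \<xi>) - m * H x \<xi>"
  shows "w = - (m *\<^sub>R DpH x \<xi>)"
proof -
  have "((\<lambda>\<eta>. - (w \<bullet> \<eta>) - m * H x \<eta>) has_derivative (\<lambda>h. - (w \<bullet> h) - m * (h \<bullet> DpH x \<xi>))) (at \<xi>)"
    using H_grad[of x \<xi>] unfolding gderiv_def by (auto intro!: derivative_eq_intros)
  then have z: "(\<lambda>h. - (w \<bullet> h) - m * (h \<bullet> DpH x \<xi>)) = (\<lambda>h. 0)"
    by (rule differential_zero_maxmin[of \<xi> UNIV, rotated 2]) (use assms in auto)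
  define v where "v = w + m *\<^sub>R DpH x \<xi>"
  have "v \<bullet> v = 0"
  proof -
    have "v \<bullet> v = w \<bullet> v + m * (v \<bullet> DpH x \<xi>)"
      by (subst (1) v_def) (simp add: inner_add_left inner_add_right inner_commute)
    then show ?thesis using fun_cong[OF z, of v] by linarith
  qed
  then show ?thesis by (simp add: v_def eq_neg_iff_add_eq_0)
qed

text \<open>
  If \<open>m \<noteq> m'\<close>, strictness comes from \<open>F\<close>.  If \<open>m = m' > 0\<close>, take a maximiser \<open>\<xi>\<close> in the supremum
  for the midpoint.  Were there no strict gain, \<open>\<xi>\<close> would also be a maximiser for \<open>w\<close> and for \<open>w'\<close>,
  and both would equal \<open>- m D\<^sub>pH(x, \<xi>)\<close>.
\<close>
lemma L_strict:
  assumes m: "0 \<le> m" "0 \<le> m'" and l: "L x m w \<le> ereal lv" "L x m' w' \<le> ereal lv'" and ne: "(m, w) \<noteq> (m', w')"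
  shows "\<exists>b0. L x ((m + m') / 2) ((w + w') /\<^sub>R 2) \<le> ereal b0 \<and> b0 < (lv + lv') / 2"
proof -
  have a: "- (w \<bullet> \<xi>) - m * H x \<xi> + Fr x m \<le> lv" "- (w' \<bullet> \<xi>) - m' * H x \<xi> + Fr x m' \<le> lv'" for \<xi>
    using l unfolding L_le_iff by auto
  show ?thesis
  proof (cases "m = m'")
    case False
    define b0 where "b0 = (lv + lv') / 2 - ((Fr x m + Fr x m') / 2 - Fr x ((m + m') / 2))"
    have "L x ((m + m') / 2) ((w + w') /\<^sub>R 2) \<le> ereal b0" unfolding L_le_iff
    proof
      fix \<xi>
      show "- (((w + w') /\<^sub>R 2) \<bullet> \<xi>) - (m + m') / 2 * H x \<xi> + Fr x ((m + m') / 2) \<le> b0"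
        using a[of \<xi>] by (simp add: b0_def inner_add_left field_simps)
    qed
    moreover have "b0 < (lv + lv') / 2" using Fr_mid(2)[OF m False, of x] unfolding b0_def by linarith
    ultimately show ?thesis by blast
  next
    case True
    then have wne: "w \<noteq> w'" using ne by simp
    (* For m = 0 a finite value forces w = 0, so the two pairs would coincide. *)
    have mp: "0 < m"
    proof (rule ccontr)
      assume "\<not> 0 < m"
      then have m0: "m = 0" using m by simp
      have z: "w = 0" if "\<And>\<xi>. - (w \<bullet> \<xi>) + 0 \<le> (lv::real)" for w :: "real ^ 'd" and lv
      proof (rule ccontr)
        assume "w \<noteq> 0"
        then have "- (w \<bullet> (- ((\<bar>lv\<bar> + 1) / (w \<bullet> w)) *\<^sub>R w)) = \<bar>lv\<bar> + 1" by simp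
        then show False using that[of "- ((\<bar>lv\<bar> + 1) / (w \<bullet> w)) *\<^sub>R w"] by linarith
      qed
      have "w = 0" "w' = 0" using z[of w lv] z[of w' lv'] a m0 True by auto
      then show False using wne by simp
    qed
    define v where "v = (w + w') /\<^sub>R 2"
    obtain \<xi> where xi: "\<And>\<eta>. - (v \<bullet> \<eta>) - m * H x \<eta> \<le> - (v \<bullet> \<xi>) - m * H x \<xi>" using P_maximiser[OF mp] by blast
    define b0 where "b0 = - (v \<bullet> \<xi>) - m * H x \<xi> + Fr x m"
    have Lv: "L x m v \<le> ereal b0" unfolding L_le_iff b0_def using xi by auto
    have avg: "b0 = ((- (w \<bullet> \<xi>) - m * H x \<xi> + Fr x m) + (- (w' \<bullet> \<xi>) - m * H x \<xi> + Fr x m)) / 2"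
      by (simp add: b0_def v_def inner_add_left field_simps)
    have "b0 \<noteq> (lv + lv') / 2"
    proof
      assume eq: "b0 = (lv + lv') / 2"
      have e1: "- (w \<bullet> \<xi>) - m * H x \<xi> + Fr x m = lv" "- (w' \<bullet> \<xi>) - m * H x \<xi> + Fr x m = lv'"
        using a[of \<xi>] True eq avg by auto
      have "w = - (m *\<^sub>R DpH x \<xi>)" by (rule P_critical) (use a(1) e1 in \<open>simp add: algebra_simps\<close>)
      moreover have "w' = - (m *\<^sub>R DpH x \<xi>)"
      proof (rule P_critical)
        fix \<eta> show "- (w' \<bullet> \<eta>) - m * H x \<eta> \<le> - (w' \<bullet> \<xi>) - m * H x \<xi>" using a(2)[of \<eta>] e1 True by simp
      qed
      ultimately show False using wne by simp
    qed
    moreover have "b0 \<le> (lv + lv') / 2" using a[of \<xi>] True avg by auto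
    ultimately show ?thesis using Lv True unfolding v_def by (intro exI[of _ b0]) auto
  qed
qed

text \<open>
  Lower semicontinuity in the form that Fatou's lemma supplies: the bounds are shifted by a
  constant \<open>C\<close> and their lower limit is taken in \<^typ>\<open>ennreal\<close>.
\<close>
lemma L_lsc:
  assumes lim: "mn \<longlonglongrightarrow> m" "wn \<longlonglongrightarrow> w" and nn: "0 \<le> m" "\<And>n. 0 \<le> mn n"
    and le: "\<And>n. L x (mn n) (wn n) \<le> ereal (lv n)"
    and fin: "liminf (\<lambda>n. ennreal (lv n + C)) \<noteq> \<infinity>"
  shows "L x m w \<le> ereal (enn2real (liminf (\<lambda>n. ennreal (lv n + C))) - C)"
  unfolding L_le_iff
proof
  fix \<xi>
  have "continuous_on {0..} (Fr x)"
    by (rule continuous_on_compose2[OF Fr_cont, of "{0..}" "\<lambda>m. (x, m)", simplified])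
       (auto intro!: continuous_on_Pair continuous_on_id continuous_on_const)
  then have "(\<lambda>n. Fr x (mn n)) \<longlonglongrightarrow> Fr x m"
    by (rule continuous_on_tendsto_compose) (use lim nn in auto)
  then have "(\<lambda>n. ennreal ((- (wn n \<bullet> \<xi>) - mn n * H x \<xi> + Fr x (mn n)) + C)) \<longlonglongrightarrow> ennreal ((- (w \<bullet> \<xi>) - m * H x \<xi> + Fr x m) + C)"
    by (intro tendsto_intros lim)
  from lim_imp_Liminf[OF sequentially_bot this]
  have "ennreal ((- (w \<bullet> \<xi>) - m * H x \<xi> + Fr x m) + C) = liminf (\<lambda>n. ennreal ((- (wn n \<bullet> \<xi>) - mn n * H x \<xi> + Fr x (mn n)) + C))" ..
  also have "\<dots> \<le> liminf (\<lambda>n. ennreal (lv n + C))"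
    by (rule Liminf_mono) (use le in \<open>auto simp: L_le_iff intro!: ennreal_leI always_eventually\<close>)
  also have "\<dots> = ennreal (enn2real (liminf (\<lambda>n. ennreal (lv n + C))))"
    using fin by (simp add: less_top)
  finally have "(- (w \<bullet> \<xi>) - m * H x \<xi> + Fr x m) + C \<le> enn2real (liminf (\<lambda>n. ennreal (lv n + C)))"
    by (simp add: ennreal_le_iff)
  then show "- (w \<bullet> \<xi>) - m * H x \<xi> + Fr x m \<le> enn2real (liminf (\<lambda>n. ennreal (lv n + C))) - C" by simp
qed

text \<open>
  By continuity in \<open>\<xi>\<close> the supremum may be taken over a countable dense set.
\<close>
lemma L_measurable:
  assumes m: "m \<in> borel_measurable (cyl T)" and w: "w \<in> borel_measurable (cyl T)" and nn: "\<And>z. 0 \<le> m z"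
  shows "(\<lambda>z. L (snd z) (m z) (w z)) \<in> borel_measurable (cyl T)"
proof -
  obtain D :: "(real ^ 'd) set" where D: "countable D" "\<And>X. open X \<Longrightarrow> X \<noteq> {} \<Longrightarrow> \<exists>d\<in>D. d \<in> X"
    by (rule countable_dense_setE) blast
  have PD: "P x m w = (SUP \<xi>\<in>D. ereal (- (w \<bullet> \<xi>) - m * H x \<xi>))" for x m w
    unfolding P_def
  proof (rule antisym)
    show "(SUP \<xi>. ereal (- (w \<bullet> \<xi>) - m * H x \<xi>)) \<le> (SUP \<xi>\<in>D. ereal (- (w \<bullet> \<xi>) - m * H x \<xi>))"
    proof (rule SUP_least)
      fix \<xi>
      define S where "S = (SUP \<xi>\<in>D. ereal (- (w \<bullet> \<xi>) - m * H x \<xi>))"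
      show "ereal (- (w \<bullet> \<xi>) - m * H x \<xi>) \<le> S"
      proof (rule ccontr)
        assume "\<not> ?thesis"
        then have "\<xi> \<in> {\<eta>. S < ereal (- (w \<bullet> \<eta>) - m * H x \<eta>)}" by simp
        moreover have "open {\<eta>. S < ereal (- (w \<bullet> \<eta>) - m * H x \<eta>)}"
          by (intro open_Collect_less continuous_on_ereal continuous_intros H_cont_xi)
        ultimately obtain d where d: "d \<in> D" "S < ereal (- (w \<bullet> d) - m * H x d)" using D(2) by blast
        have "ereal (- (w \<bullet> d) - m * H x d) \<le> S" unfolding S_def by (rule SUP_upper[OF d(1)])
        then show False using d(2) by simp
      qed
    qed
  qed (rule SUP_subset_mono, auto)
  have Hm: "(\<lambda>z. H (snd z) \<xi>) \<in> borel_measurable (cyl T)" for \<xi>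
  proof -
    have "continuous_on UNIV (\<lambda>x. H x \<xi>)"
      by (rule continuous_on_compose2[OF H_continuous, of UNIV "\<lambda>x. (x, \<xi>)", simplified])
         (auto intro!: continuous_on_Pair continuous_on_id continuous_on_const)
    then show ?thesis by (intro measurable_snd_cyl measurable_torus_cont)
  qed
  have sm: "snd \<in> borel_measurable (cyl T)" by (intro measurable_cyl_borel borel_measurable_continuous_onI continuous_intros)
  have "continuous_on UNIV (\<lambda>p. Fr (fst p) (max (snd p) 0))"
    by (rule continuous_on_compose2[OF Fr_cont[unfolded case_prod_beta'], of _ "\<lambda>p. (fst p, max (snd p) 0)", simplified])
       (auto intro!: continuous_intros)
  then have "(\<lambda>p. Fr (fst p) (max (snd p) 0)) \<in> borel_measurable borel" by (rule borel_measurable_continuous_onI)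
  from measurable_compose[OF borel_measurable_Pair[OF sm m] this]
  have Fm: "(\<lambda>z. Fr (snd z) (m z)) \<in> borel_measurable (cyl T)" by (simp add: max_absorb1[OF nn])
  have "(\<lambda>z. (SUP \<xi>\<in>D. ereal (- (w z \<bullet> \<xi>) - m z * H (snd z) \<xi>)) + ereal (Fr (snd z) (m z))) \<in> borel_measurable (cyl T)"
    using m w Hm Fm D(1) by (intro borel_measurable_ereal_add borel_measurable_SUP borel_measurable_ereal) auto
  then show ?thesis unfolding L_def PD .
qed

end

section \<open>L1 limits along directed families of convex sets\<close>

text \<open>
  A strictly convex function of linear growth; its integral is the functional that selects a limit
  point below.
\<close>
definition bracket :: "'b::real_inner \<Rightarrow> real" where
  "bracket u = sqrt (1 + (norm u)\<^sup>2)"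

lemma bracket_ge1: "1 \<le> bracket u"
  by (simp add: bracket_def)

lemma bracket_norm: "norm u \<le> bracket u"
  unfolding bracket_def by (rule real_le_rsqrt) simp

lemma bracket_sq: "(bracket u)\<^sup>2 = 1 + u \<bullet> u"
  by (simp add: bracket_def add_nonneg_nonneg power2_norm_eq_inner)

lemma bracket_cont: "continuous_on UNIV bracket"
  unfolding bracket_def by (intro continuous_intros)

definition gap :: "'b::real_inner \<Rightarrow> 'b \<Rightarrow> real" where
  "gap u v = (bracket u + bracket v) / 2 - bracket ((u + v) /\<^sub>R 2)"

text \<open>
  With \<open>U\<close>, \<open>V\<close> the brackets of \<open>u\<close>, \<open>v\<close> and \<open>N\<close> twice the bracket of the midpoint,
  \<open>(U + V)\<^sup>2 - N\<^sup>2 = 2 (U V - 1 - u \<bullet> v)\<close>, and \<open>(U V)\<^sup>2 - (1 + u \<bullet> v)\<^sup>2\<close> is \<open>|u - v|\<^sup>2\<close> plus the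
  nonnegative defect in the inequality of Cauchy and Schwarz.
\<close>
lemma gap_lower:
  "(norm (u - v))\<^sup>2 \<le> 4 * bracket u * bracket v * (bracket u + bracket v) * gap u v" "0 \<le> gap u v"
proof -
  define U V N where "U = bracket u" and "V = bracket v" and "N = 2 * bracket ((u + v) /\<^sub>R 2)"
  have UV: "1 \<le> U" "1 \<le> V" "0 \<le> N"
    using bracket_ge1[of u] bracket_ge1[of v] bracket_ge1[of "(u + v) /\<^sub>R 2"] by (auto simp: U_def V_def N_def)
  have U2: "U\<^sup>2 = 1 + u \<bullet> u" "V\<^sup>2 = 1 + v \<bullet> v" by (simp_all add: U_def V_def bracket_sq)
  have "N\<^sup>2 = 4 * (bracket ((u + v) /\<^sub>R 2))\<^sup>2" by (simp add: N_def power_mult_distrib)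
  also have "\<dots> = 4 + (u + v) \<bullet> (u + v)" by (simp add: bracket_sq)
  finally have N2: "N\<^sup>2 = 4 + (u + v) \<bullet> (u + v)" .
  define A where "A = U * V - 1 - u \<bullet> v"
  have CS: "(u \<bullet> v)\<^sup>2 \<le> (u \<bullet> u) * (v \<bullet> v)" by (rule Cauchy_Schwarz_ineq)
  have D: "(norm (u - v))\<^sup>2 = u \<bullet> u + v \<bullet> v - 2 * (u \<bullet> v)"
    by (simp add: power2_norm_eq_inner inner_diff_left inner_diff_right inner_commute)
  have "(U * V)\<^sup>2 = (1 + u \<bullet> u) * (1 + v \<bullet> v)" by (simp add: power_mult_distrib U2)
  then have e: "(U * V)\<^sup>2 - (1 + u \<bullet> v)\<^sup>2 = (norm (u - v))\<^sup>2 + ((u \<bullet> u) * (v \<bullet> v) - (u \<bullet> v)\<^sup>2)"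
    unfolding D by (simp add: power2_eq_square algebra_simps)
  have le: "(1 + u \<bullet> v)\<^sup>2 \<le> (U * V)\<^sup>2"
    using e CS zero_le_power2[of "norm (u - v)"] by linarith
  have UV0: "0 \<le> U * V" using UV by simp
  have B: "\<bar>1 + u \<bullet> v\<bar> \<le> U * V"
    using iffD2[OF abs_le_square_iff le] unfolding abs_of_nonneg[OF UV0] .
  have A0: "0 \<le> A" using B by (simp add: A_def)
  have "A * (U * V + (1 + u \<bullet> v)) = (U * V)\<^sup>2 - (1 + u \<bullet> v)\<^sup>2"
    by (simp add: A_def power2_eq_square algebra_simps)
  then have "(norm (u - v))\<^sup>2 \<le> A * (U * V + (1 + u \<bullet> v))" using e CS by linarith
  also have "\<dots> \<le> A * (2 * (U * V))" using A0 B by (intro mult_left_mono) auto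
  finally have D1: "(norm (u - v))\<^sup>2 \<le> 2 * (U * V) * A" by (simp add: algebra_simps)
  have P: "(U + V - N) * (U + V + N) = 2 * A"
  proof -
    have "(U + V - N) * (U + V + N) = U\<^sup>2 + V\<^sup>2 + 2 * (U * V) - N\<^sup>2"
      by (simp add: power2_eq_square algebra_simps)
    then show ?thesis unfolding U2 N2 A_def by (simp add: inner_add_left inner_add_right inner_commute)
  qed
  have "0 \<le> U + V - N"
  proof (rule ccontr)
    assume "\<not> ?thesis"
    then have "(U + V - N) * (U + V + N) < 0" using UV by (intro mult_neg_pos) auto
    then show False using P A0 by simp
  qed
  note NN = this
  then show "0 \<le> gap u v" by (simp add: gap_def U_def V_def N_def)
  have "2 * A \<le> (U + V - N) * (2 * (U + V))"
    unfolding P[symmetric] using NN by (intro mult_left_mono) auto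
  then have "A \<le> (U + V) * (U + V - N)" by (simp add: algebra_simps)
  then have "2 * (U * V) * A \<le> 2 * (U * V) * ((U + V) * (U + V - N))"
    using UV by (intro mult_left_mono) auto
  also have "\<dots> = 4 * U * V * (U + V) * gap u v"
    by (simp add: gap_def U_def[symmetric] V_def[symmetric] N_def field_simps)
  finally show "(norm (u - v))\<^sup>2 \<le> 4 * bracket u * bracket v * (bracket u + bracket v) * gap u v"
    using D1 unfolding U_def V_def by linarith
qed

text \<open>
  If both brackets are at most \<open>R\<close>, the gap controls \<open>|u - v|\<^sup>2\<close>; otherwise the \<open>p\<close>-th powers
  control \<open>|u - v|\<close> with a factor that is small for large \<open>R\<close>.
\<close>
lemma gap_pointwise:
  assumes p: "1 < p" and R: "1 \<le> R" and l: "0 < l"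
  shows "norm (u - v) \<le> l + 8 * R ^ 3 / l * gap u v + 2 * R powr (1 - p) * (bracket u powr p + bracket v powr p)"
proof -
  define W where "W = max (bracket u) (bracket v)"
  have W1: "1 \<le> W" using bracket_ge1[of u] by (simp add: W_def)
  have B0: "0 \<le> bracket u powr p + bracket v powr p" by simp
  show ?thesis
  proof (cases "W \<le> R")
    case True
    have b: "bracket u \<le> R" "bracket v \<le> R" using True by (auto simp: W_def)
    have p0: "0 \<le> bracket u" "0 \<le> bracket v" using bracket_ge1[of u] bracket_ge1[of v] by auto
    have "4 * bracket u * bracket v * (bracket u + bracket v) \<le> 4 * R * R * (R + R)"
      using b p0 R by (intro mult_mono add_mono mult_nonneg_nonneg add_nonneg_nonneg) auto
    then have "4 * bracket u * bracket v * (bracket u + bracket v) * gap u v \<le> 4 * R * R * (R + R) * gap u v"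
      by (rule mult_right_mono[OF _ gap_lower(2)])
    then have sq: "(norm (u - v))\<^sup>2 \<le> 8 * R ^ 3 * gap u v"
      using gap_lower(1)[of u v] by (simp add: power3_eq_cube algebra_simps)
    have "norm (u - v) \<le> l + (norm (u - v))\<^sup>2 / l"
    proof (cases "norm (u - v) \<le> l")
      case False
      then have "l * norm (u - v) \<le> norm (u - v) * norm (u - v)" by (intro mult_right_mono) auto
      then have "norm (u - v) \<le> (norm (u - v))\<^sup>2 / l" using l by (simp add: le_divide_eq power2_eq_square mult.commute)
      then show ?thesis using l by linarith
    qed (use l in \<open>simp add: add_increasing2\<close>)
    also have "\<dots> \<le> l + 8 * R ^ 3 * gap u v / l" using sq l by (simp add: divide_right_mono)
    finally show ?thesis using B0 R by (simp add: add_increasing2)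
  next
    case False
    have "norm (u - v) \<le> norm u + norm v" by (rule norm_triangle_ineq4)
    also have "\<dots> \<le> 2 * W" using bracket_norm[of u] bracket_norm[of v] by (simp add: W_def)
    also have "W = W powr (1 - p) * W powr p" using W1 powr_add[of W "1 - p" p] by simp
    also have "2 * \<dots> \<le> 2 * (R powr (1 - p) * (bracket u powr p + bracket v powr p))"
    proof -
      have "W powr (1 - p) \<le> R powr (1 - p)" using False R p by (intro powr_mono2') auto
      moreover have "W powr p \<le> bracket u powr p + bracket v powr p" by (auto simp: W_def max_def)
      ultimately show ?thesis by (intro mult_left_mono mult_mono) auto
    qed
    finally have "norm (u - v) \<le> 2 * R powr (1 - p) * (bracket u powr p + bracket v powr p)" by simp
    moreover have "0 \<le> 8 * R ^ 3 / l * gap u v" using R l gap_lower(2)[of u v] by simp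
    ultimately show ?thesis using l by linarith
  qed
qed

text \<open>
  The limit along an almost everywhere convergent subsequence is the limit in L1, by Fatou's lemma.
\<close>
lemma L1_complete:
  fixes s :: "nat \<Rightarrow> 'a \<Rightarrow> 'b::euclidean_space"
  assumes int: "\<And>n. integrable M (s n)"
    and cau: "\<And>e. 0 < e \<Longrightarrow> \<exists>N. \<forall>i\<ge>N. \<forall>j\<ge>N. (\<integral>z. norm (s i z - s j z) \<partial>M) < e"
  shows "\<exists>u. integrable M u \<and> (\<lambda>n. \<integral>z. norm (s n z - u z) \<partial>M) \<longlonglongrightarrow> 0"
proof -
  obtain r where r: "strict_mono r" "AE z in M. Cauchy (\<lambda>i. s (r i) z)"
    using cauchy_L1_AE_cauchy_subseq[OF int cau] by blast
  define u where "u z = lim (\<lambda>i. s (r i) z)" for z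
  have sm [measurable]: "s n \<in> borel_measurable M" for n using int by auto
  have um [measurable]: "u \<in> borel_measurable M"
    unfolding u_def by (rule borel_measurable_lim_metric) simp
  have lim: "AE z in M. (\<lambda>i. s (r i) z) \<longlonglongrightarrow> u z"
    using r(2) by eventually_elim (simp add: u_def Cauchy_convergent_iff convergent_LIMSEQ_iff)
  have nb: "(\<integral>\<^sup>+z. norm (s n z - u z) \<partial>M) \<le> ennreal e" if N: "\<And>i j. N \<le> i \<Longrightarrow> N \<le> j \<Longrightarrow> (\<integral>z. norm (s i z - s j z) \<partial>M) < e" and n: "N \<le> n" for N n e
  proof -
    have "(\<integral>\<^sup>+z. norm (s n z - u z) \<partial>M) = (\<integral>\<^sup>+z. liminf (\<lambda>i. ennreal (norm (s n z - s (r i) z))) \<partial>M)"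
    proof (rule nn_integral_cong_AE)
      show "AE z in M. ennreal (norm (s n z - u z)) = liminf (\<lambda>i. ennreal (norm (s n z - s (r i) z)))"
        using lim
      proof eventually_elim
        case (elim z)
        have "(\<lambda>i. ennreal (norm (s n z - s (r i) z))) \<longlonglongrightarrow> ennreal (norm (s n z - u z))"
          by (intro tendsto_intros elim)
        from lim_imp_Liminf[OF sequentially_bot this] show ?case ..
      qed
    qed
    also have "\<dots> \<le> liminf (\<lambda>i. \<integral>\<^sup>+z. ennreal (norm (s n z - s (r i) z)) \<partial>M)"
      by (rule nn_integral_liminf) measurable
    also have "\<dots> \<le> ennreal e"
    proof (rule Liminf_le)
      show "\<forall>\<^sub>F i in sequentially. (\<integral>\<^sup>+z. ennreal (norm (s n z - s (r i) z)) \<partial>M) \<le> ennreal e"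
        unfolding eventually_sequentially
      proof (intro exI[of _ N] allI impI)
        fix i assume "N \<le> i"
        then have "N \<le> r i" using seq_suble[OF r(1), of i] by linarith
        have "(\<integral>\<^sup>+z. ennreal (norm (s n z - s (r i) z)) \<partial>M) = ennreal (\<integral>z. norm (s n z - s (r i) z) \<partial>M)"
          using int by (intro nn_integral_eq_integral) auto
        also have "\<dots> \<le> ennreal e" using N[OF n \<open>N \<le> r i\<close>] by (intro ennreal_leI) simp
        finally show "(\<integral>\<^sup>+z. ennreal (norm (s n z - s (r i) z)) \<partial>M) \<le> ennreal e" .
      qed
    qed simp
    finally show ?thesis .
  qed
  obtain N where N: "\<And>i j. N \<le> i \<Longrightarrow> N \<le> j \<Longrightarrow> (\<integral>z. norm (s i z - s j z) \<partial>M) < 1" using cau[of 1] by auto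
  have "integrable M (\<lambda>z. s N z - u z)"
  proof (rule integrableI_bounded)
    have "(\<integral>\<^sup>+z. norm (s N z - u z) \<partial>M) \<le> ennreal 1" by (rule nb[where N = N]) (auto intro: N)
    then show "(\<integral>\<^sup>+z. norm (s N z - u z) \<partial>M) < \<infinity>" by (rule le_less_trans) simp
  qed simp
  then have "integrable M (\<lambda>z. s N z - (s N z - u z))" by (rule Bochner_Integration.integrable_diff[OF int])
  moreover have "(\<lambda>z. s N z - (s N z - u z)) = u" by (simp add: fun_eq_iff)
  ultimately have ui: "integrable M u" by metis
  have "(\<lambda>n. \<integral>z. norm (s n z - u z) \<partial>M) \<longlonglongrightarrow> 0"
  proof (rule LIMSEQ_I)
    fix e :: real assume e: "0 < e"
    then obtain N where N: "\<And>i j. N \<le> i \<Longrightarrow> N \<le> j \<Longrightarrow> (\<integral>z. norm (s i z - s j z) \<partial>M) < e / 2" using cau[of "e / 2"] by auto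
    have "norm ((\<integral>z. norm (s n z - u z) \<partial>M) - 0) < e" if n: "N \<le> n" for n
    proof -
      have "ennreal (\<integral>z. norm (s n z - u z) \<partial>M) \<le> ennreal (e / 2)"
        using nb[OF N n] int ui by (subst nn_integral_eq_integral[symmetric]) auto
      then have "(\<integral>z. norm (s n z - u z) \<partial>M) \<le> e / 2" using e by simp
      then show ?thesis using e by (simp add: integral_nonneg_AE)
    qed
    then show "\<exists>N. \<forall>n\<ge>N. norm ((\<integral>z. norm (s n z - u z) \<partial>M) - 0) < e" by blast
  qed
  with ui show ?thesis by blast
qed

text \<open>
  A compactness principle without weak topologies and without countability of the family.  Let
  \<open>J\<close> be the integral of the bracket.  Its infima over the members increase along the family and are
  bounded; let \<open>as\<close> be their supremum.  If the infimum over \<open>S\<close> is almost \<open>as\<close>, then elements of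
  \<open>S\<close> at which \<open>J\<close> is almost \<open>as\<close> have a midpoint in \<open>S\<close> that cannot be much better, so their gap has a
  small integral and they are close in L1.  Near-minimisers along a decreasing sequence of such
  members converge, and for every other member the near-minimisers in its intersection with that
  sequence have the same limit.
\<close>
lemma nested_convex_L1:
  fixes \<S> :: "('a \<Rightarrow> 'b::euclidean_space) set set"
  assumes fin: "finite_measure M" and p: "1 < p"
    and ne: "\<S> \<noteq> {}" "\<And>S. S \<in> \<S> \<Longrightarrow> S \<noteq> {}"
    and dir: "\<And>S S'. S \<in> \<S> \<Longrightarrow> S' \<in> \<S> \<Longrightarrow> \<exists>S''\<in>\<S>. S'' \<subseteq> S \<inter> S'"
    and conv: "\<And>S u v. S \<in> \<S> \<Longrightarrow> u \<in> S \<Longrightarrow> v \<in> S \<Longrightarrow> (\<lambda>z. (u z + v z) /\<^sub>R 2) \<in> S"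
    and meas: "\<And>S u. S \<in> \<S> \<Longrightarrow> u \<in> S \<Longrightarrow> u \<in> borel_measurable M"
    and bd: "\<And>S u. S \<in> \<S> \<Longrightarrow> u \<in> S \<Longrightarrow> integrable M (\<lambda>z. bracket (u z) powr p) \<and> (\<integral>z. bracket (u z) powr p \<partial>M) \<le> K"
  shows "\<exists>u. integrable M u \<and> (\<forall>S\<in>\<S>. \<exists>v. (\<forall>n :: nat. v n \<in> S) \<and> (\<lambda>n. \<integral>z. norm (v n z - u z) \<partial>M) \<longlonglongrightarrow> 0)"
proof -
  interpret finite_measure M by (rule fin)
  have bm: "(\<lambda>z. bracket (u z)) \<in> borel_measurable M" if "u \<in> borel_measurable M" for u :: "'a \<Rightarrow> 'b"
    using measurable_compose[OF that borel_measurable_continuous_onI[OF bracket_cont]] .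
  have ple: "bracket x \<le> bracket x powr p" for x :: 'b
    using powr_mono[of 1 p "bracket x"] p bracket_ge1[of x] by simp
  have ib: "integrable M (\<lambda>z. bracket (u z))" "(\<integral>z. bracket (u z) \<partial>M) \<le> K" if "S \<in> \<S>" "u \<in> S" for S u
  proof -
    have i: "integrable M (\<lambda>z. bracket (u z) powr p)" "(\<integral>z. bracket (u z) powr p \<partial>M) \<le> K" using bd[OF that] by auto
    show b: "integrable M (\<lambda>z. bracket (u z))"
    proof (rule Bochner_Integration.integrable_bound[OF i(1) bm[OF meas[OF that]]])
      show "AE z in M. norm (bracket (u z)) \<le> norm (bracket (u z) powr p)"
      proof (rule AE_I2)
        fix z
        show "norm (bracket (u z)) \<le> norm (bracket (u z) powr p)"
          using ple[of "u z"] bracket_ge1[of "u z"] by simp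
      qed
    qed
    have "(\<integral>z. bracket (u z) \<partial>M) \<le> (\<integral>z. bracket (u z) powr p \<partial>M)" by (intro integral_mono b i ple)
    then show "(\<integral>z. bracket (u z) \<partial>M) \<le> K" using i by linarith
  qed
  have iu: "integrable M u" if "S \<in> \<S>" "u \<in> S" for S u
  proof (rule Bochner_Integration.integrable_bound[OF ib(1)[OF that] meas[OF that]])
    show "AE z in M. norm (u z) \<le> norm (bracket (u z))"
    proof (rule AE_I2)
      fix z show "norm (u z) \<le> norm (bracket (u z))" using bracket_norm[of "u z"] by simp
    qed
  qed
  define J where "J u = (\<integral>z. bracket (u z) \<partial>M)" for u :: "'a \<Rightarrow> 'b"
  have J0: "0 \<le> J u" for u unfolding J_def
    using bracket_ge1[THEN order_trans[OF zero_le_one]] by (intro integral_nonneg_AE) auto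
  define a where "a S = Inf (J ` S)" for S
  have bb: "bdd_below (J ` S)" for S by (rule bdd_belowI[of _ 0]) (use J0 in auto)
  have aK: "a S \<le> K" if S: "S \<in> \<S>" for S
  proof -
    obtain u where u: "u \<in> S" using ne(2)[OF S] by auto
    have "a S \<le> J u" unfolding a_def using u by (intro cInf_lower bb) auto
    also have "\<dots> \<le> K" unfolding J_def by (rule ib(2)[OF S u])
    finally show ?thesis .
  qed
  define as where "as = Sup (a ` \<S>)"
  have ba: "bdd_above (a ` \<S>)" by (rule bdd_aboveI[of _ K]) (use aK in auto)
  have a_le: "a S \<le> as" if "S \<in> \<S>" for S unfolding as_def using that by (intro cSup_upper ba) auto
  have near: "\<exists>u\<in>S. J u \<le> as + \<delta>" if S: "S \<in> \<S>" and d: "0 < \<delta>" for S \<delta>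
  proof -
    have "Inf (J ` S) < as + \<delta>" using a_le[OF S] d unfolding a_def by linarith
    then obtain y where "y \<in> J ` S" "y < as + \<delta>" using cInf_lessD[of "J ` S"] ne(2)[OF S] by auto
    then show ?thesis by (auto intro: less_imp_le)
  qed
  (* R makes the tail term small, l the additive term, and delta the gap term. *)
  have small: "\<exists>S\<in>\<S>. \<exists>\<delta>>0. \<forall>u\<in>S. \<forall>v\<in>S. J u \<le> as + \<delta> \<longrightarrow> J v \<le> as + \<delta> \<longrightarrow> (\<integral>z. norm (u z - v z) \<partial>M) \<le> e"
    if e: "0 < e" for e
  proof -
    obtain S0 u0 where "S0 \<in> \<S>" "u0 \<in> S0" using ne by blast
    then have K0: "0 \<le> K" using ib(2)[of S0 u0] J0[of u0] unfolding J_def by linarith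
    have "((\<lambda>R. 4 * K * R powr (1 - p)) \<longlongrightarrow> 4 * K * 0) at_top"
      using p by (intro tendsto_intros tendsto_neg_powr filterlim_ident) auto
    then have "\<forall>\<^sub>F R in at_top. 4 * K * R powr (1 - p) < e / 3"
      using e by (intro order_tendstoD) auto
    then have "\<forall>\<^sub>F R in at_top. 1 \<le> R \<and> 4 * K * R powr (1 - p) < e / 3"
      using eventually_ge_at_top[of 1] by eventually_elim auto
    then obtain R where R: "1 \<le> R" "4 * K * R powr (1 - p) < e / 3"
      by (auto simp: eventually_at_top_linorder)
    define \<Omega> where "\<Omega> = measure M (space M)"
    define l where "l = e / (3 * (\<Omega> + 1))"
    have O: "0 \<le> \<Omega>" by (simp add: \<Omega>_def)
    have l: "0 < l" using e O by (simp add: l_def)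
    have l2: "l * \<Omega> \<le> e / 3" using e O by (simp add: l_def field_simps)
    define \<delta> where "\<delta> = e * l / (48 * R ^ 3)"
    have d: "0 < \<delta>" using e l R by (simp add: \<delta>_def)
    have d2: "8 * R ^ 3 / l * (2 * \<delta>) = e / 3" using e l R by (simp add: \<delta>_def field_simps)
    obtain S where S: "S \<in> \<S>" "as - \<delta> < a S"
      using less_cSupD[of "a ` \<S>" "as - \<delta>"] ne(1) d unfolding as_def by auto
    have "(\<integral>z. norm (u z - v z) \<partial>M) \<le> e" if u: "u \<in> S" and v: "v \<in> S" and Ju: "J u \<le> as + \<delta>" and Jv: "J v \<le> as + \<delta>" for u v
    proof -
      define c where "c z = (u z + v z) /\<^sub>R 2" for z
      have c: "c \<in> S" unfolding c_def by (rule conv[OF S(1) u v])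
      have Jc: "as - \<delta> < J c" using S(2) cInf_lower[OF _ bb, of "J c" S] c unfolding a_def by auto
      have gi: "integrable M (\<lambda>z. gap (u z) (v z))" and gI: "(\<integral>z. gap (u z) (v z) \<partial>M) = (J u + J v) / 2 - J c"
        using ib(1)[OF S(1) u] ib(1)[OF S(1) v] ib(1)[OF S(1) c] unfolding gap_def c_def J_def by auto
      have g: "(\<integral>z. gap (u z) (v z) \<partial>M) \<le> 2 * \<delta>" using Ju Jv Jc unfolding gI by argo
      have bu: "integrable M (\<lambda>z. bracket (u z) powr p)" "(\<integral>z. bracket (u z) powr p \<partial>M) \<le> K" using bd[OF S(1) u] by auto
      have bv: "integrable M (\<lambda>z. bracket (v z) powr p)" "(\<integral>z. bracket (v z) powr p \<partial>M) \<le> K" using bd[OF S(1) v] by auto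
      have "(\<integral>z. norm (u z - v z) \<partial>M) \<le>
        (\<integral>z. l + 8 * R ^ 3 / l * gap (u z) (v z) + 2 * R powr (1 - p) * (bracket (u z) powr p + bracket (v z) powr p) \<partial>M)"
        using iu[OF S(1) u] iu[OF S(1) v] gi bu bv gap_pointwise[OF p R(1) l]
        by (intro integral_mono) auto
      also have "\<dots> = l * \<Omega> + 8 * R ^ 3 / l * (\<integral>z. gap (u z) (v z) \<partial>M)
         + 2 * R powr (1 - p) * ((\<integral>z. bracket (u z) powr p \<partial>M) + (\<integral>z. bracket (v z) powr p \<partial>M))"
        using gi bu bv by (simp add: \<Omega>_def mult.commute)
      also have "\<dots> \<le> l * \<Omega> + 8 * R ^ 3 / l * (2 * \<delta>) + 2 * R powr (1 - p) * (K + K)"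
        using g bu bv l R by (intro add_mono mult_left_mono order_refl) auto
      also have "\<dots> \<le> e" using l2 d2 R(2) by (simp add: algebra_simps)
      finally show ?thesis .
    qed
    then show ?thesis using S(1) d by blast
  qed
  have "\<forall>k. \<exists>S \<delta>. S \<in> \<S> \<and> 0 < \<delta> \<and> (\<forall>u\<in>S. \<forall>v\<in>S. J u \<le> as + \<delta> \<longrightarrow> J v \<le> as + \<delta> \<longrightarrow> (\<integral>z. norm (u z - v z) \<partial>M) \<le> (1/2) ^ k)"
  proof
    fix k :: nat
    have "0 < (1/2 :: real) ^ k" by simp
    from small[OF this] show "\<exists>S \<delta>. S \<in> \<S> \<and> 0 < \<delta> \<and> (\<forall>u\<in>S. \<forall>v\<in>S. J u \<le> as + \<delta> \<longrightarrow> J v \<le> as + \<delta> \<longrightarrow> (\<integral>z. norm (u z - v z) \<partial>M) \<le> (1/2) ^ k)"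
      by blast
  qed
  then have "\<exists>Sk \<delta>. \<forall>k. Sk k \<in> \<S> \<and> 0 < \<delta> k \<and> (\<forall>u\<in>Sk k. \<forall>v\<in>Sk k. J u \<le> as + \<delta> k \<longrightarrow> J v \<le> as + \<delta> k \<longrightarrow> (\<integral>z. norm (u z - v z) \<partial>M) \<le> (1/2) ^ k)"
    unfolding choice_iff .
  then obtain Sk \<delta> where Sk': "\<forall>k. Sk k \<in> \<S> \<and> 0 < \<delta> k \<and> (\<forall>u\<in>Sk k. \<forall>v\<in>Sk k. J u \<le> as + \<delta> k \<longrightarrow> J v \<le> as + \<delta> k \<longrightarrow> (\<integral>z. norm (u z - v z) \<partial>M) \<le> (1/2) ^ k)"
    by (elim exE)
  have Sk: "\<And>k. Sk k \<in> \<S>" "\<And>k. 0 < \<delta> k" using Sk' by auto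
  have sm: "(\<integral>z. norm (u z - v z) \<partial>M) \<le> (1/2) ^ k"
    if "u \<in> Sk k" "v \<in> Sk k" "J u \<le> as + \<delta> k" "J v \<le> as + \<delta> k" for k u v
    using Sk'[THEN spec[of _ k]] that by auto
  (* A decreasing sequence of members below the Sk, by directedness. *)
  have "\<exists>Tk. \<forall>k :: nat. (Tk k \<in> \<S> \<and> Tk k \<subseteq> Sk k) \<and> Tk (Suc k) \<subseteq> Tk k"
  proof (rule dependent_nat_choice)
    show "\<exists>x. x \<in> \<S> \<and> x \<subseteq> Sk 0" using Sk by blast
    show "\<exists>y. (y \<in> \<S> \<and> y \<subseteq> Sk (Suc n)) \<and> y \<subseteq> x" if "x \<in> \<S> \<and> x \<subseteq> Sk n" for x n
      using dir[of x "Sk (Suc n)"] that Sk by blast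
  qed
  then obtain Tk where Tk: "\<And>k. Tk k \<in> \<S>" "\<And>k. Tk k \<subseteq> Sk k" "\<And>k :: nat. Tk (Suc k) \<subseteq> Tk k" by blast
  have Tmono: "Tk k \<subseteq> Sk j" if "j \<le> k" for j k
    using lift_Suc_antimono_le[of Tk, OF Tk(3) that] Tk(2)[of j] by blast
  define d where "d k = Min (\<delta> ` {..k})" for k
  have d: "0 < d k" for k unfolding d_def using Sk(2) by (subst Min_gr_iff) auto
  have dle: "d k \<le> \<delta> j" if "j \<le> k" for j k unfolding d_def using that by (intro Min_le) auto
  have "\<forall>k. \<exists>u. u \<in> Tk k \<and> J u \<le> as + d k" using near[OF Tk(1) d] by blast
  then obtain uk where uk: "\<And>k. uk k \<in> Tk k" "\<And>k. J (uk k) \<le> as + d k" by metis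
  have close: "(\<integral>z. norm (u z - v z) \<partial>M) \<le> (1/2) ^ n"
    if "n \<le> i" "n \<le> j" "u \<in> Tk i" "v \<in> Tk j" "J u \<le> as + d i" "J v \<le> as + d j" for n i j u v
    using that Tmono[of n i] Tmono[of n j] dle[of n i] dle[of n j] by (intro sm) auto
  have "\<exists>u. integrable M u \<and> (\<lambda>n. \<integral>z. norm (uk n z - u z) \<partial>M) \<longlonglongrightarrow> 0"
  proof (rule L1_complete)
    show "integrable M (uk n)" for n by (rule iu[OF Tk(1) uk(1)])
    fix e :: real assume "0 < e"
    then obtain n where "(1/2) ^ n < e" using real_arch_pow_inv[of e "1/2"] by auto
    then show "\<exists>N. \<forall>i\<ge>N. \<forall>j\<ge>N. (\<integral>z. norm (uk i z - uk j z) \<partial>M) < e"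
      using close[OF _ _ uk(1) uk(1) uk(2) uk(2)] by (meson le_less_trans)
  qed
  then obtain u where u: "integrable M u" "(\<lambda>n. \<integral>z. norm (uk n z - u z) \<partial>M) \<longlonglongrightarrow> 0" by blast
  have "\<exists>v. (\<forall>n :: nat. v n \<in> S) \<and> (\<lambda>n. \<integral>z. norm (v n z - u z) \<partial>M) \<longlonglongrightarrow> 0" if S: "S \<in> \<S>" for S
  proof -
    (* Near-minimisers in S that also lie in Tk are close to uk in L1. *)
    have "\<forall>k. \<exists>v. v \<in> S \<and> v \<in> Tk k \<and> J v \<le> as + d k"
    proof
      fix k
      obtain W where "W \<in> \<S>" "W \<subseteq> S \<inter> Tk k" using dir[OF S Tk(1)] by blast
      then show "\<exists>v. v \<in> S \<and> v \<in> Tk k \<and> J v \<le> as + d k" using near[OF _ d, of W k] by blast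
    qed
    then obtain v where v: "\<And>k. v k \<in> S" "\<And>k. v k \<in> Tk k" "\<And>k. J (v k) \<le> as + d k" by metis
    have "(\<lambda>n. \<integral>z. norm (v n z - u z) \<partial>M) \<longlonglongrightarrow> 0"
    proof (rule tendsto_sandwich[of "\<lambda>n. 0" _ _ "\<lambda>n. (1/2) ^ n + (\<integral>z. norm (uk n z - u z) \<partial>M)"])
      show "\<forall>\<^sub>F n in sequentially. 0 \<le> (\<integral>z. norm (v n z - u z) \<partial>M)" by (simp add: integral_nonneg_AE)
      have "(\<integral>z. norm (v n z - u z) \<partial>M) \<le> (1/2) ^ n + (\<integral>z. norm (uk n z - u z) \<partial>M)" for n
      proof -
        have i: "integrable M (v n)" "integrable M (uk n)" using iu[OF Tk(1) v(2)] iu[OF Tk(1) uk(1)] by auto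
        have "(\<integral>z. norm (v n z - u z) \<partial>M) \<le> (\<integral>z. norm (v n z - uk n z) + norm (uk n z - u z) \<partial>M)"
          using i u(1) norm_triangle_ineq[of "v n z - uk n z" "uk n z - u z" for z] by (intro integral_mono) auto
        also have "\<dots> = (\<integral>z. norm (v n z - uk n z) \<partial>M) + (\<integral>z. norm (uk n z - u z) \<partial>M)" using i u(1) by simp
        also have "(\<integral>z. norm (v n z - uk n z) \<partial>M) \<le> (1/2) ^ n" by (rule close[OF order_refl order_refl v(2) uk(1) v(3) uk(2)])
        finally show ?thesis by simp
      qed
      then show "\<forall>\<^sub>F n in sequentially. (\<integral>z. norm (v n z - u z) \<partial>M) \<le> (1/2) ^ n + (\<integral>z. norm (uk n z - u z) \<partial>M)" by simp
      have "(\<lambda>n. (1/2 :: real) ^ n + (\<integral>z. norm (uk n z - u z) \<partial>M)) \<longlonglongrightarrow> 0 + 0"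
        by (intro tendsto_add u(2) LIMSEQ_power_zero) simp
      then show "(\<lambda>n. (1/2 :: real) ^ n + (\<integral>z. norm (uk n z - u z) \<partial>M)) \<longlonglongrightarrow> 0" by simp
    qed simp
    with v(1) show ?thesis by blast
  qed
  with u(1) show ?thesis by blast
qed

section \<open>The dual functional and its Galerkin approximations\<close>

text \<open>
  The theorem of Bolzano and Weierstrass for the first \<open>n\<close> coordinates, one at a time.
\<close>
lemma bounded_seq_subseq:
  fixes c :: "nat \<Rightarrow> nat \<Rightarrow> real"
  assumes R: "\<And>k i. i < n \<Longrightarrow> \<bar>c k i\<bar> \<le> R"
  shows "\<exists>s l. strict_mono (s :: nat \<Rightarrow> nat) \<and> (\<forall>i<n. (\<lambda>k. c (s k) i) \<longlonglongrightarrow> l i)"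
  using R
proof (induction n)
  case 0
  show ?case by (intro exI[of _ "\<lambda>k. k"]) (auto simp: strict_mono_def)
next
  case (Suc n)
  then obtain s l where s: "strict_mono (s :: nat \<Rightarrow> nat)" "\<And>i. i < n \<Longrightarrow> (\<lambda>k. c (s k) i) \<longlonglongrightarrow> l i" by force
  have "bounded (range (\<lambda>k. c (s k) n))" using Suc.prems[of n] by (auto simp: bounded_iff)
  then obtain l' t where t: "strict_mono (t :: nat \<Rightarrow> nat)" "((\<lambda>k. c (s k) n) \<circ> t) \<longlonglongrightarrow> l'"
    using bounded_imp_convergent_subsequence by blast
  have "(\<lambda>k. c ((s \<circ> t) k) i) \<longlonglongrightarrow> (l(n := l')) i" if i: "i < Suc n" for i
  proof (cases "i = n")
    case True then show ?thesis using t(2) by (simp add: o_def)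
  next
    case False
    then show ?thesis using LIMSEQ_subseq_LIMSEQ[OF s(2)[of i] t(1)] i by (simp add: o_def)
  qed
  moreover have "strict_mono (s \<circ> t)" by (rule strict_mono_o[OF s(1) t(1)])
  ultimately show ?case by blast
qed

lemma cont_bounded_cell:
  fixes g :: "(real ^ 'd) \<times> real \<times> (real ^ 'd) \<Rightarrow> 'b::real_normed_vector"
  assumes g: "continuous_on UNIV g"
  shows "\<exists>B. \<forall>x\<in>cell. \<forall>\<alpha> \<xi>. \<bar>\<alpha>\<bar> \<le> M \<longrightarrow> norm \<xi> \<le> M \<longrightarrow> norm (g (x, \<alpha>, \<xi>)) \<le> B"
proof -
  let ?K = "(cbox (\<chi> i. -1) (\<chi> i. 2) :: (real ^ 'd) set) \<times> ({-M..M} \<times> cball 0 M)"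
  have "compact (g ` ?K)"
    by (intro compact_continuous_image compact_Times continuous_on_subset[OF g]) auto
  then obtain B where B: "\<And>z. z \<in> ?K \<Longrightarrow> norm (g z) \<le> B"
    by (meson bounded_iff compact_imp_bounded image_eqI)
  have "norm (g (x, \<alpha>, \<xi>)) \<le> B" if "x \<in> cell" "\<bar>\<alpha>\<bar> \<le> M" "norm \<xi> \<le> M" for x \<alpha> \<xi>
    using that cell_subset_cbox by (intro B) (auto simp: abs_le_iff)
  then show ?thesis by blast
qed

lemma comp_measurable:
  fixes g :: "(real ^ 'd) \<times> real \<times> (real ^ 'd) \<Rightarrow> 'b::real_normed_vector"
  assumes g: "continuous_on UNIV g" and m: "\<alpha> \<in> borel_measurable (cyl T)" "\<xi> \<in> borel_measurable (cyl T)"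
  shows "(\<lambda>z. g (snd z, \<alpha> z, \<xi> z)) \<in> borel_measurable (cyl T)"
proof -
  have sm: "snd \<in> borel_measurable (cyl T)"
    by (intro measurable_cyl_borel borel_measurable_continuous_onI continuous_intros)
  show ?thesis
    by (rule measurable_compose[OF _ borel_measurable_continuous_onI[OF g]])
       (intro borel_measurable_Pair sm m)
qed

lemma ext_integral_real:
  assumes u: "AE z in M. u z = ereal (g z)" and g: "integrable M g"
  shows "ext_integral M u = ereal (\<integral>z. g z \<partial>M)"
proof -
  have "(\<integral>\<^sup>+z. e2ennreal (u z) \<partial>M) = (\<integral>\<^sup>+z. ennreal (g z) \<partial>M)"
    by (rule nn_integral_cong_AE) (use u in eventually_elim, simp add: ennreal.rep_eq e2ennreal_ereal)
  moreover have "(\<integral>\<^sup>+z. e2ennreal (- u z) \<partial>M) = (\<integral>\<^sup>+z. ennreal (- g z) \<partial>M)"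
    by (rule nn_integral_cong_AE) (use u in eventually_elim, simp add: e2ennreal_ereal)
  moreover have "(\<integral>\<^sup>+z. ennreal (g z) \<partial>M) \<noteq> \<infinity>" "(\<integral>\<^sup>+z. ennreal (- g z) \<partial>M) \<noteq> \<infinity>"
    using integrableD[OF g] by auto
  moreover have "enn2ereal a = ereal (enn2real a)" if "a \<noteq> \<infinity>" for a :: ennreal
    using that by (cases a) auto
  ultimately show ?thesis
    unfolding ext_integral_def using real_lebesgue_integral_def[OF g] by simp
qed

context mfg_data begin

lemma cont_Hz: "continuous_on UNIV (\<lambda>p :: (real ^ 'd) \<times> real \<times> (real ^ 'd). H (fst p) (snd (snd p)))"
  by (rule continuous_on_compose2[OF H_continuous[unfolded case_prod_beta'], of _ "\<lambda>p. (fst p, snd (snd p))", simplified])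
     (intro continuous_intros)

lemma cont_DHz: "continuous_on UNIV (\<lambda>p :: (real ^ 'd) \<times> real \<times> (real ^ 'd). DpH (fst p) (snd (snd p)))"
  by (rule continuous_on_compose2[OF DpH_cont[unfolded case_prod_beta'], of _ "\<lambda>p. (fst p, snd (snd p))", simplified])
     (intro continuous_intros)

text \<open>
  The integrand of the dual functional as a function of \<open>(x, \<alpha>, \<xi>)\<close>, where \<open>\<alpha> = - \<partial>\<^sub>t\<phi>\<close> and
  \<open>\<xi> = D\<phi>\<close>.  It is convex in \<open>(\<alpha>, \<xi>)\<close> with derivative \<open>(gm, - gw)\<close>; the functions \<open>gm\<close> and \<open>gw\<close>
  give the density and the momentum that are dual to \<open>\<phi>\<close>.
\<close>
definition gA :: "(real ^ 'd) \<times> real \<times> (real ^ 'd) \<Rightarrow> real" where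
  "gA p = Fs (fst p) (fst (snd p) + H (fst p) (snd (snd p)))"

definition gm :: "(real ^ 'd) \<times> real \<times> (real ^ 'd) \<Rightarrow> real" where
  "gm p = mstar (fst p) (fst (snd p) + H (fst p) (snd (snd p)))"

definition gw :: "(real ^ 'd) \<times> real \<times> (real ^ 'd) \<Rightarrow> real ^ 'd" where
  "gw p = - (gm p *\<^sub>R DpH (fst p) (snd (snd p)))"

lemma gA_cont: "continuous_on UNIV gA"
  unfolding gA_def
  by (rule continuous_on_compose2[OF Fs_cont[unfolded case_prod_beta'], of _ "\<lambda>p. (fst p, fst (snd p) + H (fst p) (snd (snd p)))", simplified])
     (intro continuous_intros cont_Hz)

lemma gm_cont: "continuous_on UNIV gm"
  unfolding gm_def
  by (rule continuous_on_compose2[OF mstar_cont[unfolded case_prod_beta'], of _ "\<lambda>p. (fst p, fst (snd p) + H (fst p) (snd (snd p)))", simplified])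
     (intro continuous_intros cont_Hz)

lemma gw_cont: "continuous_on UNIV gw"
  unfolding gw_def by (intro continuous_intros gm_cont cont_DHz)

text \<open>
  The subgradient inequality at \<open>(\<alpha>', \<xi>')\<close>, obtained from those of \<open>F\<^sup>*\<close> and \<open>H\<close>.
\<close>
lemma gA_diff: "gA (x, \<alpha>', \<xi>') - gA (x, \<alpha>, \<xi>) \<le> gm (x, \<alpha>', \<xi>') * (\<alpha>' - \<alpha>) - gw (x, \<alpha>', \<xi>') \<bullet> (\<xi>' - \<xi>)"
proof -
  have "gA (x, \<alpha>', \<xi>') - gA (x, \<alpha>, \<xi>) \<le> gm (x, \<alpha>', \<xi>') * ((\<alpha>' + H x \<xi>') - (\<alpha> + H x \<xi>))"
    unfolding gA_def gm_def fst_conv snd_conv by (rule Fs_ineq)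
  also have "\<dots> \<le> gm (x, \<alpha>', \<xi>') * ((\<alpha>' - \<alpha>) + DpH x \<xi>' \<bullet> (\<xi>' - \<xi>))"
  proof (rule mult_left_mono)
    have "DpH x \<xi>' \<bullet> (\<xi> - \<xi>') = - (DpH x \<xi>' \<bullet> (\<xi>' - \<xi>))" by (simp add: inner_diff_right)
    then show "(\<alpha>' + H x \<xi>') - (\<alpha> + H x \<xi>) \<le> (\<alpha>' - \<alpha>) + DpH x \<xi>' \<bullet> (\<xi>' - \<xi>)"
      using H_tangent[of x \<xi>' \<xi>] by linarith
    show "0 \<le> gm (x, \<alpha>', \<xi>')" by (simp add: gm_def mstar)
  qed
  also have "\<dots> = gm (x, \<alpha>', \<xi>') * (\<alpha>' - \<alpha>) - gw (x, \<alpha>', \<xi>') \<bullet> (\<xi>' - \<xi>)"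
    by (simp add: gw_def distrib_left)
  finally show ?thesis .
qed

lemma D\<phi>T_periodic: "periodic D\<phi>T"
  by (rule GDERIV_periodic[OF \<phi>T_grad \<phi>T_periodic])

definition A_real :: "(real \<times> (real ^ 'd) \<Rightarrow> real) \<Rightarrow> (real \<times> (real ^ 'd) \<Rightarrow> real ^ 'd) \<Rightarrow> (real ^ 'd \<Rightarrow> real) \<Rightarrow> real" where
  "A_real a b c = (\<integral>z. gA (snd z, - a z, b z) \<partial>cyl T) - (\<integral>x. c x * m0 x \<partial>torus)"

lemma comp_integrable:
  fixes g :: "(real ^ 'd) \<times> real \<times> (real ^ 'd) \<Rightarrow> 'b::{banach, second_countable_topology}"
  assumes g: "continuous_on UNIV g" and m: "\<alpha> \<in> borel_measurable (cyl T)" "\<xi> \<in> borel_measurable (cyl T)"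
    and M: "\<And>z. z \<in> space (cyl T) \<Longrightarrow> \<bar>\<alpha> z\<bar> \<le> M" "\<And>z. z \<in> space (cyl T) \<Longrightarrow> norm (\<xi> z) \<le> M"
  shows "integrable (cyl T) (\<lambda>z. g (snd z, \<alpha> z, \<xi> z))"
proof -
  obtain B where B: "\<And>x \<alpha> \<xi>. x \<in> cell \<Longrightarrow> \<bar>\<alpha>\<bar> \<le> M \<Longrightarrow> norm \<xi> \<le> M \<Longrightarrow> norm (g (x, \<alpha>, \<xi>)) \<le> B"
    using cont_bounded_cell[OF g, of M] by blast
  show ?thesis
    by (rule cyl.integrable_const_bound[where B = B, OF _ comp_measurable[OF g m]])
       (use B M in \<open>auto intro!: AE_I2 simp: space_cyl\<close>)
qed

lemma comp_dominated:
  fixes g :: "(real ^ 'd) \<times> real \<times> (real ^ 'd) \<Rightarrow> 'b::{banach, second_countable_topology}"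
  assumes g: "continuous_on UNIV g" and m: "\<And>k :: nat. \<alpha>k k \<in> borel_measurable (cyl T)" "\<And>k. \<xi>k k \<in> borel_measurable (cyl T)"
    and M: "\<And>k z. z \<in> space (cyl T) \<Longrightarrow> \<bar>\<alpha>k k z\<bar> \<le> M" "\<And>k z. z \<in> space (cyl T) \<Longrightarrow> norm (\<xi>k k z) \<le> M"
    and l: "\<And>z. z \<in> space (cyl T) \<Longrightarrow> (\<lambda>k. \<alpha>k k z) \<longlonglongrightarrow> \<alpha> z" "\<And>z. z \<in> space (cyl T) \<Longrightarrow> (\<lambda>k. \<xi>k k z) \<longlonglongrightarrow> \<xi> z"
    and ml: "\<alpha> \<in> borel_measurable (cyl T)" "\<xi> \<in> borel_measurable (cyl T)"
  shows "(\<lambda>k. \<integral>z. g (snd z, \<alpha>k k z, \<xi>k k z) \<partial>cyl T) \<longlonglongrightarrow> (\<integral>z. g (snd z, \<alpha> z, \<xi> z) \<partial>cyl T)"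
proof -
  obtain B where B: "\<And>x \<alpha> \<xi>. x \<in> cell \<Longrightarrow> \<bar>\<alpha>\<bar> \<le> M \<Longrightarrow> norm \<xi> \<le> M \<Longrightarrow> norm (g (x, \<alpha>, \<xi>)) \<le> B"
    using cont_bounded_cell[OF g, of M] by blast
  show ?thesis
  proof (rule integral_dominated_convergence[where w = "\<lambda>z. B"])
    show "(\<lambda>z. g (snd z, \<alpha> z, \<xi> z)) \<in> borel_measurable (cyl T)" by (rule comp_measurable[OF g ml])
    show "(\<lambda>z. g (snd z, \<alpha>k k z, \<xi>k k z)) \<in> borel_measurable (cyl T)" for k by (rule comp_measurable[OF g m])
    show "AE z in cyl T. norm (g (snd z, \<alpha>k k z, \<xi>k k z)) \<le> B" for k
      using B M by (intro AE_I2) (auto simp: space_cyl)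
    show "AE z in cyl T. (\<lambda>k. g (snd z, \<alpha>k k z, \<xi>k k z)) \<longlonglongrightarrow> g (snd z, \<alpha> z, \<xi> z)"
    proof (rule AE_I2)
      fix z :: "real \<times> (real ^ 'd)" assume z: "z \<in> space (cyl T)"
      have "isCont g (snd z, \<alpha> z, \<xi> z)" using g by (simp add: continuous_on_eq_continuous_at)
      then show "(\<lambda>k. g (snd z, \<alpha>k k z, \<xi>k k z)) \<longlonglongrightarrow> g (snd z, \<alpha> z, \<xi> z)"
        by (rule isCont_tendsto_compose) (intro tendsto_intros l z)
    qed
  qed simp
qed

lemma C1rep_bounds:
  assumes "C1rep T \<phi> a b"
  shows "\<exists>M\<ge>0. (\<forall>z\<in>space (cyl T). \<bar>a z\<bar> \<le> M \<and> norm (b z) \<le> M)"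
    "a \<in> borel_measurable (cyl T)" "b \<in> borel_measurable (cyl T)"
    "integrable torus (\<lambda>x. \<phi> (0, x) * m0 x)"
proof -
  obtain Ma where Ma: "Ma \<ge> 0" "\<forall>t\<in>{0..T}. \<forall>x. norm (a (t, x)) \<le> Ma"
    using periodic_bounded[OF C1repD(1)[OF assms] C1repD(4)[OF assms]] by blast
  obtain Mb where Mb: "Mb \<ge> 0" "\<forall>t\<in>{0..T}. \<forall>x. norm (b (t, x)) \<le> Mb"
    using periodic_bounded[OF C1repD(2)[OF assms] C1repD(5)[OF assms]] by blast
  show "\<exists>M\<ge>0. (\<forall>z\<in>space (cyl T). \<bar>a z\<bar> \<le> M \<and> norm (b z) \<le> M)"
    using Ma Mb by (intro exI[of _ "max Ma Mb"]) (auto simp: space_cyl le_max_iff_disj)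
  show "a \<in> borel_measurable (cyl T)" "b \<in> borel_measurable (cyl T)"
    by (rule measurable_cyl_cont C1repD[OF assms])+
  have z0: "0 \<in> {0..T}" using T by simp
  show "integrable torus (\<lambda>x. \<phi> (0, x) * m0 x)"
    using m0_periodic C1repD(3)[OF assms z0]
    by (intro integrable_torus_cont continuous_intros m0_continuous GDERIV_cont[OF C1repD(7)[OF assms z0]]) (auto simp: periodic_def)
qed

lemma A_fun_eq:
  assumes "C1rep T \<phi> a b"
  shows "A_fun T f H m0 \<phi> = ereal (A_real a b (\<lambda>x. \<phi> (0, x)))"
proof -
  obtain M where M: "\<And>z. z \<in> space (cyl T) \<Longrightarrow> \<bar>a z\<bar> \<le> M \<and> norm (b z) \<le> M" using C1rep_bounds(1)[OF assms] by blast
  have i: "integrable (cyl T) (\<lambda>z. gA (snd z, - a z, b z))"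
    using M C1rep_bounds(2,3)[OF assms] by (intro comp_integrable[OF gA_cont, where M = M]) auto
  have "ext_integral (cyl T) (\<lambda>(t, x). F_star f x (- deriv (\<lambda>s. \<phi> (s, x)) t + H x (grad (\<lambda>y. \<phi> (t, y)) x)))
      = ereal (\<integral>z. gA (snd z, - a z, b z) \<partial>cyl T)"
    by (rule ext_integral_real[OF _ i])
       (auto intro!: AE_I2 simp: space_cyl F_star_eq gA_def C1rep_deriv[OF assms])
  then show ?thesis by (simp add: A_fun_def A_real_def)
qed

text \<open>
  The continuity equation for the stationary pair \<open>(m0, 0)\<close>.
\<close>
lemma m0_balance:
  assumes "C1rep T \<phi> a b"
  shows "integrable (cyl T) (\<lambda>z. m0 (snd z) * a z)"
    "(\<integral>z. m0 (snd z) * a z \<partial>cyl T) = (\<integral>x. \<phi> (T, x) * m0 x \<partial>torus) - (\<integral>x. \<phi> (0, x) * m0 x \<partial>torus)"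
proof -
  obtain M where M: "\<And>z. z \<in> space (cyl T) \<Longrightarrow> \<bar>a z\<bar> \<le> M \<and> norm (b z) \<le> M" using C1rep_bounds(1)[OF assms] by blast
  obtain Mm where Mm: "\<And>x. norm (m0 x) \<le> Mm" using periodic_bounded_space[OF m0_continuous m0_periodic] by auto
  have mm: "(\<lambda>z. m0 (snd z)) \<in> borel_measurable (cyl T)" by (rule measurable_snd_cyl[OF measurable_torus_cont[OF m0_continuous]])
  have im: "integrable (cyl T) (\<lambda>z. m0 (snd z))"
    by (rule cyl.integrable_const_bound[where B = Mm, OF _ mm]) (use Mm in auto)
  show i: "integrable (cyl T) (\<lambda>z. m0 (snd z) * a z)"
    using M by (intro integrable_cyl_mult[OF im C1rep_bounds(2)[OF assms], where M = M]) auto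
  have z: "0 \<in> {0..T}" "T \<in> {0..T}" using T by auto
  have "(\<integral>z. m0 (snd z) * a z \<partial>cyl T) = (\<integral>x. \<integral>t. m0 x * a (t, x) \<partial>tm T \<partial>torus)"
    using cyl_fubini(3)[OF i] cyl_swap[OF i] by simp
  also have "\<dots> = (\<integral>x. \<phi> (T, x) * m0 x - \<phi> (0, x) * m0 x \<partial>torus)"
  proof (intro Bochner_Integration.integral_cong refl)
    fix x :: "real ^ 'd"
    have cc: "continuous_on {0..T} (\<lambda>s. a (s, x))"
      by (intro continuous_on_compose2[OF C1repD(1)[OF assms]] continuous_intros) auto
    have "\<phi> (T, x) - \<phi> (0, x) = (\<integral>s. indicator {0<..} s * a (s, x) \<partial>tm T)"
      by (rule FTC_tm[OF C1repD(6)[OF assms] cc z(1)])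
    also have "\<dots> = (\<integral>s. a (s, x) \<partial>tm T)" by (intro Bochner_Integration.integral_cong) auto
    finally have e: "\<phi> (T, x) - \<phi> (0, x) = (\<integral>s. a (s, x) \<partial>tm T)" .
    show "(\<integral>t. m0 x * a (t, x) \<partial>tm T) = \<phi> (T, x) * m0 x - \<phi> (0, x) * m0 x"
      unfolding integral_mult_right_zero e[symmetric] by (simp add: algebra_simps)
  qed
  also have "\<dots> = (\<integral>x. \<phi> (T, x) * m0 x \<partial>torus) - (\<integral>x. \<phi> (0, x) * m0 x \<partial>torus)"
  proof (rule Bochner_Integration.integral_diff)
    show "integrable torus (\<lambda>x. \<phi> (T, x) * m0 x)"
      using m0_periodic C1repD(3)[OF assms z(2)]
      by (intro integrable_torus_cont continuous_intros m0_continuous GDERIV_cont[OF C1repD(7)[OF assms z(2)]]) (auto simp: periodic_def)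
  qed (rule C1rep_bounds(4)[OF assms])
  finally show "(\<integral>z. m0 (snd z) * a z \<partial>cyl T) = (\<integral>x. \<phi> (T, x) * m0 x \<partial>torus) - (\<integral>x. \<phi> (0, x) * m0 x \<partial>torus)" .
qed

definition Klow :: real where
  "Klow = (\<integral>x. \<phi>T x * m0 x \<partial>torus) + CH * (\<integral>z. m0 (snd z) \<partial>cyl T) + (\<integral>z. Fr (snd z) (m0 (snd z)) \<partial>(cyl T :: (real \<times> (real ^ 'd)) measure))"

lemma m0F_integrable: "integrable (cyl T) (\<lambda>z. Fr (snd z) (m0 (snd z)))" "integrable (cyl T) (\<lambda>z. m0 (snd z))"
proof -
  have c: "continuous_on UNIV (\<lambda>p :: (real ^ 'd) \<times> real \<times> (real ^ 'd). Fr (fst p) (m0 (fst p)))"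
    by (rule continuous_on_compose2[OF Fr_cont[unfolded case_prod_beta'], of _ "\<lambda>p. (fst p, m0 (fst p))", simplified])
       (auto intro!: continuous_intros continuous_on_compose2[OF m0_continuous] simp: m0_nonneg)
  have c2: "continuous_on UNIV (\<lambda>p :: (real ^ 'd) \<times> real \<times> (real ^ 'd). m0 (fst p))"
    by (auto intro!: continuous_intros continuous_on_compose2[OF m0_continuous])
  show "integrable (cyl T) (\<lambda>z. Fr (snd z) (m0 (snd z)))"
    using comp_integrable[OF c, of "\<lambda>z. 0" "\<lambda>z. 0" 0] by simp
  show "integrable (cyl T) (\<lambda>z. m0 (snd z))"
    using comp_integrable[OF c2, of "\<lambda>z. 0" "\<lambda>z. 0" 0] by simp
qed

text \<open>
  Fenchel's inequality against the stationary pair \<open>(m0, 0)\<close>.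
\<close>
lemma A_lower:
  assumes c1: "C1rep T \<phi> a b" and e: "\<And>x. \<phi> (T, x) = \<phi>T x"
  shows "- Klow \<le> A_real a b (\<lambda>x. \<phi> (0, x))"
proof -
  obtain M where M: "\<And>z. z \<in> space (cyl T) \<Longrightarrow> \<bar>a z\<bar> \<le> M \<and> norm (b z) \<le> M" using C1rep_bounds(1)[OF c1] by blast
  have i: "integrable (cyl T) (\<lambda>z. gA (snd z, - a z, b z))"
    using M C1rep_bounds(2,3)[OF c1] by (intro comp_integrable[OF gA_cont, where M = M]) auto
  have pt: "- (m0 (snd z) * a z) - CH * m0 (snd z) - Fr (snd z) (m0 (snd z)) \<le> gA (snd z, - a z, b z)" for z
  proof -
    have "0 \<le> 1 / (r * CH) * norm (b z) powr r" using r CH by simp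
    then have "- CH \<le> H (snd z) (b z)" using H_lower[of "b z" "snd z"] by linarith
    then have "m0 (snd z) * (- CH) \<le> m0 (snd z) * H (snd z) (b z)" by (rule mult_left_mono[OF _ m0_nonneg])
    then show ?thesis
      using fenchel_young[OF m0_nonneg, of "snd z" "- a z + H (snd z) (b z)" "snd z"]
      by (simp add: gA_def algebra_simps)
  qed
  have "(\<integral>z. - (m0 (snd z) * a z) - CH * m0 (snd z) - Fr (snd z) (m0 (snd z)) \<partial>cyl T) \<le> (\<integral>z. gA (snd z, - a z, b z) \<partial>cyl T)"
    by (intro integral_mono pt i Bochner_Integration.integrable_diff integrable_minus m0_balance(1)[OF c1] m0F_integrable integrable_mult_right)
  moreover have "(\<integral>z. - (m0 (snd z) * a z) - CH * m0 (snd z) - Fr (snd z) (m0 (snd z)) \<partial>cyl T)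
     = - (\<integral>z. m0 (snd z) * a z \<partial>cyl T) - CH * (\<integral>z. m0 (snd z) \<partial>(cyl T :: (real \<times> (real ^ 'd)) measure)) - (\<integral>z. Fr (snd z) (m0 (snd z)) \<partial>cyl T)"
    using m0_balance(1)[OF c1] m0F_integrable by simp
  ultimately show ?thesis
    unfolding A_real_def Klow_def m0_balance(2)[OF c1] e by linarith
qed

lemma C1rep_const: "C1rep T (\<lambda>z. \<phi>T (snd z)) (\<lambda>z. 0) (\<lambda>z. D\<phi>T (snd z))"
  unfolding C1rep_def using \<phi>T_periodic D\<phi>T_periodic \<phi>T_grad
  by (auto intro!: continuous_intros continuous_on_compose2[OF D\<phi>T_cont] simp: periodic_def)

lemma C1rep_add_scale:
  assumes u: "C1rep T \<phi> a b" and v: "C1rep T \<psi> a' b'"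
  shows "C1rep T (\<lambda>z. \<phi> z + c * \<psi> z) (\<lambda>z. a z + c * a' z) (\<lambda>z. b z + c *\<^sub>R b' z)"
proof -
  have g: "GDERIV (\<lambda>y. \<phi> (t, y) + c * \<psi> (t, y)) x :> b (t, x) + c *\<^sub>R b' (t, x)" if t: "t \<in> {0..T}" for t x
    using GDERIV_add[OF C1repD(7)[OF u t] GDERIV_mult[OF GDERIV_const[of c] C1repD(7)[OF v t]], of x] by simp
  show ?thesis
    unfolding C1rep_def
  proof (intro conjI ballI allI)
    show "continuous_on ({0..T} \<times> UNIV) (\<lambda>z. a z + c * a' z)" "continuous_on ({0..T} \<times> UNIV) (\<lambda>z. b z + c *\<^sub>R b' z)"
      by (intro continuous_intros C1repD(1,2)[OF u] C1repD(1,2)[OF v])+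
    fix t x assume t: "t \<in> {0..T}"
    show "periodic (\<lambda>x. \<phi> (t, x) + c * \<psi> (t, x))" "periodic (\<lambda>x. a (t, x) + c * a' (t, x))" "periodic (\<lambda>x. b (t, x) + c *\<^sub>R b' (t, x))"
      using C1repD(3,4,5)[OF u t] C1repD(3,4,5)[OF v t] by (auto simp: periodic_def)
    show "((\<lambda>s. \<phi> (s, x) + c * \<psi> (s, x)) has_real_derivative a (t, x) + c * a' (t, x)) (at t within {0..T})"
      by (intro DERIV_add DERIV_cmult C1repD(6)[OF u t] C1repD(6)[OF v t])
    show "GDERIV (\<lambda>y. \<phi> (t, y) + c * \<psi> (t, y)) x :> b (t, x) + c *\<^sub>R b' (t, x)" by (rule g[OF t])
  qed
qed

definition A_set :: "real set" where
  "A_set = {A_real a b (\<lambda>x. \<phi> (0, x)) | \<phi> a b. C1rep T \<phi> a b \<and> (\<forall>x. \<phi> (T, x) = \<phi>T x)}"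

lemma A_set_lower: "y \<in> A_set \<Longrightarrow> - Klow \<le> y"
  unfolding A_set_def using A_lower by blast

lemma A_set_ne: "A_set \<noteq> {}"
proof -
  have "A_real (\<lambda>z. 0) (\<lambda>z. D\<phi>T (snd z)) (\<lambda>x. \<phi>T x) \<in> A_set"
    unfolding A_set_def
    by (intro CollectI exI[of _ "\<lambda>z. \<phi>T (snd z)"] exI[of _ "\<lambda>z. 0"] exI[of _ "\<lambda>z. D\<phi>T (snd z)"]) (simp add: C1rep_const)
  then show ?thesis by blast
qed

lemma infA_le: "C1rep T \<phi> a b \<Longrightarrow> (\<And>x. \<phi> (T, x) = \<phi>T x) \<Longrightarrow> Inf A_set \<le> A_real a b (\<lambda>x. \<phi> (0, x))"
  by (rule cInf_lower) (auto simp: A_set_def intro!: bdd_belowI[of _ "- Klow"] A_lower)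

text \<open>
  For coefficients \<open>c\<close> let \<open>\<phi> = \<phi>T + \<Sum>\<^sub>i c\<^sub>i \<psi>\<^sub>i\<close>.  A minimum point \<open>l\<close> of
  \<open>G(c) = A(\<phi>) + \<epsilon> |c|\<^sup>2\<close> exists because \<open>A\<close> is bounded below.  Its optimality conditions are the
  approximate tests for \<open>m = gm\<close>, \<open>w = gw\<close>, and Fenchel's equality expresses the energy of
  \<open>(m, w)\<close> by \<open>- A(\<phi>)\<close> and a term \<open>- 2 \<epsilon> |l|\<^sup>2\<close> of the favourable sign.
\<close>
lemma galerkin:
  fixes \<psi> a :: "nat \<Rightarrow> real \<times> (real ^ 'd) \<Rightarrow> real"
  assumes c1: "\<And>i. i < n \<Longrightarrow> C1rep T (\<psi> i) (a i) (b i)" and zT: "\<And>i x. i < n \<Longrightarrow> \<psi> i (T, x) = 0" and \<delta>: "0 < \<delta>"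
  shows "\<exists>m w lv. integrable (cyl T) m \<and> integrable (cyl T) w \<and> (\<forall>z. 0 \<le> m z) \<and> integrable (cyl T) lv \<and>
    (\<forall>z. L (snd z) (m z) (w z) \<le> ereal (lv z)) \<and>
    (\<integral>z. lv z \<partial>cyl T) + (\<integral>z. w z \<bullet> D\<phi>T (snd z) \<partial>cyl T) + (\<integral>x. \<phi>T x * m0 x \<partial>torus) \<le> - Inf A_set \<and>
    (\<forall>i<n. \<bar>(\<integral>z. m z * a i z \<partial>cyl T) + (\<integral>z. w z \<bullet> b i z \<partial>cyl T) + (\<integral>x. \<psi> i (0, x) * m0 x \<partial>torus)\<bar> \<le> \<delta>)"
proof -
  define \<gamma> where "\<gamma> i = (\<integral>x. \<psi> i (0, x) * m0 x \<partial>torus)" for i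
  define c0 where "c0 = (\<integral>x. \<phi>T x * m0 x \<partial>torus)"
  define \<alpha> where "\<alpha> c z = - (\<Sum>i<n. c i * a i z)" for c z
  define \<xi> where "\<xi> c z = D\<phi>T (snd z) + (\<Sum>i<n. c i *\<^sub>R b i z)" for c z
  define I where "I c = (\<integral>z. gA (snd z, \<alpha> c z, \<xi> c z) \<partial>cyl T)" for c
  define gl where "gl c = c0 + (\<Sum>i<n. c i * \<gamma> i)" for c
  have ab: "a i \<in> borel_measurable (cyl T)" "b i \<in> borel_measurable (cyl T)" if "i < n" for i
    using C1rep_bounds(2,3)[OF c1[OF that]] .
  have Dm: "(\<lambda>z. D\<phi>T (snd z)) \<in> borel_measurable (cyl T)" by (rule measurable_snd_cyl[OF measurable_torus_cont[OF D\<phi>T_cont]])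
  have \<alpha>m: "\<alpha> c \<in> borel_measurable (cyl T)" for c
    unfolding \<alpha>_def using ab by (intro borel_measurable_uminus borel_measurable_sum borel_measurable_times) auto
  have \<xi>m: "\<xi> c \<in> borel_measurable (cyl T)" for c
    unfolding \<xi>_def using ab Dm by (intro borel_measurable_add borel_measurable_sum borel_measurable_scaleR) auto
  have "\<forall>i. \<exists>M\<ge>0. i < n \<longrightarrow> (\<forall>z\<in>space (cyl T). \<bar>a i z\<bar> \<le> M \<and> norm (b i z) \<le> M)"
  proof
    fix i show "\<exists>M\<ge>0. i < n \<longrightarrow> (\<forall>z\<in>space (cyl T). \<bar>a i z\<bar> \<le> M \<and> norm (b i z) \<le> M)"
      by (cases "i < n") (use C1rep_bounds(1)[OF c1] in auto)
  qed
  then obtain M where M: "\<And>i. 0 \<le> M i" "\<And>i z. i < n \<Longrightarrow> z \<in> space (cyl T) \<Longrightarrow> \<bar>a i z\<bar> \<le> M i"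
    "\<And>i z. i < n \<Longrightarrow> z \<in> space (cyl T) \<Longrightarrow> norm (b i z) \<le> M i" by metis
  obtain MD where MD: "\<And>x. norm (D\<phi>T x) \<le> MD" using periodic_bounded_space[OF D\<phi>T_cont D\<phi>T_periodic] by auto
  define MR where "MR R = \<bar>MD\<bar> + (\<Sum>i<n. R * M i)" for R
  have bnd: "\<bar>\<alpha> c z\<bar> \<le> MR R" "norm (\<xi> c z) \<le> MR R" if z: "z \<in> space (cyl T)" and c: "\<And>i. i < n \<Longrightarrow> \<bar>c i\<bar> \<le> R" for c R z
  proof -
    have 1: "\<bar>\<Sum>i<n. c i * a i z\<bar> \<le> (\<Sum>i<n. R * M i)"
    proof (rule order_trans[OF sum_abs sum_mono])
      fix i assume i: "i \<in> {..<n}"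
      then show "\<bar>c i * a i z\<bar> \<le> R * M i" unfolding abs_mult
        using c[of i] M(2)[of i z] z by (intro mult_mono) (auto intro: order_trans[OF abs_ge_zero])
    qed
    then show "\<bar>\<alpha> c z\<bar> \<le> MR R" unfolding \<alpha>_def MR_def by simp
    have "norm (\<Sum>i<n. c i *\<^sub>R b i z) \<le> (\<Sum>i<n. R * M i)"
    proof (rule order_trans[OF norm_sum sum_mono])
      fix i assume i: "i \<in> {..<n}"
      then show "norm (c i *\<^sub>R b i z) \<le> R * M i" unfolding norm_scaleR
        using c[of i] M(3)[of i z] z by (intro mult_mono) (auto intro: order_trans[OF abs_ge_zero])
    qed
    then show "norm (\<xi> c z) \<le> MR R" unfolding \<xi>_def MR_def
      using norm_triangle_ineq[of "D\<phi>T (snd z)" "\<Sum>i<n. c i *\<^sub>R b i z"] MD[of "snd z"] by linarith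
  qed
  have gint: "integrable (cyl T) (\<lambda>z. g (snd z, \<alpha> c z, \<xi> c z))" if g: "continuous_on UNIV g"
    for c and g :: "(real ^ 'd) \<times> real \<times> (real ^ 'd) \<Rightarrow> 'e::{banach, second_countable_topology}"
  proof -
    have "\<bar>c i\<bar> \<le> (\<Sum>j<n. \<bar>c j\<bar>)" if "i < n" for i using that by (intro member_le_sum) auto
    then show ?thesis
      by (intro comp_integrable[OF g \<alpha>m \<xi>m, where M = "MR (\<Sum>j<n. \<bar>c j\<bar>)"] bnd) auto
  qed
  have glim: "(\<lambda>k. \<integral>z. g (snd z, \<alpha> (ck k) z, \<xi> (ck k) z) \<partial>cyl T) \<longlonglongrightarrow> (\<integral>z. g (snd z, \<alpha> l z, \<xi> l z) \<partial>cyl T)"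
    if g: "continuous_on UNIV g" and R: "\<And>k i. i < n \<Longrightarrow> \<bar>ck k i\<bar> \<le> R" and l: "\<And>i. i < n \<Longrightarrow> (\<lambda>k. ck k i) \<longlonglongrightarrow> l i"
    for ck :: "nat \<Rightarrow> nat \<Rightarrow> real" and l R and g :: "(real ^ 'd) \<times> real \<times> (real ^ 'd) \<Rightarrow> 'e::{banach, second_countable_topology}"
  proof (rule comp_dominated[OF g \<alpha>m \<xi>m _ _ _ _ \<alpha>m \<xi>m, where M = "MR R"])
    show "\<bar>\<alpha> (ck k) z\<bar> \<le> MR R" "norm (\<xi> (ck k) z) \<le> MR R" if "z \<in> space (cyl T)" for k z
      by (intro bnd that R; assumption)+
    show "(\<lambda>k. \<alpha> (ck k) z) \<longlonglongrightarrow> \<alpha> l z" "(\<lambda>k. \<xi> (ck k) z) \<longlonglongrightarrow> \<xi> l z" for z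
      unfolding \<alpha>_def \<xi>_def using l by (intro tendsto_intros; simp)+
  qed
  have comb: "C1rep T (\<lambda>z. \<phi>T (snd z) + (\<Sum>i<k. c i * \<psi> i z)) (\<lambda>z. \<Sum>i<k. c i * a i z) (\<lambda>z. D\<phi>T (snd z) + (\<Sum>i<k. c i *\<^sub>R b i z))"
    if "k \<le> n" for k c
    using that
  proof (induction k)
    case 0 then show ?case using C1rep_const by simp
  next
    case (Suc k)
    then show ?case using C1rep_add_scale[OF Suc.IH c1[of k], of "c k"] by (simp add: add.assoc)
  qed
  have i0: "integrable torus (\<lambda>x. \<phi>T x * m0 x)"
    using m0_periodic \<phi>T_periodic
    by (intro integrable_torus_cont continuous_intros m0_continuous GDERIV_cont[OF \<phi>T_grad]) (auto simp: periodic_def)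
  have Areal: "A_real (\<lambda>z. \<Sum>i<n. c i * a i z) (\<xi> c) (\<lambda>x. \<phi>T x + (\<Sum>i<n. c i * \<psi> i (0, x))) = I c - gl c" for c
  proof -
    have "(\<integral>x. (\<phi>T x + (\<Sum>i<n. c i * \<psi> i (0, x))) * m0 x \<partial>torus) = (\<integral>x. \<phi>T x * m0 x + (\<Sum>i<n. c i * (\<psi> i (0, x) * m0 x)) \<partial>torus)"
      by (simp add: distrib_right sum_distrib_right mult.assoc)
    also have "\<dots> = c0 + (\<integral>x. (\<Sum>i<n. c i * (\<psi> i (0, x) * m0 x)) \<partial>torus)"
      unfolding c0_def using C1rep_bounds(4)[OF c1]
      by (intro Bochner_Integration.integral_add i0 Bochner_Integration.integrable_sum integrable_mult_right) auto
    also have "(\<integral>x. (\<Sum>i<n. c i * (\<psi> i (0, x) * m0 x)) \<partial>torus) = (\<Sum>i<n. \<integral>x. c i * (\<psi> i (0, x) * m0 x) \<partial>torus)"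
      using C1rep_bounds(4)[OF c1]
      by (intro Bochner_Integration.integral_sum integrable_mult_right) auto
    also have "\<dots> = (\<Sum>i<n. c i * \<gamma> i)" by (simp add: \<gamma>_def)
    finally show ?thesis unfolding A_real_def I_def gl_def \<alpha>_def by simp
  qed
  have infle: "Inf A_set \<le> I c - gl c" for c
    using infA_le[OF comb[OF order_refl, of c]] zT Areal[of c] by (simp add: \<xi>_def[abs_def])
  have low: "- Klow \<le> I c - gl c" for c
    using infle[of c] cInf_greatest[OF A_set_ne A_set_lower] by linarith
  (* K bounds eps |c|^2 wherever G c is at most G 0 + 1; the choice of eps then makes (2 eps c_i)^2 at most delta^2. *)
  define K where "K = \<bar>I (\<lambda>i. 0) - gl (\<lambda>i. 0)\<bar> + 1 + \<bar>Klow\<bar>"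
  have K: "0 < K" by (simp add: K_def)
  define \<epsilon> where "\<epsilon> = \<delta>\<^sup>2 / (4 * K)"
  have e: "0 < \<epsilon>" using K \<delta> by (simp add: \<epsilon>_def)
  define G where "G c = I c - gl c + \<epsilon> * (\<Sum>i<n. (c i)\<^sup>2)" for c
  have Glow: "\<epsilon> * (\<Sum>i<n. (c i)\<^sup>2) \<le> G c + Klow" for c using low[of c] by (simp add: G_def)
  have G0: "- Klow \<le> G c" for c
  proof -
    have "0 \<le> \<epsilon> * (\<Sum>i<n. (c i)\<^sup>2)" using e by (simp add: sum_nonneg)
    then show ?thesis using low[of c] by (simp add: G_def)
  qed
  define GI where "GI = Inf (range G)"
  have bb: "bdd_below (range G)" using G0 by (intro bdd_belowI[of _ "- Klow"]) auto
  have GI_le: "GI \<le> G c" for c unfolding GI_def by (intro cInf_lower bb) auto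
  have "\<forall>k. \<exists>c. G c < GI + 1 / real (Suc k)"
  proof
    fix k
    have "Inf (range G) < GI + 1 / real (Suc k)" by (simp add: GI_def)
    from cInf_lessD[OF _ this] show "\<exists>c. G c < GI + 1 / real (Suc k)" by auto
  qed
  then obtain ck where ck: "\<And>k. G (ck k) < GI + 1 / real (Suc k)" by metis
  define R where "R = sqrt (K / \<epsilon>)"
  have sqb: "(c i)\<^sup>2 \<le> K / \<epsilon>" if i: "i < n" and c: "G c \<le> G (\<lambda>i. 0) + 1" for c i
  proof -
    have "(c i)\<^sup>2 \<le> (\<Sum>i<n. (c i)\<^sup>2)" using i by (intro member_le_sum) auto
    then have "\<epsilon> * (c i)\<^sup>2 \<le> \<epsilon> * (\<Sum>i<n. (c i)\<^sup>2)" using e by simp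
    also have "\<dots> \<le> K" using Glow[of c] c by (simp add: G_def K_def)
    finally show ?thesis using e by (simp add: le_divide_eq mult.commute)
  qed
  have ckR: "\<bar>ck k i\<bar> \<le> R" if "i < n" for k i
  proof -
    have "1 / real (Suc k) \<le> 1" by simp
    then have "G (ck k) \<le> G (\<lambda>i. 0) + 1" using ck[of k] GI_le[of "\<lambda>i. 0"] by linarith
    then show ?thesis unfolding R_def using sqb[OF that, of "ck k"] by (intro real_le_rsqrt) simp
  qed
  obtain s l where s: "strict_mono (s :: nat \<Rightarrow> nat)" "\<And>i. i < n \<Longrightarrow> (\<lambda>k. ck (s k) i) \<longlonglongrightarrow> l i"
    using bounded_seq_subseq[of n ck R] ckR by blast
  have "(\<lambda>k. I (ck (s k))) \<longlonglongrightarrow> I l"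
    unfolding I_def by (rule glim[OF gA_cont]) (rule ckR s(2), assumption)+
  then have "(\<lambda>k. G (ck (s k))) \<longlonglongrightarrow> G l"
    unfolding G_def gl_def using s(2) by (intro tendsto_intros) auto
  moreover have "(\<lambda>k. GI + 1 / real (Suc (s k))) \<longlonglongrightarrow> GI + 0"
  proof (intro tendsto_add tendsto_const)
    have "(\<lambda>k. 1 / real (Suc k)) \<longlonglongrightarrow> 0" using LIMSEQ_inverse_real_of_nat by (simp add: divide_inverse)
    from LIMSEQ_subseq_LIMSEQ[OF this s(1)] show "(\<lambda>k. 1 / real (Suc (s k))) \<longlonglongrightarrow> 0" by (simp add: o_def)
  qed
  ultimately have "G l \<le> GI + 0"
    by (rule LIMSEQ_le) (use ck in \<open>auto intro!: exI[of _ 0] less_imp_le\<close>)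
  then have lmin: "G l \<le> G c" for c using GI_le[of c] by simp
  define m where "m z = gm (snd z, \<alpha> l z, \<xi> l z)" for z
  define w where "w z = gw (snd z, \<alpha> l z, \<xi> l z)" for z
  have mi: "integrable (cyl T) m" and wi: "integrable (cyl T) w"
    unfolding m_def w_def by (intro gint gm_cont gw_cont)+
  have m0': "0 \<le> m z" for z by (simp add: m_def gm_def mstar)
  have ima: "integrable (cyl T) (\<lambda>z. m z * a i z)" if "i < n" for i
    using M(2)[OF that] by (intro integrable_cyl_mult[OF mi ab(1)[OF that], where M = "M i"])
  have iwb: "integrable (cyl T) (\<lambda>z. w z \<bullet> b i z)" if "i < n" for i
    using M(3)[OF that] by (intro integrable_cyl_inner[OF wi ab(2)[OF that], where M = "M i"])
  (* The derivative of G in direction j vanishes at l: divide the subgradient inequality by t and let t tend to 0 from both sides. *)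
  have opt: "(\<integral>z. m z * a j z \<partial>cyl T) + (\<integral>z. w z \<bullet> b j z \<partial>cyl T) + \<gamma> j = 2 * \<epsilon> * l j" if j: "j < n" for j
  proof -
    define lj where "lj t = l(j := l j + t)" for t
    define Q where "Q t = (\<integral>z. gm (snd z, \<alpha> (lj t) z, \<xi> (lj t) z) * a j z \<partial>cyl T) + (\<integral>z. gw (snd z, \<alpha> (lj t) z, \<xi> (lj t) z) \<bullet> b j z \<partial>cyl T)" for t
    have sumj: "(\<Sum>i<n. lj t i * x i) = (\<Sum>i<n. l i * x i) + t * x j" for t and x :: "nat \<Rightarrow> real"
    proof -
      have "(\<Sum>i<n. lj t i * x i) = (\<Sum>i<n. l i * x i + (if i = j then t * x j else 0))"
        by (intro sum.cong) (auto simp: lj_def distrib_right)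
      then show ?thesis using j by (simp add: sum.distrib)
    qed
    have sumjv: "(\<Sum>i<n. lj t i *\<^sub>R x i) = (\<Sum>i<n. l i *\<^sub>R x i) + t *\<^sub>R x j" for t and x :: "nat \<Rightarrow> real ^ 'd"
    proof -
      have "(\<Sum>i<n. lj t i *\<^sub>R x i) = (\<Sum>i<n. l i *\<^sub>R x i + (if i = j then t *\<^sub>R x j else 0))"
        by (intro sum.cong) (auto simp: lj_def scaleR_add_left)
      then show ?thesis using j by (simp add: sum.distrib)
    qed
    have sumsq: "(\<Sum>i<n. (lj t i)\<^sup>2) = (\<Sum>i<n. (l i)\<^sup>2) + (2 * l j * t + t\<^sup>2)" for t
    proof -
      have "(\<Sum>i<n. (lj t i)\<^sup>2) = (\<Sum>i<n. (l i)\<^sup>2 + (if i = j then 2 * l j * t + t\<^sup>2 else 0))"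
        by (intro sum.cong) (auto simp: lj_def power2_sum)
      then show ?thesis using j by (simp add: sum.distrib)
    qed
    have \<alpha>j: "\<alpha> (lj t) z = \<alpha> l z - t * a j z" for t z unfolding \<alpha>_def sumj by simp
    have \<xi>j: "\<xi> (lj t) z = \<xi> l z + t *\<^sub>R b j z" for t z unfolding \<xi>_def sumjv by simp
    have ig1: "integrable (cyl T) (\<lambda>z. gm (snd z, \<alpha> (lj t) z, \<xi> (lj t) z) * a j z)" for t
      using M(2)[OF j] by (intro integrable_cyl_mult[OF gint[OF gm_cont] ab(1)[OF j], where M = "M j"])
    have ig2: "integrable (cyl T) (\<lambda>z. gw (snd z, \<alpha> (lj t) z, \<xi> (lj t) z) \<bullet> b j z)" for t
      using M(3)[OF j] by (intro integrable_cyl_inner[OF gint[OF gw_cont] ab(2)[OF j], where M = "M j"])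
    (* The subgradient is taken at the perturbed point, so only continuity of Q at 0 is used afterwards. *)
    have ineq: "0 \<le> t * (- Q t - \<gamma> j + 2 * \<epsilon> * l j + \<epsilon> * t)" for t
    proof -
      have "I (lj t) - I l = (\<integral>z. gA (snd z, \<alpha> (lj t) z, \<xi> (lj t) z) - gA (snd z, \<alpha> l z, \<xi> l z) \<partial>cyl T)"
        unfolding I_def by (rule Bochner_Integration.integral_diff[symmetric]) (intro gint gA_cont)+
      also have "\<dots> \<le> (\<integral>z. - t * (gm (snd z, \<alpha> (lj t) z, \<xi> (lj t) z) * a j z) - t * (gw (snd z, \<alpha> (lj t) z, \<xi> (lj t) z) \<bullet> b j z) \<partial>cyl T)"
      proof (rule integral_mono)
        show "integrable (cyl T) (\<lambda>z. gA (snd z, \<alpha> (lj t) z, \<xi> (lj t) z) - gA (snd z, \<alpha> l z, \<xi> l z))"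
          by (intro Bochner_Integration.integrable_diff gint gA_cont)
        show "integrable (cyl T) (\<lambda>z. - t * (gm (snd z, \<alpha> (lj t) z, \<xi> (lj t) z) * a j z) - t * (gw (snd z, \<alpha> (lj t) z, \<xi> (lj t) z) \<bullet> b j z))"
          by (intro Bochner_Integration.integrable_diff integrable_mult_right ig1 ig2)
        fix z
        show "gA (snd z, \<alpha> (lj t) z, \<xi> (lj t) z) - gA (snd z, \<alpha> l z, \<xi> l z)
          \<le> - t * (gm (snd z, \<alpha> (lj t) z, \<xi> (lj t) z) * a j z) - t * (gw (snd z, \<alpha> (lj t) z, \<xi> (lj t) z) \<bullet> b j z)"
          using gA_diff[of "snd z" "\<alpha> (lj t) z" "\<xi> (lj t) z" "\<alpha> l z" "\<xi> l z"] by (simp add: \<alpha>j \<xi>j algebra_simps)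
      qed
      also have "\<dots> = - t * Q t" using ig1 ig2 by (simp add: Q_def algebra_simps)
      finally have "I (lj t) - I l \<le> - t * Q t" .
      moreover have "0 \<le> G (lj t) - G l" using lmin[of "lj t"] by simp
      moreover have "G (lj t) - G l = (I (lj t) - I l) - t * \<gamma> j + \<epsilon> * (2 * l j * t + t\<^sup>2)"
        unfolding G_def gl_def sumj sumsq by (simp add: algebra_simps)
      ultimately show ?thesis by (simp add: algebra_simps power2_eq_square)
    qed
    have Qlim: "(\<lambda>k. Q (u k)) \<longlonglongrightarrow> Q 0" if u: "u \<longlonglongrightarrow> 0" "\<And>k. \<bar>u k\<bar> \<le> 1" for u :: "nat \<Rightarrow> real"
    proof -
      have b1: "\<bar>lj (u k) i\<bar> \<le> (\<Sum>i<n. \<bar>l i\<bar>) + 1" if i: "i < n" for k i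
      proof -
        have "\<bar>l i\<bar> \<le> (\<Sum>i<n. \<bar>l i\<bar>)" using i by (intro member_le_sum) auto
        moreover have "\<bar>lj (u k) i\<bar> \<le> \<bar>l i\<bar> + \<bar>u k\<bar>" using abs_triangle_ineq[of "l j" "u k"] by (auto simp: lj_def)
        ultimately show ?thesis using u(2)[of k] by linarith
      qed
      have b2: "(\<lambda>k. lj (u k) i) \<longlonglongrightarrow> lj 0 i" for i
        unfolding lj_def using tendsto_add[OF tendsto_const[of "l j"] u(1)] by (cases "i = j") auto
      obtain B1 where B1: "\<And>x \<alpha> \<xi>. x \<in> cell \<Longrightarrow> \<bar>\<alpha>\<bar> \<le> MR ((\<Sum>i<n. \<bar>l i\<bar>) + 1) \<Longrightarrow> norm \<xi> \<le> MR ((\<Sum>i<n. \<bar>l i\<bar>) + 1) \<Longrightarrow> norm (gm (x, \<alpha>, \<xi>)) \<le> B1"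
        using cont_bounded_cell[OF gm_cont] by blast
      obtain B2 where B2: "\<And>x \<alpha> \<xi>. x \<in> cell \<Longrightarrow> \<bar>\<alpha>\<bar> \<le> MR ((\<Sum>i<n. \<bar>l i\<bar>) + 1) \<Longrightarrow> norm \<xi> \<le> MR ((\<Sum>i<n. \<bar>l i\<bar>) + 1) \<Longrightarrow> norm (gw (x, \<alpha>, \<xi>)) \<le> B2"
        using cont_bounded_cell[OF gw_cont] by blast
      have pl: "(\<lambda>k. g (snd z, \<alpha> (lj (u k)) z, \<xi> (lj (u k)) z)) \<longlonglongrightarrow> g (snd z, \<alpha> (lj 0) z, \<xi> (lj 0) z)"
        if "continuous_on UNIV g" for z and g :: "(real ^ 'd) \<times> real \<times> (real ^ 'd) \<Rightarrow> 'e::topological_space"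
      proof -
        have "isCont g (snd z, \<alpha> (lj 0) z, \<xi> (lj 0) z)" using that by (simp add: continuous_on_eq_continuous_at)
        moreover have "(\<lambda>k. \<alpha> (lj (u k)) z) \<longlonglongrightarrow> \<alpha> (lj 0) z" "(\<lambda>k. \<xi> (lj (u k)) z) \<longlonglongrightarrow> \<xi> (lj 0) z"
          unfolding \<alpha>_def \<xi>_def by (intro tendsto_intros b2)+
        ultimately show ?thesis by (intro isCont_tendsto_compose[of _ g] tendsto_intros)
      qed
      have "(\<lambda>k. \<integral>z. gm (snd z, \<alpha> (lj (u k)) z, \<xi> (lj (u k)) z) * a j z \<partial>cyl T) \<longlonglongrightarrow> (\<integral>z. gm (snd z, \<alpha> (lj 0) z, \<xi> (lj 0) z) * a j z \<partial>cyl T)"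
      proof (rule integral_dominated_convergence[where w = "\<lambda>z. B1 * M j"])
        show "(\<lambda>z. gm (snd z, \<alpha> (lj 0) z, \<xi> (lj 0) z) * a j z) \<in> borel_measurable (cyl T)"
          "\<And>k. (\<lambda>z. gm (snd z, \<alpha> (lj (u k)) z, \<xi> (lj (u k)) z) * a j z) \<in> borel_measurable (cyl T)"
          using ig1 by (auto intro: borel_measurable_integrable)
        show "AE z in cyl T. (\<lambda>k. gm (snd z, \<alpha> (lj (u k)) z, \<xi> (lj (u k)) z) * a j z) \<longlonglongrightarrow> gm (snd z, \<alpha> (lj 0) z, \<xi> (lj 0) z) * a j z"
          by (intro AE_I2 tendsto_intros pl gm_cont)
        show "AE z in cyl T. norm (gm (snd z, \<alpha> (lj (u k)) z, \<xi> (lj (u k)) z) * a j z) \<le> B1 * M j" for k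
        proof (rule AE_I2)
          fix z :: "real \<times> (real ^ 'd)" assume z: "z \<in> space (cyl T)"
          have "norm (gm (snd z, \<alpha> (lj (u k)) z, \<xi> (lj (u k)) z)) \<le> B1"
            using z by (intro B1 bnd[OF z] b1) (auto simp: space_cyl)
          then show "norm (gm (snd z, \<alpha> (lj (u k)) z, \<xi> (lj (u k)) z) * a j z) \<le> B1 * M j"
            using M(2)[OF j z] by (simp add: abs_mult) (intro mult_mono, auto intro: order_trans[OF abs_ge_zero])
        qed
      qed simp
      moreover have "(\<lambda>k. \<integral>z. gw (snd z, \<alpha> (lj (u k)) z, \<xi> (lj (u k)) z) \<bullet> b j z \<partial>cyl T) \<longlonglongrightarrow> (\<integral>z. gw (snd z, \<alpha> (lj 0) z, \<xi> (lj 0) z) \<bullet> b j z \<partial>cyl T)"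
      proof (rule integral_dominated_convergence[where w = "\<lambda>z. B2 * M j"])
        show "(\<lambda>z. gw (snd z, \<alpha> (lj 0) z, \<xi> (lj 0) z) \<bullet> b j z) \<in> borel_measurable (cyl T)"
          "\<And>k. (\<lambda>z. gw (snd z, \<alpha> (lj (u k)) z, \<xi> (lj (u k)) z) \<bullet> b j z) \<in> borel_measurable (cyl T)"
          using ig2 by (auto intro: borel_measurable_integrable)
        show "AE z in cyl T. (\<lambda>k. gw (snd z, \<alpha> (lj (u k)) z, \<xi> (lj (u k)) z) \<bullet> b j z) \<longlonglongrightarrow> gw (snd z, \<alpha> (lj 0) z, \<xi> (lj 0) z) \<bullet> b j z"
          by (intro AE_I2 tendsto_intros pl gw_cont)
        show "AE z in cyl T. norm (gw (snd z, \<alpha> (lj (u k)) z, \<xi> (lj (u k)) z) \<bullet> b j z) \<le> B2 * M j" for k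
        proof (rule AE_I2)
          fix z :: "real \<times> (real ^ 'd)" assume z: "z \<in> space (cyl T)"
          let ?g = "gw (snd z, \<alpha> (lj (u k)) z, \<xi> (lj (u k)) z)"
          have g: "norm ?g \<le> B2"
            using z by (intro B2 bnd[OF z] b1) (auto simp: space_cyl)
          have "norm ?g * norm (b j z) \<le> B2 * M j"
            using M(3)[OF j z] g by (intro mult_mono) (auto intro: order_trans[OF norm_ge_zero])
          then show "norm (?g \<bullet> b j z) \<le> B2 * M j" using Cauchy_Schwarz_ineq2[of ?g "b j z"] by simp
        qed
      qed simp
      ultimately show ?thesis unfolding Q_def by (rule tendsto_add)
    qed
    define E where "E t = - Q t - \<gamma> j + 2 * \<epsilon> * l j + \<epsilon> * t" for t
    have Elim: "(\<lambda>k. E (u k)) \<longlonglongrightarrow> E 0" if u: "u \<longlonglongrightarrow> 0" "\<And>k. \<bar>u k\<bar> \<le> 1" for u :: "nat \<Rightarrow> real"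
      unfolding E_def by (intro tendsto_intros Qlim[OF u] u(1))
    have u0: "(\<lambda>k. 1 / real (Suc k)) \<longlonglongrightarrow> 0" using LIMSEQ_inverse_real_of_nat by (simp add: divide_inverse)
    have "0 \<le> E (1 / real (Suc k))" for k
    proof -
      have tp: "0 < 1 / real (Suc k)" by simp
      show ?thesis using ineq[of "1 / real (Suc k)"] tp unfolding E_def[symmetric] zero_le_mult_iff by linarith
    qed
    then have E1: "0 \<le> E 0"
      using LIMSEQ_le_const[OF Elim[OF u0], of 0] by auto
    have u1: "(\<lambda>k. - (1 / real (Suc k))) \<longlonglongrightarrow> 0" using tendsto_minus[OF u0] by simp
    have "E (- (1 / real (Suc k))) \<le> 0" for k
    proof -
      have "0 \<le> - (1 / real (Suc k)) * E (- (1 / real (Suc k)))" using ineq[of "- (1 / real (Suc k))"] unfolding E_def .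
      moreover have "0 < 1 / real (Suc k)" by simp
      ultimately show ?thesis unfolding zero_le_mult_iff by linarith
    qed
    then have E2: "E 0 \<le> 0"
      using LIMSEQ_le_const2[OF Elim[OF u1], of 0] by auto
    have "lj 0 = l" by (simp add: lj_def)
    then have "Q 0 = (\<integral>z. m z * a j z \<partial>cyl T) + (\<integral>z. w z \<bullet> b j z \<partial>cyl T)" by (simp add: Q_def m_def w_def)
    then show ?thesis using E1 E2 by (simp add: E_def)
  qed
  define lv where "lv z = m z * (DpH (snd z) (\<xi> l z) \<bullet> \<xi> l z - H (snd z) (\<xi> l z)) + Fr (snd z) (m z)" for z
  have lvL: "L (snd z) (m z) (w z) \<le> ereal (lv z)" for z
  proof -
    have "P (snd z) (m z) (w z) \<le> ereal (m z * (DpH (snd z) (\<xi> l z) \<bullet> \<xi> l z - H (snd z) (\<xi> l z)))"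
      using P_attained[OF m0', of "snd z" z "\<xi> l z"] by (simp add: w_def gw_def m_def)
    then show ?thesis unfolding L_def lv_def by (metis add_right_mono plus_ereal.simps(1))
  qed
  (* Fenchel equality for F at m = mstar and for H at w = - m DpH. *)
  have lveq: "lv z = - gA (snd z, \<alpha> l z, \<xi> l z) + m z * \<alpha> l z - w z \<bullet> \<xi> l z" for z
    by (simp add: lv_def gA_def Fs_def w_def gw_def m_def gm_def algebra_simps)
  have sum1: "m z * \<alpha> l z - w z \<bullet> \<xi> l z = - (\<Sum>i<n. l i * (m z * a i z + w z \<bullet> b i z)) - w z \<bullet> D\<phi>T (snd z)" for z
    by (simp add: \<alpha>_def \<xi>_def inner_add_right inner_sum_right sum_distrib_left distrib_left sum.distrib mult.left_commute sum_negf)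
  have iwD: "integrable (cyl T) (\<lambda>z. w z \<bullet> D\<phi>T (snd z))" using MD by (intro integrable_cyl_inner[OF wi Dm]) auto
  have isum: "integrable (cyl T) (\<lambda>z. \<Sum>i<n. l i * (m z * a i z + w z \<bullet> b i z))"
    using ima iwb by (intro Bochner_Integration.integrable_sum integrable_mult_right Bochner_Integration.integrable_add) auto
  have lvf: "lv = (\<lambda>z. - gA (snd z, \<alpha> l z, \<xi> l z) - (\<Sum>i<n. l i * (m z * a i z + w z \<bullet> b i z)) - w z \<bullet> D\<phi>T (snd z))"
    using lveq sum1 by (simp add: fun_eq_iff)
  have lvi: "integrable (cyl T) lv"
    unfolding lvf by (intro Bochner_Integration.integrable_diff integrable_minus gint gA_cont isum iwD)
  have "(\<integral>z. lv z \<partial>cyl T) = - I l - (\<integral>z. (\<Sum>i<n. l i * (m z * a i z + w z \<bullet> b i z)) \<partial>cyl T) - (\<integral>z. w z \<bullet> D\<phi>T (snd z) \<partial>cyl T)"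
    unfolding lvf I_def using gint[OF gA_cont, of l] isum iwD by simp
  also have "(\<integral>z. (\<Sum>i<n. l i * (m z * a i z + w z \<bullet> b i z)) \<partial>cyl T) = (\<Sum>i<n. l i * (2 * \<epsilon> * l i - \<gamma> i))"
  proof -
    have "(\<integral>z. (\<Sum>i<n. l i * (m z * a i z + w z \<bullet> b i z)) \<partial>cyl T) = (\<Sum>i<n. \<integral>z. l i * (m z * a i z + w z \<bullet> b i z) \<partial>cyl T)"
      using ima iwb by (intro Bochner_Integration.integral_sum integrable_mult_right Bochner_Integration.integrable_add) auto
    also have "\<dots> = (\<Sum>i<n. l i * (2 * \<epsilon> * l i - \<gamma> i))"
    proof (rule sum.cong[OF refl])
      fix i assume "i \<in> {..<n}"
      then have i: "i < n" by simp
      have "(\<integral>z. m z * a i z + w z \<bullet> b i z \<partial>cyl T) = 2 * \<epsilon> * l i - \<gamma> i"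
        using ima[OF i] iwb[OF i] opt[OF i] by simp
      then show "(\<integral>z. l i * (m z * a i z + w z \<bullet> b i z) \<partial>cyl T) = l i * (2 * \<epsilon> * l i - \<gamma> i)"
        unfolding integral_mult_right_zero by simp
    qed
    finally show ?thesis .
  qed
  also have "\<dots> = 2 * \<epsilon> * (\<Sum>i<n. (l i)\<^sup>2) - (\<Sum>i<n. l i * \<gamma> i)"
    by (simp add: right_diff_distrib sum_subtractf sum_distrib_left power2_eq_square mult.left_commute mult.assoc)
  finally have lvI: "(\<integral>z. lv z \<partial>cyl T) = - I l - (2 * \<epsilon> * (\<Sum>i<n. (l i)\<^sup>2) - (\<Sum>i<n. l i * \<gamma> i)) - (\<integral>z. w z \<bullet> D\<phi>T (snd z) \<partial>cyl T)" .
  have sq0: "0 \<le> \<epsilon> * (\<Sum>i<n. (l i)\<^sup>2)" using e by (simp add: sum_nonneg)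
  have Jle: "(\<integral>z. lv z \<partial>cyl T) + (\<integral>z. w z \<bullet> D\<phi>T (snd z) \<partial>cyl T) + (\<integral>x. \<phi>T x * m0 x \<partial>torus) \<le> - Inf A_set"
    using lvI sq0 infle[of l] unfolding gl_def c0_def by linarith
  have test: "\<bar>(\<integral>z. m z * a i z \<partial>cyl T) + (\<integral>z. w z \<bullet> b i z \<partial>cyl T) + (\<integral>x. \<psi> i (0, x) * m0 x \<partial>torus)\<bar> \<le> \<delta>" if i: "i < n" for i
  proof -
    have "(l i)\<^sup>2 \<le> K / \<epsilon>" using lmin[of "\<lambda>i. 0"] by (intro sqb[OF i]) simp
    then have "(2 * \<epsilon>)\<^sup>2 * (l i)\<^sup>2 \<le> (2 * \<epsilon>)\<^sup>2 * (K / \<epsilon>)" by (intro mult_left_mono) auto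
    also have "\<dots> = \<delta>\<^sup>2" using e K unfolding \<epsilon>_def by (simp add: power2_eq_square field_simps)
    finally have "(2 * \<epsilon> * l i)\<^sup>2 \<le> \<delta>\<^sup>2" by (simp add: power_mult_distrib)
    then have "\<bar>2 * \<epsilon> * l i\<bar> \<le> \<bar>\<delta>\<bar>" by (simp add: abs_le_square_iff)
    then show ?thesis using opt[OF i] \<delta> by (simp add: \<gamma>_def)
  qed
  show ?thesis
    by (intro exI[of _ m] exI[of _ w] exI[of _ lv] conjI allI impI mi wi m0' lvi lvL Jle test)
qed

end

section \<open>Weak duality and the family of approximate solutions\<close>

lemma test_function_K0:
  fixes \<zeta> :: "real \<times> (real ^ 'd) \<Rightarrow> real"
  assumes z: "\<zeta> \<in> test_functions T"
  shows "\<zeta> \<in> K0 T (\<lambda>_. 0)"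
proof -
  have C: "Ck k \<zeta>" for k using z by (auto simp: test_functions_def)
  have p: "periodic (\<lambda>x. \<zeta> (t, x))" for t using z by (auto simp: test_functions_def)
  have d: "(\<zeta> has_derivative frechet_derivative \<zeta> (at z)) (at z)" for z by (rule Ck_SucD(1)[OF C[of 1, unfolded One_nat_def]])
  have c: "continuous_on UNIV (\<lambda>z. frechet_derivative \<zeta> (at z) v)" for v
    using Ck_SucD(2)[OF C[of 1, unfolded One_nat_def]] by simp
  define a where "a z = frechet_derivative \<zeta> (at z) (1, 0)" for z
  define b where "b z = (\<Sum>i\<in>UNIV. frechet_derivative \<zeta> (at z) (0, axis i 1) *\<^sub>R (axis i 1 :: real ^ 'd))" for z
  have ca: "continuous_on S a" for S unfolding a_def by (rule continuous_on_subset[OF c]) simp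
  have cb: "continuous_on S b" for S unfolding b_def by (intro continuous_intros continuous_on_subset[OF c]) simp
  have da: "((\<lambda>s. \<zeta> (s, x)) has_real_derivative a (t, x)) (at t within S)" for t x S
  proof -
    have "((\<lambda>s. (s, x)) has_derivative (\<lambda>h. (h, 0))) (at t within S)" by (auto intro!: derivative_eq_intros)
    from has_derivative_compose[OF this d]
    have "((\<lambda>s. \<zeta> (s, x)) has_derivative (\<lambda>h. frechet_derivative \<zeta> (at (t, x)) (h, 0))) (at t within S)" .
    moreover have "frechet_derivative \<zeta> (at (t, x)) (h, 0) = a (t, x) * h" for h
    proof -
      have "(h, 0 :: real ^ 'd) = h *\<^sub>R (1, 0)" by simp
      then show ?thesis using linear_cmul[OF has_derivative_linear[OF d[of "(t, x)"]], of h "(1, 0)"] by (simp add: a_def mult.commute)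
    qed
    ultimately show ?thesis by (simp add: has_field_derivative_def)
  qed
  have db: "GDERIV (\<lambda>y. \<zeta> (t, y)) x :> b (t, x)" for t x
  proof -
    have "((\<lambda>y. (t, y)) has_derivative (\<lambda>h. (0, h))) (at x)" by (auto intro!: derivative_eq_intros)
    from has_derivative_compose[OF this d]
    have e: "((\<lambda>y. \<zeta> (t, y)) has_derivative (\<lambda>h. frechet_derivative \<zeta> (at (t, x)) (0, h))) (at x)" .
    have lin: "linear (\<lambda>h. frechet_derivative \<zeta> (at (t, x)) (0, h))" by (rule has_derivative_linear[OF e])
    have "frechet_derivative \<zeta> (at (t, x)) (0, h) = h \<bullet> b (t, x)" for h
    proof -
      have "frechet_derivative \<zeta> (at (t, x)) (0, h) = frechet_derivative \<zeta> (at (t, x)) (0, \<Sum>i\<in>UNIV. (h $ i) *\<^sub>R axis i 1)"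
        using basis_expansion[of h] by (simp add: scalar_mult_eq_scaleR)
      also have "\<dots> = (\<Sum>i\<in>UNIV. (h $ i) * frechet_derivative \<zeta> (at (t, x)) (0, axis i 1))"
        using linear_sum[OF lin, of "\<lambda>i. (h $ i) *\<^sub>R axis i 1" UNIV] linear_cmul[OF lin] by simp
      also have "\<dots> = h \<bullet> b (t, x)"
        by (simp add: b_def inner_sum_right inner_axis mult.commute)
      finally show ?thesis .
    qed
    with e show ?thesis by (simp add: gderiv_def)
  qed
  have "\<zeta> (T, x) = 0" for x using z by (auto simp: test_functions_def)
  then show ?thesis unfolding K0_def using p ca cb da db by blast
qed

lemma ce_integral:
  assumes c1: "C1rep T \<zeta> a b" and m: "integrable (cyl T) m" and w: "integrable (cyl T) w"
  shows "(\<integral>(t, x). m (t, x) * deriv (\<lambda>s. \<zeta> (s, x)) t + w (t, x) \<bullet> grad (\<lambda>y. \<zeta> (t, y)) x \<partial>cyl T)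
     = (\<integral>z. m z * a z \<partial>cyl T) + (\<integral>z. w z \<bullet> b z \<partial>cyl T)"
    and "integrable (cyl T) (\<lambda>z. m z * a z)" and "integrable (cyl T) (\<lambda>z. w z \<bullet> b z)"
proof -
  obtain Ma where Ma: "\<And>t x. t \<in> {0..T} \<Longrightarrow> norm (a (t, x)) \<le> Ma"
    using periodic_bounded[OF C1repD(1)[OF c1] C1repD(4)[OF c1]] by blast
  obtain Mb where Mb: "\<And>t x. t \<in> {0..T} \<Longrightarrow> norm (b (t, x)) \<le> Mb"
    using periodic_bounded[OF C1repD(2)[OF c1] C1repD(5)[OF c1]] by blast
  show i1: "integrable (cyl T) (\<lambda>z. m z * a z)"
    using Ma by (intro integrable_cyl_mult[OF m measurable_cyl_cont[OF C1repD(1)[OF c1]], where M = Ma]) (auto simp: space_cyl)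
  show i2: "integrable (cyl T) (\<lambda>z. w z \<bullet> b z)"
    using Mb by (intro integrable_cyl_inner[OF w measurable_cyl_cont[OF C1repD(2)[OF c1]], where M = Mb]) (auto simp: space_cyl)
  have "(\<integral>(t, x). m (t, x) * deriv (\<lambda>s. \<zeta> (s, x)) t + w (t, x) \<bullet> grad (\<lambda>y. \<zeta> (t, y)) x \<partial>cyl T)
     = (\<integral>z. m z * a z + w z \<bullet> b z \<partial>cyl T)"
    by (intro Bochner_Integration.integral_cong) (auto simp: space_cyl C1rep_deriv[OF c1])
  then show "(\<integral>(t, x). m (t, x) * deriv (\<lambda>s. \<zeta> (s, x)) t + w (t, x) \<bullet> grad (\<lambda>y. \<zeta> (t, y)) x \<partial>cyl T)
     = (\<integral>z. m z * a z \<partial>cyl T) + (\<integral>z. w z \<bullet> b z \<partial>cyl T)"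
    using i1 i2 by simp
qed

text \<open>
  Testing with the constant monomial shows that the total mass is conserved.
\<close>
lemma K1I:
  fixes m :: "real \<times> (real ^ 'd) \<Rightarrow> real"
  assumes T: "0 < T" and m: "integrable (cyl T) m" and w: "integrable (cyl T) w" and nn: "AE z in cyl T. 0 \<le> m z"
    and ce: "continuity_equation T m0 m w" and mass: "(\<integral>x. m0 x \<partial>torus) = 1"
  shows "(m, w) \<in> K1 T m0"
proof -
  have "AE t in tm T. (\<integral>x. m (t, x) \<partial>torus) = 1"
    using flux_tmono[OF ce T m w]
  proof eventually_elim
    case (elim t)
    from elim[rule_format, of "[]"] show ?case by (simp add: mass_flux_def mass)
  qed
  then show ?thesis unfolding K1_def tm_def using m w nn ce by simp
qed

lemma K1_mid:
  fixes m :: "real \<times> (real ^ 'd) \<Rightarrow> real"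
  assumes T: "0 < T" and mass: "(\<integral>x. m0 x \<partial>torus) = 1"
    and p: "(m, w) \<in> K1 T m0" "(m', w') \<in> K1 T m0"
  shows "(\<lambda>z. (m z + m' z) / 2, \<lambda>z. (w z + w' z) /\<^sub>R 2) \<in> K1 T m0"
proof -
  have m: "integrable (cyl T) m" "integrable (cyl T) m'" and w: "integrable (cyl T) w" "integrable (cyl T) w'"
    and nn: "AE z in cyl T. 0 \<le> m z" "AE z in cyl T. 0 \<le> m' z"
    and ce: "continuity_equation T m0 m w" "continuity_equation T m0 m' w'"
    using p unfolding K1_def by auto
  have mi: "integrable (cyl T) (\<lambda>z. (m z + m' z) / 2)" using m by simp
  have wi: "integrable (cyl T) (\<lambda>z. (w z + w' z) /\<^sub>R 2)" using w by simp
  have "continuity_equation T m0 (\<lambda>z. (m z + m' z) / 2) (\<lambda>z. (w z + w' z) /\<^sub>R 2)"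
    unfolding continuity_equation_def
  proof
    fix \<zeta> :: "real \<times> (real ^ 'd) \<Rightarrow> real" assume z: "\<zeta> \<in> test_functions T"
    obtain a b where c1: "C1rep T \<zeta> a b" using K0_C1rep[OF test_function_K0[OF z] T] by blast
    define c where "c = (\<integral>x. \<zeta> (0, x) * m0 x \<partial>torus)"
    have 1: "(\<integral>z. m z * a z \<partial>cyl T) + (\<integral>z. w z \<bullet> b z \<partial>cyl T) + c = 0"
      using ce(1) z ce_integral(1)[OF c1 m(1) w(1)] unfolding continuity_equation_def c_def by auto
    have 2: "(\<integral>z. m' z * a z \<partial>cyl T) + (\<integral>z. w' z \<bullet> b z \<partial>cyl T) + c = 0"
      using ce(2) z ce_integral(1)[OF c1 m(2) w(2)] unfolding continuity_equation_def c_def by auto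
    have e1: "(\<integral>z. (m z + m' z) / 2 * a z \<partial>cyl T) = ((\<integral>z. m z * a z \<partial>cyl T) + (\<integral>z. m' z * a z \<partial>cyl T)) / 2"
    proof -
      have "(\<integral>z. (m z + m' z) / 2 * a z \<partial>cyl T) = (\<integral>z. (m z * a z + m' z * a z) / 2 \<partial>cyl T)"
        by (intro Bochner_Integration.integral_cong) (auto simp: field_simps)
      then show ?thesis using ce_integral(2)[OF c1 m(1) w(1)] ce_integral(2)[OF c1 m(2) w(2)] by simp
    qed
    have e2: "(\<integral>z. ((w z + w' z) /\<^sub>R 2) \<bullet> b z \<partial>cyl T) = ((\<integral>z. w z \<bullet> b z \<partial>cyl T) + (\<integral>z. w' z \<bullet> b z \<partial>cyl T)) / 2"
    proof -
      have "(\<integral>z. ((w z + w' z) /\<^sub>R 2) \<bullet> b z \<partial>cyl T) = (\<integral>z. (w z \<bullet> b z + w' z \<bullet> b z) / 2 \<partial>cyl T)"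
        by (intro Bochner_Integration.integral_cong) (auto simp: inner_add_left field_simps)
      then show ?thesis using ce_integral(3)[OF c1 m(1) w(1)] ce_integral(3)[OF c1 m(2) w(2)] by simp
    qed
    show "(\<integral>(t, x). (m (t, x) + m' (t, x)) / 2 * deriv (\<lambda>s. \<zeta> (s, x)) t + ((w (t, x) + w' (t, x)) /\<^sub>R 2) \<bullet> grad (\<lambda>y. \<zeta> (t, y)) x \<partial>cyl T)
      + (\<integral>x. \<zeta> (0, x) * m0 x \<partial>torus) = 0"
      unfolding ce_integral(1)[OF c1 mi wi] e1 e2 c_def[symmetric] using 1 2 by argo
  qed
  moreover have "AE z in cyl T. 0 \<le> (m z + m' z) / 2" using nn by eventually_elim simp
  ultimately show ?thesis by (intro K1I[OF T mi wi _ _ mass])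
qed

context mfg_data begin

lemma INF_A: "(INF \<phi>\<in>K0 T \<phi>T. A_fun T f H m0 \<phi>) = ereal (Inf A_set)"
proof (rule antisym)
  show "ereal (Inf A_set) \<le> (INF \<phi>\<in>K0 T \<phi>T. A_fun T f H m0 \<phi>)"
  proof (rule INF_greatest)
    fix \<phi> assume p: "\<phi> \<in> K0 T \<phi>T"
    obtain a b where c1: "C1rep T \<phi> a b" using K0_C1rep[OF p T] by blast
    have "\<phi> (T, x) = \<phi>T x" for x using p by (simp add: K0_def)
    from infA_le[OF c1 this] show "ereal (Inf A_set) \<le> A_fun T f H m0 \<phi>" by (simp add: A_fun_eq[OF c1])
  qed
  show "(INF \<phi>\<in>K0 T \<phi>T. A_fun T f H m0 \<phi>) \<le> ereal (Inf A_set)"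
  proof (rule ereal_le_epsilon2)
      fix e :: real assume "0 < e"
      then have "Inf A_set < Inf A_set + e" by simp
      from cInf_lessD[OF A_set_ne this] obtain y where y: "y \<in> A_set" "y < Inf A_set + e" by blast
      then obtain \<phi> a b where c1: "C1rep T \<phi> a b" "\<And>x. \<phi> (T, x) = \<phi>T x" "y = A_real a b (\<lambda>x. \<phi> (0, x))"
        unfolding A_set_def by blast
      have "\<phi> \<in> K0 T \<phi>T" unfolding K0_def using C1repD[OF c1(1)] c1(2)
        by (intro CollectI conjI exI[of _ a] exI[of _ b]) auto
      then have "(INF \<phi>\<in>K0 T \<phi>T. A_fun T f H m0 \<phi>) \<le> A_fun T f H m0 \<phi>" by (rule INF_lower)
      also have "\<dots> = ereal y" using A_fun_eq[OF c1(1)] c1(3) by simp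
      also have "\<dots> \<le> ereal (Inf A_set) + ereal e" using y by simp
      finally show "(INF \<phi>\<in>K0 T \<phi>T. A_fun T f H m0 \<phi>) \<le> ereal (Inf A_set) + ereal e" .
  qed
qed

text \<open>
  The terminal term of the primal functional, in the form given by \<open>terminal_value\<close>; it is affine
  in \<open>w\<close>.
\<close>
definition aff :: "(real \<times> (real ^ 'd) \<Rightarrow> real ^ 'd) \<Rightarrow> real" where
  "aff w = (\<integral>z. w z \<bullet> D\<phi>T (snd z) \<partial>cyl T) + (\<integral>x. \<phi>T x * m0 x \<partial>torus)"

lemma D\<phi>T_meas: "(\<lambda>z. D\<phi>T (snd z)) \<in> borel_measurable (cyl T)"
  by (rule measurable_snd_cyl[OF measurable_torus_cont[OF D\<phi>T_cont]])

lemma wD_integrable: assumes "integrable (cyl T) w" shows "integrable (cyl T) (\<lambda>z. w z \<bullet> D\<phi>T (snd z))"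
proof -
  obtain MD where MD: "\<And>x. norm (D\<phi>T x) \<le> MD" using periodic_bounded_space[OF D\<phi>T_cont D\<phi>T_periodic] by auto
  then show ?thesis by (intro integrable_cyl_inner[OF assms D\<phi>T_meas, where M = MD]) auto
qed

text \<open>
  Clamping \<open>m\<close> at 0 changes nothing almost everywhere on \<^const>\<open>K1\<close> and keeps the density
  measurable and bounded below everywhere.
\<close>
definition Lz :: "(real \<times> (real ^ 'd) \<Rightarrow> real) \<Rightarrow> (real \<times> (real ^ 'd) \<Rightarrow> real ^ 'd) \<Rightarrow> real \<times> (real ^ 'd) \<Rightarrow> ereal" where
  "Lz m w z = L (snd z) (max (m z) 0) (w z)"

lemma Lz_lower: "\<exists>C\<ge>0. \<forall>m w z. - ereal C \<le> Lz m w z"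
proof -
  obtain \<kappa> C where k: "0 < \<kappa>" "0 \<le> C" "\<And>x m w. 0 \<le> m \<Longrightarrow> ereal (\<kappa> * (m powr q + norm w powr pw) - C) \<le> L x m w"
    using L_coercive by blast
  have "- ereal C \<le> Lz m w z" for m w z
  proof -
    have "- C \<le> \<kappa> * (max (m z) 0 powr q + norm (w z) powr pw) - C" using k(1) by simp
    then have "ereal (- C) \<le> ereal (\<kappa> * (max (m z) 0 powr q + norm (w z) powr pw) - C)" by simp
    also have "\<dots> \<le> Lz m w z" unfolding Lz_def by (rule k(3)) simp
    finally show ?thesis by simp
  qed
  then show ?thesis using k(2) by blast
qed

lemma Lz_measurable:
  assumes "integrable (cyl T) m" "integrable (cyl T) w"
  shows "Lz m w \<in> borel_measurable (cyl T)"
  unfolding Lz_def[abs_def] using assms by (intro L_measurable) auto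

lemma B_integrand:
  assumes "(m, w) \<in> K1 T m0"
  shows "AE z in cyl T. (case z of (t, x) \<Rightarrow> kinetic H x (m (t, x)) (w (t, x)) + coupling_primitive f x (m (t, x))) = Lz m w z"
proof -
  have "AE z in cyl T. 0 \<le> m z" using assms by (simp add: K1_def)
  then show ?thesis by eventually_elim (auto simp: Lz_def L_eq max_absorb1)
qed

text \<open>
  The density is bounded below, so an integrable upper bound makes it integrable.
\<close>
lemma B_upper:
  assumes K: "(m, w) \<in> K1 T m0" and l: "integrable (cyl T) lv" "AE z in cyl T. Lz m w z \<le> ereal (lv z)"
  shows "\<exists>g. integrable (cyl T) g \<and> (AE z in cyl T. Lz m w z = ereal (g z)) \<and> B_fun T f H \<phi>T (m, w) = ereal ((\<integral>z. g z \<partial>cyl T) + aff w)"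
proof -
  have m: "integrable (cyl T) m" and w: "integrable (cyl T) w" using K by (auto simp: K1_def)
  obtain C where C: "0 \<le> C" "\<And>z. - ereal C \<le> Lz m w z" using Lz_lower by blast
  define g where "g z = real_of_ereal (Lz m w z)" for z
  have gm: "g \<in> borel_measurable (cyl T)" unfolding g_def using Lz_measurable[OF m w] by measurable
  have ae: "AE z in cyl T. Lz m w z = ereal (g z)"
    using l(2)
  proof eventually_elim
    case (elim z)
    then show ?case using C(2)[of z] by (cases "Lz m w z") (auto simp: g_def)
  qed
  have gi: "integrable (cyl T) g"
  proof (rule Bochner_Integration.integrable_bound[OF _ gm])
    show "integrable (cyl T) (\<lambda>z. \<bar>lv z\<bar> + C)" using l(1) by simp
    show "AE z in cyl T. norm (g z) \<le> norm (\<bar>lv z\<bar> + C)"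
      using ae l(2)
    proof eventually_elim
      case (elim z)
      then show ?case using C(2)[of z] C(1) by auto
    qed
  qed
  have "ext_integral (cyl T) (\<lambda>(t, x). kinetic H x (m (t, x)) (w (t, x)) + coupling_primitive f x (m (t, x))) = ereal (\<integral>z. g z \<partial>cyl T)"
    by (rule ext_integral_real[OF _ gi]) (use B_integrand[OF K] ae in \<open>eventually_elim, simp\<close>)
  then have "B_fun T f H \<phi>T (m, w) = ereal (\<integral>z. g z \<partial>cyl T) + ereal (\<integral>x. \<phi>T x \<partial>at_time T m T)"
    by (simp add: B_fun_def Let_def)
  also have "(\<integral>x. \<phi>T x \<partial>at_time T m T) = aff w"
    using terminal_value[OF T K m0_continuous m0_periodic \<phi>T_grad D\<phi>T_cont \<phi>T_periodic] by (simp add: aff_def)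
  finally show ?thesis using gi ae by auto
qed

text \<open>
  The negative part of the density is bounded, so a finite functional means an integrable density.
\<close>
lemma B_finite:
  assumes K: "(m, w) \<in> K1 T m0" and fin: "B_fun T f H \<phi>T (m, w) \<noteq> \<infinity>"
  shows "\<exists>g. integrable (cyl T) g \<and> (AE z in cyl T. Lz m w z = ereal (g z)) \<and> B_fun T f H \<phi>T (m, w) = ereal ((\<integral>z. g z \<partial>cyl T) + aff w)"
proof -
  have m: "integrable (cyl T) m" and w: "integrable (cyl T) w" using K by (auto simp: K1_def)
  obtain C where C: "0 \<le> C" "\<And>z. - ereal C \<le> Lz m w z" using Lz_lower by blast
  define u where "u = (\<lambda>(t, x). kinetic H x (m (t, x)) (w (t, x)) + coupling_primitive f x (m (t, x)))"
  have ae: "AE z in cyl T. u z = Lz m w z" using B_integrand[OF K] by (simp add: u_def)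
  have I: "ext_integral (cyl T) u \<noteq> \<infinity>"
    using fin by (auto simp: B_fun_def Let_def u_def)
  have neg: "(\<integral>\<^sup>+z. e2ennreal (- u z) \<partial>cyl T) \<noteq> \<infinity>"
  proof -
    have "(\<integral>\<^sup>+z. e2ennreal (- u z) \<partial>cyl T) \<le> (\<integral>\<^sup>+z. ennreal C \<partial>(cyl T :: (real \<times> (real ^ 'd)) measure))"
    proof (rule nn_integral_mono_AE)
      show "AE z in cyl T. e2ennreal (- u z) \<le> ennreal C"
        using ae
      proof eventually_elim
        case (elim z)
        have "- u z \<le> ereal C" using C(2)[of z] unfolding elim by (simp add: ereal_uminus_le_reorder)
        then have "e2ennreal (- u z) \<le> e2ennreal (ereal C)" by (rule e2ennreal_mono)
        then show ?case by (simp add: e2ennreal_ereal)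
      qed
    qed
    also have "\<dots> < \<infinity>" by (simp add: ennreal_mult_eq_top_iff less_top[symmetric])
    finally show ?thesis by simp
  qed
  have pos: "(\<integral>\<^sup>+z. e2ennreal (u z) \<partial>cyl T) \<noteq> \<infinity>"
  proof
    assume "(\<integral>\<^sup>+z. e2ennreal (u z) \<partial>cyl T) = \<infinity>"
    then have "ext_integral (cyl T) u = \<infinity>" unfolding ext_integral_def using neg
      by (cases "\<integral>\<^sup>+z. e2ennreal (- u z) \<partial>cyl T") auto
    with I show False by simp
  qed
  have eq: "(\<integral>\<^sup>+z. e2ennreal (u z) \<partial>cyl T) = (\<integral>\<^sup>+z. e2ennreal (Lz m w z) \<partial>cyl T)"
    by (rule nn_integral_cong_AE) (use ae in \<open>eventually_elim, simp\<close>)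
  have em: "(\<lambda>z. e2ennreal (Lz m w z)) \<in> borel_measurable (cyl T)"
    using Lz_measurable[OF m w] by measurable
  have fin2: "AE z in cyl T. e2ennreal (Lz m w z) \<noteq> \<infinity>"
    using pos unfolding eq by (intro nn_integral_PInf_AE[OF em]) auto
  define lv where "lv z = enn2real (e2ennreal (Lz m w z))" for z
  have "integrable (cyl T) lv"
  proof (rule integrableI_bounded)
    show "lv \<in> borel_measurable (cyl T)" unfolding lv_def using em by measurable
    have "(\<integral>\<^sup>+z. ennreal (norm (lv z)) \<partial>cyl T) \<le> (\<integral>\<^sup>+z. e2ennreal (Lz m w z) \<partial>cyl T)"
      unfolding lv_def by (intro nn_integral_mono) (simp add: ennreal_enn2real_if)
    then show "(\<integral>\<^sup>+z. ennreal (norm (lv z)) \<partial>cyl T) < \<infinity>" using pos unfolding eq by (auto simp: less_top[symmetric] top_unique)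
  qed
  moreover have "AE z in cyl T. Lz m w z \<le> ereal (lv z)"
    using fin2
  proof eventually_elim
    case (elim z)
    then show ?case unfolding lv_def
    proof (cases "Lz m w z")
      case (real v)
      then show "Lz m w z \<le> ereal (enn2real (e2ennreal (Lz m w z)))" by (cases "0 \<le> v") (auto simp: e2ennreal_ereal ennreal_neg)
    qed (auto simp: e2ennreal_infty)
  qed
  ultimately show ?thesis by (rule B_upper[OF K])
qed

text \<open>
  Integrate Fenchel's inequalities for \<open>F\<close> and \<open>H\<close> pointwise, and evaluate the linear terms by
  the continuity equation tested with \<open>\<phi> - \<phi>T\<close>.
\<close>
lemma weak_duality:
  assumes K: "(m, w) \<in> K1 T m0" and g: "integrable (cyl T) g" "AE z in cyl T. Lz m w z = ereal (g z)"
  shows "- Inf A_set \<le> (\<integral>z. g z \<partial>cyl T) + aff w"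
proof -
  have m: "integrable (cyl T) m" and w: "integrable (cyl T) w" and ce: "continuity_equation T m0 m w"
    and nn: "AE z in cyl T. 0 \<le> m z" using K by (auto simp: K1_def)
  have "- ((\<integral>z. g z \<partial>cyl T) + aff w) \<le> Inf A_set"
  proof (rule cInf_greatest[OF A_set_ne])
    fix y assume "y \<in> A_set"
    then obtain \<phi> a b where c1: "C1rep T \<phi> a b" and fT: "\<And>x. \<phi> (T, x) = \<phi>T x" and y: "y = A_real a b (\<lambda>x. \<phi> (0, x))"
      unfolding A_set_def by blast
    have c2: "C1rep T (\<lambda>z. \<phi> z + (-1) * \<phi>T (snd z)) (\<lambda>z. a z + (-1) * 0) (\<lambda>z. b z + (-1) *\<^sub>R D\<phi>T (snd z))"
      by (rule C1rep_add_scale[OF c1 C1rep_const])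
    have bal: "balanced T m0 m w (\<lambda>z. a z + (-1) * 0) (\<lambda>z. b z + (-1) *\<^sub>R D\<phi>T (snd z)) (\<lambda>x. \<phi> (0, x) + (-1) * \<phi>T (snd (0::real, x)))"
      by (rule cont_eq_C1[OF ce T m w m0_continuous m0_periodic c2]) (simp add: fT)
    have i1: "integrable (cyl T) (\<lambda>z. m z * a z)" and i2: "integrable (cyl T) (\<lambda>z. w z \<bullet> b z)"
      using ce_integral(2,3)[OF c1 m w] .
    have i3: "integrable torus (\<lambda>x. \<phi> (0, x) * m0 x)" by (rule C1rep_bounds(4)[OF c1])
    have i4: "integrable torus (\<lambda>x. \<phi>T x * m0 x)" using C1rep_bounds(4)[OF C1rep_const] by simp
    have iw: "integrable (cyl T) (\<lambda>z. w z \<bullet> D\<phi>T (snd z))" by (rule wD_integrable[OF w])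
    have "(\<integral>z. m z * (a z + (-1) * 0) \<partial>cyl T) + (\<integral>z. w z \<bullet> (b z + (-1) *\<^sub>R D\<phi>T (snd z)) \<partial>cyl T)
       + (\<integral>x. (\<phi> (0, x) + (-1) * \<phi>T (snd (0::real, x))) * m0 x \<partial>torus) = 0"
      using bal unfolding balanced_def by blast
    moreover have "(\<integral>z. w z \<bullet> (b z + (-1) *\<^sub>R D\<phi>T (snd z)) \<partial>cyl T) = (\<integral>z. w z \<bullet> b z \<partial>cyl T) - (\<integral>z. w z \<bullet> D\<phi>T (snd z) \<partial>cyl T)"
      using i2 iw by (simp add: inner_diff_right)
    moreover have "(\<integral>x. (\<phi> (0, x) + (-1) * \<phi>T (snd (0::real, x))) * m0 x \<partial>torus) = (\<integral>x. \<phi> (0, x) * m0 x \<partial>torus) - (\<integral>x. \<phi>T x * m0 x \<partial>torus)"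
      using i3 i4 by (simp add: left_diff_distrib)
    ultimately have E: "(\<integral>z. m z * a z \<partial>cyl T) + (\<integral>z. w z \<bullet> b z \<partial>cyl T) + (\<integral>x. \<phi> (0, x) * m0 x \<partial>torus) = aff w"
      by (simp add: aff_def)
    obtain M where M: "\<And>z. z \<in> space (cyl T) \<Longrightarrow> \<bar>a z\<bar> \<le> M \<and> norm (b z) \<le> M" using C1rep_bounds(1)[OF c1] by blast
    have i: "integrable (cyl T) (\<lambda>z. gA (snd z, - a z, b z))"
      using M C1rep_bounds(2,3)[OF c1] by (intro comp_integrable[OF gA_cont, where M = M]) auto
    have "(\<integral>z. - (m z * a z) - w z \<bullet> b z \<partial>cyl T) \<le> (\<integral>z. gA (snd z, - a z, b z) + g z \<partial>cyl T)"
    proof (rule integral_mono_AE)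
      show "integrable (cyl T) (\<lambda>z. - (m z * a z) - w z \<bullet> b z)" using i1 i2 by simp
      show "integrable (cyl T) (\<lambda>z. gA (snd z, - a z, b z) + g z)" using i g(1) by simp
      show "AE z in cyl T. - (m z * a z) - w z \<bullet> b z \<le> gA (snd z, - a z, b z) + g z"
        using g(2) nn
      proof eventually_elim
        case (elim z)
        have fy: "m z * (- a z + H (snd z) (b z)) - Fr (snd z) (m z) \<le> gA (snd z, - a z, b z)"
          unfolding gA_def using fenchel_young[OF elim(2), of "- a z + H (snd z) (b z)" "snd z"] by simp
        have "ereal (- (w z \<bullet> b z) - m z * H (snd z) (b z) + Fr (snd z) (m z)) \<le> ereal (g z)"
          using L_lower[of "w z" "b z" "m z" "snd z"] elim by (simp add: Lz_def max_absorb1)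
        then show ?case using fy by (simp add: algebra_simps)
      qed
    qed
    also have "(\<integral>z. - (m z * a z) - w z \<bullet> b z \<partial>cyl T) = - (\<integral>z. m z * a z \<partial>cyl T) - (\<integral>z. w z \<bullet> b z \<partial>cyl T)" using i1 i2 by simp
    also have "(\<integral>z. gA (snd z, - a z, b z) + g z \<partial>cyl T) = (\<integral>z. gA (snd z, - a z, b z) \<partial>cyl T) + (\<integral>z. g z \<partial>cyl T)" using i g(1) by simp
    finally show "- ((\<integral>z. g z \<partial>cyl T) + aff w) \<le> y" using E unfolding y A_real_def by linarith
  qed
  then show ?thesis by linarith
qed

text \<open>
  An energy bound controls \<open>m\<close> in \<open>L\<^sup>q\<close> and \<open>w\<close> in \<open>L\<^sup>p\<close>; the linear terminal term is absorbed by
  Young's inequality because \<open>pw > 1\<close>.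
\<close>
lemma coercive_integrals:
  "\<exists>K. \<forall>m w lv. m \<in> borel_measurable (cyl T) \<longrightarrow> integrable (cyl T) w \<longrightarrow> (\<forall>z. 0 \<le> m z) \<longrightarrow> integrable (cyl T) lv \<longrightarrow>
     (AE z in cyl T. L (snd z) (m z) (w z) \<le> ereal (lv z)) \<longrightarrow> (\<integral>z. lv z \<partial>cyl T) + aff w \<le> - Inf A_set \<longrightarrow>
     integrable (cyl T) (\<lambda>z. m z powr q) \<and> integrable (cyl T) (\<lambda>z. norm (w z) powr pw) \<and>
     (\<integral>z. m z powr q + norm (w z) powr pw \<partial>cyl T) \<le> K"
proof -
  obtain \<kappa> C where k: "0 < \<kappa>" "0 \<le> C" "\<And>x m w. 0 \<le> m \<Longrightarrow> ereal (\<kappa> * (m powr q + norm w powr pw) - C) \<le> L x m w"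
    using L_coercive by blast
  obtain MD where MD: "\<And>x. norm (D\<phi>T x) \<le> MD" using periodic_bounded_space[OF D\<phi>T_cont D\<phi>T_periodic] by auto
  have MD0: "0 \<le> MD" using MD[of 0] norm_ge_zero order_trans by blast
  obtain K1 where K1: "0 \<le> K1" "\<And>s. 0 \<le> s \<Longrightarrow> MD * s \<le> \<kappa> / 2 * s powr pw + K1"
    using young_absorb[OF pw_gt1, of "\<kappa> / 2" MD] k(1) MD0 by auto
  define \<Omega> where "\<Omega> = measure (cyl T :: (real \<times> (real ^ 'd)) measure) (space (cyl T))"
  define c0 where "c0 = (\<integral>x. \<phi>T x * m0 x \<partial>torus)"
  define K where "K = (2 / \<kappa>) * (- Inf A_set - c0 + (C + K1) * \<Omega>)"
  show ?thesis
  proof (intro exI[of _ K] allI impI)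
    fix m lv :: "real \<times> (real ^ 'd) \<Rightarrow> real" and w :: "real \<times> (real ^ 'd) \<Rightarrow> real ^ 'd"
    assume m: "m \<in> borel_measurable (cyl T)" and w: "integrable (cyl T) w" and nn: "\<forall>z. 0 \<le> m z" and li: "integrable (cyl T) lv"
      and le: "AE z in cyl T. L (snd z) (m z) (w z) \<le> ereal (lv z)" and J: "(\<integral>z. lv z \<partial>cyl T) + aff w \<le> - Inf A_set"
    have wm: "w \<in> borel_measurable (cyl T)" using w by auto
    have ae: "AE z in cyl T. \<kappa> * (m z powr q + norm (w z) powr pw) - C \<le> lv z"
      using le
    proof eventually_elim
      case (elim z)
      have "ereal (\<kappa> * (m z powr q + norm (w z) powr pw) - C) \<le> ereal (lv z)" using k(3)[of "m z" "w z" "snd z"] nn elim order_trans by blast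
      then show ?case by simp
    qed
    have bi: "integrable (cyl T) (\<lambda>z. (lv z + C) / \<kappa>)" using li by simp
    have qi: "integrable (cyl T) (\<lambda>z. m z powr q)"
    proof (rule Bochner_Integration.integrable_bound[OF bi])
      show "(\<lambda>z. m z powr q) \<in> borel_measurable (cyl T)" using m by measurable
      show "AE z in cyl T. norm (m z powr q) \<le> norm ((lv z + C) / \<kappa>)"
        using ae
      proof eventually_elim
        case (elim z)
        have "0 \<le> \<kappa> * norm (w z) powr pw" using k(1) by simp
        then have "\<kappa> * m z powr q \<le> lv z + C" using elim by (simp add: distrib_left)
        then have "m z powr q \<le> (lv z + C) / \<kappa>" using k(1) by (simp add: le_divide_eq mult.commute)
        then have "m z powr q \<le> \<bar>(lv z + C) / \<kappa>\<bar>" using abs_ge_self[of "(lv z + C) / \<kappa>"] by linarith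
        then show ?case unfolding real_norm_def by (simp only: abs_of_nonneg[OF powr_ge_zero])
      qed
    qed
    have pi: "integrable (cyl T) (\<lambda>z. norm (w z) powr pw)"
    proof (rule Bochner_Integration.integrable_bound[OF bi])
      show "(\<lambda>z. norm (w z) powr pw) \<in> borel_measurable (cyl T)" using wm by measurable
      show "AE z in cyl T. norm (norm (w z) powr pw) \<le> norm ((lv z + C) / \<kappa>)"
        using ae
      proof eventually_elim
        case (elim z)
        have "0 \<le> \<kappa> * m z powr q" using k(1) by simp
        then have "\<kappa> * norm (w z) powr pw \<le> lv z + C" using elim by (simp add: distrib_left)
        then have "norm (w z) powr pw \<le> (lv z + C) / \<kappa>" using k(1) by (simp add: le_divide_eq mult.commute)
        then have "norm (w z) powr pw \<le> \<bar>(lv z + C) / \<kappa>\<bar>" using abs_ge_self[of "(lv z + C) / \<kappa>"] by linarith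
        then show ?case unfolding real_norm_def by (simp only: abs_of_nonneg[OF powr_ge_zero])
      qed
    qed
    have iw: "integrable (cyl T) (\<lambda>z. w z \<bullet> D\<phi>T (snd z))" by (rule wD_integrable[OF w])
    have "(\<integral>z. \<kappa> / 2 * (m z powr q + norm (w z) powr pw) - (C + K1) \<partial>cyl T) \<le> (\<integral>z. lv z + w z \<bullet> D\<phi>T (snd z) \<partial>cyl T)"
    proof (rule integral_mono_AE)
      show "integrable (cyl T) (\<lambda>z. \<kappa> / 2 * (m z powr q + norm (w z) powr pw) - (C + K1))" using qi pi by simp
      show "integrable (cyl T) (\<lambda>z. lv z + w z \<bullet> D\<phi>T (snd z))" using li iw by simp
      show "AE z in cyl T. \<kappa> / 2 * (m z powr q + norm (w z) powr pw) - (C + K1) \<le> lv z + w z \<bullet> D\<phi>T (snd z)"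
        using ae
      proof eventually_elim
        case (elim z)
        have "\<bar>w z \<bullet> D\<phi>T (snd z)\<bar> \<le> norm (w z) * MD"
          using Cauchy_Schwarz_ineq2[of "w z" "D\<phi>T (snd z)"] mult_left_mono[OF MD[of "snd z"] norm_ge_zero[of "w z"]] by linarith
        then have "- (w z \<bullet> D\<phi>T (snd z)) \<le> \<kappa> / 2 * norm (w z) powr pw + K1"
          using K1(2)[of "norm (w z)"] by (simp add: mult.commute)
        moreover have "0 \<le> \<kappa> / 2 * m z powr q" using k(1) by simp
        moreover have "\<kappa> * (m z powr q + norm (w z) powr pw) = 2 * (\<kappa> / 2 * m z powr q) + 2 * (\<kappa> / 2 * norm (w z) powr pw)"
          by (simp add: distrib_left)
        moreover have "\<kappa> / 2 * (m z powr q + norm (w z) powr pw) = \<kappa> / 2 * m z powr q + \<kappa> / 2 * norm (w z) powr pw"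
          by (simp only: distrib_left)
        ultimately show ?case using elim by linarith
      qed
    qed
    also have "(\<integral>z. lv z + w z \<bullet> D\<phi>T (snd z) \<partial>cyl T) = (\<integral>z. lv z \<partial>cyl T) + aff w - c0"
      using li iw by (simp add: aff_def c0_def)
    also have "\<dots> \<le> - Inf A_set - c0" using J by simp
    also have "(\<integral>z. \<kappa> / 2 * (m z powr q + norm (w z) powr pw) - (C + K1) \<partial>cyl T) = \<kappa> / 2 * (\<integral>z. m z powr q + norm (w z) powr pw \<partial>cyl T) - (C + K1) * \<Omega>"
      using qi pi by (simp add: \<Omega>_def mult.commute)
    finally have "\<kappa> / 2 * (\<integral>z. m z powr q + norm (w z) powr pw \<partial>cyl T) \<le> - Inf A_set - c0 + (C + K1) * \<Omega>" by simp
    then have "(2 / \<kappa>) * (\<kappa> / 2 * (\<integral>z. m z powr q + norm (w z) powr pw \<partial>cyl T)) \<le> K"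
      unfolding K_def using k(1) by (intro mult_left_mono) auto
    then show "integrable (cyl T) (\<lambda>z. m z powr q) \<and> integrable (cyl T) (\<lambda>z. norm (w z) powr pw) \<and>
     (\<integral>z. m z powr q + norm (w z) powr pw \<partial>cyl T) \<le> K" using qi pi k(1) by simp
  qed
qed

lemma bracket_pw:
  assumes m: "0 \<le> m"
  shows "bracket (m, w :: real ^ 'd) powr pw \<le> 3 powr pw * (2 + (m powr q + norm w powr pw))"
proof -
  have p: "1 < pw" by (rule pw_gt1)
  define M where "M = max 1 (max m (norm w))"
  have M: "1 \<le> M" "m \<le> M" "norm w \<le> M" by (auto simp: M_def)
  have "(norm (m, w))\<^sup>2 = m\<^sup>2 + (norm w)\<^sup>2" by (simp add: norm_Pair)
  moreover have "m\<^sup>2 \<le> M\<^sup>2" "(norm w)\<^sup>2 \<le> M\<^sup>2" "1 \<le> M\<^sup>2" using M m by (auto intro!: power_mono)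
  ultimately have "1 + (norm (m, w))\<^sup>2 \<le> (3 * M)\<^sup>2" by (simp add: power_mult_distrib)
  then have "bracket (m, w) \<le> 3 * M" unfolding bracket_def using M(1) by (intro real_le_lsqrt) auto
  then have "bracket (m, w) powr pw \<le> (3 * M) powr pw"
    using bracket_ge1[of "(m, w)"] p by (intro powr_mono2) auto
  also have "\<dots> = 3 powr pw * M powr pw" using M by (simp add: powr_mult)
  also have "\<dots> \<le> 3 powr pw * (2 + (m powr q + norm w powr pw))"
  proof (rule mult_left_mono)
    have mq: "m powr pw \<le> 1 + m powr q"
    proof (cases "m \<le> 1")
      case True
      then have "m powr pw \<le> 1" using m p by (intro powr_le1) auto
      then show ?thesis by (simp add: add_increasing2)
    next
      case False
      then have "m powr pw \<le> m powr q" using pw_le_q by (intro powr_mono) auto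
      then show ?thesis by simp
    qed
    consider "M = 1" | "M = m" | "M = norm w" by (metis M_def max_def)
    then show "M powr pw \<le> 2 + (m powr q + norm w powr pw)"
    proof cases
      case 2
      have "0 \<le> norm w powr pw" by simp
      then show ?thesis using mq unfolding 2 by linarith
    qed (simp_all add: add_increasing2)
  qed simp
  finally show ?thesis .
qed

definition test_triples where
  "test_triples = {(\<psi> :: real \<times> (real ^ 'd) \<Rightarrow> real, a, b). C1rep T \<psi> a b \<and> (\<forall>x. \<psi> (T, x) = 0)}"

definition defect where
  "defect (u :: real \<times> (real ^ 'd) \<Rightarrow> real \<times> (real ^ 'd)) t = (case t of (\<psi> :: real \<times> (real ^ 'd) \<Rightarrow> real, a, b) \<Rightarrow> (\<integral>z. fst (u z) * a z \<partial>cyl T) + (\<integral>z. snd (u z) \<bullet> b z \<partial>cyl T) + (\<integral>x. \<psi> (0, x) * m0 x \<partial>torus))"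

text \<open>
  Pairs whose energy does not exceed the value predicted by duality and which satisfy the tests in
  \<open>E\<close> up to \<open>\<delta>\<close>.  The energy bound is stated by an integrable majorant \<open>lv\<close> of the density, which
  avoids extended-real integrals.
\<close>
definition near_solutions where
  "near_solutions E \<delta> = {u :: real \<times> (real ^ 'd) \<Rightarrow> real \<times> (real ^ 'd). integrable (cyl T) (\<lambda>z. fst (u z)) \<and> integrable (cyl T) (\<lambda>z. snd (u z)) \<and> (\<forall>z. 0 \<le> fst (u z)) \<and>
     (\<exists>lv. integrable (cyl T) lv \<and> (AE z in cyl T. L (snd z) (fst (u z)) (snd (u z)) \<le> ereal (lv z)) \<and> (\<integral>z. lv z \<partial>cyl T) + aff (\<lambda>z. snd (u z)) \<le> - Inf A_set) \<and>
     (\<forall>t\<in>E. \<bar>defect u t\<bar> \<le> \<delta>)}"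

lemma near_solutions_ne:
  assumes E: "finite E" "E \<subseteq> test_triples" and d: "0 < \<delta>"
  shows "near_solutions E \<delta> \<noteq> {}"
proof -
  obtain tn n where n: "E = tn ` {i :: nat. i < n}"
    using finite_imp_nat_seg_image_inj_on[OF E(1)] by blast
  define \<psi> a b where "\<psi> i = fst (tn i)" and "a i = fst (snd (tn i))" and "b i = snd (snd (tn i))" for i
  have c1: "C1rep T (\<psi> i) (a i) (b i)" "\<And>x. \<psi> i (T, x) = 0" if "i < n" for i
    using E(2) n that by (auto simp: test_triples_def \<psi>_def a_def b_def case_prod_beta')
  obtain m w lv where g: "integrable (cyl T) m" "integrable (cyl T) w" "\<forall>z. 0 \<le> m z" "integrable (cyl T) lv"
    "\<forall>z. L (snd z) (m z) (w z) \<le> ereal (lv z)"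
    "(\<integral>z. lv z \<partial>cyl T) + (\<integral>z. w z \<bullet> D\<phi>T (snd z) \<partial>cyl T) + (\<integral>x. \<phi>T x * m0 x \<partial>torus) \<le> - Inf A_set"
    "\<forall>i<n. \<bar>(\<integral>z. m z * a i z \<partial>cyl T) + (\<integral>z. w z \<bullet> b i z \<partial>cyl T) + (\<integral>x. \<psi> i (0, x) * m0 x \<partial>torus)\<bar> \<le> \<delta>"
    using galerkin[of n \<psi> a b \<delta>, OF c1(1) c1(2) d] by blast
  have "(\<lambda>z. (m z, w z)) \<in> near_solutions E \<delta>"
    unfolding near_solutions_def
  proof (intro CollectI conjI)
    show "\<exists>lv. integrable (cyl T) lv \<and> (AE z in cyl T. L (snd z) (fst (m z, w z)) (snd (m z, w z)) \<le> ereal (lv z)) \<and>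
        (\<integral>z. lv z \<partial>cyl T) + aff (\<lambda>z. snd (m z, w z)) \<le> - Inf A_set"
    proof (intro exI[of _ lv] conjI g(4))
      show "AE z in cyl T. L (snd z) (fst (m z, w z)) (snd (m z, w z)) \<le> ereal (lv z)"
        using g(5) by (intro AE_I2) (simp only: fst_conv snd_conv)
      show "(\<integral>z. lv z \<partial>cyl T) + aff (\<lambda>z. snd (m z, w z)) \<le> - Inf A_set" using g(6) by (simp add: aff_def)
    qed
    show "\<forall>t\<in>E. \<bar>defect (\<lambda>z. (m z, w z)) t\<bar> \<le> \<delta>"
      using g(7) unfolding n by (auto simp: defect_def \<psi>_def a_def b_def case_prod_beta')
  qed (use g in auto)
  then show ?thesis by blast
qed

lemma aff_mid: "integrable (cyl T) w \<Longrightarrow> integrable (cyl T) w' \<Longrightarrow> aff (\<lambda>z. (w z + w' z) /\<^sub>R 2) = (aff w + aff w') / 2"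
proof -
  assume w: "integrable (cyl T) w" "integrable (cyl T) w'"
  have "(\<integral>z. ((w z + w' z) /\<^sub>R 2) \<bullet> D\<phi>T (snd z) \<partial>cyl T) = (\<integral>z. (w z \<bullet> D\<phi>T (snd z) + w' z \<bullet> D\<phi>T (snd z)) / 2 \<partial>cyl T)"
    by (intro Bochner_Integration.integral_cong) (auto simp: inner_add_left field_simps)
  also have "\<dots> = ((\<integral>z. w z \<bullet> D\<phi>T (snd z) \<partial>cyl T) + (\<integral>z. w' z \<bullet> D\<phi>T (snd z) \<partial>cyl T)) / 2"
    using wD_integrable[OF w(1)] wD_integrable[OF w(2)] by simp
  finally show ?thesis by (simp add: aff_def field_simps)
qed

lemma near_solutions_mid:
  assumes E: "E \<subseteq> test_triples" and u: "u \<in> near_solutions E \<delta>" and v: "v \<in> near_solutions E \<delta>"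
  shows "(\<lambda>z. (u z + v z) /\<^sub>R 2) \<in> near_solutions E \<delta>"
proof -
  have iu: "integrable (cyl T) (\<lambda>z. fst (u z))" "integrable (cyl T) (\<lambda>z. snd (u z))" "\<And>z. 0 \<le> fst (u z)" "\<And>t. t \<in> E \<Longrightarrow> \<bar>defect u t\<bar> \<le> \<delta>"
    using u unfolding near_solutions_def by auto
  have iv: "integrable (cyl T) (\<lambda>z. fst (v z))" "integrable (cyl T) (\<lambda>z. snd (v z))" "\<And>z. 0 \<le> fst (v z)" "\<And>t. t \<in> E \<Longrightarrow> \<bar>defect v t\<bar> \<le> \<delta>"
    using v unfolding near_solutions_def by auto
  obtain l1 where l1: "integrable (cyl T) l1" "AE z in cyl T. L (snd z) (fst (u z)) (snd (u z)) \<le> ereal (l1 z)" "(\<integral>z. l1 z \<partial>cyl T) + aff (\<lambda>z. snd (u z)) \<le> - Inf A_set"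
    using u unfolding near_solutions_def by auto
  obtain l2 where l2: "integrable (cyl T) l2" "AE z in cyl T. L (snd z) (fst (v z)) (snd (v z)) \<le> ereal (l2 z)" "(\<integral>z. l2 z \<partial>cyl T) + aff (\<lambda>z. snd (v z)) \<le> - Inf A_set"
    using v unfolding near_solutions_def by auto
  have f: "fst ((u z + v z) /\<^sub>R 2) = (fst (u z) + fst (v z)) / 2" "snd ((u z + v z) /\<^sub>R 2) = (snd (u z) + snd (v z)) /\<^sub>R 2" for z
    by (simp_all add: field_simps)
  show ?thesis unfolding near_solutions_def mem_Collect_eq f
  proof (intro conjI exI[of _ "\<lambda>z. (l1 z + l2 z) / 2"] ballI)
    show "integrable (cyl T) (\<lambda>z. (fst (u z) + fst (v z)) / 2)" "integrable (cyl T) (\<lambda>z. (snd (u z) + snd (v z)) /\<^sub>R 2)"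
      using iu iv by simp_all
    show "\<forall>z. 0 \<le> (fst (u z) + fst (v z)) / 2" using iu(3) iv(3) by simp
    show "integrable (cyl T) (\<lambda>z. (l1 z + l2 z) / 2)" using l1 l2 by simp
    show "AE z in cyl T. L (snd z) ((fst (u z) + fst (v z)) / 2) ((snd (u z) + snd (v z)) /\<^sub>R 2) \<le> ereal ((l1 z + l2 z) / 2)"
      using l1(2) l2(2)
    proof eventually_elim
      case (elim z)
      then show ?case by (rule L_mid[OF iu(3) iv(3)])
    qed
    have "(\<integral>z. (l1 z + l2 z) / 2 \<partial>cyl T) = ((\<integral>z. l1 z \<partial>cyl T) + (\<integral>z. l2 z \<partial>cyl T)) / 2" using l1 l2 by simp
    then show "(\<integral>z. (l1 z + l2 z) / 2 \<partial>cyl T) + aff (\<lambda>z. (snd (u z) + snd (v z)) /\<^sub>R 2) \<le> - Inf A_set"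
      unfolding aff_mid[OF iu(2) iv(2)] using l1(3) l2(3) by argo
    fix t assume t: "t \<in> E"
    obtain \<psi> a b where tt: "t = (\<psi>, a, b)" by (cases t) auto
    have c1: "C1rep T \<psi> a b" using E t by (auto simp: test_triples_def tt)
    have i: "integrable (cyl T) (\<lambda>z. fst (u z) * a z)" "integrable (cyl T) (\<lambda>z. snd (u z) \<bullet> b z)"
      "integrable (cyl T) (\<lambda>z. fst (v z) * a z)" "integrable (cyl T) (\<lambda>z. snd (v z) \<bullet> b z)"
      using ce_integral(2,3)[OF c1 iu(1,2)] ce_integral(2,3)[OF c1 iv(1,2)] by auto
    have "(\<integral>z. (fst (u z) + fst (v z)) / 2 * a z \<partial>cyl T) = (\<integral>z. (fst (u z) * a z + fst (v z) * a z) / 2 \<partial>cyl T)"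
      by (intro Bochner_Integration.integral_cong) (auto simp: field_simps)
    moreover have "(\<integral>z. ((snd (u z) + snd (v z)) /\<^sub>R 2) \<bullet> b z \<partial>cyl T) = (\<integral>z. (snd (u z) \<bullet> b z + snd (v z) \<bullet> b z) / 2 \<partial>cyl T)"
      by (intro Bochner_Integration.integral_cong) (auto simp: inner_add_left field_simps)
    ultimately have "defect (\<lambda>z. (u z + v z) /\<^sub>R 2) t = (defect u t + defect v t) / 2"
      unfolding defect_def tt f using i by (simp add: field_simps)
    then show "\<bar>defect (\<lambda>z. (u z + v z) /\<^sub>R 2) t\<bar> \<le> \<delta>" using iu(4)[OF t] iv(4)[OF t] unfolding abs_le_iff by argo
  qed
qed

end

section \<open>Existence, uniqueness and integrability of the minimiser\<close>

context mfg_data begin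

lemma pairing_tendsto:
  fixes u :: "real \<times> (real ^ 'd) \<Rightarrow> real \<times> (real ^ 'd)"
  assumes v: "\<And>n :: nat. integrable (cyl T) (v n)" and u: "integrable (cyl T) u"
    and lim: "(\<lambda>n. \<integral>z. norm (v n z - u z) \<partial>cyl T) \<longlonglongrightarrow> 0"
    and a: "a \<in> borel_measurable (cyl T)" and b: "b \<in> borel_measurable (cyl T)"
    and M: "\<And>z. z \<in> space (cyl T) \<Longrightarrow> \<bar>a z\<bar> \<le> M \<and> norm (b z) \<le> M"
  shows "(\<lambda>n. (\<integral>z. fst (v n z) * a z \<partial>cyl T) + (\<integral>z. snd (v n z) \<bullet> b z \<partial>cyl T))
    \<longlonglongrightarrow> (\<integral>z. fst (u z) * a z \<partial>cyl T) + (\<integral>z. snd (u z) \<bullet> b z \<partial>cyl T)"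
proof -
  have i1: "integrable (cyl T) (\<lambda>z. fst (g z) * a z)" and i2: "integrable (cyl T) (\<lambda>z. snd (g z) \<bullet> b z)"
    if g: "integrable (cyl T) g" for g :: "real \<times> (real ^ 'd) \<Rightarrow> real \<times> (real ^ 'd)"
  proof -
    have "integrable (cyl T) (\<lambda>z. fst (g z))" "integrable (cyl T) (\<lambda>z. snd (g z))"
      using integrable_bounded_linear[OF bounded_linear_fst g] integrable_bounded_linear[OF bounded_linear_snd g] by simp_all
    then show "integrable (cyl T) (\<lambda>z. fst (g z) * a z)" "integrable (cyl T) (\<lambda>z. snd (g z) \<bullet> b z)"
      using M a b integrable_cyl_mult[of T "\<lambda>z. fst (g z)" a M] integrable_cyl_inner[of T "\<lambda>z. snd (g z)" b M] by auto
  qed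
  let ?I = "\<lambda>g :: real \<times> (real ^ 'd) \<Rightarrow> real \<times> (real ^ 'd). (\<integral>z. fst (g z) * a z \<partial>cyl T) + (\<integral>z. snd (g z) \<bullet> b z \<partial>cyl T)"
  have bnd: "norm (?I (v n) - ?I u) \<le> (2 * M) * (\<integral>z. norm (v n z - u z) \<partial>cyl T)" for n
  proof -
    have iv: "integrable (cyl T) (\<lambda>z. v n z - u z)" using v u by simp
    have "?I (v n) - ?I u = (\<integral>z. fst (v n z - u z) * a z + snd (v n z - u z) \<bullet> b z \<partial>cyl T)"
      using i1[OF v[of n]] i2[OF v[of n]] i1[OF u] i2[OF u] by (simp add: left_diff_distrib inner_diff_left)
    also have "norm \<dots> \<le> (\<integral>z. (2 * M) * norm (v n z - u z) \<partial>cyl T)"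
    proof (rule order_trans[OF integral_norm_bound], rule integral_mono)
      show "integrable (cyl T) (\<lambda>z. norm (fst (v n z - u z) * a z + snd (v n z - u z) \<bullet> b z))"
        using Bochner_Integration.integrable_add[OF i1[OF iv] i2[OF iv]] by (rule integrable_norm)
      show "integrable (cyl T) (\<lambda>z. (2 * M) * norm (v n z - u z))" using iv by simp
      fix z :: "real \<times> (real ^ 'd)" assume z: "z \<in> space (cyl T)"
      have nf: "\<bar>fst p\<bar> \<le> norm p" "norm (snd p) \<le> norm p" for p :: "real \<times> (real ^ 'd)"
        using norm_fst_le[of "fst p" "snd p"] norm_snd_le[of "snd p" "fst p"] by simp_all
      have 1: "\<bar>fst (v n z - u z) * a z\<bar> \<le> norm (v n z - u z) * M"
        unfolding abs_mult using M[OF z] by (intro mult_mono nf) auto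
      have "\<bar>snd (v n z - u z) \<bullet> b z\<bar> \<le> norm (snd (v n z - u z)) * norm (b z)" by (rule Cauchy_Schwarz_ineq2)
      also have "\<dots> \<le> norm (v n z - u z) * M"
        using M[OF z] by (intro mult_mono nf) auto
      finally show "norm (fst (v n z - u z) * a z + snd (v n z - u z) \<bullet> b z) \<le> (2 * M) * norm (v n z - u z)"
        using 1 by (simp add: mult.commute)
    qed
    finally show ?thesis by simp
  qed
  have "(\<lambda>n. (2 * M) * (\<integral>z. norm (v n z - u z) \<partial>cyl T)) \<longlonglongrightarrow> 0" using tendsto_mult_right_zero[OF lim] .
  then have "(\<lambda>n. ?I (v n) - ?I u) \<longlonglongrightarrow> 0"
    by (rule Lim_null_comparison[rotated]) (use bnd in \<open>auto intro!: always_eventually\<close>)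
  then show ?thesis by (rule LIM_zero_cancel)
qed

lemma near_solutions_integrable:
  assumes "u \<in> near_solutions E \<delta>" shows "integrable (cyl T) u"
proof -
  have i: "integrable (cyl T) (\<lambda>z. fst (u z))" "integrable (cyl T) (\<lambda>z. snd (u z))" using assms by (auto simp: near_solutions_def)
  have m: "(\<lambda>z. (fst (u z), snd (u z))) \<in> borel_measurable (cyl T)" using i by (intro borel_measurable_Pair) auto
  have "integrable (cyl T) (\<lambda>z. \<bar>fst (u z)\<bar> + norm (snd (u z)))" using i by simp
  then show ?thesis
    by (rule Bochner_Integration.integrable_bound)
       (use m norm_Pair_le[of "fst (u z)" "snd (u z)" for z] in \<open>auto intro!: AE_I2 order_trans[OF _ abs_ge_self]\<close>)
qed

lemma near_solutions_bound: "\<exists>K. \<forall>E \<delta> u. u \<in> near_solutions E \<delta> \<longrightarrow>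
  integrable (cyl T) (\<lambda>z. bracket (u z) powr pw) \<and> (\<integral>z. bracket (u z) powr pw \<partial>cyl T) \<le> K"
proof -
  obtain K where K: "\<And>m w lv. m \<in> borel_measurable (cyl T) \<Longrightarrow> integrable (cyl T) w \<Longrightarrow> (\<forall>z. 0 \<le> m z) \<Longrightarrow> integrable (cyl T) lv \<Longrightarrow>
     (AE z in cyl T. L (snd z) (m z) (w z) \<le> ereal (lv z)) \<Longrightarrow> (\<integral>z. lv z \<partial>cyl T) + aff w \<le> - Inf A_set \<Longrightarrow>
     integrable (cyl T) (\<lambda>z. m z powr q) \<and> integrable (cyl T) (\<lambda>z. norm (w z) powr pw) \<and>
     (\<integral>z. m z powr q + norm (w z) powr pw \<partial>cyl T) \<le> K"
    using coercive_integrals by blast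
  define \<Omega> where "\<Omega> = measure (cyl T :: (real \<times> (real ^ 'd)) measure) (space (cyl T))"
  show ?thesis
  proof (intro exI[of _ "3 powr pw * (2 * \<Omega> + K)"] allI impI)
    fix E \<delta> u assume u: "u \<in> near_solutions E \<delta>"
    have nn: "\<forall>z. 0 \<le> fst (u z)" using u by (simp add: near_solutions_def)
    obtain lv where lv: "integrable (cyl T) lv" "AE z in cyl T. L (snd z) (fst (u z)) (snd (u z)) \<le> ereal (lv z)"
      "(\<integral>z. lv z \<partial>cyl T) + aff (\<lambda>z. snd (u z)) \<le> - Inf A_set" using u by (auto simp: near_solutions_def)
    have ui: "integrable (cyl T) (\<lambda>z. fst (u z))" "integrable (cyl T) (\<lambda>z. snd (u z))" using u by (auto simp: near_solutions_def)
    then have mm: "(\<lambda>z. fst (u z)) \<in> borel_measurable (cyl T)" by auto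
    have k: "integrable (cyl T) (\<lambda>z. fst (u z) powr q)" "integrable (cyl T) (\<lambda>z. norm (snd (u z)) powr pw)"
      "(\<integral>z. fst (u z) powr q + norm (snd (u z)) powr pw \<partial>cyl T) \<le> K" using K[OF mm ui(2) nn lv] by auto
    have le: "bracket (u z) powr pw \<le> 3 powr pw * (2 + (fst (u z) powr q + norm (snd (u z)) powr pw))" for z
      using bracket_pw[of "fst (u z)" "snd (u z)"] nn by simp
    have ki: "integrable (cyl T) (\<lambda>z. fst (u z) powr q + norm (snd (u z)) powr pw)" by (rule Bochner_Integration.integrable_add[OF k(1,2)])
    have ri: "integrable (cyl T) (\<lambda>z. 3 powr pw * (2 + (fst (u z) powr q + norm (snd (u z)) powr pw)))"
      by (intro integrable_mult_right Bochner_Integration.integrable_add ki) simp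
    have um: "u \<in> borel_measurable (cyl T)" using near_solutions_integrable[OF u] by auto
    have bm: "(\<lambda>z. bracket (u z)) \<in> borel_measurable (cyl T)"
      using measurable_compose[OF um borel_measurable_continuous_onI[OF bracket_cont]] .
    have bi: "integrable (cyl T) (\<lambda>z. bracket (u z) powr pw)"
    proof (rule Bochner_Integration.integrable_bound[OF ri])
      show "(\<lambda>z. bracket (u z) powr pw) \<in> borel_measurable (cyl T)" using bm by measurable
    qed (use le in \<open>auto intro!: AE_I2 order_trans[OF _ abs_ge_self]\<close>)
    have "(\<integral>z. bracket (u z) powr pw \<partial>cyl T) \<le> (\<integral>z. 3 powr pw * (2 + (fst (u z) powr q + norm (snd (u z)) powr pw)) \<partial>cyl T)"
      by (rule integral_mono[OF bi ri le])
    also have "\<dots> = 3 powr pw * (\<integral>z. 2 + (fst (u z) powr q + norm (snd (u z)) powr pw) \<partial>cyl T)" by simp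
    also have "(\<integral>z. 2 + (fst (u z) powr q + norm (snd (u z)) powr pw) \<partial>cyl T) = 2 * \<Omega> + (\<integral>z. fst (u z) powr q + norm (snd (u z)) powr pw \<partial>cyl T)"
      using Bochner_Integration.integral_add[OF cyl.integrable_const ki] by (simp add: \<Omega>_def)
    also have "3 powr pw * \<dots> \<le> 3 powr pw * (2 * \<Omega> + K)" using k(3) by (intro mult_left_mono) auto
    finally show "integrable (cyl T) (\<lambda>z. bracket (u z) powr pw) \<and> (\<integral>z. bracket (u z) powr pw \<partial>cyl T) \<le> 3 powr pw * (2 * \<Omega> + K)"
      using bi by simp
  qed
qed

lemma exists_limit:
  "\<exists>u. integrable (cyl T) u \<and> (\<forall>E \<delta>. finite E \<longrightarrow> E \<subseteq> test_triples \<longrightarrow> 0 < \<delta> \<longrightarrow>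
     (\<exists>v. (\<forall>n :: nat. v n \<in> near_solutions E \<delta>) \<and> (\<lambda>n. \<integral>z. norm (v n z - u z) \<partial>cyl T) \<longlonglongrightarrow> 0))"
proof -
  define \<S> where "\<S> = {near_solutions E \<delta> | E \<delta>. finite E \<and> E \<subseteq> test_triples \<and> 0 < \<delta>}"
  have \<S>I: "near_solutions E \<delta> \<in> \<S>" if "finite E" "E \<subseteq> test_triples" "0 < \<delta>" for E \<delta> using that by (auto simp: \<S>_def)
  obtain K where K: "\<And>E \<delta> u. u \<in> near_solutions E \<delta> \<Longrightarrow>
    integrable (cyl T) (\<lambda>z. bracket (u z) powr pw) \<and> (\<integral>z. bracket (u z) powr pw \<partial>cyl T) \<le> K"
    using near_solutions_bound by blast
  have "\<exists>u. integrable (cyl T) u \<and> (\<forall>S\<in>\<S>. \<exists>v. (\<forall>n :: nat. v n \<in> S) \<and> (\<lambda>n. \<integral>z. norm (v n z - u z) \<partial>cyl T) \<longlonglongrightarrow> 0)"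
  proof (rule nested_convex_L1[OF cyl.finite_measure_axioms pw_gt1, where K = K])
    show "\<S> \<noteq> {}" using \<S>I[of "{}" 1] by auto
    show "S \<noteq> {}" if "S \<in> \<S>" for S using that near_solutions_ne unfolding \<S>_def by blast
    show "\<exists>S''\<in>\<S>. S'' \<subseteq> S \<inter> S'" if S: "S \<in> \<S>" "S' \<in> \<S>" for S S'
    proof -
      obtain E \<delta> where 1: "S = near_solutions E \<delta>" "finite E" "E \<subseteq> test_triples" "0 < \<delta>" using S(1) by (auto simp: \<S>_def)
      obtain E' \<delta>' where 2: "S' = near_solutions E' \<delta>'" "finite E'" "E' \<subseteq> test_triples" "0 < \<delta>'" using S(2) by (auto simp: \<S>_def)
      have "near_solutions (E \<union> E') (min \<delta> \<delta>') \<subseteq> S \<inter> S'" unfolding 1(1) 2(1) near_solutions_def by auto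
      moreover have "near_solutions (E \<union> E') (min \<delta> \<delta>') \<in> \<S>" using 1 2 by (intro \<S>I) auto
      ultimately show ?thesis by blast
    qed
    show "(\<lambda>z. (u z + v z) /\<^sub>R 2) \<in> S" if "S \<in> \<S>" "u \<in> S" "v \<in> S" for S u v
      using that near_solutions_mid by (auto simp: \<S>_def)
    show "u \<in> borel_measurable (cyl T)" if S: "S \<in> \<S>" "u \<in> S" for S u
    proof -
      from S(1) obtain E \<delta> where "S = near_solutions E \<delta>" unfolding \<S>_def by blast
      with S(2) have "u \<in> near_solutions E \<delta>" by simp
      then show ?thesis using near_solutions_integrable borel_measurable_integrable by blast
    qed
    show "integrable (cyl T) (\<lambda>z. bracket (u z) powr pw) \<and> (\<integral>z. bracket (u z) powr pw \<partial>cyl T) \<le> K" if "S \<in> \<S>" "u \<in> S" for S u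
      using that K unfolding \<S>_def by blast
  qed
  then show ?thesis using \<S>I by blast
qed

lemma aff_tendsto:
  fixes u :: "real \<times> (real ^ 'd) \<Rightarrow> real \<times> (real ^ 'd)"
  assumes v: "\<And>n :: nat. integrable (cyl T) (v n)" and u: "integrable (cyl T) u"
    and lim: "(\<lambda>n. \<integral>z. norm (v n z - u z) \<partial>cyl T) \<longlonglongrightarrow> 0"
  shows "(\<lambda>n. aff (\<lambda>z. snd (v n z))) \<longlonglongrightarrow> aff (\<lambda>z. snd (u z))"
proof -
  obtain MD where MD: "\<And>x. norm (D\<phi>T x) \<le> MD" using periodic_bounded_space[OF D\<phi>T_cont D\<phi>T_periodic] by auto
  have MD0: "0 \<le> MD" using MD[of 0] norm_ge_zero order_trans by blast
  have "(\<lambda>n. (\<integral>z. fst (v n z) * 0 \<partial>cyl T) + (\<integral>z. snd (v n z) \<bullet> D\<phi>T (snd z) \<partial>cyl T))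
    \<longlonglongrightarrow> (\<integral>z. fst (u z) * 0 \<partial>cyl T) + (\<integral>z. snd (u z) \<bullet> D\<phi>T (snd z) \<partial>cyl T)"
    using MD MD0 by (intro pairing_tendsto[OF v u lim _ D\<phi>T_meas, where M = MD]) auto
  then show ?thesis unfolding aff_def by (intro tendsto_add) simp_all
qed

lemma defect_zero:
  assumes u: "integrable (cyl T) u" and t: "t \<in> test_triples"
    and app: "\<And>\<delta>. 0 < \<delta> \<Longrightarrow> \<exists>v. (\<forall>n :: nat. v n \<in> near_solutions {t} \<delta>) \<and> (\<lambda>n. \<integral>z. norm (v n z - u z) \<partial>cyl T) \<longlonglongrightarrow> 0"
  shows "defect u t = 0"
proof -
  obtain \<psi> a b where tt: "t = (\<psi>, a, b)" by (cases t) auto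
  have c1: "C1rep T \<psi> a b" using t by (simp add: test_triples_def tt)
  obtain M where M: "\<And>z. z \<in> space (cyl T) \<Longrightarrow> \<bar>a z\<bar> \<le> M \<and> norm (b z) \<le> M" using C1rep_bounds(1)[OF c1] by blast
  have "\<bar>defect u t\<bar> \<le> 0 + \<delta>" if d: "0 < \<delta>" for \<delta>
  proof -
    obtain v where v: "\<And>n :: nat. v n \<in> near_solutions {t} \<delta>" "(\<lambda>n. \<integral>z. norm (v n z - u z) \<partial>cyl T) \<longlonglongrightarrow> 0" using app[OF d] by blast
    have "(\<lambda>n. (\<integral>z. fst (v n z) * a z \<partial>cyl T) + (\<integral>z. snd (v n z) \<bullet> b z \<partial>cyl T))
      \<longlonglongrightarrow> (\<integral>z. fst (u z) * a z \<partial>cyl T) + (\<integral>z. snd (u z) \<bullet> b z \<partial>cyl T)"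
      by (rule pairing_tendsto[OF near_solutions_integrable[OF v(1)] u v(2) C1rep_bounds(2,3)[OF c1] M])
    from tendsto_add[OF this tendsto_const[of "\<integral>x. \<psi> (0, x) * m0 x \<partial>torus"]]
    have "(\<lambda>n. defect (v n) t) \<longlonglongrightarrow> defect u t" by (simp add: defect_def tt)
    then have "(\<lambda>n. \<bar>defect (v n) t\<bar>) \<longlonglongrightarrow> \<bar>defect u t\<bar>" by (rule tendsto_rabs)
    moreover have "\<bar>defect (v n) t\<bar> \<le> \<delta>" for n using v(1)[of n] by (simp add: near_solutions_def)
    ultimately show ?thesis by (simp add: LIMSEQ_le_const2)
  qed
  then have "\<bar>defect u t\<bar> \<le> 0" by (rule field_le_epsilon)
  then show ?thesis by simp
qed

text \<open>
  Fatou's lemma along an almost everywhere convergent subsequence, together with lower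
  semicontinuity of the density; the terminal term is continuous in L1.
\<close>
lemma limit_energy:
  assumes v: "\<And>n :: nat. v n \<in> near_solutions E \<delta>" and u: "integrable (cyl T) u"
    and lim: "(\<lambda>n. \<integral>z. norm (v n z - u z) \<partial>cyl T) \<longlonglongrightarrow> 0"
  shows "\<exists>lv. integrable (cyl T) lv \<and>
     (AE z in cyl T. 0 \<le> fst (u z) \<and> L (snd z) (fst (u z)) (snd (u z)) \<le> ereal (lv z)) \<and>
     (\<integral>z. lv z \<partial>cyl T) + aff (\<lambda>z. snd (u z)) \<le> - Inf A_set"
proof -
  define \<beta> where "\<beta> = - Inf A_set"
  define \<Omega> where "\<Omega> = measure (cyl T :: (real \<times> (real ^ 'd)) measure) (space (cyl T))"
  have vi: "integrable (cyl T) (v n)" for n by (rule near_solutions_integrable[OF v])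
  have vn: "0 \<le> fst (v n z)" for n z using v[of n] unfolding near_solutions_def mem_Collect_eq by blast
  have "\<forall>n. \<exists>lv. integrable (cyl T) lv \<and> (AE z in cyl T. L (snd z) (fst (v n z)) (snd (v n z)) \<le> ereal (lv z)) \<and>
      (\<integral>z. lv z \<partial>cyl T) + aff (\<lambda>z. snd (v n z)) \<le> \<beta>"
    using v unfolding near_solutions_def mem_Collect_eq \<beta>_def by simp
  from choice[OF this] obtain lv where lv0: "\<forall>n. integrable (cyl T) (lv n) \<and>
      (AE z in cyl T. L (snd z) (fst (v n z)) (snd (v n z)) \<le> ereal (lv n z)) \<and>
      (\<integral>z. lv n z \<partial>cyl T) + aff (\<lambda>z. snd (v n z)) \<le> \<beta>" ..
  have lv: "integrable (cyl T) (lv n)" "AE z in cyl T. L (snd z) (fst (v n z)) (snd (v n z)) \<le> ereal (lv n z)"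
    "(\<integral>z. lv n z \<partial>cyl T) + aff (\<lambda>z. snd (v n z)) \<le> \<beta>" for n
    using spec[OF lv0, of n] by blast+
  obtain C where C: "0 \<le> C" "\<And>m w z. - ereal C \<le> Lz m w z" using Lz_lower by blast
  have lvC: "AE z in cyl T. 0 \<le> lv n z + C" for n
    using lv(2)[of n]
  proof eventually_elim
    case (elim z)
    have "- ereal C \<le> L (snd z) (fst (v n z)) (snd (v n z))"
      using C(2)[of "\<lambda>z. fst (v n z)" "\<lambda>z. snd (v n z)" z] vn by (simp add: Lz_def max_absorb1)
    also note elim
    finally show ?case by simp
  qed
  have di: "integrable (cyl T) (\<lambda>z. v n z - u z)" for n using vi u by simp
  obtain s where s: "strict_mono s" "AE z in cyl T. (\<lambda>n. v (s n) z - u z) \<longlonglongrightarrow> 0"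
    using tendsto_L1_AE_subseq[OF di lim] by blast
  define G where "G z = liminf (\<lambda>n. ennreal (lv (s n) z + C))" for z
  have Gm: "G \<in> borel_measurable (cyl T)"
  proof -
    have "(\<lambda>z. ennreal (lv (s n) z + C)) \<in> borel_measurable (cyl T)" for n using lv(1)[of "s n"] by auto
    then show ?thesis unfolding G_def by measurable
  qed
  (* Upper bounds for the integrals of the shifted majorants, and their limit. *)
  define b where "b n = \<beta> - aff (\<lambda>z. snd (v (s n) z)) + C * \<Omega>" for n
  define b0 where "b0 = \<beta> - aff (\<lambda>z. snd (u z)) + C * \<Omega>"
  have bl: "b \<longlonglongrightarrow> b0"
    unfolding b_def b0_def
    using LIMSEQ_subseq_LIMSEQ[OF aff_tendsto[OF vi u lim] s(1)] by (intro tendsto_intros) (simp add: o_def)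
  have nb: "(\<integral>\<^sup>+z. ennreal (lv (s n) z + C) \<partial>cyl T) = ennreal (\<integral>z. lv (s n) z + C \<partial>cyl T)"
    and ib: "(\<integral>z. lv (s n) z + C \<partial>cyl T) \<le> b n" and i0: "0 \<le> (\<integral>z. lv (s n) z + C \<partial>cyl T)" for n
  proof -
    show "(\<integral>\<^sup>+z. ennreal (lv (s n) z + C) \<partial>cyl T) = ennreal (\<integral>z. lv (s n) z + C \<partial>cyl T)"
      using lv(1) by (intro nn_integral_eq_integral lvC) simp
    have "(\<integral>z. lv (s n) z + C \<partial>cyl T) = (\<integral>z. lv (s n) z \<partial>cyl T) + C * \<Omega>"
      using Bochner_Integration.integral_add[OF lv(1) cyl.integrable_const[of T C]] by (simp add: \<Omega>_def)
    then show "(\<integral>z. lv (s n) z + C \<partial>cyl T) \<le> b n" using lv(3)[of "s n"] by (simp add: b_def)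
    show "0 \<le> (\<integral>z. lv (s n) z + C \<partial>cyl T)" by (rule integral_nonneg_AE[OF lvC])
  qed
  have b00: "0 \<le> b0" by (rule LIMSEQ_le_const[OF bl]) (use order_trans[OF i0 ib] in blast)
  have Gi: "(\<integral>\<^sup>+z. G z \<partial>cyl T) \<le> ennreal b0"
  proof -
    have "(\<integral>\<^sup>+z. G z \<partial>cyl T) \<le> liminf (\<lambda>n. \<integral>\<^sup>+z. ennreal (lv (s n) z + C) \<partial>cyl T)"
      unfolding G_def using lv(1) by (intro nn_integral_liminf) auto
    also have "\<dots> \<le> liminf (\<lambda>n. ennreal (b n))"
      unfolding nb by (intro Liminf_mono always_eventually allI ennreal_leI ib)
    also have "\<dots> = ennreal b0"
      by (intro lim_imp_Liminf tendsto_ennrealI bl) simp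
    finally show ?thesis .
  qed
  have Gf: "AE z in cyl T. G z \<noteq> \<infinity>"
    by (rule nn_integral_PInf_AE[OF Gm]) (use Gi in \<open>auto simp: top_unique\<close>)
  define l0 where "l0 z = enn2real (G z)" for z
  have l0m: "l0 \<in> borel_measurable (cyl T)" unfolding l0_def using Gm by measurable
  have l0n: "(\<integral>\<^sup>+z. ennreal (l0 z) \<partial>cyl T) \<le> ennreal b0"
  proof -
    have "(\<integral>\<^sup>+z. ennreal (l0 z) \<partial>cyl T) \<le> (\<integral>\<^sup>+z. G z \<partial>cyl T)"
      unfolding l0_def by (intro nn_integral_mono) (simp add: ennreal_enn2real_if)
    then show ?thesis using Gi by (rule order_trans)
  qed
  have l0i: "integrable (cyl T) l0"
  proof (rule integrableI_nonneg[OF l0m])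
    show "AE z in cyl T. 0 \<le> l0 z" by (simp add: l0_def)
    show "(\<integral>\<^sup>+z. ennreal (l0 z) \<partial>cyl T) < \<infinity>" using l0n by (simp add: order_le_less_trans)
  qed
  have "ennreal (\<integral>z. l0 z \<partial>cyl T) \<le> ennreal b0"
    using l0n nn_integral_eq_integral[OF l0i AE_I2] by (simp add: l0_def[abs_def])
  then have l0b: "(\<integral>z. l0 z \<partial>cyl T) \<le> b0" using b00 by (simp add: ennreal_le_iff)
  have ae: "AE z in cyl T. 0 \<le> fst (u z) \<and> L (snd z) (fst (u z)) (snd (u z)) \<le> ereal (l0 z - C)"
  proof -
    have "AE z in cyl T. \<forall>n. L (snd z) (fst (v n z)) (snd (v n z)) \<le> ereal (lv n z)"
      using lv(2) by (simp add: AE_all_countable)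
    with s(2) Gf show ?thesis
    proof eventually_elim
      case (elim z)
      have "(\<lambda>n. v (s n) z) \<longlonglongrightarrow> u z" using elim(1) by (rule LIM_zero_cancel)
      then have l: "(\<lambda>n. fst (v (s n) z)) \<longlonglongrightarrow> fst (u z)" "(\<lambda>n. snd (v (s n) z)) \<longlonglongrightarrow> snd (u z)"
        by (auto intro: tendsto_fst tendsto_snd)
      have n: "0 \<le> fst (u z)" by (rule LIMSEQ_le_const[OF l(1)]) (use vn in blast)
      have "L (snd z) (fst (u z)) (snd (u z)) \<le> ereal (enn2real (liminf (\<lambda>n. ennreal (lv (s n) z + C))) - C)"
        by (rule L_lsc[OF l n vn]) (use elim in \<open>auto simp: G_def\<close>)
      then show ?case using n by (simp add: l0_def G_def)
    qed
  qed
  show ?thesis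
  proof (intro exI[of _ "\<lambda>z. l0 z - C"] conjI ae)
    show "integrable (cyl T) (\<lambda>z. l0 z - C)" using l0i by simp
    have "(\<integral>z. l0 z - C \<partial>cyl T) = (\<integral>z. l0 z \<partial>cyl T) - C * \<Omega>"
      using Bochner_Integration.integral_diff[OF l0i cyl.integrable_const[of T C]] by (simp add: \<Omega>_def)
    then show "(\<integral>z. l0 z - C \<partial>cyl T) + aff (\<lambda>z. snd (u z)) \<le> - Inf A_set"
      using l0b unfolding b0_def \<beta>_def by linarith
  qed
qed


lemma B_ge:
  assumes "p \<in> K1 T m0" shows "ereal (- Inf A_set) \<le> B_fun T f H \<phi>T p"
proof (cases "B_fun T f H \<phi>T p = \<infinity>")
  case False
  obtain m w where p: "p = (m, w)" by (cases p) auto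
  obtain g where g: "integrable (cyl T) g" "AE z in cyl T. Lz m w z = ereal (g z)" "B_fun T f H \<phi>T (m, w) = ereal ((\<integral>z. g z \<partial>cyl T) + aff w)"
    using B_finite[of m w] assms False unfolding p by blast
  show ?thesis unfolding p g(3) using weak_duality[of m w g] assms g(1,2) unfolding p by simp
qed simp

text \<open>
  The L1 limit satisfies every test exactly and keeps the energy bound, so it belongs to
  \<^const>\<open>K1\<close>; weak duality gives the reverse bound.
\<close>
lemma minimiser_exists:
  "\<exists>m w. (m, w) \<in> K1 T m0 \<and> B_fun T f H \<phi>T (m, w) = ereal (- Inf A_set)"
proof -
  obtain u where u: "integrable (cyl T) u" and app: "\<And>E \<delta>. finite E \<Longrightarrow> E \<subseteq> test_triples \<Longrightarrow> 0 < \<delta> \<Longrightarrow>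
     \<exists>v. (\<forall>n :: nat. v n \<in> near_solutions E \<delta>) \<and> (\<lambda>n. \<integral>z. norm (v n z - u z) \<partial>cyl T) \<longlonglongrightarrow> 0"
    using exists_limit by blast
  obtain v where v: "\<And>n :: nat. v n \<in> near_solutions {} 1" "(\<lambda>n. \<integral>z. norm (v n z - u z) \<partial>cyl T) \<longlonglongrightarrow> 0"
    using app[of "{}" 1] by auto
  obtain lv where lv: "integrable (cyl T) lv"
     "AE z in cyl T. 0 \<le> fst (u z) \<and> L (snd z) (fst (u z)) (snd (u z)) \<le> ereal (lv z)"
     "(\<integral>z. lv z \<partial>cyl T) + aff (\<lambda>z. snd (u z)) \<le> - Inf A_set"
    using limit_energy[OF v(1) u v(2)] by blast
  define m where "m z = fst (u z)" for z
  define w where "w z = snd (u z)" for z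
  have mi: "integrable (cyl T) m" and wi: "integrable (cyl T) w"
    using integrable_bounded_linear[OF bounded_linear_fst u] integrable_bounded_linear[OF bounded_linear_snd u]
    by (simp_all add: m_def[abs_def] w_def[abs_def])
  have nn: "AE z in cyl T. 0 \<le> m z" using lv(2) by eventually_elim (simp add: m_def)
  have "continuity_equation T m0 m w"
    unfolding continuity_equation_def
  proof
    fix \<zeta> :: "real \<times> (real ^ 'd) \<Rightarrow> real" assume z: "\<zeta> \<in> test_functions T"
    obtain a b where c1: "C1rep T \<zeta> a b" using K0_C1rep[OF test_function_K0[OF z] T] by blast
    have "\<zeta> (T, x) = 0" for x using test_function_K0[OF z] by (simp add: K0_def)
    then have t: "(\<zeta>, a, b) \<in> test_triples" using c1 by (simp add: test_triples_def)
    have "defect u (\<zeta>, a, b) = 0"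
      by (rule defect_zero[OF u t]) (use app[of "{(\<zeta>, a, b)}"] t in auto)
    then show "(\<integral>(t, x). m (t, x) * deriv (\<lambda>s. \<zeta> (s, x)) t + w (t, x) \<bullet> grad (\<lambda>y. \<zeta> (t, y)) x \<partial>cyl T)
     + (\<integral>x. \<zeta> (0, x) * m0 x \<partial>torus) = 0"
      unfolding ce_integral(1)[OF c1 mi wi] by (simp add: defect_def m_def w_def)
  qed
  then have K: "(m, w) \<in> K1 T m0" by (intro K1I[OF T mi wi nn _ m0_mass])
  have le: "AE z in cyl T. Lz m w z \<le> ereal (lv z)"
    using lv(2) by eventually_elim (simp add: Lz_def m_def w_def max_absorb1)
  obtain g where g: "integrable (cyl T) g" "AE z in cyl T. Lz m w z = ereal (g z)" "B_fun T f H \<phi>T (m, w) = ereal ((\<integral>z. g z \<partial>cyl T) + aff w)"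
    using B_upper[OF K lv(1) le] by blast
  have "AE z in cyl T. g z \<le> lv z" using le g(2) by eventually_elim simp
  then have "(\<integral>z. g z \<partial>cyl T) \<le> (\<integral>z. lv z \<partial>cyl T)" by (rule integral_mono_AE[OF g(1) lv(1)])
  moreover have "aff w = aff (\<lambda>z. snd (u z))" by (simp add: w_def[abs_def])
  ultimately have "B_fun T f H \<phi>T (m, w) \<le> ereal (- Inf A_set)" using lv(3) unfolding g(3) by simp
  with B_ge[OF K] K show ?thesis by (meson antisym)
qed

lemma minimiser_Lp:
  assumes K: "(m, w) \<in> K1 T m0" and B: "B_fun T f H \<phi>T (m, w) = ereal (- Inf A_set)"
  shows "in_Lp (cyl T) q m" "in_Lp (cyl T) pw w"
proof -
  have m: "integrable (cyl T) m" and w: "integrable (cyl T) w" and nn: "AE z in cyl T. 0 \<le> m z"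
    using K by (auto simp: K1_def)
  have mm: "m \<in> borel_measurable (cyl T)" and wm: "w \<in> borel_measurable (cyl T)" using m w by auto
  obtain g where g: "integrable (cyl T) g" "AE z in cyl T. Lz m w z = ereal (g z)" "B_fun T f H \<phi>T (m, w) = ereal ((\<integral>z. g z \<partial>cyl T) + aff w)"
    using B_finite[OF K] B by auto
  have le: "AE z in cyl T. L (snd z) (max (m z) 0) (w z) \<le> ereal (g z)" using g(2) by eventually_elim (simp add: Lz_def)
  have J: "(\<integral>z. g z \<partial>cyl T) + aff w \<le> - Inf A_set" using g(3) B by simp
  have mx: "(\<lambda>z. max (m z) 0) \<in> borel_measurable (cyl T)" using mm by measurable
  have "integrable (cyl T) (\<lambda>z. max (m z) 0 powr q) \<and> integrable (cyl T) (\<lambda>z. norm (w z) powr pw)"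
    using coercive_integrals mx w g(1) le J by (meson max.cobounded2)
  then have i: "integrable (cyl T) (\<lambda>z. max (m z) 0 powr q)" "integrable (cyl T) (\<lambda>z. norm (w z) powr pw)" by auto
  have "integrable (cyl T) (\<lambda>z. norm (m z) powr q)"
  proof (rule integrable_cong_AE_imp[OF i(1)])
    show "(\<lambda>z. norm (m z) powr q) \<in> borel_measurable (cyl T)" using mm by measurable
    show "AE z in cyl T. max (m z) 0 powr q = norm (m z) powr q" using nn by eventually_elim (simp add: max_absorb1)
  qed
  then show "in_Lp (cyl T) q m" "in_Lp (cyl T) pw w" using mm wm i(2) by (simp_all add: in_Lp_def)
qed

text \<open>
  Compare the energy of the midpoint, which weak duality bounds from below, with the mean of the
  two energies: the two densities must agree almost everywhere, which strict convexity permits only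
  where the pairs agree.
\<close>
lemma minimiser_unique:
  assumes K: "(m, w) \<in> K1 T m0" "(m', w') \<in> K1 T m0"
    and B: "B_fun T f H \<phi>T (m, w) = ereal (- Inf A_set)" "B_fun T f H \<phi>T (m', w') = ereal (- Inf A_set)"
  shows "AE z in cyl T. m' z = m z \<and> w' z = w z"
proof -
  have w: "integrable (cyl T) w" "integrable (cyl T) w'" and nn: "AE z in cyl T. 0 \<le> m z" "AE z in cyl T. 0 \<le> m' z"
    using K by (auto simp: K1_def)
  obtain g where g: "integrable (cyl T) g" "AE z in cyl T. Lz m w z = ereal (g z)" "B_fun T f H \<phi>T (m, w) = ereal ((\<integral>z. g z \<partial>cyl T) + aff w)"
    using B_finite[OF K(1)] B by auto
  obtain g' where g': "integrable (cyl T) g'" "AE z in cyl T. Lz m' w' z = ereal (g' z)" "B_fun T f H \<phi>T (m', w') = ereal ((\<integral>z. g' z \<partial>cyl T) + aff w')"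
    using B_finite[OF K(2)] B by auto
  define mm where "mm z = (m z + m' z) / 2" for z
  define ww where "ww z = (w z + w' z) /\<^sub>R 2" for z
  (* h is the mean of the two densities and k, below, the density of the midpoint. *)
  define h where "h z = (g z + g' z) / 2" for z
  have KK: "(mm, ww) \<in> K1 T m0" using K1_mid[OF T m0_mass K] by (simp add: mm_def[abs_def] ww_def[abs_def])
  have hi: "integrable (cyl T) h" using g(1) g'(1) by (simp add: h_def[abs_def])
  have le: "AE z in cyl T. Lz mm ww z \<le> ereal (h z)"
    using nn g(2) g'(2)
  proof eventually_elim
    case (elim z)
    then show ?case
      using L_mid[of "m z" "m' z" "snd z" "w z" "g z" "w' z" "g' z"] by (simp add: Lz_def mm_def ww_def h_def max_absorb1)
  qed
  obtain k where k: "integrable (cyl T) k" "AE z in cyl T. Lz mm ww z = ereal (k z)"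
    using B_upper[OF KK hi le] by blast
  have "- Inf A_set \<le> (\<integral>z. k z \<partial>cyl T) + aff ww" by (rule weak_duality[OF KK k])
  moreover have "aff ww = (aff w + aff w') / 2" unfolding ww_def by (rule aff_mid[OF w])
  moreover have "(\<integral>z. h z \<partial>cyl T) = ((\<integral>z. g z \<partial>cyl T) + (\<integral>z. g' z \<partial>cyl T)) / 2" using g(1) g'(1) by (simp add: h_def)
  moreover have "(\<integral>z. g z \<partial>cyl T) + aff w = - Inf A_set" "(\<integral>z. g' z \<partial>cyl T) + aff w' = - Inf A_set" using g(3) g'(3) B by auto
  ultimately have "(\<integral>z. h z \<partial>cyl T) \<le> (\<integral>z. k z \<partial>cyl T)" by argo
  then have i: "(\<integral>z. h z - k z \<partial>cyl T) \<le> 0" using hi k(1) by simp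
  have p: "AE z in cyl T. 0 \<le> h z - k z" using le k(2) by eventually_elim simp
  have "(\<integral>z. h z - k z \<partial>cyl T) = 0" using i integral_nonneg_AE[OF p] by simp
  then have "AE z in cyl T. h z - k z = 0"
    using integral_nonneg_eq_0_iff_AE[OF _ p] hi k(1) by simp
  then show ?thesis using nn g(2) g'(2) k(2)
  proof eventually_elim
    case (elim z)
    show ?case
    proof (rule ccontr)
      assume ne: "\<not> (m' z = m z \<and> w' z = w z)"
      have "\<exists>b0. L (snd z) ((m z + m' z) / 2) ((w z + w' z) /\<^sub>R 2) \<le> ereal b0 \<and> b0 < (g z + g' z) / 2"
        by (rule L_strict) (use elim ne in \<open>auto simp: Lz_def max_absorb1\<close>)
      then obtain b0 where b0: "L (snd z) ((m z + m' z) / 2) ((w z + w' z) /\<^sub>R 2) \<le> ereal b0" "b0 < h z" unfolding h_def by blast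
      have "ereal (k z) \<le> ereal b0" using b0(1) elim by (simp add: Lz_def mm_def ww_def max_absorb1)
      then show False using b0(2) elim(1) by simp
    qed
  qed
qed

end

theorem lemma2p1:
  fixes T q r r' \<theta> :: real
    and f :: "real ^ 'd \<Rightarrow> real \<Rightarrow> real"
    and H :: "real ^ 'd \<Rightarrow> real ^ 'd \<Rightarrow> real"
    and \<phi>T m0 :: "real ^ 'd \<Rightarrow> real"
  assumes T: "0 < T"
    and f_periodic: "\<And>\<tau>. 0 \<le> \<tau> \<Longrightarrow> periodic (\<lambda>x. f x \<tau>)"
    and f_continuous: "continuous_on (UNIV \<times> {0..}) (\<lambda>(x, \<tau>). f x \<tau>)"
    and f_increasing: "\<And>x. strict_mono_on {0..} (f x)"
    and f_zero: "\<And>x. f x 0 = 0"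
    and q: "1 < q"
    and f_growth: "\<exists>C>0. \<forall>x. \<forall>\<tau>\<ge>0.
      1 / C * \<tau> powr (q - 1) - C \<le> f x \<tau> \<and> f x \<tau> \<le> C * \<tau> powr (q - 1) + C"
    and H_periodic: "\<And>\<xi>. periodic (\<lambda>x. H x \<xi>)"
    and H_continuous: "continuous_on UNIV (\<lambda>(x, \<xi>). H x \<xi>)"
    and H_convex: "\<And>x. convex_on UNIV (H x)"
    and H_differentiable: "\<exists>DpH. (\<forall>x \<xi>. GDERIV (H x) \<xi> :> DpH x \<xi>) \<and>
      continuous_on UNIV (\<lambda>(x, \<xi>). DpH x \<xi>)"
    and r: "max (real CARD('d) * (q - 1)) 1 < r"
    and H_growth: "\<exists>C>0. \<forall>x \<xi>.
      1 / (r * C) * norm \<xi> powr r - C \<le> H x \<xi> \<and> H x \<xi> \<le> C / r * norm \<xi> powr r + C"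
    and r': "1 / r + 1 / r' = 1"
    and \<theta>: "0 \<le> \<theta>" "\<theta> < r / (real CARD('d) + 1)"
    and H_x_dependence: "\<exists>C>0. \<forall>x y \<xi>.
      \<bar>H x \<xi> - H y \<xi>\<bar> \<le> C * torus_dist x y * max (norm \<xi>) 1 powr \<theta>"
    and \<phi>T_periodic: "periodic \<phi>T"
    and \<phi>T_C1: "\<exists>D. (\<forall>x. GDERIV \<phi>T x :> D x) \<and> continuous_on UNIV D"
    and m0_periodic: "periodic m0"
    and m0_continuous: "continuous_on UNIV m0"
    and m0_nonneg: "\<And>x. 0 \<le> m0 x"
    and m0_mass: "(\<integral>x. m0 x \<partial>torus) = 1"
  shows "\<exists>m w. (m, w) \<in> K1 T m0 \<and>
      (\<forall>p\<in>K1 T m0. B_fun T f H \<phi>T (m, w) \<le> B_fun T f H \<phi>T p) \<and>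
      (INF \<phi>\<in>K0 T \<phi>T. A_fun T f H m0 \<phi>) = - B_fun T f H \<phi>T (m, w) \<and>
      (\<forall>m' w'. (m', w') \<in> K1 T m0 \<and>
         (\<forall>p\<in>K1 T m0. B_fun T f H \<phi>T (m', w') \<le> B_fun T f H \<phi>T p) \<longrightarrow>
         (AE z in cyl T. m' z = m z \<and> w' z = w z)) \<and>
      in_Lp (cyl T) q m \<and> in_Lp (cyl T) (r' * q / (r' + q - 1)) w"
proof -
  obtain Cf where Cf: "0 < Cf" "\<And>x \<tau>. 0 \<le> \<tau> \<Longrightarrow> 1 / Cf * \<tau> powr (q - 1) - Cf \<le> f x \<tau>"
    using f_growth by blast
  obtain DpH where DpH: "\<And>x \<xi>. GDERIV (H x) \<xi> :> DpH x \<xi>" "continuous_on UNIV (\<lambda>(x, \<xi>). DpH x \<xi>)"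
    using H_differentiable by blast
  obtain CH where CH: "0 < CH" "\<And>x \<xi>. 1 / (r * CH) * norm \<xi> powr r - CH \<le> H x \<xi>" "\<And>x \<xi>. H x \<xi> \<le> CH / r * norm \<xi> powr r + CH"
    using H_growth by blast
  obtain D\<phi>T where D: "\<And>x. GDERIV \<phi>T x :> D\<phi>T x" "continuous_on UNIV D\<phi>T"
    using \<phi>T_C1 by blast
  have r1: "1 < r" using r by simp
  interpret mfg_data T q r f H DpH \<phi>T m0 D\<phi>T Cf CH
    by unfold_locales (fact T f_continuous f_increasing f_zero q Cf H_continuous H_convex DpH r1 CH \<phi>T_periodic D
      m0_periodic m0_continuous m0_nonneg m0_mass)+
  have pw: "r' * q / (r' + q - 1) = pw"
  proof -
    have "1 / r' = (r - 1) / r" using r' r1 by (simp add: field_simps)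
    moreover have "r' \<noteq> 0" using r' r1 by auto
    ultimately have e: "r' = r / (r - 1)" using r1 by (simp add: field_simps)
    have "r' + q - 1 = (r + (q - 1) * (r - 1)) / (r - 1)" unfolding e using r1 by (simp add: field_simps)
    then show ?thesis unfolding pw_def e using r1 by simp
  qed
  obtain m w where mw: "(m, w) \<in> K1 T m0" "B_fun T f H \<phi>T (m, w) = ereal (- Inf A_set)"
    using minimiser_exists by blast
  have inf: "(INF \<phi>\<in>K0 T \<phi>T. A_fun T f H m0 \<phi>) = - B_fun T f H \<phi>T (m, w)"
    unfolding INF_A mw(2) by simp
  have uni: "AE z in cyl T. m' z = m z \<and> w' z = w z"
    if "(m', w') \<in> K1 T m0 \<and> (\<forall>p\<in>K1 T m0. B_fun T f H \<phi>T (m', w') \<le> B_fun T f H \<phi>T p)" for m' w'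
  proof -
    have "B_fun T f H \<phi>T (m', w') = ereal (- Inf A_set)"
      using that mw B_ge[of "(m', w')"] by (metis antisym)
    then show ?thesis using minimiser_unique[OF mw(1) _ mw(2)] that by blast
  qed
  have "\<forall>p\<in>K1 T m0. B_fun T f H \<phi>T (m, w) \<le> B_fun T f H \<phi>T p" unfolding mw(2) using B_ge by blast
  then show ?thesis using mw(1) inf uni minimiser_Lp[OF mw] unfolding pw by blast
qed

end
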